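(* Let $d\in\{1,2,3\}$, let $\Omega\subset\mathbb{R}^d$ be a bounded domain with (strong) Lipschitz boundary, $T>0$, $I=(0,T)$, $\bar I=[-T,T]$, $\mu_0,m_0>0$ constants, and $0<\beta<\infty$. Let $h\in (H^s(I))^d$ with $s\ge1$, $g\in(L^\infty(\Omega))^d$, $p\in(L^\infty(\Omega))^d$, $H(x,t)=g(x)-h(t)$ and $$\kappa(x,t)=\mu_0m_0\,p(x)^t\frac{\mathrm{d}}{\mathrm{d}t}\left[\frac{\mathcal{L}_\beta(|H(x,t)|)}{|H(x,t)|}H(x,t)\right].$$ Suppose that the zero extension to $\mathbb{R}$ of the filter $a:\bar I\to\mathbb{R}$ belongs to the Besov space $B^r_{1,\theta}(\mathbb{R})$ for some $r\ge0$ and $0<\theta\le\infty$. Let $$\widehat\kappa(x,t)=\int_I\kappa(x,t')\,a(t-t')\,\mathrm{d}t',\quad t\in I,$$ and let $\widehat F:L^2(\Omega)\to L^2(I)$ be the integral operator $(\widehat Fc)(t)=\int_\Omega c(x)\widehat\kappa(x,t)\,\mathrm{d}x$. Then the singular values $\sigma_n$ of $\widehat F$ (ordered nonincreasingly) satisfy $\sigma_n\le C n^{\frac12-s-r}$ for all $n\ge1$, with a constant $C$ independent of $n$.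
   Context: The superscript $t$ on a vector denotes transpose and $|\cdot|$ is the Euclidean norm. The (scaled) Langevin function is $\mathcal{L}_\beta(z)=\coth(\beta z)-(\beta z)^{-1}$ (with $\mathcal{L}_\beta(0)=0$ by continuity), and $\mathcal{L}_\beta(|H|)/|H|$ is understood by its continuous extension where $H=0$. $H^s(I)$ is the $L^2$-based Sobolev space (Sobolev--Slobodeckij for non-integer $s$). $B^r_{q,\theta}(\mathbb{R})$ denotes the standard Besov space with smoothness $r$, integrability $q$ and fine index $\theta$; the zero extension of $a$ equals $a$ on $\bar I$ and $0$ on $\mathbb{R}\setminus\bar I$. *)

theory Defs
  imports "HOL-Analysis.Analysis" "HOL-Real_Asymp.Real_Asymp"
begin

section \<open>Spaces of square integrable and essentially bounded functions\<close>

text \<open>Elements of Lebesgue spaces are represented by functions, and equality in these spaces is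
  equality almost everywhere.\<close>

definition L2 :: "'a measure \<Rightarrow> ('a \<Rightarrow> real) set" where
  "L2 M = {f. f \<in> borel_measurable M \<and> integrable M (\<lambda>x. (f x)\<^sup>2)}"

definition L2_inner :: "'a measure \<Rightarrow> ('a \<Rightarrow> real) \<Rightarrow> ('a \<Rightarrow> real) \<Rightarrow> real" where
  "L2_inner M f g = (\<integral>x. f x * g x \<partial>M)"

definition Linfty :: "'a measure \<Rightarrow> ('a \<Rightarrow> real) set" where
  "Linfty M = {f. f \<in> borel_measurable M \<and> (\<exists>C. AE x in M. \<bar>f x\<bar> \<le> C)}"

section \<open>Lipschitz domains\<close>

definition bounded_domain :: "'a::euclidean_space set \<Rightarrow> bool" where
  "bounded_domain \<Omega> \<longleftrightarrow> open \<Omega> \<and> connected \<Omega> \<and> \<Omega> \<noteq> {} \<and> bounded \<Omega>"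

text \<open>Near each boundary point \<^term>\<open>\<Omega>\<close> is the strict epigraph of a Lipschitz function, in a
  Cartesian coordinate system whose last axis points in the direction of the unit vector
  \<^term>\<open>e\<close>.  The remaining coordinates of \<^term>\<open>y\<close> are given by its projection
  \<^term>\<open>y - (y \<bullet> e) *\<^sub>R e\<close> to the orthogonal complement of \<^term>\<open>e\<close>.  In dimension one this
  complement is trivial and the boundary consists of isolated end points.\<close>

definition strong_lipschitz_boundary :: "'a::euclidean_space set \<Rightarrow> bool" where
  "strong_lipschitz_boundary \<Omega> \<longleftrightarrow>
     (\<forall>z\<in>frontier \<Omega>. \<exists>U e L \<gamma>. open U \<and> z \<in> U \<and> norm e = 1 \<and>
        L-lipschitz_on {v. v \<bullet> e = 0} (\<gamma> :: 'a \<Rightarrow> real) \<and>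
        \<Omega> \<inter> U = {y \<in> U. \<gamma> (y - (y \<bullet> e) *\<^sub>R e) < y \<bullet> e})"

section \<open>Weak derivatives and Sobolev--Slobodeckij spaces on open subsets of the line\<close>

definition smooth :: "(real \<Rightarrow> real) \<Rightarrow> bool" where
  "smooth \<phi> \<longleftrightarrow> (\<forall>k x. ((deriv ^^ k) \<phi>) field_differentiable (at x))"

definition test_function :: "real set \<Rightarrow> (real \<Rightarrow> real) \<Rightarrow> bool" where
  "test_function S \<phi> \<longleftrightarrow> smooth \<phi> \<and> (\<exists>K. compact K \<and> K \<subseteq> S \<and> (\<forall>x. x \<notin> K \<longrightarrow> \<phi> x = 0))"

definition locally_integrable :: "real set \<Rightarrow> (real \<Rightarrow> real) \<Rightarrow> bool" where
  "locally_integrable S u \<longleftrightarrow> (\<forall>K. compact K \<and> K \<subseteq> S \<longrightarrow> integrable (lebesgue_on K) u)"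

definition has_weak_derivative ::
  "nat \<Rightarrow> real set \<Rightarrow> (real \<Rightarrow> real) \<Rightarrow> (real \<Rightarrow> real) \<Rightarrow> bool" where
  "has_weak_derivative k S u v \<longleftrightarrow> locally_integrable S u \<and> locally_integrable S v \<and>
     (\<forall>\<phi>. test_function S \<phi> \<longrightarrow>
        (\<integral>x. u x * (deriv ^^ k) \<phi> x \<partial>lebesgue_on S) =
        (-1) ^ k * (\<integral>x. v x * \<phi> x \<partial>lebesgue_on S))"

text \<open>A version of the first weak derivative; it is determined up to a null set.\<close>

definition weak_deriv :: "real set \<Rightarrow> (real \<Rightarrow> real) \<Rightarrow> real \<Rightarrow> real" where
  "weak_deriv S u = (SOME v. has_weak_derivative 1 S u v)"

text \<open>The square of the Gagliardo (Slobodeckij) seminorm of order \<^term>\<open>\<sigma>\<close>.\<close>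

definition gagliardo :: "real \<Rightarrow> real set \<Rightarrow> (real \<Rightarrow> real) \<Rightarrow> ennreal" where
  "gagliardo \<sigma> S v =
     (\<integral>\<^sup>+x. (\<integral>\<^sup>+y. ennreal ((v x - v y)\<^sup>2 / \<bar>x - y\<bar> powr (1 + 2 * \<sigma>)) \<partial>lebesgue_on S) \<partial>lebesgue_on S)"

text \<open>The space $H^s(S)$ for real $s \ge 0$.\<close>

definition sobolev_H :: "real \<Rightarrow> real set \<Rightarrow> (real \<Rightarrow> real) set" where
  "sobolev_H s S = {u.
     (\<forall>k \<le> nat \<lfloor>s\<rfloor>. \<exists>v \<in> L2 (lebesgue_on S). has_weak_derivative k S u v) \<and>
     (s \<notin> \<int> \<longrightarrow> (\<exists>v. has_weak_derivative (nat \<lfloor>s\<rfloor>) S u v \<and> gagliardo (frac s) S v < \<infinity>))}"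

section \<open>Besov spaces on the line\<close>

definition ennreal_powr :: "ennreal \<Rightarrow> real \<Rightarrow> ennreal" where
  "ennreal_powr x p = (if x = \<infinity> then \<infinity> else ennreal (enn2real x powr p))"

text \<open>The $L^q$ (quasi-)norm for $0 < q \le \infty$ of a nonnegative function.  With the counting
  measure on the natural numbers this is also the $\ell^q$ (quasi-)norm.\<close>

definition Lq_norm :: "'a measure \<Rightarrow> ennreal \<Rightarrow> ('a \<Rightarrow> ennreal) \<Rightarrow> ennreal" where
  "Lq_norm M q u =
     (if q = \<infinity> then Inf {C. AE x in M. u x \<le> C}
      else ennreal_powr (\<integral>\<^sup>+x. ennreal_powr (u x) (enn2real q) \<partial>M) (1 / enn2real q))"

text \<open>A generator of a smooth dyadic resolution of unity $(\varphi_j)_{j \ge 0}$ on the frequency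
  line: $\varphi_0 = \varphi$ and
  $\varphi_j(\xi) = \varphi(2^{-j}\xi) - \varphi(2^{-j+1}\xi)$ for $j \ge 1$.\<close>

definition dyadic_generator :: "(real \<Rightarrow> real) \<Rightarrow> bool" where
  "dyadic_generator \<phi> \<longleftrightarrow> smooth \<phi> \<and> (\<forall>\<xi>. \<bar>\<xi>\<bar> \<le> 1 \<longrightarrow> \<phi> \<xi> = 1) \<and> (\<forall>\<xi>. 2 \<le> \<bar>\<xi>\<bar> \<longrightarrow> \<phi> \<xi> = 0)"

definition dyadic_part :: "(real \<Rightarrow> real) \<Rightarrow> nat \<Rightarrow> real \<Rightarrow> real" where
  "dyadic_part \<phi> j \<xi> = (if j = 0 then \<phi> \<xi> else \<phi> (\<xi> / 2 ^ j) - \<phi> (2 * \<xi> / 2 ^ j))"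

definition inverse_fourier :: "(real \<Rightarrow> real) \<Rightarrow> real \<Rightarrow> complex" where
  "inverse_fourier \<psi> x = (\<integral>\<xi>. complex_of_real (\<psi> \<xi>) * cis (x * \<xi>) \<partial>lebesgue) / complex_of_real (2 * pi)"

text \<open>The Littlewood--Paley block
  $\mathcal{F}^{-1}(\varphi_j\,\mathcal{F} f) = (\mathcal{F}^{-1}\varphi_j) * f$.\<close>

definition LP_block :: "(real \<Rightarrow> real) \<Rightarrow> nat \<Rightarrow> (real \<Rightarrow> real) \<Rightarrow> real \<Rightarrow> complex" where
  "LP_block \<phi> j f x =
     (\<integral>y. inverse_fourier (dyadic_part \<phi> j) (x - y) * complex_of_real (f y) \<partial>lebesgue)"

definition besov_norm ::
  "(real \<Rightarrow> real) \<Rightarrow> real \<Rightarrow> ennreal \<Rightarrow> ennreal \<Rightarrow> (real \<Rightarrow> real) \<Rightarrow> ennreal" where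
  "besov_norm \<phi> r q \<theta> f =
     Lq_norm (count_space UNIV) \<theta>
       (\<lambda>j. ennreal (2 powr (real j * r)) *
            Lq_norm lebesgue q (\<lambda>x. ennreal (cmod (LP_block \<phi> j f x))))"

text \<open>Functions that are (regular) tempered distributions: they are absolutely integrable against
  every Schwartz function.  For functions with bounded support this means integrability.\<close>

definition tempered :: "(real \<Rightarrow> real) \<Rightarrow> bool" where
  "tempered f \<longleftrightarrow> (\<exists>N::nat. integrable lebesgue (\<lambda>x. f x / (1 + \<bar>x\<bar>) ^ N))"

text \<open>The functions in $B^r_{q,\theta}(\mathbb{R})$.  Different resolutions of unity yield
  equivalent (quasi-)norms, so the choice of \<^term>\<open>\<phi>\<close> is immaterial.\<close>

definition besov :: "real \<Rightarrow> ennreal \<Rightarrow> ennreal \<Rightarrow> (real \<Rightarrow> real) set" where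
  "besov r q \<theta> = {f. tempered f \<and> (\<exists>\<phi>. dyadic_generator \<phi> \<and> besov_norm \<phi> r q \<theta> f < \<infinity>)}"

section \<open>Singular values of operators between spaces of square integrable functions\<close>

definition adjoint_L2 ::
  "'a measure \<Rightarrow> 'b measure \<Rightarrow> (('a \<Rightarrow> real) \<Rightarrow> 'b \<Rightarrow> real) \<Rightarrow> (('b \<Rightarrow> real) \<Rightarrow> 'a \<Rightarrow> real) \<Rightarrow> bool" where
  "adjoint_L2 M N A B \<longleftrightarrow>
     (\<forall>f \<in> L2 M. \<forall>g \<in> L2 N. B g \<in> L2 M \<and> L2_inner N (A f) g = L2_inner M f (B g))"

text \<open>\<^term>\<open>v\<close> satisfies $A^* A v = \lambda^2 v$.\<close>

definition singular_vector ::
  "'a measure \<Rightarrow> 'b measure \<Rightarrow> (('a \<Rightarrow> real) \<Rightarrow> 'b \<Rightarrow> real) \<Rightarrow> real \<Rightarrow> ('a \<Rightarrow> real) \<Rightarrow> bool" where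
  "singular_vector M N A l v \<longleftrightarrow> v \<in> L2 M \<and>
     (\<exists>B. adjoint_L2 M N A B \<and> (AE x in M. B (A v) x = l\<^sup>2 * v x))"

text \<open>The $n$-th singular value ($n \ge 1$) of a compact operator, that is, the $n$-th entry of the
  nonincreasing list of the square roots of the eigenvalues of $A^* A$, repeated according to their
  multiplicities and continued by zeros.  It is the largest $l > 0$ for which at least $n$
  eigenvalues of $A^* A$, counted with multiplicity, have a square root $\ge l$, and zero if
  there is no such $l$; having $n$ such eigenvalues means having $n$ orthonormal eigenvectors that
  belong to them.\<close>

definition singular_value ::
  "'a measure \<Rightarrow> 'b measure \<Rightarrow> (('a \<Rightarrow> real) \<Rightarrow> 'b \<Rightarrow> real) \<Rightarrow> nat \<Rightarrow> real" where
  "singular_value M N A n = Sup ({0} \<union> {l. 0 < l \<and>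
     (\<exists>v lam. (\<forall>i<n. \<forall>j<n. L2_inner M (v i) (v j) = (if i = j then 1 else 0)) \<and>
              (\<forall>i<n. l \<le> lam i \<and> singular_vector M N A (lam i) (v i)))})"

section \<open>The imaging operator\<close>

definition langevin :: "real \<Rightarrow> real \<Rightarrow> real" where
  "langevin \<beta> z = (if z = 0 then 0 else cosh (\<beta> * z) / sinh (\<beta> * z) - 1 / (\<beta> * z))"

definition langevin_quot :: "real \<Rightarrow> real \<Rightarrow> real" where
  "langevin_quot \<beta> z = (if z = 0 then \<beta> / 3 else langevin \<beta> z / z)"

lemma langevin_quot_continuous_extension:
  assumes "0 < \<beta>"
  shows "((\<lambda>z. langevin \<beta> z / z) \<longlongrightarrow> langevin_quot \<beta> 0) (at 0)"
proof -
  have "((\<lambda>z. (cosh (\<beta> * z) / sinh (\<beta> * z) - 1 / (\<beta> * z)) / z) \<longlongrightarrow> \<beta> / 3) (at 0)"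
    using assms by (real_asymp, simp_all add: field_simps)
  moreover have "\<forall>\<^sub>F z in at 0. (cosh (\<beta> * z) / sinh (\<beta> * z) - 1 / (\<beta> * z)) / z = langevin \<beta> z / z"
    by (auto simp: langevin_def eventually_at intro: exI[of _ 1])
  ultimately show ?thesis
    unfolding langevin_quot_def by (simp add: Lim_transform_eventually)
qed

definition magnetization ::
  "real \<Rightarrow> ('x \<Rightarrow> real ^ 'd) \<Rightarrow> (real \<Rightarrow> real ^ 'd) \<Rightarrow> 'x \<Rightarrow> real \<Rightarrow> real ^ 'd" where
  "magnetization \<beta> g h x t = (let H = g x - h t in langevin_quot \<beta> (norm H) *\<^sub>R H)"

text \<open>The time derivative is the weak derivative on $I = (0,T)$, taken componentwise.\<close>

definition kappa ::
  "real \<Rightarrow> real \<Rightarrow> real \<Rightarrow> real \<Rightarrow> ('x \<Rightarrow> real ^ 'd) \<Rightarrow> (real \<Rightarrow> real ^ 'd) \<Rightarrow> ('x \<Rightarrow> real ^ 'd)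
    \<Rightarrow> 'x \<Rightarrow> real \<Rightarrow> real" where
  "kappa T mu0 m0 \<beta> g h p x t =
     mu0 * m0 * (p x \<bullet> (\<chi> i. weak_deriv {0<..<T} (\<lambda>\<tau>. magnetization \<beta> g h x \<tau> $ i) t))"

definition zero_extension :: "real \<Rightarrow> (real \<Rightarrow> real) \<Rightarrow> real \<Rightarrow> real" where
  "zero_extension T a t = (if t \<in> {-T..T} then a t else 0)"

definition filtered_kernel ::
  "real \<Rightarrow> (real \<Rightarrow> real) \<Rightarrow> ('x \<Rightarrow> real \<Rightarrow> real) \<Rightarrow> 'x \<Rightarrow> real \<Rightarrow> real" where
  "filtered_kernel T a k x t = (\<integral>t'. k x t' * a (t - t') \<partial>lebesgue_on {0<..<T})"

definition integral_operator :: "'x measure \<Rightarrow> ('x \<Rightarrow> 'y \<Rightarrow> real) \<Rightarrow> ('x \<Rightarrow> real) \<Rightarrow> 'y \<Rightarrow> real" where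
  "integral_operator M k c t = (\<integral>x. c x * k x t \<partial>M)"

end

theory Submission
  imports Defs "HOL-Probability.Probability"
begin

text \<open>The filtered operator is an integral operator with kernel $\kappa$ followed by the convolution
  with $a$.  At the dyadic level $J$ both factors are of finite rank up to a small error.  The
  low-frequency part of $a$ is an entire function of exponential type $O(2^J)$, so it agrees on $[-T,T]$
  with a polynomial of degree $O(2^J)$ up to an exponentially small error, and what is left of $a$
  has $L^1$ norm $O(2^{-Jr})$.  The piecewise Taylor expansion of $\kappa(x,\cdot)$ on the
  dyadic mesh with $2^J$ cells has $O(2^J)$ terms and an $L^2$ error $O(2^{-J(s-1)})$.
  The span of $n$ singular vectors with singular values at least $l$ contains a subspace of dimension
  at least $n/2$ on which the finite-rank parts vanish if $2^J$ is a small multiple of $n$.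
  Young's inequality for the convolution and Bessel's inequality then give
  $l^2 n / 2 \le C\, 2^{-2J(r+s-1)}$, that is, $l \le C' n^{1/2-s-r}$.\<close>

section \<open>Orthonormal systems and singular values of filtered operators\<close>

text \<open>The exponent splits as r + (s - 1) + 1/2. The filter is merely integrable, so its error
  is measured as a convolution operator on L2, which yields r. The kernel error is measured in the
  Hilbert--Schmidt norm: this dominates the sum of squared norms over all remaining directions, each
  contributing at least l^2, and dividing by their number, about n/2, yields the additional 1/2.
  Since \<open>singular_value\<close> is a supremum over orthonormal systems of singular vectors,
  each system can be bounded by itself. Two obstacles shape the rest. The top derivative of
  \<open>h\<close> is known only in L2, with a Gagliardo seminorm for fractional \<open>s\<close>;
  time derivatives of the kernel are therefore tracked as expressions in which it occurs linearly,
  with coefficients whose oscillation on a mesh cell is controlled. Moreover \<open>g\<close>,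
  \<open>p\<close>, \<open>h\<close>, \<open>a\<close> and the weak derivative in
  \<open>kappa\<close> are determined only up to null sets; versions that are bounded everywhere,
  absolutely continuous or Borel replace them before any estimate.\<close>

lemma sum_lincomb_mult:
  fixes a b :: "nat \<Rightarrow> real"
  shows "(\<Sum>i\<in>I. (\<Sum>p<K. a p * c p i) * (\<Sum>r<L. b r * d r i)) =
         (\<Sum>p<K. \<Sum>r<L. a p * b r * (\<Sum>i\<in>I. c p i * d r i))"
proof -
  have "(\<Sum>i\<in>I. (\<Sum>p<K. a p * c p i) * (\<Sum>r<L. b r * d r i))
      = (\<Sum>i\<in>I. \<Sum>p<K. \<Sum>r<L. a p * b r * (c p i * d r i))"
    by (simp add: sum_product mult_ac)
  also have "\<dots> = (\<Sum>p<K. \<Sum>i\<in>I. \<Sum>r<L. a p * b r * (c p i * d r i))"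
    by (rule sum.swap)
  also have "\<dots> = (\<Sum>p<K. \<Sum>r<L. \<Sum>i\<in>I. a p * b r * (c p i * d r i))"
    by (intro sum.cong refl, rule sum.swap)
  finally show ?thesis by (simp add: sum_distrib_left)
qed

text \<open>These are the first \<open>n\<close> rows of the Householder reflection that sends
  \<open>l\<close> to a multiple of the last unit vector: the rows of a reflection are orthonormal,
  and all but the last annihilate \<open>l\<close>. For \<open>l = 0\<close> unit vectors serve
  instead.\<close>

lemma householder_rows:
  fixes l :: "nat \<Rightarrow> real"
  shows "\<exists>c. (\<forall>j<n. \<forall>k<n. (\<Sum>i<Suc n. c j i * c k i) = (if j = k then 1 else 0)) \<and>
             (\<forall>j<n. (\<Sum>i<Suc n. c j i * l i) = 0)"
proof (cases "\<forall>i<Suc n. l i = 0")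
  case True
  have "(\<Sum>i<Suc n. (if i = j then 1 else 0) * (if i = k then 1 else 0)) = (if j = k then 1 else (0::real))"
    if "j < n" "k < n" for j k
  proof -
    have "(\<Sum>i<Suc n. (if i = j then 1 else 0) * (if i = k then 1 else (0::real)))
       = (\<Sum>i<Suc n. (if i = j then (if j = k then 1 else 0) else 0))"
      by (intro sum.cong) auto
    with that show ?thesis by (simp del: sum.lessThan_Suc)
  qed
  with True show ?thesis
    by (intro exI[of _ "\<lambda>j i. if i = j then 1 else 0"]) (auto intro!: sum.neutral simp del: sum.lessThan_Suc)
next
  case False
  then obtain i0 where i0: "i0 < Suc n" "l i0 \<noteq> 0" by auto
  define S where "S = (\<Sum>i<Suc n. (l i)\<^sup>2)"
  have S0: "S > 0" unfolding S_def by (rule sum_pos2[of _ i0]) (use i0 in auto)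
  \<comment> \<open>The sign opposite to \<open>l n\<close> prevents cancellation: the squared
    length \<open>W\<close> of the reflection vector is at least \<open>2 * S\<close>, hence
    positive.\<close>
  define \<alpha> where "\<alpha> = (if l n \<le> 0 then sqrt S else - sqrt S)"
  have \<alpha>2: "\<alpha>\<^sup>2 = S" using S0 by (simp add: \<alpha>_def)
  have \<alpha>l: "\<alpha> * l n \<le> 0" using S0 by (auto simp: \<alpha>_def mult_le_0_iff)
  define w where "w i = l i - (if i = n then \<alpha> else 0)" for i
  define W where "W = (\<Sum>i<Suc n. (w i)\<^sup>2)"
  have wl: "(\<Sum>i<Suc n. w i * l i) = S - \<alpha> * l n"
    by (simp add: S_def w_def power2_eq_square algebra_simps)
  have W: "W = 2 * (S - \<alpha> * l n)"
    using \<alpha>2 by (simp add: W_def S_def w_def power2_eq_square algebra_simps)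
  have W0: "W > 0" using W S0 \<alpha>l by simp
  define c where "c j i = (if i = j then 1 else 0) - 2 * w j * w i / W" for j i
  have 1: "(\<Sum>i<Suc n. c j i * f i) = f j - 2 * w j / W * (\<Sum>i<Suc n. w i * f i)"
    if "j < n" for j f
  proof -
    have "(\<Sum>i<Suc n. c j i * f i) = (\<Sum>i<Suc n. (if i = j then f j else 0) - 2 * w j / W * (w i * f i))"
      by (intro sum.cong) (auto simp: c_def algebra_simps)
    with that show ?thesis
      by (simp add: sum_subtractf sum_distrib_left del: sum.lessThan_Suc)
  qed
  have 2: "(\<Sum>i<Suc n. w i * c k i) = - w k" if "k < n" for k
  proof -
    have "(\<Sum>i<Suc n. w i * c k i) = (\<Sum>i<Suc n. c k i * w i)" by (simp add: mult.commute)
    also have "\<dots> = w k - 2 * w k / W * (\<Sum>i<Suc n. w i * w i)" by (rule 1[OF that])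
    also have "(\<Sum>i<Suc n. w i * w i) = W" by (simp add: W_def power2_eq_square)
    finally show ?thesis using W0 by simp
  qed
  have "(\<Sum>i<Suc n. c j i * c k i) = (if j = k then 1 else 0)" if "j < n" "k < n" for j k
    using 1[OF that(1), of "c k"] 2[OF that(2)] W0
    by (simp add: c_def[of k j] del: sum.lessThan_Suc)
  moreover have "(\<Sum>i<Suc n. c j i * l i) = 0" if "j < n" for j
  proof -
    have "(\<Sum>i<Suc n. c j i * l i) = l j - 2 * w j / W * (W / 2)"
    proof -
      have "S - \<alpha> * l n = W / 2" using W by simp
      then show ?thesis using 1[OF that, of l] wl by metis
    qed
    also have "\<dots> = 0" using W0 that by (simp add: w_def)
    finally show ?thesis .
  qed
  ultimately show ?thesis by blast
qed

text \<open>Each functional costs one dimension. In the induction, \<open>Suc n\<close> rows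
  annihilate the first \<open>m\<close> functionals; a Householder step in the coordinates of these
  rows gives up one of them to annihilate functional \<open>m\<close> as well.\<close>

lemma orthonormal_rows_annihilating:
  fixes l :: "nat \<Rightarrow> nat \<Rightarrow> real"
  shows "\<exists>c. (\<forall>j<n. \<forall>k<n. (\<Sum>i<n+m. c j i * c k i) = (if j = k then 1 else 0)) \<and>
             (\<forall>j<n. \<forall>q<m. (\<Sum>i<n+m. c j i * l q i) = 0)"
proof (induction m arbitrary: n)
  case 0
  have "(\<Sum>i<n. (if i = j then 1 else 0) * (if i = k then 1 else 0)) = (if j = k then 1 else (0::real))"
    if "j < n" "k < n" for j k
  proof -
    have "(\<Sum>i<n. (if i = j then 1 else 0) * (if i = k then 1 else (0::real)))
       = (\<Sum>i<n. (if i = j then (if j = k then 1 else 0) else 0))"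
      by (intro sum.cong) auto
    with that show ?thesis by simp
  qed
  then show ?case
    by (intro exI[of _ "\<lambda>j i. if i = j then 1 else 0"]) auto
next
  case (Suc m)
  define N where "N = n + Suc m"
  obtain c1 where c1: "\<And>j k. j < Suc n \<Longrightarrow> k < Suc n \<Longrightarrow> (\<Sum>i<N. c1 j i * c1 k i) = (if j = k then 1 else 0)"
      "\<And>j q. j < Suc n \<Longrightarrow> q < m \<Longrightarrow> (\<Sum>i<N. c1 j i * l q i) = 0"
    using Suc[of "Suc n"] unfolding N_def add_Suc_shift[symmetric] by blast
  obtain c2 where c2: "\<And>j k. j < n \<Longrightarrow> k < n \<Longrightarrow> (\<Sum>i<Suc n. c2 j i * c2 k i) = (if j = k then 1 else 0)"
      "\<And>j. j < n \<Longrightarrow> (\<Sum>p<Suc n. c2 j p * (\<Sum>i<N. c1 p i * l m i)) = 0"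
    using householder_rows[of n "\<lambda>p. \<Sum>i<N. c1 p i * l m i"] by blast
  define c where "c j i = (\<Sum>p<Suc n. c2 j p * c1 p i)" for j i
  have "(\<Sum>i<N. c j i * c k i) = (if j = k then 1 else 0)" if "j < n" "k < n" for j k
  proof -
    have "(\<Sum>i<N. c j i * c k i) = (\<Sum>p<Suc n. \<Sum>r<Suc n. c2 j p * c2 k r * (if p = r then 1 else 0))"
      unfolding c_def sum_lincomb_mult using c1(1) by (intro sum.cong refl) auto
    also have "\<dots> = (\<Sum>p<Suc n. \<Sum>r<Suc n. if r = p then c2 j p * c2 k p else 0)"
      by (intro sum.cong refl) auto
    also have "\<dots> = (\<Sum>p<Suc n. c2 j p * c2 k p)"
      by (intro sum.cong refl) (subst sum.delta, auto)
    finally show ?thesis using c2(1) that by simp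
  qed
  moreover have "(\<Sum>i<N. c j i * l q i) = 0" if "j < n" "q < Suc m" for j q
  proof -
    have "(\<Sum>i<N. c j i * l q i) = (\<Sum>p<Suc n. c2 j p * (\<Sum>i<N. c1 p i * l q i))"
      unfolding c_def sum_distrib_right sum_distrib_left
      by (subst sum.swap) (simp add: mult_ac del: sum.lessThan_Suc)
    then show ?thesis using c1(2) c2(2) that by (cases "q = m") (auto intro!: sum.neutral simp del: sum.lessThan_Suc)
  qed
  ultimately show ?case unfolding N_def by blast
qed

section \<open>Inner product calculus for square integrable functions\<close>

lemma L2_measurable [measurable_dest]: "f \<in> L2 M \<Longrightarrow> f \<in> borel_measurable M"
  by (simp add: L2_def)

lemma L2_integrable_mult:
  assumes "f \<in> L2 M" "g \<in> L2 M"
  shows "integrable M (\<lambda>x. f x * g x)"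
proof (rule Bochner_Integration.integrable_bound[of M "\<lambda>x. (f x)\<^sup>2 + (g x)\<^sup>2"])
  show "AE x in M. norm (f x * g x) \<le> norm ((f x)\<^sup>2 + (g x)\<^sup>2)"
  proof (rule AE_I2)
    fix x
    have "2 * (\<bar>f x\<bar> * \<bar>g x\<bar>) \<le> \<bar>f x\<bar>\<^sup>2 + \<bar>g x\<bar>\<^sup>2"
      using sum_squares_bound[of "\<bar>f x\<bar>" "\<bar>g x\<bar>"] by (simp add: mult_ac)
    moreover have "0 \<le> \<bar>f x\<bar> * \<bar>g x\<bar>" by simp
    ultimately have "\<bar>f x\<bar> * \<bar>g x\<bar> \<le> \<bar>f x\<bar>\<^sup>2 + \<bar>g x\<bar>\<^sup>2" by linarith
    then show "norm (f x * g x) \<le> norm ((f x)\<^sup>2 + (g x)\<^sup>2)" by (simp add: abs_mult)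
  qed
qed (use assms in \<open>auto simp: L2_def\<close>)

lemma L2_scale:
  assumes "f \<in> L2 M" shows "(\<lambda>x. a * f x) \<in> L2 M"
  using assms by (auto simp: L2_def power_mult_distrib)

lemma L2_add:
  assumes "f \<in> L2 M" "g \<in> L2 M" shows "(\<lambda>x. f x + g x) \<in> L2 M"
  using assms L2_integrable_mult[OF assms]
  by (auto simp: L2_def power2_sum mult.assoc)

lemma L2_sum:
  assumes "\<And>j. j \<in> J \<Longrightarrow> f j \<in> L2 M" shows "(\<lambda>x. \<Sum>j\<in>J. a j * f j x) \<in> L2 M"
  using assms
proof (induction J rule: infinite_finite_induct)
  case (insert x F)
  then show ?case by (auto intro!: L2_add L2_scale)
qed (auto simp: L2_def)

lemma L2_inner_sum_left:
  assumes "\<And>j. j \<in> J \<Longrightarrow> f j \<in> L2 M" "g \<in> L2 M"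
  shows "L2_inner M (\<lambda>x. \<Sum>j\<in>J. a j * f j x) g = (\<Sum>j\<in>J. a j * L2_inner M (f j) g)"
  unfolding L2_inner_def sum_distrib_right
  using L2_integrable_mult[OF assms(1) assms(2)]
  by (subst Bochner_Integration.integral_sum) (auto simp: mult.assoc)

lemma L2_inner_commute: "L2_inner M f g = L2_inner M g f"
  by (simp add: L2_inner_def mult.commute)

lemma L2_inner_sum_sum:
  assumes "\<And>j. j < K \<Longrightarrow> f j \<in> L2 M" "\<And>j. j < L \<Longrightarrow> g j \<in> L2 M"
  shows "L2_inner M (\<lambda>x. \<Sum>j<K. a j * f j x) (\<lambda>x. \<Sum>j<L. b j * g j x)
       = (\<Sum>j<K. \<Sum>k<L. a j * b k * L2_inner M (f j) (g k))"
proof -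
  have "L2_inner M (\<lambda>x. \<Sum>j<K. a j * f j x) (\<lambda>x. \<Sum>j<L. b j * g j x)
      = (\<Sum>j<K. a j * L2_inner M (\<lambda>x. \<Sum>j<L. b j * g j x) (f j))"
    using assms by (subst L2_inner_sum_left) (auto intro: L2_sum simp: L2_inner_commute)
  also have "\<dots> = (\<Sum>j<K. a j * (\<Sum>k<L. b k * L2_inner M (f j) (g k)))"
    using assms by (intro sum.cong refl) (subst L2_inner_sum_left, auto simp: L2_inner_commute)
  finally show ?thesis by (simp add: sum_distrib_left mult.assoc)
qed

lemma bessel_L2:
  fixes f :: "nat \<Rightarrow> 'a \<Rightarrow> real"
  assumes f: "\<And>j. j < d \<Longrightarrow> f j \<in> L2 M" and \<phi>: "\<phi> \<in> L2 M"
    and orth: "\<And>j k. j < d \<Longrightarrow> k < d \<Longrightarrow> L2_inner M (f j) (f k) = (if j = k then 1 else 0)"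
  shows "(\<Sum>j<d. (L2_inner M (f j) \<phi>)\<^sup>2) \<le> (\<integral>x. (\<phi> x)\<^sup>2 \<partial>M)"
proof -
  define a where "a j = L2_inner M (f j) \<phi>" for j
  define g where "g x = (\<Sum>j<d. a j * f j x)" for x
  have gL: "g \<in> L2 M" unfolding g_def using f by (intro L2_sum) auto
  have 1: "L2_inner M g \<phi> = (\<Sum>j<d. (a j)\<^sup>2)"
    unfolding g_def using f \<phi> by (subst L2_inner_sum_left) (auto simp: a_def power2_eq_square)
  have "L2_inner M g g = (\<Sum>j<d. \<Sum>k<d. a j * a k * L2_inner M (f j) (f k))"
    unfolding g_def using f by (intro L2_inner_sum_sum) auto
  also have "\<dots> = (\<Sum>j<d. \<Sum>k<d. if k = j then (a j)\<^sup>2 else 0)"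
    using orth by (intro sum.cong refl) (auto simp: power2_eq_square)
  also have "\<dots> = (\<Sum>j<d. (a j)\<^sup>2)"
    by (intro sum.cong refl) (subst sum.delta, auto)
  finally have 2: "L2_inner M g g = (\<Sum>j<d. (a j)\<^sup>2)" .
  have "0 \<le> (\<integral>x. (\<phi> x - g x)\<^sup>2 \<partial>M)" by simp
  also have "(\<lambda>x. (\<phi> x - g x)\<^sup>2) = (\<lambda>x. (\<phi> x)\<^sup>2 - 2 * (g x * \<phi> x) + g x * g x)"
    by (auto simp: power2_eq_square algebra_simps)
  also have "(\<integral>x. \<dots> x \<partial>M) = (\<integral>x. (\<phi> x)\<^sup>2 \<partial>M) - 2 * L2_inner M g \<phi> + L2_inner M g g"
    using L2_integrable_mult[OF gL gL] L2_integrable_mult[OF gL \<phi>] \<phi>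
    by (simp add: L2_inner_def L2_def)
  finally show ?thesis using 1 2 by (simp add: a_def)
qed

section \<open>Young's inequality for convolution on the time interval\<close>

abbreviation ivl :: "real \<Rightarrow> real measure" where "ivl T \<equiv> lebesgue_on {0<..<T}"

lemma ivl_id_measurable [measurable]: "(\<lambda>x. x) \<in> ivl T \<rightarrow>\<^sub>M borel"
  by (rule measurable_restrict_space1) (rule measurable_completion, simp)

lemma borel_measurable_ivl: "f \<in> borel_measurable borel \<Longrightarrow> f \<in> borel_measurable (ivl T)"
  by (rule measurable_compose[OF ivl_id_measurable])

lemma finite_measure_ivl: "finite_measure (ivl T)"
  by (rule finite_measure_lebesgue_on) (simp add: bounded_set_imp_lmeasurable)

lemma sigma_finite_ivl: "sigma_finite_measure (ivl T)"
  using finite_measure_ivl finite_measure.axioms(1) by blast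

lemma nn_integral_ivl_le:
  assumes [measurable]: "f \<in> borel_measurable borel"
  shows "(\<integral>\<^sup>+t. f t \<partial>ivl T) \<le> (\<integral>\<^sup>+t. f t \<partial>lborel)"
proof -
  have "(\<integral>\<^sup>+t. f t \<partial>ivl T) = (\<integral>\<^sup>+t. f t * indicator {0<..<T} t \<partial>lebesgue)"
    by (subst nn_integral_restrict_space) auto
  also have "\<dots> \<le> (\<integral>\<^sup>+t. f t \<partial>lebesgue)"
    by (intro nn_integral_mono) (auto simp: indicator_def)
  also have "\<dots> = (\<integral>\<^sup>+t. f t \<partial>lborel)"
    by (rule nn_integral_completion)
  finally show ?thesis .
qed

text \<open>In a convolution integral the case \<open>c = -1\<close> serves the integration over
  \<open>t'\<close>, the case \<open>c = 1\<close> the one over \<open>t\<close>.\<close>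

lemma nn_integral_ivl_shift_le:
  assumes [measurable]: "f \<in> borel_measurable borel" and c: "\<bar>c\<bar> = 1"
  shows "(\<integral>\<^sup>+t. f (s + c * t) \<partial>ivl T) \<le> (\<integral>\<^sup>+t. f t \<partial>lborel)"
proof -
  have "(\<integral>\<^sup>+t. f (s + c * t) \<partial>ivl T) \<le> (\<integral>\<^sup>+t. f (s + c * t) \<partial>lborel)"
    by (rule nn_integral_ivl_le) measurable
  also have "\<dots> = (\<integral>\<^sup>+t. f t \<partial>lborel)"
    using nn_integral_real_affine[of f c s] c by auto
  finally show ?thesis .
qed

text \<open>Schur's argument: Cauchy--Schwarz for the density |e(t - t')| bounds the inner square by
  the L1 norm of \<open>e\<close> times a weighted square, and Tonelli's theorem allows the
  remaining integrations in the other order. Extended nonnegative integrals postpone all questions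
  of convergence.\<close>

lemma young_nn_integral:
  assumes w[measurable]: "w \<in> borel_measurable (ivl T)" and e[measurable]: "e \<in> borel_measurable borel"
  shows "(\<integral>\<^sup>+t. (\<integral>\<^sup>+t'. ennreal \<bar>w t' * e (t - t')\<bar> \<partial>ivl T)\<^sup>2 \<partial>ivl T)
      \<le> (\<integral>\<^sup>+t. ennreal \<bar>e t\<bar> \<partial>lborel)\<^sup>2 * (\<integral>\<^sup>+t. ennreal ((w t)\<^sup>2) \<partial>ivl T)"
proof -
  define E where "E = (\<integral>\<^sup>+t. ennreal \<bar>e t\<bar> \<partial>lborel)"
  interpret N: sigma_finite_measure "ivl T" by (rule sigma_finite_ivl)
  interpret P: pair_sigma_finite "ivl T" "ivl T" by unfold_locales
  have E1: "(\<integral>\<^sup>+t'. ennreal \<bar>e (t - t')\<bar> \<partial>ivl T) \<le> E" for t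
    using nn_integral_ivl_shift_le[of "\<lambda>t. ennreal \<bar>e t\<bar>" "-1" T t] by (simp add: E_def)
  have E2: "(\<integral>\<^sup>+t. ennreal \<bar>e (t - t')\<bar> \<partial>ivl T) \<le> E" for t'
    using nn_integral_ivl_shift_le[of "\<lambda>t. ennreal \<bar>e t\<bar>" 1 T "-t'"] by (simp add: E_def)
  have "(\<integral>\<^sup>+t'. ennreal \<bar>w t' * e (t - t')\<bar> \<partial>ivl T)\<^sup>2
      \<le> E * (\<integral>\<^sup>+t'. ennreal ((w t')\<^sup>2) * ennreal \<bar>e (t - t')\<bar> \<partial>ivl T)" for t
  proof -
    have "(\<integral>\<^sup>+t'. ennreal \<bar>w t' * e (t - t')\<bar> \<partial>ivl T)
      = (\<integral>\<^sup>+t'. ennreal (\<bar>w t'\<bar> * sqrt \<bar>e (t - t')\<bar>) * ennreal (sqrt \<bar>e (t - t')\<bar>) \<partial>ivl T)"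
      by (intro nn_integral_cong) (simp add: abs_mult ennreal_mult'[symmetric])
    then have "(\<integral>\<^sup>+t'. ennreal \<bar>w t' * e (t - t')\<bar> \<partial>ivl T)\<^sup>2
      \<le> (\<integral>\<^sup>+t'. (ennreal (\<bar>w t'\<bar> * sqrt \<bar>e (t - t')\<bar>))\<^sup>2 \<partial>ivl T) *
         (\<integral>\<^sup>+t'. (ennreal (sqrt \<bar>e (t - t')\<bar>))\<^sup>2 \<partial>ivl T)"
      by (simp only:) (rule Cauchy_Schwarz_nn_integral, measurable)
    also have "\<dots> = (\<integral>\<^sup>+t'. ennreal ((w t')\<^sup>2) * ennreal \<bar>e (t - t')\<bar> \<partial>ivl T) *
         (\<integral>\<^sup>+t'. ennreal \<bar>e (t - t')\<bar> \<partial>ivl T)"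
      by (simp add: ennreal_power power_mult_distrib ennreal_mult'[symmetric])
    also have "\<dots> \<le> (\<integral>\<^sup>+t'. ennreal ((w t')\<^sup>2) * ennreal \<bar>e (t - t')\<bar> \<partial>ivl T) * E"
      by (intro mult_left_mono E1) auto
    finally show ?thesis by (simp add: mult.commute)
  qed
  then have "(\<integral>\<^sup>+t. (\<integral>\<^sup>+t'. ennreal \<bar>w t' * e (t - t')\<bar> \<partial>ivl T)\<^sup>2 \<partial>ivl T)
     \<le> (\<integral>\<^sup>+t. E * (\<integral>\<^sup>+t'. ennreal ((w t')\<^sup>2) * ennreal \<bar>e (t - t')\<bar> \<partial>ivl T) \<partial>ivl T)"
    by (intro nn_integral_mono)
  also have "\<dots> = E * (\<integral>\<^sup>+t. (\<integral>\<^sup>+t'. ennreal ((w t')\<^sup>2) * ennreal \<bar>e (t - t')\<bar> \<partial>ivl T) \<partial>ivl T)"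
    by (rule nn_integral_cmult) measurable
  also have "(\<integral>\<^sup>+t. (\<integral>\<^sup>+t'. ennreal ((w t')\<^sup>2) * ennreal \<bar>e (t - t')\<bar> \<partial>ivl T) \<partial>ivl T)
     = (\<integral>\<^sup>+t'. (\<integral>\<^sup>+t. ennreal ((w t')\<^sup>2) * ennreal \<bar>e (t - t')\<bar> \<partial>ivl T) \<partial>ivl T)"
    by (rule P.Fubini'[symmetric]) measurable
  also have "\<dots> = (\<integral>\<^sup>+t'. ennreal ((w t')\<^sup>2) * (\<integral>\<^sup>+t. ennreal \<bar>e (t - t')\<bar> \<partial>ivl T) \<partial>ivl T)"
    by (intro nn_integral_cong nn_integral_cmult) measurable
  also have "\<dots> \<le> (\<integral>\<^sup>+t'. ennreal ((w t')\<^sup>2) * E \<partial>ivl T)"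
    by (intro nn_integral_mono mult_left_mono E2) auto
  also have "\<dots> = (\<integral>\<^sup>+t'. ennreal ((w t')\<^sup>2) \<partial>ivl T) * E"
    by (rule nn_integral_multc) measurable
  also have "E * ((\<integral>\<^sup>+t'. ennreal ((w t')\<^sup>2) \<partial>ivl T) * E) = E\<^sup>2 * (\<integral>\<^sup>+t'. ennreal ((w t')\<^sup>2) \<partial>ivl T)"
    by (simp add: power2_eq_square mult_ac)
  finally show ?thesis
    by (simp add: E_def mult_left_mono)
qed

text \<open>Finiteness in the nonnegative version gives absolute convergence for almost every
  \<open>t\<close>; its bound then carries over to the Bochner integral.\<close>

lemma conv_L2:
  assumes w: "w \<in> L2 (ivl T)" and e: "integrable lborel e"
  shows "AE t in ivl T. integrable (ivl T) (\<lambda>t'. w t' * e (t - t'))" (is ?A)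
    and "(\<lambda>t. \<integral>t'. w t' * e (t - t') \<partial>ivl T) \<in> L2 (ivl T)" (is ?B)
    and "(\<integral>t. (\<integral>t'. w t' * e (t - t') \<partial>ivl T)\<^sup>2 \<partial>ivl T)
           \<le> (\<integral>t. \<bar>e t\<bar> \<partial>lborel)\<^sup>2 * (\<integral>t. (w t)\<^sup>2 \<partial>ivl T)" (is ?C)
proof -
  interpret N: sigma_finite_measure "ivl T" by (rule sigma_finite_ivl)
  have [measurable]: "w \<in> borel_measurable (ivl T)" using w by (simp add: L2_def)
  have e_m[measurable]: "e \<in> borel_measurable borel" using borel_measurable_integrable[OF e] by simp
  define G where "G t = (\<integral>\<^sup>+t'. ennreal \<bar>w t' * e (t - t')\<bar> \<partial>ivl T)" for t
  define y where "y t = (\<integral>t'. w t' * e (t - t') \<partial>ivl T)" for t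
  define R where "R = (\<integral>t. \<bar>e t\<bar> \<partial>lborel)\<^sup>2 * (\<integral>t. (w t)\<^sup>2 \<partial>ivl T)"
  have R0: "0 \<le> R" unfolding R_def by simp
  have G[measurable]: "G \<in> borel_measurable (ivl T)" unfolding G_def by measurable
  have y[measurable]: "y \<in> borel_measurable (ivl T)" unfolding y_def by measurable
  have "(\<integral>\<^sup>+t. (G t)\<^sup>2 \<partial>ivl T) \<le> (\<integral>\<^sup>+t. ennreal \<bar>e t\<bar> \<partial>lborel)\<^sup>2 * (\<integral>\<^sup>+t. ennreal ((w t)\<^sup>2) \<partial>ivl T)"
    unfolding G_def by (rule young_nn_integral) measurable
  also have "\<dots> = ennreal R"
    using e w by (simp add: R_def nn_integral_eq_integral L2_def ennreal_power ennreal_mult)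
  finally have GR: "(\<integral>\<^sup>+t. (G t)\<^sup>2 \<partial>ivl T) \<le> ennreal R" .
  then have "(\<integral>\<^sup>+t. (G t)\<^sup>2 \<partial>ivl T) \<noteq> \<infinity>" by (auto simp: top_unique)
  then have "AE t in ivl T. (G t)\<^sup>2 \<noteq> \<infinity>"
    by (intro nn_integral_PInf_AE) auto
  then show ?A
  proof eventually_elim
    case (elim t)
    then have "G t < \<infinity>" by (auto simp: less_top power2_eq_square ennreal_mult_eq_top_iff)
    then show ?case unfolding G_def by (intro integrableI_bounded) auto
  qed
  \<comment> \<open>Where the integral diverges, the Bochner integral is 0 by convention, so this
    holds for every \<open>t\<close>.\<close>
  have yG: "ennreal \<bar>y t\<bar> \<le> G t" for t
    using integral_norm_bound_ennreal[of "ivl T" "\<lambda>t'. w t' * e (t - t')"]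
    by (cases "integrable (ivl T) (\<lambda>t'. w t' * e (t - t'))") (auto simp: y_def G_def not_integrable_integral_eq)
  have "(\<integral>\<^sup>+t. ennreal ((y t)\<^sup>2) \<partial>ivl T) \<le> (\<integral>\<^sup>+t. (G t)\<^sup>2 \<partial>ivl T)"
  proof (intro nn_integral_mono)
    fix t
    have "ennreal ((y t)\<^sup>2) = (ennreal \<bar>y t\<bar>)\<^sup>2" by (simp add: ennreal_power)
    also have "\<dots> \<le> (G t)\<^sup>2" by (intro power_mono yG) auto
    finally show "ennreal ((y t)\<^sup>2) \<le> (G t)\<^sup>2" .
  qed
  with GR have yR: "(\<integral>\<^sup>+t. ennreal ((y t)\<^sup>2) \<partial>ivl T) \<le> ennreal R" by simp
  have yi: "integrable (ivl T) (\<lambda>t. (y t)\<^sup>2)"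
    using le_less_trans[OF yR, of \<infinity>] by (intro integrableI_bounded) auto
  then show ?B by (simp add: L2_def y_def[symmetric])
  have "ennreal (\<integral>t. (y t)\<^sup>2 \<partial>ivl T) \<le> ennreal R"
    using yR nn_integral_eq_integral[OF yi] by simp
  then show ?C using R0 by (simp add: R_def y_def)
qed

lemma finite_measure_L2_integrable:
  assumes "finite_measure M" "f \<in> L2 M" shows "integrable M f"
proof -
  interpret finite_measure M by fact
  have "(\<lambda>x. 1) \<in> L2 M" by (simp add: L2_def)
  from L2_integrable_mult[OF assms(2) this] show ?thesis by simp
qed

lemma L2_bounded:
  assumes "finite_measure M" "f \<in> borel_measurable M" "\<And>x. x \<in> space M \<Longrightarrow> \<bar>f x\<bar> \<le> C"
  shows "f \<in> L2 M"
proof -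
  interpret finite_measure M by fact
  have "integrable M (\<lambda>x. (f x)\<^sup>2)"
  proof (rule integrable_const_bound[of _ "C\<^sup>2"])
    show "AE x in M. norm ((f x)\<^sup>2) \<le> C\<^sup>2"
    proof (rule AE_I2)
      fix x assume "x \<in> space M"
      from power_mono[OF assms(3)[OF this], of 2] show "norm ((f x)\<^sup>2) \<le> C\<^sup>2" by simp
    qed
  qed (use assms in measurable)
  then show ?thesis using assms by (simp add: L2_def)
qed

lemma (in pair_sigma_finite) integrable_tensor:
  fixes f :: "'a \<Rightarrow> real" and g :: "'b \<Rightarrow> real"
  assumes f: "integrable M1 f" and g: "integrable M2 g"
  shows "integrable (M1 \<Otimes>\<^sub>M M2) (\<lambda>(x, y). f x * g y)"
proof -
  have [measurable]: "f \<in> borel_measurable M1" "g \<in> borel_measurable M2"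
    using f g by auto
  show ?thesis
  proof (rule Fubini_integrable)
    show "integrable M1 (\<lambda>x. \<integral>y. norm (case (x, y) of (x, y) \<Rightarrow> f x * g y) \<partial>M2)"
      using f by (simp add: abs_mult)
    show "AE x in M1. integrable M2 (\<lambda>y. case (x, y) of (x, y) \<Rightarrow> f x * g y)"
      using g by simp
  qed measurable
qed

text \<open>The envelope \<open>B\<close> is uniform in \<open>x\<close> but only square integrable
  in time, since the kernel to which this applies contains a weak derivative of the applied field.
  The values of \<open>A\<close> are prescribed on L2 functions and inside the open interval, which
  is all that singular vectors see.\<close>

locale filtered_operator =
  fixes M :: "'x measure" and T :: real and k :: "'x \<Rightarrow> real \<Rightarrow> real" and B a :: "real \<Rightarrow> real"
    and A :: "('x \<Rightarrow> real) \<Rightarrow> real \<Rightarrow> real"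
  assumes fin: "finite_measure M"
    and k_measurable [measurable]: "case_prod k \<in> borel_measurable (M \<Otimes>\<^sub>M ivl T)"
    and B: "B \<in> L2 (ivl T)"
    and k_le: "\<And>x t. x \<in> space M \<Longrightarrow> t \<in> {0<..<T} \<Longrightarrow> \<bar>k x t\<bar> \<le> B t"
    and a: "integrable lborel a"
    and A: "\<And>c t. c \<in> L2 M \<Longrightarrow> t \<in> {0<..<T} \<Longrightarrow>
        A c t = (\<integral>x. c x * (\<integral>t'. k x t' * a (t - t') \<partial>ivl T) \<partial>M)"
begin

lemma a_measurable [measurable]: "a \<in> borel_measurable borel"
  using borel_measurable_integrable[OF a] by simp

lemma B_measurable [measurable]: "B \<in> borel_measurable (ivl T)"
  using B by (simp add: L2_def)

sublocale M: finite_measure M by (rule fin)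
sublocale N: finite_measure "ivl T" by (rule finite_measure_ivl)
sublocale P: pair_sigma_finite M "ivl T" by unfold_locales

text \<open>The unfiltered operator: up to null sets of times, \<open>A\<close> is \<open>K\<close>
  followed by the convolution with \<open>a\<close>.\<close>

definition K :: "('x \<Rightarrow> real) \<Rightarrow> real \<Rightarrow> real" where "K c t = (\<integral>x. c x * k x t \<partial>M)"

lemma space_ivl [simp]: "space (ivl T) = {0<..<T}" by simp

lemma k_section [measurable]: "t \<in> {0<..<T} \<Longrightarrow> (\<lambda>x. k x t) \<in> borel_measurable M"
proof -
  assume t: "t \<in> {0<..<T}"
  have "(\<lambda>x. (x, t)) \<in> M \<rightarrow>\<^sub>M M \<Otimes>\<^sub>M ivl T" using t by (intro measurable_Pair) auto
  from measurable_compose[OF this k_measurable] show "(\<lambda>x. k x t) \<in> borel_measurable M" by simp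
qed

lemma k_L2: "t \<in> {0<..<T} \<Longrightarrow> (\<lambda>x. k x t) \<in> L2 M"
  by (rule L2_bounded[OF fin k_section k_le])

lemma K_L2:
  assumes c: "c \<in> L2 M" shows "K c \<in> L2 (ivl T)"
proof -
  have [measurable]: "c \<in> borel_measurable M" using c by (simp add: L2_def)
  have ci: "integrable M c" by (rule finite_measure_L2_integrable[OF fin c])
  have Km[measurable]: "K c \<in> borel_measurable (ivl T)" unfolding K_def by measurable
  define I where "I = (\<integral>x. \<bar>c x\<bar> \<partial>M)"
  have le: "\<bar>K c t\<bar> \<le> I * \<bar>B t\<bar>" if t: "t \<in> {0<..<T}" for t
  proof -
    have "\<bar>K c t\<bar> \<le> (\<integral>x. \<bar>c x * k x t\<bar> \<partial>M)"
      unfolding K_def using integral_norm_bound[of M "\<lambda>x. c x * k x t"] by simp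
    also have "\<dots> \<le> (\<integral>x. \<bar>c x\<bar> * \<bar>B t\<bar> \<partial>M)"
    proof (rule integral_mono)
      show "integrable M (\<lambda>x. \<bar>c x * k x t\<bar>)"
        using L2_integrable_mult[OF c k_L2[OF t]] by simp
      show "\<bar>c x * k x t\<bar> \<le> \<bar>c x\<bar> * \<bar>B t\<bar>" if "x \<in> space M" for x
        using k_le[OF that t] by (auto simp: abs_mult intro!: mult_left_mono)
    qed (use ci in simp)
    finally show ?thesis by (simp add: I_def)
  qed
  have "integrable (ivl T) (\<lambda>t. (K c t)\<^sup>2)"
  proof (rule Bochner_Integration.integrable_bound[of _ "\<lambda>t. (I * B t)\<^sup>2"])
    show "integrable (ivl T) (\<lambda>t. (I * B t)\<^sup>2)"
      using L2_scale[OF B, of I] by (simp add: L2_def)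
    show "AE t in ivl T. norm ((K c t)\<^sup>2) \<le> norm ((I * B t)\<^sup>2)"
    proof (rule AE_I2)
      fix t assume "t \<in> space (ivl T)"
      then have "\<bar>K c t\<bar>\<^sup>2 \<le> (I * \<bar>B t\<bar>)\<^sup>2" using le[of t] by (intro power_mono) auto
      then show "norm ((K c t)\<^sup>2) \<le> norm ((I * B t)\<^sup>2)" by (simp add: power_mult_distrib)
    qed
  qed measurable
  then show ?thesis by (simp add: L2_def)
qed

text \<open>Fubini's theorem, available at those \<open>t\<close> where the convolution of the
  envelope \<open>B\<close> with \<open>a\<close> converges absolutely; as \<open>a\<close> is
  merely integrable, these are almost all \<open>t\<close>.\<close>

lemma A_eq_conv:
  assumes c: "c \<in> L2 M"
  shows "AE t in ivl T. A c t = (\<integral>t'. K c t' * a (t - t') \<partial>ivl T)"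
proof -
  have [measurable]: "c \<in> borel_measurable M" using c by (simp add: L2_def)
  have ci: "integrable M c" by (rule finite_measure_L2_integrable[OF fin c])
  have "AE t in ivl T. integrable (ivl T) (\<lambda>t'. B t' * a (t - t'))"
    by (rule conv_L2(1)[OF B a])
  moreover have "AE t in ivl T. t \<in> {0<..<T}" using AE_space[of "ivl T"] by simp
  ultimately show ?thesis
  proof eventually_elim
    case (elim t)
    have int: "integrable (M \<Otimes>\<^sub>M ivl T) (\<lambda>(x, t'). c x * (k x t' * a (t - t')))"
    proof (rule Bochner_Integration.integrable_bound[OF P.integrable_tensor[OF ci elim(1)]])
      show "AE z in M \<Otimes>\<^sub>M ivl T. norm (case z of (x, t') \<Rightarrow> c x * (k x t' * a (t - t')))
          \<le> norm (case z of (x, t') \<Rightarrow> c x * (B t' * a (t - t')))"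
      proof (rule AE_I2)
        fix z assume "z \<in> space (M \<Otimes>\<^sub>M ivl T)"
        then obtain x t' where z: "z = (x, t')" "x \<in> space M" "t' \<in> {0<..<T}"
          by (auto simp: space_pair_measure)
        from k_le[OF z(2,3)] have "\<bar>k x t'\<bar> \<le> \<bar>B t'\<bar>" by linarith
        then show "norm (case z of (x, t') \<Rightarrow> c x * (k x t' * a (t - t')))
          \<le> norm (case z of (x, t') \<Rightarrow> c x * (B t' * a (t - t')))"
          using z by (auto simp: abs_mult intro!: mult_left_mono mult_right_mono)
      qed
    qed measurable
    have "A c t = (\<integral>x. (\<integral>t'. c x * (k x t' * a (t - t')) \<partial>ivl T) \<partial>M)"
      using A[OF c elim(2)] by simp
    also have "\<dots> = (\<integral>t'. (\<integral>x. c x * (k x t' * a (t - t')) \<partial>M) \<partial>ivl T)"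
      by (rule P.Fubini_integral[OF int, symmetric])
    also have "\<dots> = (\<integral>t'. K c t' * a (t - t') \<partial>ivl T)"
      unfolding K_def by (intro Bochner_Integration.integral_cong refl)
        (simp add: mult.assoc[symmetric])
    finally show ?case .
  qed
qed

lemma A_measurable:
  assumes c: "c \<in> L2 M" shows "A c \<in> borel_measurable (ivl T)"
proof -
  have [measurable]: "c \<in> borel_measurable M" using c by (simp add: L2_def)
  have "(\<lambda>t. \<integral>x. c x * (\<integral>t'. k x t' * a (t - t') \<partial>ivl T) \<partial>M) \<in> borel_measurable (ivl T)"
    by measurable
  then show ?thesis using A[OF c] by (subst measurable_cong) auto
qed

lemma A_L2:
  assumes c: "c \<in> L2 M" shows "A c \<in> L2 (ivl T)"
proof -
  have m: "A c \<in> borel_measurable (ivl T)" by (rule A_measurable[OF c])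
  have "(\<lambda>t. \<integral>t'. K c t' * a (t - t') \<partial>ivl T) \<in> L2 (ivl T)"
    by (rule conv_L2(2)[OF K_L2[OF c] a])
  then have L: "integrable (ivl T) (\<lambda>t. (\<integral>t'. K c t' * a (t - t') \<partial>ivl T)\<^sup>2)"
    and lm: "(\<lambda>t. \<integral>t'. K c t' * a (t - t') \<partial>ivl T) \<in> borel_measurable (ivl T)"
    by (simp_all add: L2_def)
  have "integrable (ivl T) (\<lambda>t. (A c t)\<^sup>2)"
  proof (rule integrable_cong_AE_imp[OF L])
    show "AE t in ivl T. (\<integral>t'. K c t' * a (t - t') \<partial>ivl T)\<^sup>2 = (A c t)\<^sup>2"
      using A_eq_conv[OF c] by eventually_elim simp
  qed (use m in measurable)
  with m show ?thesis by (simp add: L2_def)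
qed

lemma K_sum:
  assumes "\<And>i. i < n \<Longrightarrow> v i \<in> L2 M" "t \<in> {0<..<T}"
  shows "K (\<lambda>x. \<Sum>i<n. c i * v i x) t = (\<Sum>i<n. c i * K (v i) t)"
  using L2_inner_sum_left[of "{..<n}" v M "\<lambda>x. k x t" c] assms k_L2
  by (auto simp: K_def L2_inner_def)

text \<open>By the binomial theorem a polynomial in \<open>t - t'\<close> is a combination of powers
  of \<open>t'\<close>, so it disappears on integration against a function whose moments vanish.
  Both times lie in (0, T), hence only arguments with |t - t'| < T occur.\<close>

lemma conv_polynomial_remainder:
  assumes w: "w \<in> L2 (ivl T)" and t: "t \<in> {0<..<T}"
    and orth: "\<And>j. j < S \<Longrightarrow> (\<integral>t'. w t' * t' ^ j \<partial>ivl T) = 0"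
    and apr: "\<And>\<tau>. \<bar>\<tau>\<bar> < T \<Longrightarrow> a \<tau> = (\<Sum>j<S. p j * \<tau> ^ j) + e \<tau>"
    and i: "integrable (ivl T) (\<lambda>t'. w t' * e (t - t'))"
  shows "(\<integral>t'. w t' * a (t - t') \<partial>ivl T) = (\<integral>t'. w t' * e (t - t') \<partial>ivl T)"
proof -
  have pw: "(\<lambda>t'. t' ^ j) \<in> L2 (ivl T)" for j
  proof (rule L2_bounded[OF finite_measure_ivl, of _ _ "T ^ j"])
    show "\<bar>x ^ j\<bar> \<le> T ^ j" if "x \<in> space (ivl T)" for x
      using that by (auto simp: power_abs intro!: power_mono)
  qed simp
  have wi: "integrable (ivl T) (\<lambda>t'. w t' * t' ^ j)" for j
    by (rule L2_integrable_mult[OF w pw])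
  have mono: "w t' * (t - t') ^ j = (\<Sum>q\<le>j. (of_nat (j choose q) * t ^ (j - q) * (-1) ^ q) * (w t' * t' ^ q))" for j t'
  proof -
    have "(t - t') ^ j = (- t' + t) ^ j" by simp
    also have "\<dots> = (\<Sum>q\<le>j. of_nat (j choose q) * (- t') ^ q * t ^ (j - q))"
      by (rule binomial_ring)
    finally show ?thesis
      by (simp add: sum_distrib_left power_minus[of t'] mult_ac)
  qed
  have mi: "integrable (ivl T) (\<lambda>t'. w t' * (t - t') ^ j)" for j
    unfolding mono using wi by auto
  have m0: "(\<integral>t'. w t' * (t - t') ^ j \<partial>ivl T) = 0" if "j < S" for j
    unfolding mono using wi orth that by (subst Bochner_Integration.integral_sum) auto
  have "(\<integral>t'. w t' * a (t - t') \<partial>ivl T) =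
      (\<integral>t'. (\<Sum>j<S. p j * (w t' * (t - t') ^ j)) + w t' * e (t - t') \<partial>ivl T)"
  proof (intro Bochner_Integration.integral_cong refl)
    fix t' assume "t' \<in> space (ivl T)"
    then have "\<bar>t - t'\<bar> < T" using t by auto
    from apr[OF this] show "w t' * a (t - t') = (\<Sum>j<S. p j * (w t' * (t - t') ^ j)) + w t' * e (t - t')"
      by (simp add: algebra_simps sum_distrib_left)
  qed
  also have "\<dots> = (\<Sum>j<S. p j * (\<integral>t'. w t' * (t - t') ^ j \<partial>ivl T)) + (\<integral>t'. w t' * e (t - t') \<partial>ivl T)"
    using mi i by (simp add: Bochner_Integration.integral_sum)
  finally show ?thesis using m0 by simp
qed

text \<open>Of the singular vectors' span only the annihilator of \<open>R + S\<close> functionals is used: there the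
  finite-rank parts of the kernel and of the filter act trivially, and the remaining dimensions are
  summed by Bessel's inequality.\<close>

lemma singular_system_bound:
  fixes v :: "nat \<Rightarrow> 'x \<Rightarrow> real"
  assumes dec: "\<And>x t. x \<in> space M \<Longrightarrow> t \<in> {0<..<T} \<Longrightarrow> k x t = (\<Sum>r<R. b r x * d r t) + \<rho> x t"
    and b: "\<And>r. r < R \<Longrightarrow> b r \<in> L2 M"
    and \<rho>: "case_prod \<rho> \<in> borel_measurable (M \<Otimes>\<^sub>M ivl T)"
    and K2: "(\<integral>\<^sup>+t. \<integral>\<^sup>+x. ennreal ((\<rho> x t)\<^sup>2) \<partial>M \<partial>ivl T) \<le> ennreal K2" "0 \<le> K2"
    and apr: "\<And>\<tau>. \<bar>\<tau>\<bar> < T \<Longrightarrow> a \<tau> = (\<Sum>j<S. p j * \<tau> ^ j) + e \<tau>"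
    and e: "integrable lborel e" "(\<integral>t. \<bar>e t\<bar> \<partial>lborel) \<le> E"
    and orth: "\<And>i j. i < n \<Longrightarrow> j < n \<Longrightarrow> L2_inner M (v i) (v j) = (if i = j then 1 else 0)"
    and lam: "\<And>i. i < n \<Longrightarrow> l \<le> lam i"
    and sing: "\<And>i. i < n \<Longrightarrow> singular_vector M (ivl T) A (lam i) (v i)"
    and l: "0 < l"
  shows "l\<^sup>2 * real (n - (R + S)) \<le> E\<^sup>2 * K2"
proof (cases "R + S \<le> n")
  case False
  \<comment> \<open>Here the truncated difference \<open>n - (R + S)\<close> is 0.\<close>
  then show ?thesis using K2 by simp
next
  case True
  define D where "D = n - (R + S)"
  have n: "n = D + (R + S)" using True by (simp add: D_def)
  have E0: "0 \<le> E" using e(2) by (rule order_trans[rotated]) simp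
  have vL: "v i \<in> L2 M" if "i < n" for i
    using sing[OF that] by (simp add: singular_vector_def)
  define y where "y i = A (v i)" for i
  have yL: "y i \<in> L2 (ivl T)" if "i < n" for i
    unfolding y_def by (rule A_L2[OF vL[OF that]])
  \<comment> \<open>Singular vectors have orthogonal images: the adjoint belonging to
    \<open>v j\<close> turns the inner product of the images into an eigenvalue times that of the
    vectors.\<close>
  have yy: "L2_inner (ivl T) (y i) (y j) = (lam j)\<^sup>2 * (if i = j then 1 else 0)"
    if ij: "i < n" "j < n" for i j
  proof -
    obtain Bj where Bj: "adjoint_L2 M (ivl T) A Bj" "AE x in M. Bj (A (v j)) x = (lam j)\<^sup>2 * v j x"
      using sing[OF ij(2)] by (auto simp: singular_vector_def)
    have BL: "Bj (y j) \<in> L2 M" and "L2_inner (ivl T) (y i) (y j) = L2_inner M (v i) (Bj (y j))"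
      using Bj(1) vL[OF ij(1)] yL[OF ij(2)] by (auto simp: adjoint_L2_def y_def)
    note this(2)
    also have "L2_inner M (v i) (Bj (y j)) = (\<integral>x. (lam j)\<^sup>2 * (v i x * v j x) \<partial>M)"
      unfolding L2_inner_def
    proof (rule integral_cong_AE)
      show "AE x in M. v i x * Bj (y j) x = (lam j)\<^sup>2 * (v i x * v j x)"
        using Bj(2) by eventually_elim (simp add: y_def)
    qed (use BL vL[OF ij(1)] vL[OF ij(2)] in measurable)
    also have "\<dots> = (lam j)\<^sup>2 * L2_inner M (v i) (v j)"
      by (simp add: L2_inner_def)
    finally show ?thesis using orth[OF ij] by simp
  qed
  \<comment> \<open>The first \<open>R\<close> functionals test against the spatial factors
    \<open>b\<close> of the kernel, the other \<open>S\<close> are moments of the unfiltered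
    images.\<close>
  define L where "L q i = (if q < R then L2_inner M (v i) (b q)
      else (\<integral>t'. K (v i) t' * t' ^ (q - R) \<partial>ivl T))" for q i
  obtain c where c: "\<And>j k. j < D \<Longrightarrow> k < D \<Longrightarrow> (\<Sum>i<n. c j i * c k i) = (if j = k then 1 else 0)"
      "\<And>j q. j < D \<Longrightarrow> q < R + S \<Longrightarrow> (\<Sum>i<n. c j i * L q i) = 0"
    using orthonormal_rows_annihilating[of D "R + S" L] unfolding n by metis
  define f where "f j x = (\<Sum>i<n. c j i * v i x)" for j x
  define W where "W j = K (f j)" for j
  define z where "z j t = (\<Sum>i<n. c j i * y i t)" for j t
  have fL: "f j \<in> L2 M" for j unfolding f_def using vL by (intro L2_sum) auto
  have WL: "W j \<in> L2 (ivl T)" for j unfolding W_def by (rule K_L2[OF fL])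
  have zL: "z j \<in> L2 (ivl T)" for j unfolding z_def using yL by (intro L2_sum) auto
  have ff: "L2_inner M (f j) (f k) = (if j = k then 1 else 0)" if "j < D" "k < D" for j k
  proof -
    have "L2_inner M (f j) (f k) = (\<Sum>p<n. \<Sum>r<n. c j p * c k r * L2_inner M (v p) (v r))"
      unfolding f_def using vL by (intro L2_inner_sum_sum) auto
    also have "\<dots> = (\<Sum>p<n. \<Sum>r<n. if r = p then c j p * c k p else 0)"
      using orth by (intro sum.cong refl) auto
    also have "\<dots> = (\<Sum>p<n. c j p * c k p)"
      by (intro sum.cong refl) (subst sum.delta, auto)
    finally show ?thesis using c(1) that by simp
  qed
  \<comment> \<open>A combination, with coefficients of unit length, of orthogonal vectors of norm
    at least \<open>l\<close> again has norm at least \<open>l\<close>.\<close>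
  have zz: "l\<^sup>2 \<le> (\<integral>t. (z j t)\<^sup>2 \<partial>ivl T)" if "j < D" for j
  proof -
    have "(\<integral>t. (z j t)\<^sup>2 \<partial>ivl T) = L2_inner (ivl T) (z j) (z j)"
      by (simp add: L2_inner_def power2_eq_square)
    also have "\<dots> = (\<Sum>p<n. \<Sum>r<n. c j p * c j r * L2_inner (ivl T) (y p) (y r))"
      unfolding z_def using yL by (intro L2_inner_sum_sum) auto
    also have "\<dots> = (\<Sum>p<n. \<Sum>r<n. if r = p then c j p * c j p * (lam p)\<^sup>2 else 0)"
      using yy by (intro sum.cong refl) auto
    also have "\<dots> = (\<Sum>p<n. c j p * c j p * (lam p)\<^sup>2)"
      by (intro sum.cong refl) (subst sum.delta, auto)
    also have "\<dots> \<ge> (\<Sum>p<n. c j p * c j p * l\<^sup>2)"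
      using lam l by (intro sum_mono mult_left_mono power_mono) auto
    finally show ?thesis using c(1)[OF that that] by (simp add: sum_distrib_right[symmetric])
  qed
  have zW: "AE t in ivl T. z j t = (\<integral>t'. W j t' * e (t - t') \<partial>ivl T)" if j: "j < D" for j
  proof -
    have orthW: "(\<integral>t'. W j t' * t' ^ q \<partial>ivl T) = 0" if "q < S" for q
    proof -
      have pw: "(\<lambda>t'. t' ^ q) \<in> L2 (ivl T)"
      proof (rule L2_bounded[OF finite_measure_ivl, of _ _ "T ^ q"])
        show "\<bar>x ^ q\<bar> \<le> T ^ q" if "x \<in> space (ivl T)" for x
          using that by (auto simp: power_abs intro!: power_mono)
      qed simp
      have "(\<integral>t'. W j t' * t' ^ q \<partial>ivl T) = (\<integral>t'. (\<Sum>i<n. c j i * K (v i) t') * t' ^ q \<partial>ivl T)"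
        unfolding W_def f_def using vL by (intro Bochner_Integration.integral_cong refl) (simp add: K_sum)
      also have "\<dots> = (\<Sum>i<n. c j i * (\<integral>t'. K (v i) t' * t' ^ q \<partial>ivl T))"
        using L2_inner_sum_left[of "{..<n}" "\<lambda>i. K (v i)" "ivl T" "\<lambda>t'. t' ^ q" "c j"] K_L2 vL pw
        by (simp add: L2_inner_def)
      also have "\<dots> = (\<Sum>i<n. c j i * L (R + q) i)" by (simp add: L_def)
      also have "\<dots> = 0" using c(2)[OF j, of "R + q"] that by simp
      finally show ?thesis .
    qed
    have "AE t in ivl T. \<forall>i\<in>{..<n}. integrable (ivl T) (\<lambda>t'. K (v i) t' * a (t - t'))"
      using conv_L2(1)[OF K_L2[OF vL] a] by (intro AE_finite_allI) auto
    moreover have "AE t in ivl T. \<forall>i\<in>{..<n}. y i t = (\<integral>t'. K (v i) t' * a (t - t') \<partial>ivl T)"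
      unfolding y_def using A_eq_conv[OF vL] by (intro AE_finite_allI) auto
    moreover have "AE t in ivl T. integrable (ivl T) (\<lambda>t'. W j t' * e (t - t'))"
      by (rule conv_L2(1)[OF WL e(1)])
    moreover have "AE t in ivl T. t \<in> {0<..<T}" using AE_space[of "ivl T"] by simp
    ultimately show ?thesis
    proof eventually_elim
      case (elim t)
      have "z j t = (\<Sum>i<n. c j i * (\<integral>t'. K (v i) t' * a (t - t') \<partial>ivl T))"
        unfolding z_def using elim by (intro sum.cong) auto
      also have "\<dots> = (\<integral>t'. (\<Sum>i<n. c j i * (K (v i) t' * a (t - t'))) \<partial>ivl T)"
        using elim by (subst Bochner_Integration.integral_sum) auto
      also have "\<dots> = (\<integral>t'. W j t' * a (t - t') \<partial>ivl T)"
        unfolding W_def f_def using vL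
        by (intro Bochner_Integration.integral_cong refl)
           (simp add: K_sum sum_distrib_right mult.assoc)
      also have "\<dots> = (\<integral>t'. W j t' * e (t - t') \<partial>ivl T)"
        by (rule conv_polynomial_remainder[OF WL elim(4) orthW apr elim(3)])
      finally show ?case .
    qed
  qed
  have zE: "(\<integral>t. (z j t)\<^sup>2 \<partial>ivl T) \<le> E\<^sup>2 * (\<integral>t. (W j t)\<^sup>2 \<partial>ivl T)" if j: "j < D" for j
  proof -
    have cL: "(\<lambda>t. \<integral>t'. W j t' * e (t - t') \<partial>ivl T) \<in> L2 (ivl T)"
      by (rule conv_L2(2)[OF WL e(1)])
    have "(\<integral>t. (z j t)\<^sup>2 \<partial>ivl T) = (\<integral>t. (\<integral>t'. W j t' * e (t - t') \<partial>ivl T)\<^sup>2 \<partial>ivl T)"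
    proof (rule integral_cong_AE)
      show "AE t in ivl T. (z j t)\<^sup>2 = (\<integral>t'. W j t' * e (t - t') \<partial>ivl T)\<^sup>2"
        using zW[OF j] by eventually_elim simp
    qed (use zL[of j] cL in \<open>auto simp: L2_def\<close>)
    also have "\<dots> \<le> (\<integral>t. \<bar>e t\<bar> \<partial>lborel)\<^sup>2 * (\<integral>t. (W j t)\<^sup>2 \<partial>ivl T)"
      by (rule conv_L2(3)[OF WL e(1)])
    also have "\<dots> \<le> E\<^sup>2 * (\<integral>t. (W j t)\<^sup>2 \<partial>ivl T)"
      using e(2) by (intro mult_right_mono power_mono) auto
    finally show ?thesis .
  qed
  \<comment> \<open>For fixed \<open>t\<close> the number \<open>W j t\<close> is the coefficient of
    \<rho>(., t) along \<open>f j\<close>, because the finite-rank part is annihilated. Bessel's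
    inequality controls the squares of all \<open>D\<close> coefficients at once; this is the source
    of the gain n^(-1/2).\<close>
  have pt: "ennreal (\<Sum>j<D. (W j t)\<^sup>2) \<le> (\<integral>\<^sup>+x. ennreal ((\<rho> x t)\<^sup>2) \<partial>M)" if t: "t \<in> {0<..<T}" for t
  proof (cases "(\<integral>\<^sup>+x. ennreal ((\<rho> x t)\<^sup>2) \<partial>M) = \<infinity>")
    case False
    have "(\<lambda>x. (x, t)) \<in> M \<rightarrow>\<^sub>M M \<Otimes>\<^sub>M ivl T" using t by (intro measurable_Pair) auto
    from measurable_compose[OF this \<rho>] have rm[measurable]: "(\<lambda>x. \<rho> x t) \<in> borel_measurable M" by simp
    have ri: "integrable M (\<lambda>x. (\<rho> x t)\<^sup>2)"
      using False by (intro integrableI_bounded) (auto simp: less_top)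
    then have rL: "(\<lambda>x. \<rho> x t) \<in> L2 M" using rm by (simp add: L2_def)
    have "W j t = L2_inner M (f j) (\<lambda>x. \<rho> x t)" if j: "j < D" for j
    proof -
      have "W j t = L2_inner M (f j) (\<lambda>x. (\<Sum>r<R. d r t * b r x) + \<rho> x t)"
        unfolding W_def K_def L2_inner_def
        using dec[OF _ t] by (intro Bochner_Integration.integral_cong refl) (simp add: mult.commute)
      also have "\<dots> = L2_inner M (f j) (\<lambda>x. \<Sum>r<R. d r t * b r x) + L2_inner M (f j) (\<lambda>x. \<rho> x t)"
        unfolding L2_inner_def distrib_left
        by (intro Bochner_Integration.integral_add L2_integrable_mult fL rL L2_sum b) auto
      also have "L2_inner M (f j) (\<lambda>x. \<Sum>r<R. d r t * b r x) = (\<Sum>r<R. d r t * L2_inner M (f j) (b r))"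
        using L2_inner_sum_left[of "{..<R}" b M "f j" "\<lambda>r. d r t"] b fL by (simp add: L2_inner_commute)
      also have "\<dots> = 0"
      proof (intro sum.neutral ballI)
        fix r assume r: "r \<in> {..<R}"
        have "L2_inner M (f j) (b r) = (\<Sum>i<n. c j i * L2_inner M (v i) (b r))"
          unfolding f_def using vL b r by (intro L2_inner_sum_left) auto
        also have "\<dots> = (\<Sum>i<n. c j i * L r i)" using r by (simp add: L_def)
        also have "\<dots> = 0" using c(2)[OF j, of r] r by simp
        finally show "d r t * L2_inner M (f j) (b r) = 0" by simp
      qed
      finally show ?thesis by simp
    qed
    then have "(\<Sum>j<D. (W j t)\<^sup>2) = (\<Sum>j<D. (L2_inner M (f j) (\<lambda>x. \<rho> x t))\<^sup>2)" by simp
    also have "\<dots> \<le> (\<integral>x. (\<rho> x t)\<^sup>2 \<partial>M)"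
      using fL rL ff by (intro bessel_L2) auto
    finally have "ennreal (\<Sum>j<D. (W j t)\<^sup>2) \<le> ennreal (\<integral>x. (\<rho> x t)\<^sup>2 \<partial>M)" by (rule ennreal_leI)
    then show ?thesis using nn_integral_eq_integral[OF ri] by simp
  qed simp
  have Wi: "integrable (ivl T) (\<lambda>t. (W j t)\<^sup>2)" for j using WL[of j] by (simp add: L2_def)
  have "ennreal (\<Sum>j<D. (\<integral>t. (W j t)\<^sup>2 \<partial>ivl T)) = ennreal (\<integral>t. (\<Sum>j<D. (W j t)\<^sup>2) \<partial>ivl T)"
    using Wi by (simp add: Bochner_Integration.integral_sum)
  also have "\<dots> = (\<integral>\<^sup>+t. ennreal (\<Sum>j<D. (W j t)\<^sup>2) \<partial>ivl T)"
    using Wi by (intro nn_integral_eq_integral[symmetric]) (auto intro!: sum_nonneg)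
  also have "\<dots> \<le> (\<integral>\<^sup>+t. \<integral>\<^sup>+x. ennreal ((\<rho> x t)\<^sup>2) \<partial>M \<partial>ivl T)"
    by (intro nn_integral_mono pt) simp
  also have "\<dots> \<le> ennreal K2" by (rule K2)
  finally have WK: "(\<Sum>j<D. (\<integral>t. (W j t)\<^sup>2 \<partial>ivl T)) \<le> K2" using K2(2) by simp
  have "l\<^sup>2 * real D = (\<Sum>j<D. l\<^sup>2)" by simp
  also have "\<dots> \<le> (\<Sum>j<D. E\<^sup>2 * (\<integral>t. (W j t)\<^sup>2 \<partial>ivl T))"
    using zz zE by (intro sum_mono) (meson lessThan_iff order_trans)
  also have "\<dots> = E\<^sup>2 * (\<Sum>j<D. (\<integral>t. (W j t)\<^sup>2 \<partial>ivl T))" by (simp add: sum_distrib_left)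
  also have "\<dots> \<le> E\<^sup>2 * K2" by (intro mult_left_mono WK) simp
  finally show ?thesis by (simp add: D_def)
qed

end

text \<open>From here on the measurability prover would apply this rule to the unknown source space of an
  arbitrary subgoal.\<close>

declare ivl_id_measurable [measurable del]

section \<open>Polynomial approximation of Besov functions\<close>

text \<open>The positive and the negative part of \<open>f\<close> are densities of two measures
  that agree on all half-lines, hence on all Borel sets; densities are unique almost
  everywhere.\<close>

lemma AE_eq_0_if_interval_integrals_0:
  fixes f :: "real \<Rightarrow> real"
  assumes f: "integrable lborel f"
    and zero: "\<And>c d. c < d \<Longrightarrow> (\<integral>x. indicator {c..d} x * f x \<partial>lborel) = 0"
  shows "AE x in lborel. f x = 0"
proof -
  have [measurable]: "f \<in> borel_measurable borel" using borel_measurable_integrable[OF f] by simp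
  define p where "p x = max (f x) 0" for x
  define n where "n x = max (- f x) 0" for x
  have [measurable]: "p \<in> borel_measurable borel" "n \<in> borel_measurable borel"
    unfolding p_def n_def by measurable
  have pi: "integrable lborel p" and ni: "integrable lborel n"
    unfolding p_def n_def using f by auto
  \<comment> \<open>Half-lines are exhausted by compact intervals; the shift by 2 in the right end
    point keeps them nondegenerate for every \<open>k\<close>.\<close>
  have half: "(\<integral>x. indicator {c<..} x * f x \<partial>lborel) = 0" for c
  proof (rule LIMSEQ_unique)
    show "(\<lambda>k. \<integral>x. indicator {c + inverse (real (Suc k))..c + 2 + real k} x * f x \<partial>lborel)
        \<longlonglongrightarrow> (\<integral>x. indicator {c<..} x * f x \<partial>lborel)"
    proof (rule integral_dominated_convergence[where w = "\<lambda>x. \<bar>f x\<bar>"])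
      show "AE x in lborel. (\<lambda>k. indicator {c + inverse (real (Suc k))..c + 2 + real k} x * f x)
          \<longlonglongrightarrow> indicator {c<..} x * f x"
      proof (rule AE_I2, rule tendsto_eventually)
        fix x
        show "\<forall>\<^sub>F k in sequentially. indicator {c + inverse (real (Suc k))..c + 2 + real k} x * f x
            = indicator {c<..} x * f x"
        proof (cases "c < x")
          case True
          obtain k1 where k1: "inverse (real (Suc k1)) < x - c"
            using True reals_Archimedean[of "x - c"] by auto
          obtain k2 where k2: "x - c < real k2" using reals_Archimedean2 by blast
          show ?thesis
          proof (rule eventually_sequentiallyI[of "max k1 k2"])
            fix k assume k: "max k1 k2 \<le> k"
            have "inverse (real (Suc k)) \<le> inverse (real (Suc k1))"
              using k by (intro le_imp_inverse_le) auto
            then have "c + inverse (real (Suc k)) \<le> x" using k1 by linarith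
            then show "indicator {c + inverse (real (Suc k))..c + 2 + real k} x * f x
                = indicator {c<..} x * f x"
              using k k2 True by (simp add: indicator_def del: of_nat_Suc)
          qed
        next
          case False
          have "0 < inverse (real (Suc k))" for k by simp
          with False have "\<not> (c + inverse (real (Suc k)) \<le> x)" for k
            by (smt (verit))
          with False show ?thesis by (simp add: indicator_def)
        qed
      qed
    qed (use f in \<open>auto simp: indicator_def\<close>)
    have "(\<integral>x. indicator {c + inverse (real (Suc k))..c + 2 + real k} x * f x \<partial>lborel) = 0" for k
    proof (rule zero)
      have "inverse (real (Suc k)) \<le> 1" by (simp add: field_simps)
      then show "c + inverse (real (Suc k)) < c + 2 + real k" by linarith
    qed
    then show "(\<lambda>k. \<integral>x. indicator {c + inverse (real (Suc k))..c + 2 + real k} x * f x \<partial>lborel) \<longlonglongrightarrow> 0"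
      by simp
  qed
  have pint: "integrable lborel (\<lambda>x. p x * indicator {c<..} x)"
    and nint: "integrable lborel (\<lambda>x. n x * indicator {c<..} x)" for c
    using integrable_mult_indicator[OF _ pi, of "{c<..}"] integrable_mult_indicator[OF _ ni, of "{c<..}"]
    by (simp_all add: mult.commute)
  have "(\<integral>x. p x * indicator {c<..} x \<partial>lborel) = (\<integral>x. n x * indicator {c<..} x \<partial>lborel)" for c
  proof -
    have "(\<integral>x. p x * indicator {c<..} x \<partial>lborel) - (\<integral>x. n x * indicator {c<..} x \<partial>lborel)
        = (\<integral>x. p x * indicator {c<..} x - n x * indicator {c<..} x \<partial>lborel)"
      using pint nint by simp
    also have "\<dots> = (\<integral>x. indicator {c<..} x * f x \<partial>lborel)"
      by (intro Bochner_Integration.integral_cong) (auto simp: p_def n_def indicator_def)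
    finally show ?thesis using half by simp
  qed
  then have "(\<integral>\<^sup>+x. ennreal (p x) * indicator {c<..} x \<partial>lborel) = (\<integral>\<^sup>+x. ennreal (n x) * indicator {c<..} x \<partial>lborel)" for c
    using nn_integral_eq_integral[OF pint[of c]] nn_integral_eq_integral[OF nint[of c]]
    by (simp add: p_def n_def ennreal_mult ennreal_indicator)
  then have em: "emeasure (density lborel p) {c<..} = emeasure (density lborel n) {c<..}" for c
    by (simp add: emeasure_density)
  have fin: "emeasure (density lborel p) {c<..} < \<infinity>" for c
    using nn_integral_eq_integral[OF pint[of c]]
    by (simp add: emeasure_density p_def ennreal_mult ennreal_indicator)
  have "density lborel p = density lborel n"
    by (rule measure_eqI_lessThan) (use em fin in auto)
  then have "AE x in lborel. ennreal (p x) = ennreal (n x)"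
    by (intro sigma_finite_measure.density_unique[OF sigma_finite_lborel]) auto
  then show ?thesis
    by eventually_elim (auto simp: p_def n_def max_def split: if_splits)
qed

section \<open>Gaussians and their Fourier transforms\<close>

lemma std_normal_cos_sin:
  "(\<integral>x. cos (t * x) * std_normal_density x \<partial>lborel) = exp (- t\<^sup>2 / 2)"
  "(\<integral>x. sin (t * x) * std_normal_density x \<partial>lborel) = 0"
proof -
  have i: "integrable lborel (\<lambda>x. std_normal_density x *\<^sub>R iexp (t * x))"
  proof (rule Bochner_Integration.integrable_bound[of _ std_normal_density])
    show "integrable lborel std_normal_density" by simp
  qed auto
  have "complex_of_real (exp (- t\<^sup>2 / 2)) = char std_normal_distribution t"
    by (simp add: char_std_normal_distribution)
  also have "\<dots> = (\<integral>x. std_normal_density x *\<^sub>R iexp (t * x) \<partial>lborel)"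
    unfolding char_def by (subst integral_density) auto
  finally have c: "complex_of_real (exp (- t\<^sup>2 / 2)) = (\<integral>x. std_normal_density x *\<^sub>R iexp (t * x) \<partial>lborel)" .
  have "exp (- t\<^sup>2 / 2) = (\<integral>x. Re (std_normal_density x *\<^sub>R iexp (t * x)) \<partial>lborel)"
    using arg_cong[OF c, of Re] integral_bounded_linear[OF bounded_linear_Re i] by simp
  then show "(\<integral>x. cos (t * x) * std_normal_density x \<partial>lborel) = exp (- t\<^sup>2 / 2)"
    by (simp add: Re_exp mult.commute)
  have "0 = (\<integral>x. Im (std_normal_density x *\<^sub>R iexp (t * x)) \<partial>lborel)"
    using arg_cong[OF c, of Im] integral_bounded_linear[OF bounded_linear_Im i] by simp
  then show "(\<integral>x. sin (t * x) * std_normal_density x \<partial>lborel) = 0"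
    by (simp add: Im_exp mult.commute)
qed

text \<open>Unnormalised: the bound by 1 makes it a convenient weight under dominated convergence,
  and the Fourier transform of \<open>gauss s\<close> is a multiple of
  \<open>gauss (1 / s)\<close>.\<close>

definition gauss :: "real \<Rightarrow> real \<Rightarrow> real" where "gauss s x = exp (- (s * x)\<^sup>2 / 2)"

lemma gauss_measurable [measurable]: "gauss s \<in> borel_measurable borel"
  unfolding gauss_def by measurable

lemma gauss_std_normal: "gauss s x = sqrt (2 * pi) * std_normal_density (0 + s * x)"
  by (simp add: gauss_def std_normal_density_def)

lemma gauss_nonneg: "0 \<le> gauss s x" and gauss_pos: "0 < gauss s x" and gauss_le_1: "gauss s x \<le> 1"
  by (simp_all add: gauss_def)

lemma gauss_integrable: "0 < s \<Longrightarrow> integrable lborel (gauss s)"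
  using lborel_integrable_real_affine[of std_normal_density s 0]
  by (simp add: gauss_std_normal[abs_def])

lemma gauss_fourier:
  assumes s: "0 < s"
  shows "(\<integral>x. cos (x * \<xi>) * gauss s x \<partial>lborel) = sqrt (2 * pi) / s * gauss (1 / s) \<xi>"
    and "(\<integral>x. sin (x * \<xi>) * gauss s x \<partial>lborel) = 0"
proof -
  have "(\<integral>x. cos (\<xi> / s * x) * std_normal_density x \<partial>lborel)
     = s *\<^sub>R (\<integral>x. cos (\<xi> / s * (0 + s * x)) * std_normal_density (0 + s * x) \<partial>lborel)"
    using lborel_integral_real_affine[of s "\<lambda>x. cos (\<xi> / s * x) * std_normal_density x" 0] s by simp
  also have "(\<integral>x. cos (\<xi> / s * (0 + s * x)) * std_normal_density (0 + s * x) \<partial>lborel)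
     = (\<integral>x. cos (x * \<xi>) * gauss s x / sqrt (2 * pi) \<partial>lborel)"
    using s by (intro Bochner_Integration.integral_cong refl) (simp add: gauss_std_normal mult.commute)
  also have "s *\<^sub>R \<dots> = s / sqrt (2 * pi) * (\<integral>x. cos (x * \<xi>) * gauss s x \<partial>lborel)"
    by simp
  finally have "s / sqrt (2 * pi) * (\<integral>x. cos (x * \<xi>) * gauss s x \<partial>lborel) = gauss (1 / s) \<xi>"
    unfolding std_normal_cos_sin by (simp add: gauss_def)
  then show "(\<integral>x. cos (x * \<xi>) * gauss s x \<partial>lborel) = sqrt (2 * pi) / s * gauss (1 / s) \<xi>"
    using s by (simp add: field_simps)
  have "(\<integral>x. sin (\<xi> / s * x) * std_normal_density x \<partial>lborel)
     = s *\<^sub>R (\<integral>x. sin (\<xi> / s * (0 + s * x)) * std_normal_density (0 + s * x) \<partial>lborel)"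
    using lborel_integral_real_affine[of s "\<lambda>x. sin (\<xi> / s * x) * std_normal_density x" 0] s by simp
  also have "(\<integral>x. sin (\<xi> / s * (0 + s * x)) * std_normal_density (0 + s * x) \<partial>lborel)
     = (\<integral>x. sin (x * \<xi>) * gauss s x / sqrt (2 * pi) \<partial>lborel)"
    using s by (intro Bochner_Integration.integral_cong refl) (simp add: gauss_std_normal mult.commute)
  also have "s *\<^sub>R \<dots> = s / sqrt (2 * pi) * (\<integral>x. sin (x * \<xi>) * gauss s x \<partial>lborel)"
    by simp
  finally show "(\<integral>x. sin (x * \<xi>) * gauss s x \<partial>lborel) = 0"
    using s unfolding std_normal_cos_sin by simp
qed

text \<open>Addition theorem for the cosine after a translation by \<open>y\<close>; the sine moment
  of the even function \<open>gauss s\<close> is 0.\<close>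

lemma gauss_fourier_shift:
  assumes s: "0 < s"
  shows "(\<integral>x. cos ((x - u) * \<xi>) * gauss s (x - y) \<partial>lborel)
    = sqrt (2 * pi) / s * (cos ((y - u) * \<xi>) * gauss (1 / s) \<xi>)"
proof -
  have ci: "integrable lborel (\<lambda>x. cos (x * \<xi>) * gauss s x)"
    and si: "integrable lborel (\<lambda>x. sin (x * \<xi>) * gauss s x)"
    by (rule Bochner_Integration.integrable_bound[OF gauss_integrable[OF s]];
        auto simp: abs_mult gauss_nonneg intro!: mult_left_le_one_le)+
  have "(\<integral>x. cos ((x - u) * \<xi>) * gauss s (x - y) \<partial>lborel)
     = (\<integral>x. cos ((y + 1 * x - u) * \<xi>) * gauss s (y + 1 * x - y) \<partial>lborel)"
    using lborel_integral_real_affine[of 1 "\<lambda>x. cos ((x - u) * \<xi>) * gauss s (x - y)" y] by simp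
  also have "\<dots> = (\<integral>x. cos ((y - u) * \<xi>) * (cos (x * \<xi>) * gauss s x) - sin ((y - u) * \<xi>) * (sin (x * \<xi>) * gauss s x) \<partial>lborel)"
  proof (intro Bochner_Integration.integral_cong refl)
    fix x
    have "(y + 1 * x - u) * \<xi> = (y - u) * \<xi> + x * \<xi>" by (simp add: algebra_simps)
    moreover have "y + 1 * x - y = x" by simp
    ultimately show "cos ((y + 1 * x - u) * \<xi>) * gauss s (y + 1 * x - y) =
       cos ((y - u) * \<xi>) * (cos (x * \<xi>) * gauss s x) - sin ((y - u) * \<xi>) * (sin (x * \<xi>) * gauss s x)"
      by (simp only: cos_add left_diff_distrib mult.assoc)
  qed
  also have "\<dots> = cos ((y - u) * \<xi>) * (\<integral>x. cos (x * \<xi>) * gauss s x \<partial>lborel)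
      - sin ((y - u) * \<xi>) * (\<integral>x. sin (x * \<xi>) * gauss s x \<partial>lborel)"
    using ci si by simp
  finally show ?thesis unfolding gauss_fourier[OF s] by simp
qed

text \<open>Smoothing the indicator of [c, d] by a Gaussian of width 1/(k+1) gives a superposition
  of translated Gaussians, against which \<open>f\<close> integrates to 0. As \<open>k\<close>
  grows, the smoothed functions tend to the indicator off the two end points, so all interval
  integrals of \<open>f\<close> vanish.\<close>

lemma AE_eq_0_if_gauss_integrals_0:
  fixes f :: "real \<Rightarrow> real"
  assumes f: "integrable lborel f"
    and zero: "\<And>s y. 0 < s \<Longrightarrow> (\<integral>x. f x * gauss s (x - y) \<partial>lborel) = 0"
  shows "AE x in lborel. f x = 0"
proof (rule AE_eq_0_if_interval_integrals_0[OF f])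
  have [measurable]: "f \<in> borel_measurable borel" using borel_measurable_integrable[OF f] by simp
  fix c d :: real assume cd: "c < d"
  define w where "w k x = (\<integral>z. indicator {c..d} (x - z / real (Suc k)) * std_normal_density z \<partial>lborel)" for k x
  have [measurable]: "w k \<in> borel_measurable borel" for k unfolding w_def by measurable
  have ii: "integrable lborel (\<lambda>z. indicator {c..d} (x - z / real (Suc k)) * std_normal_density z)" for k x
    by (rule Bochner_Integration.integrable_bound[of _ std_normal_density]) (auto simp: indicator_def)
  have wb: "\<bar>w k x\<bar> \<le> 1" for k x
  proof -
    have "\<bar>w k x\<bar> \<le> (\<integral>z. norm (indicator {c..d} (x - z / real (Suc k)) * std_normal_density z) \<partial>lborel)"
      unfolding w_def
      using integral_norm_bound[of lborel "\<lambda>z. indicator {c..d} (x - z / real (Suc k)) * std_normal_density z"]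
      by (simp only: real_norm_def)
    also have "\<dots> \<le> (\<integral>z. std_normal_density z \<partial>lborel)"
      using ii by (intro integral_mono integrable_norm) (auto simp: indicator_def)
    finally show ?thesis by simp
  qed
  have w0: "(\<integral>x. w k x * f x \<partial>lborel) = 0" for k
  proof -
    define K where "K = real (Suc k)"
    have K: "K > 0" by (simp add: K_def)
    \<comment> \<open>The substitution \<open>z = K * (x - y)\<close> turns the average over shifts
      into an integral of translated Gaussians over [c, d].\<close>
    have w_eq: "w k x = K / sqrt (2 * pi) * (\<integral>y. indicator {c..d} y * gauss K (x - y) \<partial>lborel)" for x
    proof -
      have "w k x = K * (\<integral>y. indicator {c..d} (x - (K * x + (-K) * y) / K) * std_normal_density (K * x + (-K) * y) \<partial>lborel)"
        unfolding w_def K_def[symmetric]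
        using lborel_integral_real_affine[of "-K" "\<lambda>z. indicator {c..d} (x - z / K) * std_normal_density z" "K * x"] K
        by simp
      also have "(\<lambda>y. indicator {c..d} (x - (K * x + (-K) * y) / K) * std_normal_density (K * x + (-K) * y))
         = (\<lambda>y. indicator {c..d} y * gauss K (x - y) / sqrt (2 * pi))"
      proof
        fix y
        have "x - (K * x + (-K) * y) / K = y" using K by (simp add: field_simps)
        moreover have "std_normal_density (K * x + (-K) * y) = gauss K (x - y) / sqrt (2 * pi)"
          by (simp add: std_normal_density_def gauss_def algebra_simps)
        ultimately show "indicator {c..d} (x - (K * x + (-K) * y) / K) * std_normal_density (K * x + (-K) * y)
          = indicator {c..d} y * gauss K (x - y) / sqrt (2 * pi)" by simp
      qed
      finally show ?thesis by simp
    qed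
    have int: "integrable (lborel \<Otimes>\<^sub>M lborel) (\<lambda>(x, y). indicator {c..d} y * gauss K (x - y) * f x)"
    proof (rule lborel_pair.Fubini_integrable)
      have iy: "integrable lborel (\<lambda>y. indicator {c..d} y * gauss K (x - y) * f x)" for x
      proof -
        have "integrable lborel (\<lambda>y. f x * indicator {c..d} y)"
          using cd by (intro integrable_mult_right integrable_real_indicator) auto
        then show ?thesis
          by (rule Bochner_Integration.integrable_bound)
             (auto simp: indicator_def abs_mult gauss_nonneg gauss_le_1 intro!: mult_left_le_one_le)
      qed
      then show "AE x in lborel. integrable lborel (\<lambda>y. case (x, y) of (x, y) \<Rightarrow> indicator {c..d} y * gauss K (x - y) * f x)"
        by simp
      show "integrable lborel (\<lambda>x. \<integral>y. norm (case (x, y) of (x, y) \<Rightarrow> indicator {c..d} y * gauss K (x - y) * f x) \<partial>lborel)"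
      proof (rule Bochner_Integration.integrable_bound[of _ "\<lambda>x. f x * (d - c)"])
        show "AE x in lborel. norm (\<integral>y. norm (case (x, y) of (x, y) \<Rightarrow> indicator {c..d} y * gauss K (x - y) * f x) \<partial>lborel)
            \<le> norm (f x * (d - c))"
        proof (rule AE_I2)
          fix x
          have "(\<integral>y. norm (indicator {c..d} y * gauss K (x - y) * f x) \<partial>lborel)
              \<le> (\<integral>y. \<bar>f x\<bar> * indicator {c..d} y \<partial>lborel)"
          proof (rule integral_mono[OF integrable_norm[OF iy]])
            show "integrable lborel (\<lambda>y. \<bar>f x\<bar> * indicator {c..d} y)"
              using cd by (intro integrable_mult_right integrable_real_indicator) auto
          qed (auto simp: indicator_def abs_mult gauss_nonneg gauss_le_1 intro!: mult_left_le_one_le)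
          also have "\<dots> = \<bar>f x\<bar> * (d - c)" using cd by simp
          finally show "norm (\<integral>y. norm (case (x, y) of (x, y) \<Rightarrow> indicator {c..d} y * gauss K (x - y) * f x) \<partial>lborel)
            \<le> norm (f x * (d - c))" using cd by (simp add: abs_mult)
        qed
      qed (use f in auto)
    qed measurable
    have "(\<integral>x. w k x * f x \<partial>lborel) = K / sqrt (2 * pi) * (\<integral>x. (\<integral>y. indicator {c..d} y * gauss K (x - y) * f x \<partial>lborel) \<partial>lborel)"
      unfolding w_eq by (simp add: mult.assoc integral_mult_left_zero[symmetric] del: integral_mult_left_zero)
    also have "(\<integral>x. (\<integral>y. indicator {c..d} y * gauss K (x - y) * f x \<partial>lborel) \<partial>lborel)
      = (\<integral>y. (\<integral>x. indicator {c..d} y * gauss K (x - y) * f x \<partial>lborel) \<partial>lborel)"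
      using lborel_pair.Fubini_integral[OF int] by simp
    also have "\<dots> = (\<integral>y. indicator {c..d} y * (\<integral>x. f x * gauss K (x - y) \<partial>lborel) \<partial>lborel)"
      unfolding integral_mult_right_zero[symmetric]
      by (intro Bochner_Integration.integral_cong refl) (simp add: mult_ac)
    finally show ?thesis using zero[OF K] by simp
  qed
  have lim: "(\<lambda>k. w k x) \<longlonglongrightarrow> indicator {c..d} x" if x: "x \<noteq> c" "x \<noteq> d" for x
  proof -
    have "(\<lambda>k. w k x) \<longlonglongrightarrow> (\<integral>z. indicator {c..d} x * std_normal_density z \<partial>lborel)"
      unfolding w_def
    proof (rule integral_dominated_convergence[where w = std_normal_density])
      show "AE z in lborel. (\<lambda>k. indicator {c..d} (x - z / real (Suc k)) * std_normal_density z)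
          \<longlonglongrightarrow> indicator {c..d} x * std_normal_density z"
      proof (rule AE_I2, rule tendsto_mult_right)
        fix z
        have "(\<lambda>k. x - z / real (Suc k)) \<longlonglongrightarrow> x - 0"
          by (intro tendsto_diff tendsto_const LIMSEQ_Suc[OF lim_const_over_n])
        then have t: "(\<lambda>k. x - z / real (Suc k)) \<longlonglongrightarrow> x" by simp
        consider "x < c" | "c < x" "x < d" | "d < x" using x by linarith
        then show "(\<lambda>k. indicator {c..d} (x - z / real (Suc k)) :: real) \<longlonglongrightarrow> indicator {c..d} x"
        proof cases
          case 1
          have "\<forall>\<^sub>F k in sequentially. x - z / real (Suc k) < c" using order_tendstoD(2)[OF t 1] .
          then show ?thesis using 1 by (intro tendsto_eventually) (auto elim!: eventually_mono simp: indicator_def)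
        next
          case 2
          have "\<forall>\<^sub>F k in sequentially. c < x - z / real (Suc k) \<and> x - z / real (Suc k) < d"
            using order_tendstoD(1)[OF t 2(1)] order_tendstoD(2)[OF t 2(2)] by eventually_elim simp
          then show ?thesis using 2 by (intro tendsto_eventually) (auto elim!: eventually_mono simp: indicator_def)
        next
          case 3
          have "\<forall>\<^sub>F k in sequentially. d < x - z / real (Suc k)" using order_tendstoD(1)[OF t 3] .
          then show ?thesis using 3 by (intro tendsto_eventually) (auto elim!: eventually_mono simp: indicator_def)
        qed
      qed
    qed (auto simp: indicator_def)
    then show ?thesis by simp
  qed
  show "(\<integral>x. indicator {c..d} x * f x \<partial>lborel) = 0"
  proof (rule LIMSEQ_unique)
    show "(\<lambda>k. \<integral>x. w k x * f x \<partial>lborel) \<longlonglongrightarrow> (\<integral>x. indicator {c..d} x * f x \<partial>lborel)"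
    proof (rule integral_dominated_convergence[where w = "\<lambda>x. \<bar>f x\<bar>"])
      have "AE x in lborel. x \<noteq> c \<and> x \<noteq> d"
        using AE_lborel_singleton[of c] AE_lborel_singleton[of d] by eventually_elim simp
      then show "AE x in lborel. (\<lambda>k. w k x * f x) \<longlonglongrightarrow> indicator {c..d} x * f x"
        by eventually_elim (intro tendsto_mult_right lim, auto)
      show "AE x in lborel. norm (w k x * f x) \<le> \<bar>f x\<bar>" for k
        using wb by (auto simp: abs_mult intro!: mult_left_le_one_le)
    qed (use f in auto)
    show "(\<lambda>k. \<integral>x. w k x * f x \<partial>lborel) \<longlonglongrightarrow> 0" using w0 by simp
  qed
qed

text \<open>The term of index \<open>k\<close> in the exponential series at \<open>k\<close> gives
  k^k / k! \<le> e^k \<le> 3^k.\<close>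

lemma power_div_fact_le:
  assumes "0 \<le> x"
  shows "x ^ k / fact k \<le> (3 * x / real k) ^ k"
proof (cases "k = 0")
  case False
  have "real k ^ k / fact k \<le> (\<Sum>i\<le>k. real k ^ i / fact i)"
    by (rule member_le_sum) auto
  also have "\<dots> \<le> exp (real k)"
  proof -
    have "(\<Sum>i\<in>{..k}. inverse (fact i) * real k ^ i) \<le> (\<Sum>i. inverse (fact i) * real k ^ i)"
      using summable_exp[of "real k"] by (intro sum_le_suminf) auto
    then show ?thesis by (simp add: exp_def divide_inverse mult.commute)
  qed
  also have "\<dots> = exp 1 ^ k" by (simp add: exp_of_nat_mult[symmetric])
  also have "\<dots> \<le> 3 ^ k" using exp_le by (intro power_mono) auto
  finally have "real k ^ k / fact k \<le> 3 ^ k" .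
  then have "(x / real k) ^ k * (real k ^ k / fact k) \<le> (x / real k) ^ k * 3 ^ k"
    using assms by (intro mult_left_mono) auto
  with False show ?thesis by (simp add: power_divide power_mult_distrib mult.commute)
qed simp

lemma cos_taylor:
  fixes x :: real
  shows "\<bar>cos x - (\<Sum>i<k. cos_coeff i * x ^ i)\<bar> \<le> \<bar>x\<bar> ^ k / fact k"
proof -
  obtain t where "cos x = (\<Sum>i<k. cos_coeff i * x ^ i) + cos (t + 1/2 * real k * pi) / fact k * x ^ k"
    using Maclaurin_cos_expansion[of x k] by auto
  then have "\<bar>cos x - (\<Sum>i<k. cos_coeff i * x ^ i)\<bar> = \<bar>cos (t + 1/2 * real k * pi)\<bar> * (\<bar>x\<bar> ^ k / fact k)"
    by (simp add: abs_mult power_abs)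
  also have "\<dots> \<le> 1 * (\<bar>x\<bar> ^ k / fact k)"
    by (intro mult_right_mono) auto
  finally show ?thesis by simp
qed

text \<open>What the approximation argument uses of a dyadic generator: the support bounds the
  frequencies and so the exponential type, and the plateau makes the cutoffs at level 2^J tend to
  1.\<close>

locale frequency_cutoff =
  fixes \<phi> :: "real \<Rightarrow> real" and \<Phi> :: real
  assumes cont: "continuous_on UNIV \<phi>"
    and supp: "\<And>x. 2 \<le> \<bar>x\<bar> \<Longrightarrow> \<phi> x = 0"
    and one: "\<And>x. \<bar>x\<bar> \<le> 1 \<Longrightarrow> \<phi> x = 1"
    and bound: "\<And>x. \<bar>\<phi> x\<bar> \<le> \<Phi>"
begin

lemma \<phi>_measurable [measurable]: "\<phi> \<in> borel_measurable borel"
  using cont by (rule borel_measurable_continuous_onI)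

lemma \<Phi>_nonneg: "0 \<le> \<Phi>" using bound[of 0] by linarith

lemma \<phi>_scaled_le: "0 < L \<Longrightarrow> \<bar>\<phi> (\<xi> / L)\<bar> \<le> \<Phi> * indicator {-2*L..2*L} \<xi>"
  using bound[of "\<xi> / L"] supp[of "\<xi> / L"] by (auto simp: indicator_def abs_divide field_simps)

lemma \<phi>_scaled_integrable:
  assumes "0 < L" shows "integrable lborel (\<lambda>\<xi>. \<phi> (\<xi> / L))"
proof -
  have "integrable lborel (\<lambda>\<xi>. \<Phi> * indicator {-2*L..2*L} \<xi>)"
    using assms by (intro integrable_mult_right integrable_real_indicator) auto
  then show ?thesis
    by (rule Bochner_Integration.integrable_bound) (use \<phi>_scaled_le[OF assms] \<Phi>_nonneg in \<open>auto intro: order_trans\<close>)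
qed

lemma \<phi>_scaled_integral_le:
  assumes "0 < L" shows "(\<integral>\<xi>. \<bar>\<phi> (\<xi> / L)\<bar> \<partial>lborel) \<le> 4 * L * \<Phi>"
proof -
  have "(\<integral>\<xi>. \<bar>\<phi> (\<xi> / L)\<bar> \<partial>lborel) \<le> (\<integral>\<xi>. \<Phi> * indicator {-2*L..2*L} \<xi> \<partial>lborel)"
  proof (rule integral_mono[OF integrable_abs[OF \<phi>_scaled_integrable[OF assms]]])
    show "integrable lborel (\<lambda>\<xi>. \<Phi> * indicator {-2*L..2*L} \<xi>)"
      using assms by (intro integrable_mult_right integrable_real_indicator) auto
  qed (rule \<phi>_scaled_le[OF assms])
  with assms show ?thesis by (simp add: mult_ac)
qed

text \<open>The real part of the inverse Fourier transform of $\varphi(\cdot/L)$, so that \<open>S a L\<close> below is the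
  smooth low-frequency part of \<open>a\<close>.  As \<open>\<phi>\<close> need not be even, the imaginary part
  may be nonzero.\<close>

definition q :: "real \<Rightarrow> real \<Rightarrow> real" where
  "q L z = (\<integral>\<xi>. \<phi> (\<xi> / L) * cos (z * \<xi>) \<partial>lborel) / (2 * pi)"

lemma q_measurable [measurable]: "q L \<in> borel_measurable borel"
  unfolding q_def by measurable

lemma q_bounded: "0 < L \<Longrightarrow> \<bar>q L z\<bar> \<le> 4 * L * \<Phi>"
proof -
  assume L: "0 < L"
  have "\<bar>\<integral>\<xi>. \<phi> (\<xi> / L) * cos (z * \<xi>) \<partial>lborel\<bar> \<le> (\<integral>\<xi>. \<bar>\<phi> (\<xi> / L)\<bar> \<partial>lborel)"
  proof -
    have "\<bar>\<integral>\<xi>. \<phi> (\<xi> / L) * cos (z * \<xi>) \<partial>lborel\<bar> \<le> (\<integral>\<xi>. \<bar>\<phi> (\<xi> / L) * cos (z * \<xi>)\<bar> \<partial>lborel)"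
      using integral_norm_bound[of lborel "\<lambda>\<xi>. \<phi> (\<xi> / L) * cos (z * \<xi>)"] by simp
    also have "\<dots> \<le> (\<integral>\<xi>. \<bar>\<phi> (\<xi> / L)\<bar> \<partial>lborel)"
    proof (rule integral_mono)
      show "integrable lborel (\<lambda>\<xi>. \<bar>\<phi> (\<xi> / L) * cos (z * \<xi>)\<bar>)"
        by (rule Bochner_Integration.integrable_bound[OF \<phi>_scaled_integrable[OF L]])
           (auto simp: abs_mult intro!: mult_left_le)
    qed (use \<phi>_scaled_integrable[OF L] in \<open>auto simp: abs_mult intro!: mult_left_le\<close>)
    finally show ?thesis .
  qed
  also have "\<dots> \<le> 4 * L * \<Phi>" by (rule \<phi>_scaled_integral_le[OF L])
  finally have 1: "\<bar>\<integral>\<xi>. \<phi> (\<xi> / L) * cos (z * \<xi>) \<partial>lborel\<bar> \<le> 4 * L * \<Phi>" .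
  have "\<bar>q L z\<bar> = \<bar>\<integral>\<xi>. \<phi> (\<xi> / L) * cos (z * \<xi>) \<partial>lborel\<bar> / (2 * pi)"
    by (simp add: q_def abs_divide)
  also have "\<dots> \<le> 4 * L * \<Phi> / 1"
    using 1 L \<Phi>_nonneg pi_gt3 by (intro frac_le) auto
  finally show ?thesis by simp
qed

text \<open>The Taylor polynomial of the cosine is integrated against the cutoff. Frequencies beyond
  \<open>2 * L\<close> are cut off, so the remainder is at most (2 L Z)^k / k!; the cutoff has mass
  at most 4 L \<Phi>, and the factor 1/(2 pi) is bounded by 1.\<close>

lemma q_polynomial:
  assumes L: "0 < L" and z: "\<bar>z\<bar> \<le> Z"
  shows "\<bar>q L z - (\<Sum>i<k. ((\<integral>\<xi>. \<phi> (\<xi> / L) * cos_coeff i * \<xi> ^ i \<partial>lborel) / (2 * pi)) * z ^ i)\<bar>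
     \<le> 4 * L * \<Phi> * ((2 * L * Z) ^ k / fact k)"
proof -
  have ii: "integrable lborel (\<lambda>\<xi>. \<phi> (\<xi> / L) * cos_coeff i * \<xi> ^ i)" for i
  proof -
    have "integrable lborel (\<lambda>\<xi>. \<phi> (\<xi> / L) * (\<bar>cos_coeff i\<bar> * (2 * L) ^ i))"
      using \<phi>_scaled_integrable[OF L] by simp
    then show ?thesis
    proof (rule Bochner_Integration.integrable_bound)
      show "AE \<xi> in lborel. norm (\<phi> (\<xi> / L) * cos_coeff i * \<xi> ^ i) \<le> norm (\<phi> (\<xi> / L) * (\<bar>cos_coeff i\<bar> * (2 * L) ^ i))"
      proof (rule AE_I2)
        fix \<xi>
        show "norm (\<phi> (\<xi> / L) * cos_coeff i * \<xi> ^ i) \<le> norm (\<phi> (\<xi> / L) * (\<bar>cos_coeff i\<bar> * (2 * L) ^ i))"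
        proof (cases "\<bar>\<xi>\<bar> \<le> 2 * L")
          case True
          then have "\<bar>\<xi>\<bar> ^ i \<le> (2 * L) ^ i" by (intro power_mono) auto
          then show ?thesis using L
            by (simp add: abs_mult power_abs mult.assoc mult_left_mono)
        next
          case False
          then have "\<phi> (\<xi> / L) = 0" using L by (intro supp) (auto simp: abs_divide field_simps)
          then show ?thesis by simp
        qed
      qed
    qed measurable
  qed
  have ic: "integrable lborel (\<lambda>\<xi>. \<phi> (\<xi> / L) * cos (z * \<xi>))"
    by (rule Bochner_Integration.integrable_bound[OF \<phi>_scaled_integrable[OF L]])
       (auto simp: abs_mult intro!: mult_left_le)
  define D where "D = (\<integral>\<xi>. \<phi> (\<xi> / L) * cos (z * \<xi>) \<partial>lborel) - (\<Sum>i<k. (\<integral>\<xi>. \<phi> (\<xi> / L) * cos_coeff i * \<xi> ^ i \<partial>lborel) * z ^ i)"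
  have iD: "integrable lborel (\<lambda>\<xi>. \<phi> (\<xi> / L) * cos (z * \<xi>) - (\<Sum>i<k. \<phi> (\<xi> / L) * cos_coeff i * \<xi> ^ i * z ^ i))"
    using ii ic by auto
  have Deq: "D = (\<integral>\<xi>. \<phi> (\<xi> / L) * cos (z * \<xi>) - (\<Sum>i<k. \<phi> (\<xi> / L) * cos_coeff i * \<xi> ^ i * z ^ i) \<partial>lborel)"
    unfolding D_def using ii ic by (simp add: Bochner_Integration.integral_sum)
  have "\<bar>D\<bar> \<le> (\<integral>\<xi>. \<bar>\<phi> (\<xi> / L) * cos (z * \<xi>) - (\<Sum>i<k. \<phi> (\<xi> / L) * cos_coeff i * \<xi> ^ i * z ^ i)\<bar> \<partial>lborel)"
    unfolding Deq using integral_norm_bound[of lborel "\<lambda>\<xi>. \<phi> (\<xi> / L) * cos (z * \<xi>) - (\<Sum>i<k. \<phi> (\<xi> / L) * cos_coeff i * \<xi> ^ i * z ^ i)"]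
    by (simp only: real_norm_def)
  also have "\<dots> \<le> (\<integral>\<xi>. \<bar>\<phi> (\<xi> / L)\<bar> * ((2 * L * Z) ^ k / fact k) \<partial>lborel)"
  proof (rule integral_mono)
    fix \<xi>
    have e: "\<phi> (\<xi> / L) * cos (z * \<xi>) - (\<Sum>i<k. \<phi> (\<xi> / L) * cos_coeff i * \<xi> ^ i * z ^ i)
       = \<phi> (\<xi> / L) * (cos (z * \<xi>) - (\<Sum>i<k. cos_coeff i * (z * \<xi>) ^ i))"
      by (simp only: right_diff_distrib sum_distrib_left power_mult_distrib mult_ac)
    show "\<bar>\<phi> (\<xi> / L) * cos (z * \<xi>) - (\<Sum>i<k. \<phi> (\<xi> / L) * cos_coeff i * \<xi> ^ i * z ^ i)\<bar>
        \<le> \<bar>\<phi> (\<xi> / L)\<bar> * ((2 * L * Z) ^ k / fact k)"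
    proof (cases "\<bar>\<xi>\<bar> \<le> 2 * L")
      case True
      have "\<bar>z * \<xi>\<bar> \<le> Z * (2 * L)" unfolding abs_mult using True z by (intro mult_mono) auto
      then have "\<bar>z * \<xi>\<bar> ^ k \<le> (2 * L * Z) ^ k" by (intro power_mono) (auto simp: mult_ac)
      then have "\<bar>cos (z * \<xi>) - (\<Sum>i<k. cos_coeff i * (z * \<xi>) ^ i)\<bar> \<le> (2 * L * Z) ^ k / fact k"
        using cos_taylor[of "z * \<xi>" k] by (meson divide_right_mono fact_ge_zero order_trans)
      then show ?thesis unfolding e abs_mult by (intro mult_left_mono) auto
    next
      case False
      then have "\<phi> (\<xi> / L) = 0" using L by (intro supp) (auto simp: abs_divide field_simps)
      then show ?thesis by simp
    qed
  qed (use iD \<phi>_scaled_integrable[OF L] in \<open>auto intro!: integrable_mult_left integrable_abs\<close>)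
  also have "\<dots> = (\<integral>\<xi>. \<bar>\<phi> (\<xi> / L)\<bar> \<partial>lborel) * ((2 * L * Z) ^ k / fact k)" by simp
  also have "\<dots> \<le> 4 * L * \<Phi> * ((2 * L * Z) ^ k / fact k)"
    using L z by (intro mult_right_mono \<phi>_scaled_integral_le) auto
  finally have D: "\<bar>D\<bar> \<le> 4 * L * \<Phi> * ((2 * L * Z) ^ k / fact k)" .
  have "q L z - (\<Sum>i<k. ((\<integral>\<xi>. \<phi> (\<xi> / L) * cos_coeff i * \<xi> ^ i \<partial>lborel) / (2 * pi)) * z ^ i) = D / (2 * pi)"
    by (simp add: q_def D_def diff_divide_distrib sum_divide_distrib)
  then have "\<bar>q L z - (\<Sum>i<k. ((\<integral>\<xi>. \<phi> (\<xi> / L) * cos_coeff i * \<xi> ^ i \<partial>lborel) / (2 * pi)) * z ^ i)\<bar> = \<bar>D\<bar> / (2 * pi)"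
    by (simp add: abs_divide)
  also have "\<dots> \<le> 4 * L * \<Phi> * ((2 * L * Z) ^ k / fact k) / 1"
    using D L z \<Phi>_nonneg pi_gt3 by (intro frac_le) auto
  finally show ?thesis by simp
qed

definition S :: "(real \<Rightarrow> real) \<Rightarrow> real \<Rightarrow> real \<Rightarrow> real" where
  "S a L x = (\<integral>y. q L (x - y) * a y \<partial>lborel)"

lemma q_a_integrable:
  assumes "integrable lborel a" "0 < L" shows "integrable lborel (\<lambda>y. q L (x - y) * a y)"
proof -
  have [measurable]: "a \<in> borel_measurable borel" using borel_measurable_integrable[OF assms(1)] by simp
  have "integrable lborel (\<lambda>y. 4 * L * \<Phi> * a y)" using assms by simp
  then show ?thesis
  proof (rule Bochner_Integration.integrable_bound)
    show "AE y in lborel. norm (q L (x - y) * a y) \<le> norm (4 * L * \<Phi> * a y)"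
      using q_bounded[OF assms(2)] \<Phi>_nonneg assms(2)
      by (intro AE_I2) (auto simp: abs_mult intro!: mult_right_mono)
  qed measurable
qed

lemma S_measurable [measurable (raw)]:
  assumes [measurable]: "a \<in> borel_measurable borel"
  shows "S a L \<in> borel_measurable borel"
  unfolding S_def by measurable

lemma shifted_power_polynomial:
  fixes a :: "real \<Rightarrow> real"
  assumes ai: "\<And>i. integrable lborel (\<lambda>y. y ^ i * a y)"
  shows "(\<integral>y. (x - y) ^ i * a y \<partial>lborel)
     = (\<Sum>j\<le>i. (of_nat (i choose j) * (-1) ^ (i - j) * (\<integral>y. y ^ (i - j) * a y \<partial>lborel)) * x ^ j)"
proof -
  have e: "(x - y) ^ i * a y = (\<Sum>j\<le>i. (of_nat (i choose j) * (-1) ^ (i - j) * x ^ j) * (y ^ (i - j) * a y))" for y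
  proof -
    have "(x - y) ^ i = (x + (- y)) ^ i" by simp
    also have "\<dots> = (\<Sum>j\<le>i. of_nat (i choose j) * x ^ j * (- y) ^ (i - j))" by (rule binomial_ring)
    finally show ?thesis
      by (simp add: sum_distrib_right sum_distrib_left power_minus[of y] mult_ac)
  qed
  have "(\<integral>y. (x - y) ^ i * a y \<partial>lborel)
     = (\<Sum>j\<le>i. (of_nat (i choose j) * (-1) ^ (i - j) * x ^ j) * (\<integral>y. y ^ (i - j) * a y \<partial>lborel))"
    unfolding e using ai by (simp add: Bochner_Integration.integral_sum)
  then show ?thesis by (simp add: mult_ac)
qed

text \<open>For \<open>x\<close> and \<open>y\<close> in [-T, T] the argument \<open>x - y\<close>
  has modulus at most \<open>2 * T\<close>, whence \<open>4 * L * T\<close>. Binomial expansion of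
  the powers of \<open>x - y\<close> makes the approximation of the convolution kernel
  \<open>q\<close> a polynomial in \<open>x\<close> whose coefficients involve moments of
  \<open>a\<close>.\<close>

lemma S_polynomial:
  assumes a: "integrable lborel a" and T: "\<And>y. T < \<bar>y\<bar> \<Longrightarrow> a y = 0" and L: "0 < L" and T0: "0 < T"
  shows "\<exists>p. \<forall>x. \<bar>x\<bar> \<le> T \<longrightarrow> \<bar>S a L x - (\<Sum>j<k. p j * x ^ j)\<bar>
      \<le> 4 * L * \<Phi> * ((4 * L * T) ^ k / fact k) * (\<integral>y. \<bar>a y\<bar> \<partial>lborel)"
proof -
  have [measurable]: "a \<in> borel_measurable borel" using borel_measurable_integrable[OF a] by simp
  have ai: "integrable lborel (\<lambda>y. y ^ i * a y)" for i
  proof -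
    have "integrable lborel (\<lambda>y. T ^ i * a y)" using a by simp
    then show ?thesis
    proof (rule Bochner_Integration.integrable_bound)
      show "AE y in lborel. norm (y ^ i * a y) \<le> norm (T ^ i * a y)"
      proof (rule AE_I2)
        fix y show "norm (y ^ i * a y) \<le> norm (T ^ i * a y)"
        proof (cases "T < \<bar>y\<bar>")
          case False
          then have "\<bar>y\<bar> ^ i \<le> T ^ i" by (intro power_mono) auto
          then show ?thesis using T0 by (simp add: abs_mult power_abs mult_right_mono)
        qed (simp add: T)
      qed
    qed measurable
  qed
  define c where "c i = (\<integral>\<xi>. \<phi> (\<xi> / L) * cos_coeff i * \<xi> ^ i \<partial>lborel) / (2 * pi)" for i
  define m where "m i j = of_nat (i choose j) * (-1) ^ (i - j) * (\<integral>y. y ^ (i - j) * a y \<partial>lborel)" for i j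
  \<comment> \<open>The coefficients are regrouped by powers of \<open>x\<close>; the conditional
    encodes the triangular range \<open>j \<le> i < k\<close>.\<close>
  define p where "p j = (\<Sum>i<k. if j \<le> i then c i * m i j else 0)" for j
  have xi: "integrable lborel (\<lambda>y. (x - y) ^ i * a y)" for x i
  proof -
    have "(\<lambda>y. (x - y) ^ i * a y) = (\<lambda>y. \<Sum>j\<le>i. (of_nat (i choose j) * (-1) ^ (i - j) * x ^ j) * (y ^ (i - j) * a y))"
    proof
      fix y
      have "(x - y) ^ i = (x + (- y)) ^ i" by simp
      also have "\<dots> = (\<Sum>j\<le>i. of_nat (i choose j) * x ^ j * (- y) ^ (i - j))" by (rule binomial_ring)
      finally show "(x - y) ^ i * a y = (\<Sum>j\<le>i. (of_nat (i choose j) * (-1) ^ (i - j) * x ^ j) * (y ^ (i - j) * a y))"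
        by (simp add: sum_distrib_right sum_distrib_left power_minus[of y] mult_ac)
    qed
    then show ?thesis using ai by simp
  qed
  have "\<bar>S a L x - (\<Sum>j<k. p j * x ^ j)\<bar> \<le> 4 * L * \<Phi> * ((4 * L * T) ^ k / fact k) * (\<integral>y. \<bar>a y\<bar> \<partial>lborel)"
    if x: "\<bar>x\<bar> \<le> T" for x
  proof -
    have "(\<Sum>j<k. p j * x ^ j) = (\<Sum>j<k. \<Sum>i<k. if j \<le> i then c i * m i j * x ^ j else 0)"
      unfolding p_def sum_distrib_right by (intro sum.cong refl) auto
    also have "\<dots> = (\<Sum>i<k. \<Sum>j<k. if j \<le> i then c i * m i j * x ^ j else 0)"
      by (rule sum.swap)
    also have "\<dots> = (\<Sum>i<k. \<Sum>j\<le>i. c i * m i j * x ^ j)"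
    proof (rule sum.cong[OF refl])
      fix i assume i: "i \<in> {..<k}"
      have "(\<Sum>j<k. if j \<le> i then c i * m i j * x ^ j else 0) = (\<Sum>j\<in>{j\<in>{..<k}. j \<le> i}. c i * m i j * x ^ j)"
        by (rule sum.inter_filter[symmetric]) simp
      also have "{j\<in>{..<k}. j \<le> i} = {..i}" using i by auto
      finally show "(\<Sum>j<k. if j \<le> i then c i * m i j * x ^ j else 0) = (\<Sum>j\<le>i. c i * m i j * x ^ j)" .
    qed
    also have "\<dots> = (\<Sum>i<k. c i * (\<integral>y. (x - y) ^ i * a y \<partial>lborel))"
      unfolding shifted_power_polynomial[OF ai] m_def by (simp only: sum_distrib_left mult.assoc)
    also have "\<dots> = (\<integral>y. (\<Sum>i<k. c i * ((x - y) ^ i * a y)) \<partial>lborel)"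
      using xi by (simp add: Bochner_Integration.integral_sum)
    finally have Deq: "S a L x - (\<Sum>j<k. p j * x ^ j)
       = (\<integral>y. q L (x - y) * a y - (\<Sum>i<k. c i * ((x - y) ^ i * a y)) \<partial>lborel)"
      unfolding S_def using xi q_a_integrable[OF a L, of x] by simp
    have "\<bar>S a L x - (\<Sum>j<k. p j * x ^ j)\<bar> \<le> (\<integral>y. \<bar>q L (x - y) * a y - (\<Sum>i<k. c i * ((x - y) ^ i * a y))\<bar> \<partial>lborel)"
      unfolding Deq using integral_norm_bound[of lborel "\<lambda>y. q L (x - y) * a y - (\<Sum>i<k. c i * ((x - y) ^ i * a y))"] by (simp only: real_norm_def)
    also have "\<dots> \<le> (\<integral>y. 4 * L * \<Phi> * ((4 * L * T) ^ k / fact k) * \<bar>a y\<bar> \<partial>lborel)"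
    proof (rule integral_mono)
      show "integrable lborel (\<lambda>y. \<bar>q L (x - y) * a y - (\<Sum>i<k. c i * ((x - y) ^ i * a y))\<bar>)"
        using xi q_a_integrable[OF a L, of x] by (intro integrable_abs Bochner_Integration.integrable_diff) auto
      fix y
      show "\<bar>q L (x - y) * a y - (\<Sum>i<k. c i * ((x - y) ^ i * a y))\<bar>
          \<le> 4 * L * \<Phi> * ((4 * L * T) ^ k / fact k) * \<bar>a y\<bar>"
      proof (cases "T < \<bar>y\<bar>")
        case False
        then have "\<bar>x - y\<bar> \<le> 2 * T" using x by linarith
        from q_polynomial[OF L this, of k]
        have "\<bar>q L (x - y) - (\<Sum>i<k. c i * (x - y) ^ i)\<bar> \<le> 4 * L * \<Phi> * ((4 * L * T) ^ k / fact k)"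
          by (simp add: c_def mult_ac)
        moreover have "q L (x - y) * a y - (\<Sum>i<k. c i * ((x - y) ^ i * a y))
          = (q L (x - y) - (\<Sum>i<k. c i * (x - y) ^ i)) * a y"
          by (simp only: left_diff_distrib sum_distrib_right mult.assoc)
        ultimately show ?thesis by (metis abs_mult abs_ge_zero mult_right_mono)
      qed (simp add: T)
    qed (use a in simp)
    finally show ?thesis by simp
  qed
  then show ?thesis by blast
qed

text \<open>Testing against Gaussians, whose Fourier transforms are explicit, identifies the limit of
  \<open>S a (2 ^ J)\<close> without decay estimates for \<open>q\<close>.\<close>

lemma S_gauss:
  assumes a: "integrable lborel a" and L: "0 < L" and s: "0 < s"
  shows "(\<integral>x. S a L x * gauss s (x - y) \<partial>lborel)
     = (\<integral>u. a u * (1 / (sqrt (2 * pi) * s) * (\<integral>\<xi>. \<phi> (\<xi> / L) * (cos ((y - u) * \<xi>) * gauss (1 / s) \<xi>) \<partial>lborel)) \<partial>lborel)"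
proof -
  have [measurable]: "a \<in> borel_measurable borel" using borel_measurable_integrable[OF a] by simp
  have gi: "integrable lborel (\<lambda>x. gauss s (x - y))" for y
    using lborel_integrable_real_affine[OF gauss_integrable[OF s], of 1 "-y"] by simp
  have int1: "integrable (lborel \<Otimes>\<^sub>M lborel) (\<lambda>(x, u). q L (x - u) * a u * gauss s (x - y))"
  proof (rule Bochner_Integration.integrable_bound)
    show "integrable (lborel \<Otimes>\<^sub>M lborel) (\<lambda>(x, u). (4 * L * \<Phi> * gauss s (x - y)) * a u)"
    proof (rule lborel_pair.Fubini_integrable)
      show "integrable lborel (\<lambda>x. \<integral>u. norm (case (x, u) of (x, u) \<Rightarrow> (4 * L * \<Phi> * gauss s (x - y)) * a u) \<partial>lborel)"
        using gi by (simp add: abs_mult)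
    qed (use a in simp_all)
    show "AE z in lborel \<Otimes>\<^sub>M lborel. norm (case z of (x, u) \<Rightarrow> q L (x - u) * a u * gauss s (x - y))
        \<le> norm (case z of (x, u) \<Rightarrow> (4 * L * \<Phi> * gauss s (x - y)) * a u)"
    proof (rule AE_I2, clarify)
      fix x u
      have "\<bar>q L (x - u)\<bar> * (\<bar>a u\<bar> * gauss s (x - y)) \<le> 4 * L * \<Phi> * (\<bar>a u\<bar> * gauss s (x - y))"
        using q_bounded[OF L] by (intro mult_right_mono) (auto simp: gauss_nonneg)
      then show "norm (q L (x - u) * a u * gauss s (x - y)) \<le> norm ((4 * L * \<Phi> * gauss s (x - y)) * a u)"
        using L \<Phi>_nonneg by (simp add: abs_mult gauss_nonneg mult_ac)
    qed
  qed measurable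
  have inner: "(\<integral>x. q L (x - u) * gauss s (x - y) \<partial>lborel)
     = 1 / (sqrt (2 * pi) * s) * (\<integral>\<xi>. \<phi> (\<xi> / L) * (cos ((y - u) * \<xi>) * gauss (1 / s) \<xi>) \<partial>lborel)" for u
  proof -
    have int2: "integrable (lborel \<Otimes>\<^sub>M lborel) (\<lambda>(x, \<xi>). \<phi> (\<xi> / L) * cos ((x - u) * \<xi>) * gauss s (x - y))"
    proof (rule Bochner_Integration.integrable_bound)
      show "integrable (lborel \<Otimes>\<^sub>M lborel) (\<lambda>(x, \<xi>). gauss s (x - y) * \<phi> (\<xi> / L))"
      proof (rule lborel_pair.Fubini_integrable)
        show "integrable lborel (\<lambda>x. \<integral>\<xi>. norm (case (x, \<xi>) of (x, \<xi>) \<Rightarrow> gauss s (x - y) * \<phi> (\<xi> / L)) \<partial>lborel)"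
          using gi by (simp add: abs_mult)
      qed (use \<phi>_scaled_integrable[OF L] in simp_all)
      show "AE z in lborel \<Otimes>\<^sub>M lborel. norm (case z of (x, \<xi>) \<Rightarrow> \<phi> (\<xi> / L) * cos ((x - u) * \<xi>) * gauss s (x - y))
          \<le> norm (case z of (x, \<xi>) \<Rightarrow> gauss s (x - y) * \<phi> (\<xi> / L))"
      proof (rule AE_I2, clarify)
        fix x \<xi>
        have "\<bar>cos ((x - u) * \<xi>)\<bar> * (\<bar>\<phi> (\<xi> / L)\<bar> * gauss s (x - y)) \<le> 1 * (\<bar>\<phi> (\<xi> / L)\<bar> * gauss s (x - y))"
          by (intro mult_right_mono) (auto simp: gauss_nonneg)
        then show "norm (\<phi> (\<xi> / L) * cos ((x - u) * \<xi>) * gauss s (x - y)) \<le> norm (gauss s (x - y) * \<phi> (\<xi> / L))"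
          by (simp add: abs_mult gauss_nonneg mult_ac)
      qed
    qed measurable
    have "(\<integral>x. q L (x - u) * gauss s (x - y) \<partial>lborel)
       = (\<integral>x. (\<integral>\<xi>. \<phi> (\<xi> / L) * cos ((x - u) * \<xi>) * gauss s (x - y) \<partial>lborel) \<partial>lborel) / (2 * pi)"
      by (simp add: q_def)
    also have "(\<integral>x. (\<integral>\<xi>. \<phi> (\<xi> / L) * cos ((x - u) * \<xi>) * gauss s (x - y) \<partial>lborel) \<partial>lborel)
       = (\<integral>\<xi>. (\<integral>x. \<phi> (\<xi> / L) * cos ((x - u) * \<xi>) * gauss s (x - y) \<partial>lborel) \<partial>lborel)"
      by (rule lborel_pair.Fubini_integral[OF int2, symmetric])
    also have "\<dots> = (\<integral>\<xi>. \<phi> (\<xi> / L) * (\<integral>x. cos ((x - u) * \<xi>) * gauss s (x - y) \<partial>lborel) \<partial>lborel)"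
      by (simp add: mult.assoc)
    also have "\<dots> = (\<integral>\<xi>. sqrt (2 * pi) / s * (\<phi> (\<xi> / L) * (cos ((y - u) * \<xi>) * gauss (1 / s) \<xi>)) \<partial>lborel)"
      unfolding gauss_fourier_shift[OF s] by (simp add: mult_ac)
    also have "\<dots> = sqrt (2 * pi) / s * (\<integral>\<xi>. \<phi> (\<xi> / L) * (cos ((y - u) * \<xi>) * gauss (1 / s) \<xi>) \<partial>lborel)"
      by (rule integral_mult_right_zero)
    finally have "(\<integral>x. q L (x - u) * gauss s (x - y) \<partial>lborel)
       = sqrt (2 * pi) / s * (\<integral>\<xi>. \<phi> (\<xi> / L) * (cos ((y - u) * \<xi>) * gauss (1 / s) \<xi>) \<partial>lborel) / (2 * pi)" .
    moreover have "sqrt (2 * pi) / s * X / (2 * pi) = 1 / (sqrt (2 * pi) * s) * X" for X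
    proof -
      define w where "w = sqrt (2 * pi)"
      have w: "w > 0" "2 * pi = w * w" by (simp_all add: w_def)
      show ?thesis unfolding w_def[symmetric] w(2) using w(1) s by (simp add: field_simps)
    qed
    ultimately show ?thesis by simp
  qed
  have "(\<integral>x. S a L x * gauss s (x - y) \<partial>lborel)
     = (\<integral>x. (\<integral>u. q L (x - u) * a u * gauss s (x - y) \<partial>lborel) \<partial>lborel)"
    by (simp add: S_def)
  also have "\<dots> = (\<integral>u. (\<integral>x. q L (x - u) * a u * gauss s (x - y) \<partial>lborel) \<partial>lborel)"
    by (rule lborel_pair.Fubini_integral[OF int1, symmetric])
  also have "\<dots> = (\<integral>u. a u * (\<integral>x. q L (x - u) * gauss s (x - y) \<partial>lborel) \<partial>lborel)"
    by (simp add: mult.left_commute mult.commute)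
  finally show ?thesis unfolding inner .
qed

text \<open>At each frequency the cutoff at 2^J is eventually 1, and a Gaussian in frequency
  dominates. Without cutoff the explicit transform is applied to a Gaussian a second time, which is
  Fourier inversion in closed form.\<close>

lemma S_gauss_limit:
  assumes a: "integrable lborel a" and s: "0 < s"
  shows "(\<lambda>J. \<integral>x. S a (2 ^ J) x * gauss s (x - y) \<partial>lborel) \<longlonglongrightarrow> (\<integral>u. a u * gauss s (u - y) \<partial>lborel)"
proof -
  have [measurable]: "a \<in> borel_measurable borel" using borel_measurable_integrable[OF a] by simp
  define G where "G = gauss (1 / s)"
  have Gi: "integrable lborel G" using s by (simp add: G_def gauss_integrable)
  have [measurable]: "G \<in> borel_measurable borel" by (simp add: G_def)
  have G0: "0 \<le> G \<xi>" for \<xi> by (simp add: G_def gauss_nonneg)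
  define c where "c = 1 / (sqrt (2 * pi) * s)"
  define P where "P J u = (\<integral>\<xi>. \<phi> (\<xi> / 2 ^ J) * (cos ((y - u) * \<xi>) * G \<xi>) \<partial>lborel)" for J :: nat and u
  have dom: "\<bar>\<phi> (\<xi> / 2 ^ J) * (cos ((y - u) * \<xi>) * G \<xi>)\<bar> \<le> \<Phi> * G \<xi>" for J :: nat and u \<xi>
  proof -
    have "\<bar>cos ((y - u) * \<xi>)\<bar> * G \<xi> \<le> 1 * G \<xi>" by (intro mult_right_mono) (auto simp: G0)
    then show ?thesis unfolding abs_mult using bound[of "\<xi> / 2 ^ J"] G0[of \<xi>] \<Phi>_nonneg
      by (intro mult_mono) auto
  qed
  have Plim: "(\<lambda>J. P J u) \<longlonglongrightarrow> gauss s (u - y) / c" for u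
  proof -
    have "(\<lambda>J. P J u) \<longlonglongrightarrow> (\<integral>\<xi>. 1 * (cos ((y - u) * \<xi>) * G \<xi>) \<partial>lborel)"
      unfolding P_def
    proof (rule integral_dominated_convergence[where w = "\<lambda>\<xi>. \<Phi> * G \<xi>"])
      show "AE \<xi> in lborel. (\<lambda>J. \<phi> (\<xi> / 2 ^ J) * (cos ((y - u) * \<xi>) * G \<xi>)) \<longlonglongrightarrow> 1 * (cos ((y - u) * \<xi>) * G \<xi>)"
      proof (rule AE_I2, rule tendsto_mult_right, rule tendsto_eventually)
        fix \<xi> :: real
        obtain n :: nat where n: "\<bar>\<xi>\<bar> < 2 ^ n" using real_arch_pow[of 2 "\<bar>\<xi>\<bar>"] by auto
        show "\<forall>\<^sub>F J in sequentially. \<phi> (\<xi> / 2 ^ J) = 1"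
        proof (rule eventually_sequentiallyI[of n])
          fix J assume "n \<le> J"
          then have "(2::real) ^ n \<le> 2 ^ J" by (intro power_increasing) auto
          with n have "\<bar>\<xi>\<bar> \<le> 2 ^ J" by linarith
          then show "\<phi> (\<xi> / 2 ^ J) = 1" by (intro one) (simp add: abs_divide)
        qed
      qed
    qed (use Gi dom in auto)
    also have "(\<integral>\<xi>. 1 * (cos ((y - u) * \<xi>) * G \<xi>) \<partial>lborel) = gauss s (u - y) / c"
    proof -
      have "(\<integral>\<xi>. cos (\<xi> * (y - u)) * gauss (1 / s) \<xi> \<partial>lborel) = sqrt (2 * pi) / (1 / s) * gauss (1 / (1 / s)) (y - u)"
        using s by (intro gauss_fourier) auto
      also have "gauss (1 / (1 / s)) (y - u) = gauss s (u - y)"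
        by (simp add: gauss_def power_mult_distrib power2_commute)
      finally show ?thesis using s by (simp add: c_def G_def mult.commute)
    qed
    finally show ?thesis .
  qed
  have c0: "c > 0" using s by (simp add: c_def)
  define GI where "GI = (\<integral>\<xi>. \<Phi> * G \<xi> \<partial>lborel)"
  have Pb: "\<bar>P J u\<bar> \<le> GI" for J u
  proof -
    have pi: "integrable lborel (\<lambda>\<xi>. \<phi> (\<xi> / 2 ^ J) * (cos ((y - u) * \<xi>) * G \<xi>))"
    proof -
      have "integrable lborel (\<lambda>\<xi>. \<Phi> * G \<xi>)" using Gi by simp
      then show ?thesis
        by (rule Bochner_Integration.integrable_bound) (use dom in \<open>auto intro: order_trans[OF dom abs_ge_self]\<close>)
    qed
    have "\<bar>P J u\<bar> \<le> (\<integral>\<xi>. \<bar>\<phi> (\<xi> / 2 ^ J) * (cos ((y - u) * \<xi>) * G \<xi>)\<bar> \<partial>lborel)"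
      unfolding P_def using integral_norm_bound[of lborel "\<lambda>\<xi>. \<phi> (\<xi> / 2 ^ J) * (cos ((y - u) * \<xi>) * G \<xi>)"] by simp
    also have "\<dots> \<le> GI" unfolding GI_def
      using pi Gi dom by (intro integral_mono integrable_abs integrable_mult_right) auto
    finally show ?thesis .
  qed
  have [measurable]: "P J \<in> borel_measurable borel" for J unfolding P_def by measurable
  have "(\<lambda>J. \<integral>u. a u * (c * P J u) \<partial>lborel) \<longlonglongrightarrow> (\<integral>u. a u * (c * (gauss s (u - y) / c)) \<partial>lborel)"
  proof (rule integral_dominated_convergence[where w = "\<lambda>u. \<bar>a u\<bar> * (c * GI)"])
    show "AE u in lborel. (\<lambda>J. a u * (c * P J u)) \<longlonglongrightarrow> a u * (c * (gauss s (u - y) / c))"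
      by (intro AE_I2 tendsto_mult_left Plim)
    show "AE u in lborel. norm (a u * (c * P J u)) \<le> \<bar>a u\<bar> * (c * GI)" for J
      using Pb c0 by (auto simp: abs_mult intro!: mult_left_mono)
  qed (use a in auto)
  moreover have "c * (gauss s (u - y) / c) = gauss s (u - y)" for u using c0 by simp
  moreover have "(\<integral>x. S a (2 ^ J) x * gauss s (x - y) \<partial>lborel) = (\<integral>u. a u * (c * P J u) \<partial>lborel)" for J
    unfolding c_def P_def G_def by (rule S_gauss[OF a _ s]) simp
  ultimately show ?thesis by (simp only:)
qed

end

section \<open>Besov norms and Littlewood--Paley blocks\<close>

lemma ennreal_powr_1 [simp]: "ennreal_powr x 1 = x"
  by (cases x) (auto simp: ennreal_powr_def)

lemma Lq_norm_1: "Lq_norm M 1 u = (\<integral>\<^sup>+x. u x \<partial>M)"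
  by (simp add: Lq_norm_def)

text \<open>Every sequence space of index \<theta> embeds into the bounded sequences, as a single
  term is at most the whole sum. Only this uniform bound on the weighted blocks is passed
  on.\<close>

lemma Lq_norm_count_space_bound:
  fixes u :: "nat \<Rightarrow> ennreal"
  assumes \<theta>: "0 < \<theta>" and fin: "Lq_norm (count_space UNIV) \<theta> u < \<infinity>"
  shows "\<exists>C\<ge>0. \<forall>j. u j \<le> ennreal C"
proof (cases "\<theta> = \<infinity>")
  case True
  then obtain C where C: "C < \<infinity>" "\<And>j. u j \<le> C"
    using fin by (auto simp: Lq_norm_def Inf_less_iff AE_count_space)
  then show ?thesis
    by (intro exI[of _ "enn2real C"]) auto
next
  case False
  define t where "t = enn2real \<theta>"
  have t: "t > 0" using \<theta> False by (simp add: t_def enn2real_positive_iff less_top)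
  define X where "X = (\<integral>\<^sup>+j. ennreal_powr (u j) t \<partial>count_space UNIV)"
  have X: "X \<noteq> \<infinity>" using fin False by (auto simp: Lq_norm_def X_def t_def ennreal_powr_def split: if_splits)
  have "u j \<le> ennreal (enn2real X powr (1 / t))" for j
  proof -
    have le: "ennreal_powr (u j) t \<le> X"
      unfolding X_def by (rule nn_integral_ge_point) simp
    then have uj: "u j \<noteq> \<infinity>" using X by (auto simp: ennreal_powr_def top_unique)
    then have "ennreal (enn2real (u j) powr t) \<le> X"
      using le by (simp add: ennreal_powr_def)
    also have "X = ennreal (enn2real X)" using X by (simp add: less_top)
    finally have "ennreal (enn2real (u j) powr t) \<le> ennreal (enn2real X)" .
    then have "enn2real (u j) powr t \<le> enn2real X" by simp
    then have "(enn2real (u j) powr t) powr (1 / t) \<le> enn2real X powr (1 / t)"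
      using t by (intro powr_mono2) auto
    then have "enn2real (u j) \<le> enn2real X powr (1 / t)"
      using t by (simp add: powr_powr)
    then have "ennreal (enn2real (u j)) \<le> ennreal (enn2real X powr (1 / t))" by (rule ennreal_leI)
    moreover have "ennreal (enn2real (u j)) = u j" using uj by (simp add: less_top)
    ultimately show ?thesis by simp
  qed
  then show ?thesis by (intro exI[of _ "enn2real X powr (1 / t)"]) auto
qed

lemma besov_1_block_bound:
  assumes f: "f \<in> besov r 1 \<theta>" and \<theta>: "0 < \<theta>"
  obtains \<phi> C where "dyadic_generator \<phi>" "0 \<le> C"
    "\<And>j. (\<integral>\<^sup>+x. ennreal (cmod (LP_block \<phi> j f x)) \<partial>lebesgue) \<le> ennreal (C * 2 powr - (r * real j))"
proof -
  obtain \<phi> where \<phi>: "dyadic_generator \<phi>" "besov_norm \<phi> r 1 \<theta> f < \<infinity>"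
    using f by (auto simp: besov_def)
  obtain C where C: "0 \<le> C" "\<And>j. ennreal (2 powr (real j * r)) * (\<integral>\<^sup>+x. ennreal (cmod (LP_block \<phi> j f x)) \<partial>lebesgue) \<le> ennreal C"
    using Lq_norm_count_space_bound[OF \<theta> \<phi>(2)[unfolded besov_norm_def]] by (auto simp: Lq_norm_1)
  show ?thesis
  proof (rule that[OF \<phi>(1) C(1)])
    fix j
    let ?X = "\<integral>\<^sup>+x. ennreal (cmod (LP_block \<phi> j f x)) \<partial>lebesgue"
    have "?X = ennreal (2 powr - (r * real j) * 2 powr (real j * r)) * ?X"
      by (simp add: powr_add[symmetric] mult.commute)
    also have "\<dots> = ennreal (2 powr - (r * real j)) * (ennreal (2 powr (real j * r)) * ?X)"
      by (simp add: ennreal_mult' mult.assoc)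
    also have "\<dots> \<le> ennreal (2 powr - (r * real j)) * ennreal C"
      by (intro mult_left_mono C) auto
    also have "\<dots> = ennreal (C * 2 powr - (r * real j))"
      using C(1) by (simp add: ennreal_mult' mult.commute)
    finally show "?X \<le> ennreal (C * 2 powr - (r * real j))" .
  qed
qed

lemma dyadic_generator_cutoff:
  assumes "dyadic_generator \<phi>"
  obtains \<Phi> where "frequency_cutoff \<phi> \<Phi>"
proof -
  have "\<phi> field_differentiable (at x)" for x
    using assms unfolding dyadic_generator_def smooth_def
    by (metis funpow_0)
  then have c: "continuous_on UNIV \<phi>"
    by (simp add: continuous_on_eq_continuous_at field_differentiable_imp_continuous_at)
  then have "compact (\<phi> ` {-2..2})"
    by (intro compact_continuous_image continuous_on_subset[OF c]) auto
  then obtain B where B: "\<forall>x\<in>{-2..2}. \<bar>\<phi> x\<bar> \<le> B"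
    using compact_imp_bounded[of "\<phi> ` {-2..2}"] by (auto simp: bounded_iff)
  have "\<bar>\<phi> x\<bar> \<le> max B 0" for x
  proof (cases "2 \<le> \<bar>x\<bar>")
    case True
    then show ?thesis using assms by (simp add: dyadic_generator_def)
  next
    case False
    then have "x \<in> {-2..2}" by auto
    with B have "\<bar>\<phi> x\<bar> \<le> B" by blast
    then show ?thesis by simp
  qed
  then have "frequency_cutoff \<phi> (max B 0)"
    using assms c by unfold_locales (auto simp: dyadic_generator_def)
  then show ?thesis by (rule that)
qed

context frequency_cutoff
begin

lemma dyadic_part_eq:
  "dyadic_part \<phi> j \<xi> = \<phi> (\<xi> / 2 ^ j) - (if j = 0 then 0 else \<phi> (\<xi> / 2 ^ (j - 1)))"
  by (cases j) (auto simp: dyadic_part_def)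

lemma dyadic_part_integrable: "integrable lborel (dyadic_part \<phi> j)"
  unfolding dyadic_part_eq[abs_def]
  by (cases "j = 0") (auto intro!: Bochner_Integration.integrable_diff \<phi>_scaled_integrable
      \<phi>_scaled_integrable[of 1, simplified])

lemma cis_measurable [measurable]: "cis \<in> borel_measurable borel"
  by (intro borel_measurable_continuous_onI continuous_intros)

lemma inverse_fourier_integrable:
  "integrable lborel (\<lambda>\<xi>. complex_of_real (dyadic_part \<phi> j \<xi>) * cis (x * \<xi>))"
proof -
  have [measurable]: "dyadic_part \<phi> j \<in> borel_measurable borel"
    using borel_measurable_integrable[OF dyadic_part_integrable] by simp
  show ?thesis
    by (rule Bochner_Integration.integrable_bound[OF dyadic_part_integrable[of j]])
       (auto simp: norm_mult)
qed

lemma inverse_fourier_lborel: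
  "inverse_fourier (dyadic_part \<phi> j) x
    = (\<integral>\<xi>. complex_of_real (dyadic_part \<phi> j \<xi>) * cis (x * \<xi>) \<partial>lborel) / complex_of_real (2 * pi)"
  unfolding inverse_fourier_def
  using borel_measurable_integrable[OF inverse_fourier_integrable]
  by (subst integral_completion) auto

lemma inverse_fourier_measurable [measurable]: "inverse_fourier (dyadic_part \<phi> j) \<in> borel_measurable borel"
proof -
  have [measurable]: "dyadic_part \<phi> j \<in> borel_measurable borel"
    using borel_measurable_integrable[OF dyadic_part_integrable] by simp
  show ?thesis unfolding inverse_fourier_lborel[abs_def] by measurable
qed

lemma norm_inverse_fourier_le:
  "cmod (inverse_fourier (dyadic_part \<phi> j) x) \<le> (\<integral>\<xi>. \<bar>dyadic_part \<phi> j \<xi>\<bar> \<partial>lborel) / (2 * pi)"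
proof -
  have "cmod (\<integral>\<xi>. complex_of_real (dyadic_part \<phi> j \<xi>) * cis (x * \<xi>) \<partial>lborel)
      \<le> (\<integral>\<xi>. cmod (complex_of_real (dyadic_part \<phi> j \<xi>) * cis (x * \<xi>)) \<partial>lborel)"
    by (rule integral_norm_bound)
  also have "\<dots> = (\<integral>\<xi>. \<bar>dyadic_part \<phi> j \<xi>\<bar> \<partial>lborel)" by (simp add: norm_mult)
  finally show ?thesis by (simp add: inverse_fourier_lborel norm_divide divide_right_mono)
qed

lemma Re_inverse_fourier:
  "Re (inverse_fourier (dyadic_part \<phi> j) x) = q (2 ^ j) x - (if j = 0 then 0 else q (2 ^ (j - 1)) x)"
proof -
  have i: "integrable lborel (\<lambda>\<xi>. \<phi> (\<xi> / 2 ^ n) * cos (x * \<xi>))" for n :: nat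
    by (rule Bochner_Integration.integrable_bound[OF \<phi>_scaled_integrable[of "2 ^ n"]])
       (auto simp: abs_mult intro!: mult_left_le)
  have "Re (\<integral>\<xi>. complex_of_real (dyadic_part \<phi> j \<xi>) * cis (x * \<xi>) \<partial>lborel)
     = (\<integral>\<xi>. Re (complex_of_real (dyadic_part \<phi> j \<xi>) * cis (x * \<xi>)) \<partial>lborel)"
    by (rule integral_bounded_linear[OF bounded_linear_Re inverse_fourier_integrable, symmetric])
  also have "\<dots> = (\<integral>\<xi>. \<phi> (\<xi> / 2 ^ j) * cos (x * \<xi>) - (if j = 0 then 0 else \<phi> (\<xi> / 2 ^ (j - 1)) * cos (x * \<xi>)) \<partial>lborel)"
    by (intro Bochner_Integration.integral_cong refl) (auto simp: dyadic_part_eq left_diff_distrib)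
  also have "\<dots> = (\<integral>\<xi>. \<phi> (\<xi> / 2 ^ j) * cos (x * \<xi>) \<partial>lborel)
      - (if j = 0 then 0 else (\<integral>\<xi>. \<phi> (\<xi> / 2 ^ (j - 1)) * cos (x * \<xi>) \<partial>lborel))"
    using i by (cases "j = 0") auto
  finally show ?thesis
    by (simp add: inverse_fourier_lborel q_def Re_divide_of_real diff_divide_distrib del: of_real_mult)
qed

text \<open>As \<open>f\<close> is real, the real part of a block is the convolution with the real
  part of its kernel, that is, the increment of the partial sums \<open>S\<close> from level
  \<open>j - 1\<close> to level \<open>j\<close>. Level 0 starts the telescoping sum.\<close>

lemma Re_LP_block:
  assumes f: "f \<in> borel_measurable lebesgue" and a: "integrable lborel a"
    and fa: "AE x in lborel. f x = a x"
  shows "Re (LP_block \<phi> j f x) = S a (2 ^ j) x - (if j = 0 then 0 else S a (2 ^ (j - 1)) x)"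
proof -
  have [measurable]: "a \<in> borel_measurable borel" using borel_measurable_integrable[OF a] by simp
  let ?I = "inverse_fourier (dyadic_part \<phi> j)"
  have Im: "(\<lambda>y. ?I (x - y)) \<in> borel_measurable lebesgue"
    by (rule measurable_completion) simp
  have am: "a \<in> borel_measurable lebesgue" by (rule measurable_completion) simp
  have "LP_block \<phi> j f x = (\<integral>y. ?I (x - y) * complex_of_real (a y) \<partial>lebesgue)"
    unfolding LP_block_def
  proof (rule integral_cong_AE)
    show "AE y in lebesgue. ?I (x - y) * complex_of_real (f y) = ?I (x - y) * complex_of_real (a y)"
      using AE_completion[OF fa] by eventually_elim simp
  qed (use f Im am in measurable)
  also have "\<dots> = (\<integral>y. ?I (x - y) * complex_of_real (a y) \<partial>lborel)"
    by (rule integral_completion) measurable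
  finally have LP: "LP_block \<phi> j f x = (\<integral>y. ?I (x - y) * complex_of_real (a y) \<partial>lborel)" .
  have int: "integrable lborel (\<lambda>y. ?I (x - y) * complex_of_real (a y))"
  proof -
    define B where "B = (\<integral>\<xi>. \<bar>dyadic_part \<phi> j \<xi>\<bar> \<partial>lborel) / (2 * pi)"
    have "integrable lborel (\<lambda>y. B * a y)" using a by simp
    then show ?thesis
    proof (rule Bochner_Integration.integrable_bound)
      show "AE y in lborel. norm (?I (x - y) * complex_of_real (a y)) \<le> norm (B * a y)"
      proof (rule AE_I2)
        fix y
        have "cmod (?I (x - y)) \<le> \<bar>B\<bar>" using norm_inverse_fourier_le[of j "x - y"] by (simp add: B_def)
        then show "norm (?I (x - y) * complex_of_real (a y)) \<le> norm (B * a y)"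
          by (simp add: norm_mult abs_mult mult_right_mono)
      qed
    qed measurable
  qed
  have "Re (LP_block \<phi> j f x) = (\<integral>y. Re (?I (x - y) * complex_of_real (a y)) \<partial>lborel)"
    unfolding LP by (rule integral_bounded_linear[OF bounded_linear_Re int, symmetric])
  also have "\<dots> = (\<integral>y. q (2 ^ j) (x - y) * a y - (if j = 0 then 0 else q (2 ^ (j - 1)) (x - y) * a y) \<partial>lborel)"
    by (intro Bochner_Integration.integral_cong refl) (auto simp: Re_inverse_fourier left_diff_distrib)
  also have "\<dots> = S a (2 ^ j) x - (if j = 0 then 0 else S a (2 ^ (j - 1)) x)"
    unfolding S_def using q_a_integrable[OF a] by (cases "j = 0") auto
  finally show ?thesis .
qed

text \<open>The increments telescope to \<open>S a (2 ^ J)\<close>, and their L1 norms decay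
  geometrically because \<open>r > 0\<close>. So the series converges absolutely in L1 and almost
  everywhere, Gaussian test integrals identify its sum with \<open>a\<close>, and the geometric tail
  gives the rate.\<close>

lemma S_L1_approximation:
  assumes a: "integrable lborel a" and C: "0 \<le> C" and r: "0 < r"
    and blocks: "\<And>j. (\<integral>\<^sup>+x. ennreal \<bar>S a (2 ^ j) x - (if j = 0 then 0 else S a (2 ^ (j - 1)) x)\<bar> \<partial>lborel)
        \<le> ennreal (C * 2 powr - (r * real j))"
  shows "integrable lborel (S a (2 ^ J))"
    and "(\<integral>x. \<bar>a x - S a (2 ^ J) x\<bar> \<partial>lborel) \<le> C / (1 - 2 powr - r) * 2 powr - (r * real J)"
proof -
  have am[measurable]: "a \<in> borel_measurable borel" using borel_measurable_integrable[OF a] by simp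
  define g where "g j x = S a (2 ^ j) x - (if j = 0 then 0 else S a (2 ^ (j - 1)) x)" for j x
  define \<rho> where "\<rho> = 2 powr - r"
  have \<rho>: "0 < \<rho>" "\<rho> < 1" using r by (auto simp: \<rho>_def powr_less_one)
  have \<rho>p: "2 powr - (r * real j) = \<rho> ^ j" for j
    by (simp add: \<rho>_def powr_powr powr_realpow[symmetric])
  have [measurable]: "g j \<in> borel_measurable borel" for j
    unfolding g_def by (cases "j = 0") auto
  have gn: "(\<integral>\<^sup>+x. ennreal \<bar>g j x\<bar> \<partial>lborel) \<le> ennreal (C * \<rho> ^ j)" for j
    using blocks[of j] by (simp add: g_def \<rho>p)
  have gi: "integrable lborel (g j)" for j
    using le_less_trans[OF gn[of j], of \<infinity>] by (intro integrableI_bounded) auto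
  have gI: "(\<integral>x. \<bar>g j x\<bar> \<partial>lborel) \<le> C * \<rho> ^ j" for j
  proof -
    have "ennreal (\<integral>x. \<bar>g j x\<bar> \<partial>lborel) \<le> ennreal (C * \<rho> ^ j)"
      using gn[of j] nn_integral_eq_integral[of lborel "\<lambda>x. \<bar>g j x\<bar>"] gi[of j] by simp
    then show ?thesis using C \<rho> by simp
  qed
  have Sg: "S a (2 ^ J) x = (\<Sum>j<Suc J. g j x)" for J x
    by (induction J) (auto simp: g_def)
  show "integrable lborel (S a (2 ^ J))"
    unfolding Sg[abs_def] using gi by auto
  have sumI: "summable (\<lambda>j. \<integral>x. norm (g j x) \<partial>lborel)"
  proof (rule summable_comparison_test')
    show "summable (\<lambda>j. C * \<rho> ^ j)" using \<rho> by (intro summable_mult summable_geometric) auto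
    show "norm (\<integral>x. norm (g j x) \<partial>lborel) \<le> C * \<rho> ^ j" if "0 \<le> j" for j
      using gI[of j] by simp
  qed
  have AEs: "AE x in lborel. summable (\<lambda>j. norm (g j x))"
  proof -
    have "(\<integral>\<^sup>+x. (\<Sum>j. ennreal \<bar>g j x\<bar>) \<partial>lborel) = (\<Sum>j. \<integral>\<^sup>+x. ennreal \<bar>g j x\<bar> \<partial>lborel)"
      by (rule nn_integral_suminf) measurable
    also have "\<dots> = (\<Sum>j. ennreal (\<integral>x. norm (g j x) \<partial>lborel))"
      using nn_integral_eq_integral[of lborel "\<lambda>x. \<bar>g _ x\<bar>"] gi by simp
    also have "\<dots> = ennreal (\<Sum>j. \<integral>x. norm (g j x) \<partial>lborel)"
      using sumI by (intro suminf_ennreal2) auto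
    finally have "(\<integral>\<^sup>+x. (\<Sum>j. ennreal \<bar>g j x\<bar>) \<partial>lborel) \<noteq> \<infinity>" by simp
    then have "AE x in lborel. (\<Sum>j. ennreal \<bar>g j x\<bar>) \<noteq> \<infinity>"
      by (intro nn_integral_PInf_AE) auto
    then show ?thesis
      by eventually_elim (auto intro!: summable_suminf_not_top)
  qed
  define b where "b x = (\<Sum>j. g j x)" for x
  have bi: "integrable lborel b"
    unfolding b_def using gi AEs sumI by (rule integrable_suminf)
  define w where "w x = (\<Sum>j. norm (g j x))" for x
  have wi: "integrable lborel w"
    unfolding w_def
  proof (rule integrable_suminf)
    show "AE x in lborel. summable (\<lambda>i. norm (norm (g i x)))" using AEs by simp
  qed (use gi sumI in auto)
  have "AE x in lborel. b x - a x = 0"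
  proof (rule AE_eq_0_if_gauss_integrals_0)
    show "integrable lborel (\<lambda>x. b x - a x)" using bi a by simp
    fix s y :: real assume s: "0 < s"
    have bg: "integrable lborel (\<lambda>x. f x * gauss s (x - y))" if "integrable lborel f" for f :: "real \<Rightarrow> real"
    proof -
      have [measurable]: "f \<in> borel_measurable borel" using borel_measurable_integrable[OF that] by simp
      show ?thesis
        by (rule Bochner_Integration.integrable_bound[OF that])
           (auto simp: abs_mult gauss_nonneg gauss_le_1 intro!: mult_left_le)
    qed
    have "(\<lambda>J. \<integral>x. S a (2 ^ J) x * gauss s (x - y) \<partial>lborel) \<longlonglongrightarrow> (\<integral>x. b x * gauss s (x - y) \<partial>lborel)"
    proof (rule integral_dominated_convergence[where w = w])
      show "AE x in lborel. (\<lambda>J. S a (2 ^ J) x * gauss s (x - y)) \<longlonglongrightarrow> b x * gauss s (x - y)"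
        using AEs
      proof eventually_elim
        case (elim x)
        have "(\<lambda>J. \<Sum>j<Suc J. g j x) \<longlonglongrightarrow> b x"
          unfolding b_def using summable_LIMSEQ[OF summable_norm_cancel[OF elim]] by (rule LIMSEQ_Suc)
        then show ?case unfolding Sg by (intro tendsto_mult_right)
      qed
      show "AE x in lborel. norm (S a (2 ^ J) x * gauss s (x - y)) \<le> w x" for J
        using AEs
      proof eventually_elim
        case (elim x)
        have "norm (S a (2 ^ J) x) \<le> (\<Sum>j<Suc J. norm (g j x))" unfolding Sg by (rule norm_sum)
        also have "\<dots> \<le> w x" unfolding w_def using elim by (intro sum_le_suminf) auto
        finally have "norm (S a (2 ^ J) x) \<le> w x" .
        moreover have "norm (S a (2 ^ J) x * gauss s (x - y)) \<le> norm (S a (2 ^ J) x)"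
          by (auto simp: abs_mult gauss_nonneg gauss_le_1 intro!: mult_left_le)
        ultimately show ?case by linarith
      qed
    qed (use wi bi in auto)
    from LIMSEQ_unique[OF this S_gauss_limit[OF a s]]
    have "(\<integral>x. b x * gauss s (x - y) \<partial>lborel) = (\<integral>x. a x * gauss s (x - y) \<partial>lborel)" .
    then show "(\<integral>x. (b x - a x) * gauss s (x - y) \<partial>lborel) = 0"
      using bg[OF bi] bg[OF a] by (simp add: left_diff_distrib)
  qed
  then have ab: "AE x in lborel. a x = b x" by eventually_elim simp
  define h where "h j = g (j + Suc J)" for j
  have hs: "summable (\<lambda>j. \<integral>x. norm (h j x) \<partial>lborel)"
    unfolding h_def using sumI by (rule summable_ignore_initial_segment)
  have hA: "AE x in lborel. summable (\<lambda>j. norm (h j x))"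
    using AEs unfolding h_def by eventually_elim (rule summable_ignore_initial_segment)
  have hi: "integrable lborel (\<lambda>x. \<Sum>j. norm (h j x))"
  proof (rule integrable_suminf)
    show "AE x in lborel. summable (\<lambda>i. norm (norm (h i x)))" using hA by simp
  qed (use gi hs in \<open>auto simp: h_def\<close>)
  have "(\<integral>x. \<bar>a x - S a (2 ^ J) x\<bar> \<partial>lborel) \<le> (\<integral>x. (\<Sum>j. norm (h j x)) \<partial>lborel)"
  proof (rule integral_mono_AE)
    show "integrable lborel (\<lambda>x. \<bar>a x - S a (2 ^ J) x\<bar>)"
      unfolding Sg[abs_def] using gi a by (intro integrable_abs Bochner_Integration.integrable_diff) auto
    show "AE x in lborel. \<bar>a x - S a (2 ^ J) x\<bar> \<le> (\<Sum>j. norm (h j x))"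
      using ab hA AEs
    proof eventually_elim
      case (elim x)
      have "b x = (\<Sum>j. h j x) + (\<Sum>j<Suc J. g j x)"
        unfolding b_def h_def using summable_norm_cancel[OF elim(3)]
        by (rule suminf_split_initial_segment)
      then have "a x - S a (2 ^ J) x = (\<Sum>j. h j x)" using elim(1) by (simp add: Sg)
      then show ?case using summable_norm[OF elim(2)] by simp
    qed
  qed (rule hi)
  also have "\<dots> = (\<Sum>j. \<integral>x. norm (h j x) \<partial>lborel)"
  proof (rule integral_suminf)
    show "AE x in lborel. summable (\<lambda>i. norm (norm (h i x)))" using hA by simp
  qed (use gi hs in \<open>auto simp: h_def\<close>)
  also have "\<dots> \<le> (\<Sum>j. C * \<rho> ^ Suc J * \<rho> ^ j)"
  proof (rule suminf_le[OF _ hs])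
    show "summable (\<lambda>j. C * \<rho> ^ Suc J * \<rho> ^ j)" using \<rho> by (intro summable_mult summable_geometric) auto
    show "(\<integral>x. norm (h j x) \<partial>lborel) \<le> C * \<rho> ^ Suc J * \<rho> ^ j" for j
      using gI[of "j + Suc J"] by (simp add: h_def power_add mult_ac)
  qed
  also have "\<dots> = C * \<rho> ^ Suc J * (1 / (1 - \<rho>))"
    using \<rho> by (subst suminf_mult) (auto simp: suminf_geometric summable_geometric)
  \<comment> \<open>The tail starts at level \<open>J + 1\<close>; the spare factor \<rho> is given
    away.\<close>
  also have "\<dots> \<le> C * \<rho> ^ J * (1 / (1 - \<rho>))"
    using \<rho> C by (intro mult_right_mono mult_left_mono power_decreasing) auto
  finally show "(\<integral>x. \<bar>a x - S a (2 ^ J) x\<bar> \<partial>lborel) \<le> C / (1 - 2 powr - r) * 2 powr - (r * real J)"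
    unfolding \<rho>p \<rho>_def[symmetric] by simp
qed

end

text \<open>On the bounded support the weight in \<open>tempered\<close> lies between 1 and (1 +
  T)^N, so temperedness amounts to integrability. The Borel version is cut off once more because
  agreement almost everywhere does not force it to vanish outside [-T, T].\<close>

lemma tempered_zero_extension_integrable:
  assumes f: "tempered (zero_extension T a)" and T: "0 < T"
  obtains a0 where "integrable lborel a0" "AE x in lborel. zero_extension T a x = a0 x"
    "\<And>x. T < \<bar>x\<bar> \<Longrightarrow> a0 x = 0" "zero_extension T a \<in> borel_measurable lebesgue"
proof -
  let ?f = "zero_extension T a"
  obtain N where N: "integrable lebesgue (\<lambda>x. ?f x / (1 + \<bar>x\<bar>) ^ N)"
    using f by (auto simp: tempered_def)
  have pos: "1 + \<bar>x\<bar> \<noteq> 0" for x :: real using abs_ge_zero[of x] by linarith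
  have wm: "(\<lambda>x::real. (1 + \<bar>x\<bar>) ^ N) \<in> borel_measurable lebesgue"
    by (rule measurable_completion) simp
  have "(\<lambda>x. (?f x / (1 + \<bar>x\<bar>) ^ N) * (1 + \<bar>x\<bar>) ^ N) \<in> borel_measurable lebesgue"
    using borel_measurable_integrable[OF N] wm by (rule borel_measurable_times)
  then have fm: "?f \<in> borel_measurable lebesgue" using pos by simp
  have fi: "integrable lebesgue ?f"
  proof -
    have "integrable lebesgue (\<lambda>x. ?f x / (1 + \<bar>x\<bar>) ^ N * (1 + T) ^ N)"
      using N by (intro integrable_mult_left)
    then show ?thesis
    proof (rule Bochner_Integration.integrable_bound[OF _ fm])
      show "AE x in lebesgue. norm (?f x) \<le> norm (?f x / (1 + \<bar>x\<bar>) ^ N * (1 + T) ^ N)"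
      proof (rule AE_I2)
        fix x
        show "norm (?f x) \<le> norm (?f x / (1 + \<bar>x\<bar>) ^ N * (1 + T) ^ N)"
        proof (cases "x \<in> {-T..T}")
          case True
          then have "(1 + \<bar>x\<bar>) ^ N \<le> (1 + T) ^ N" by (intro power_mono) auto
          moreover have "0 < (1 + \<bar>x\<bar>) ^ N" by (rule zero_less_power) (use abs_ge_zero[of x] in linarith)
          ultimately have "1 \<le> (1 + T) ^ N / (1 + \<bar>x\<bar>) ^ N" by simp
          then have "norm (?f x) * 1 \<le> norm (?f x) * ((1 + T) ^ N / (1 + \<bar>x\<bar>) ^ N)"
            by (intro mult_left_mono) auto
          then show ?thesis using T by (simp add: abs_mult abs_divide power_abs)
        next
          case False
          then show ?thesis by (auto simp: zero_extension_def)
        qed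
      qed
    qed
  qed
  obtain a1 where a1: "a1 \<in> borel_measurable lborel" "AE x in lborel. ?f x = a1 x"
    using completion_ex_borel_measurable_real[OF fm] by auto
  define a0 where "a0 x = indicator {-T..T} x * a1 x" for x
  have a0m[measurable]: "a0 \<in> borel_measurable borel" using a1(1) unfolding a0_def by simp
  have e: "AE x in lborel. ?f x = a0 x"
    using a1(2) by eventually_elim (auto simp: a0_def zero_extension_def indicator_def split: if_splits)
  have "integrable lebesgue a0"
  proof (rule integrable_cong_AE_imp[OF fi])
    show "a0 \<in> borel_measurable lebesgue" by (rule measurable_completion) simp
    show "AE x in lebesgue. ?f x = a0 x" by (rule AE_completion[OF e])
  qed
  then have "integrable lborel a0" by (subst (asm) integrable_completion) auto
  then show ?thesis by (rule that[OF _ e _ fm]) (auto simp: a0_def indicator_def)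
qed

text \<open>Two errors add up: the L1 distance of \<open>a0\<close> from its low-frequency part, and
  the uniform distance of that part from a polynomial on [-T, T]. The second is negligible once the
  degree is a suitable fixed multiple of 2^J.\<close>

lemma besov_polynomial_approximation:
  assumes f: "zero_extension T a \<in> besov r 1 \<theta>" and \<theta>: "0 < \<theta>" and r: "0 \<le> r" and T: "0 < T"
  obtains a0 C D where "integrable lborel a0" "AE x in lborel. zero_extension T a x = a0 x"
    "0 \<le> C"
    "\<And>J. \<exists>p e. (\<forall>\<tau>. \<bar>\<tau>\<bar> < T \<longrightarrow> a0 \<tau> = (\<Sum>j<D * 2 ^ J. p j * \<tau> ^ j) + e \<tau>) \<and>
        integrable lborel e \<and> (\<integral>t. \<bar>e t\<bar> \<partial>lborel) \<le> C * 2 powr - (r * real J)"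
proof -
  obtain a0 where a0: "integrable lborel a0" "AE x in lborel. zero_extension T a x = a0 x"
    "\<And>x. T < \<bar>x\<bar> \<Longrightarrow> a0 x = 0" "zero_extension T a \<in> borel_measurable lebesgue"
    using tempered_zero_extension_integrable[OF _ T] f by (auto simp: besov_def)
  have [measurable]: "a0 \<in> borel_measurable borel" using borel_measurable_integrable[OF a0(1)] by simp
  define A where "A = (\<integral>t. \<bar>a0 t\<bar> \<partial>lborel)"
  have A0: "0 \<le> A" by (simp add: A_def)
  show ?thesis
  proof (cases "r = 0")
    case True
    show ?thesis
    \<comment> \<open>For \<open>r = 0\<close> no decay is claimed: the polynomial is empty and the
      whole filter is the error.\<close>
    proof (rule that[OF a0(1,2) A0, of 0])
      fix J
      show "\<exists>p e. (\<forall>\<tau>. \<bar>\<tau>\<bar> < T \<longrightarrow> a0 \<tau> = (\<Sum>j<0 * 2 ^ J. p j * \<tau> ^ j) + e \<tau>) \<and>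
        integrable lborel e \<and> (\<integral>t. \<bar>e t\<bar> \<partial>lborel) \<le> A * 2 powr - (r * real J)"
        using a0(1) True by (intro exI[of _ "\<lambda>_. 0"] exI[of _ a0]) (auto simp: A_def)
    qed
  next
    case False
    then have r: "0 < r" using r by simp
    obtain \<phi> C where \<phi>: "dyadic_generator \<phi>" and C: "0 \<le> C"
      "\<And>j. (\<integral>\<^sup>+x. ennreal (cmod (LP_block \<phi> j (zero_extension T a) x)) \<partial>lebesgue) \<le> ennreal (C * 2 powr - (r * real j))"
      using besov_1_block_bound[OF f \<theta>] by blast
    obtain \<Phi> where "frequency_cutoff \<phi> \<Phi>" using dyadic_generator_cutoff[OF \<phi>] .
    then interpret frequency_cutoff \<phi> \<Phi> .
    have blocks: "(\<integral>\<^sup>+x. ennreal \<bar>S a0 (2 ^ j) x - (if j = 0 then 0 else S a0 (2 ^ (j - 1)) x)\<bar> \<partial>lborel)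
        \<le> ennreal (C * 2 powr - (r * real j))" for j
    proof -
      have "(\<integral>\<^sup>+x. ennreal \<bar>S a0 (2 ^ j) x - (if j = 0 then 0 else S a0 (2 ^ (j - 1)) x)\<bar> \<partial>lborel)
         = (\<integral>\<^sup>+x. ennreal \<bar>S a0 (2 ^ j) x - (if j = 0 then 0 else S a0 (2 ^ (j - 1)) x)\<bar> \<partial>lebesgue)"
        by (rule nn_integral_completion[symmetric])
      also have "\<dots> = (\<integral>\<^sup>+x. ennreal \<bar>Re (LP_block \<phi> j (zero_extension T a) x)\<bar> \<partial>lebesgue)"
        by (simp add: Re_LP_block[OF a0(4,1,2)])
      also have "\<dots> \<le> (\<integral>\<^sup>+x. ennreal (cmod (LP_block \<phi> j (zero_extension T a) x)) \<partial>lebesgue)"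
        by (intro nn_integral_mono ennreal_leI abs_Re_le_cmod)
      also have "\<dots> \<le> ennreal (C * 2 powr - (r * real j))" by (rule C)
      finally show ?thesis .
    qed
    define C1 where "C1 = C / (1 - 2 powr - r)"
    have "2 powr - r < 1" using r by (simp add: powr_less_one)
    then have C1: "0 \<le> C1" using C by (simp add: C1_def)
    \<comment> \<open>The summand \<open>24 * T\<close> makes the base
      \<open>3 * (4 * L * T) / k\<close> at most 1/2. The rest, \<open>r + 1\<close>, makes (1/2)^k
      at most 2^(-(r + 1) J), which pays for the rate and for the factor \<open>L = 2 ^ J\<close> in
      front.\<close>
    define D where "D = nat \<lceil>24 * T + r + 1\<rceil>"
    have D: "24 * T \<le> real D" "r + 1 \<le> real D" "1 \<le> real D"
      using T r real_nat_ceiling_ge[of "24 * T + r + 1"] unfolding D_def by linarith+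
    define C2 where "C2 = C1 + 4 * \<Phi> * A * (2 * T)"
    have C2: "0 \<le> C2" using C1 A0 \<Phi>_nonneg T by (simp add: C2_def)
    show ?thesis
    proof (rule that[OF a0(1,2) C2, of D])
      fix J
      define L :: real where "L = 2 ^ J"
      define k where "k = D * 2 ^ J"
      have L: "L \<ge> 1" by (simp add: L_def)
      have k: "real k = real D * L" by (simp add: k_def L_def)
      obtain p where p: "\<And>x. \<bar>x\<bar> \<le> T \<Longrightarrow> \<bar>S a0 L x - (\<Sum>j<k. p j * x ^ j)\<bar>
          \<le> 4 * L * \<Phi> * ((4 * L * T) ^ k / fact k) * A"
        using S_polynomial[OF a0(1,3) _ T, of L k] L by (auto simp: A_def)
      have small: "L * ((4 * L * T) ^ k / fact k) \<le> 2 powr - (r * real J)"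
      proof -
        have "(4 * L * T) ^ k / fact k \<le> (3 * (4 * L * T) / real k) ^ k"
          using L T by (intro power_div_fact_le) auto
        also have "\<dots> \<le> (1 / 2) ^ k"
        proof (rule power_mono)
          have "24 * (L * T) \<le> real D * L" using D(1) L by (metis mult.assoc mult.commute mult_right_mono order_trans[OF zero_le_one])
          then show "3 * (4 * L * T) / real k \<le> 1 / 2"
            unfolding k using D(3) L by (simp add: field_simps)
        qed (use L T in auto)
        also have "\<dots> = 2 powr - (real D * L)"
          by (simp add: powr_minus powr_realpow[symmetric] k[symmetric] power_one_over inverse_eq_divide)
        also have "\<dots> \<le> 2 powr - ((r + 1) * real J)"
        proof -
          have "real J \<le> L" using of_nat_less_two_power[of J, where ?'a = real] by (simp add: L_def)
          then have "(r + 1) * real J \<le> real D * L" using D(2) r by (intro mult_mono) auto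
          then show ?thesis by (intro powr_mono) auto
        qed
        finally have "L * ((4 * L * T) ^ k / fact k) \<le> L * 2 powr - ((r + 1) * real J)"
          using L by (intro mult_left_mono) auto
        also have "\<dots> = 2 powr (real J) * 2 powr - ((r + 1) * real J)" by (simp add: L_def powr_realpow)
        also have "\<dots> = 2 powr - (r * real J)" by (simp add: powr_add[symmetric] algebra_simps)
        finally show ?thesis .
      qed
      define \<epsilon> where "\<epsilon> = 4 * \<Phi> * A * 2 powr - (r * real J)"
      have e0: "0 \<le> \<epsilon>" using \<Phi>_nonneg A0 by (simp add: \<epsilon>_def)
      have pe: "\<bar>S a0 L x - (\<Sum>j<k. p j * x ^ j)\<bar> \<le> \<epsilon>" if "\<bar>x\<bar> \<le> T" for x
      proof -
        have "4 * L * \<Phi> * ((4 * L * T) ^ k / fact k) * A = (4 * \<Phi> * A) * (L * ((4 * L * T) ^ k / fact k))"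
          by simp
        also have "\<dots> \<le> \<epsilon>" unfolding \<epsilon>_def using \<Phi>_nonneg A0 by (intro mult_left_mono small) auto
        finally show ?thesis using p[OF that] by linarith
      qed
      \<comment> \<open>The error is cut off to (-T, T), since a nonzero polynomial is not
        integrable on the line.\<close>
      define e where "e \<tau> = (if \<bar>\<tau>\<bar> < T then a0 \<tau> - (\<Sum>j<k. p j * \<tau> ^ j) else 0)" for \<tau>
      have [measurable]: "e \<in> borel_measurable borel" unfolding e_def by measurable
      have Si: "integrable lborel (S a0 L)"
        unfolding L_def by (rule S_L1_approximation(1)[OF a0(1) C(1) r blocks])
      have ind: "integrable lborel (\<lambda>x. \<epsilon> * indicator {-T..T} x)"
        using T by (intro integrable_mult_right integrable_real_indicator) auto
      have bnd: "\<bar>e x\<bar> \<le> \<bar>a0 x - S a0 L x\<bar> + \<epsilon> * indicator {-T..T} x" for x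
      proof (cases "\<bar>x\<bar> < T")
        case True
        then show ?thesis using pe[of x] by (auto simp: e_def indicator_def)
      next
        case False
        then show ?thesis using e0 by (auto simp: e_def indicator_def)
      qed
      have di: "integrable lborel (\<lambda>x. \<bar>a0 x - S a0 L x\<bar> + \<epsilon> * indicator {-T..T} x)"
        using a0(1) Si ind by (intro Bochner_Integration.integrable_add integrable_abs Bochner_Integration.integrable_diff)
      have ei: "integrable lborel e"
        by (rule Bochner_Integration.integrable_bound[OF di]) (use bnd in \<open>auto intro: order_trans[OF bnd abs_ge_self]\<close>)
      have "(\<integral>t. \<bar>e t\<bar> \<partial>lborel) \<le> (\<integral>x. \<bar>a0 x - S a0 L x\<bar> + \<epsilon> * indicator {-T..T} x \<partial>lborel)"
        using ei di bnd by (intro integral_mono) auto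
      also have "\<dots> = (\<integral>x. \<bar>a0 x - S a0 L x\<bar> \<partial>lborel) + (\<integral>x. \<epsilon> * indicator {-T..T} x \<partial>lborel)"
        using a0(1) Si ind by (intro Bochner_Integration.integral_add integrable_abs Bochner_Integration.integrable_diff)
      also have "(\<integral>x. \<epsilon> * indicator {-T..T} x \<partial>lborel) = \<epsilon> * (2 * T)" using T by simp
      also have "(\<integral>x. \<bar>a0 x - S a0 L x\<bar> \<partial>lborel) \<le> C1 * 2 powr - (r * real J)"
        unfolding L_def C1_def by (rule S_L1_approximation(2)[OF a0(1) C(1) r blocks])
      finally have "(\<integral>t. \<bar>e t\<bar> \<partial>lborel) \<le> C2 * 2 powr - (r * real J)"
        by (simp add: C2_def \<epsilon>_def algebra_simps)
      then show "\<exists>p e. (\<forall>\<tau>. \<bar>\<tau>\<bar> < T \<longrightarrow> a0 \<tau> = (\<Sum>j<D * 2 ^ J. p j * \<tau> ^ j) + e \<tau>) \<and>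
        integrable lborel e \<and> (\<integral>t. \<bar>e t\<bar> \<partial>lborel) \<le> C2 * 2 powr - (r * real J)"
        using ei by (intro exI[of _ p] exI[of _ e]) (auto simp: e_def k_def)
    qed
  qed
qed

section \<open>Absolutely continuous functions and weak derivatives\<close>

text \<open>Absolute continuity with a prescribed density: \<open>F\<close> is a primitive of one
  fixed function \<open>f\<close>. The integral form keeps the calculus free of null sets and of
  pointwise derivatives.\<close>

definition ac_on :: "real \<Rightarrow> (real \<Rightarrow> real) \<Rightarrow> (real \<Rightarrow> real) \<Rightarrow> bool" where
  "ac_on T F f \<longleftrightarrow> f absolutely_integrable_on {0..T} \<and> (\<forall>t\<in>{0..T}. F t = F 0 + integral {0..t} f)"

lemma abs_integrable_sub:
  fixes f :: "real \<Rightarrow> real"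
  assumes "f absolutely_integrable_on {0..T}" "0 \<le> s" "t \<le> T"
  shows "f absolutely_integrable_on {s..t}" "f integrable_on {s..t}" "(\<lambda>x. \<bar>f x\<bar>) integrable_on {s..t}"
proof -
  show 1: "f absolutely_integrable_on {s..t}"
    using assms by (intro absolutely_integrable_on_subinterval[OF assms(1)]) auto
  show "f integrable_on {s..t}" using 1 by (rule set_lebesgue_integral_eq_integral(1))
  show "(\<lambda>x. \<bar>f x\<bar>) integrable_on {s..t}"
    by (rule set_lebesgue_integral_eq_integral(1)[OF set_integrable_abs, OF 1])
qed

lemma integral_diff_indefinite:
  fixes f :: "real \<Rightarrow> real"
  assumes "f absolutely_integrable_on {0..T}" "0 \<le> s" "s \<le> t" "t \<le> T"
  shows "integral {0..t} f - integral {0..s} f = integral {s..t} f"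
  using Henstock_Kurzweil_Integration.integral_combine[of 0 s t f] abs_integrable_sub(2)[OF assms(1), of 0 t] assms by simp

lemma ac_on_eq: "ac_on T F f \<Longrightarrow> t \<in> {0..T} \<Longrightarrow> F t = F 0 + integral {0..t} f"
  unfolding ac_on_def by blast

lemma ac_on_integrable: "ac_on T F f \<Longrightarrow> f absolutely_integrable_on {0..T}"
  unfolding ac_on_def by blast

lemma ac_onI:
  "f absolutely_integrable_on {0..T} \<Longrightarrow> (\<And>t. t \<in> {0..T} \<Longrightarrow> F t = F 0 + integral {0..t} f) \<Longrightarrow> ac_on T F f"
  unfolding ac_on_def by blast

lemma ac_on_diff:
  assumes "ac_on T F f" "0 \<le> s" "s \<le> t" "t \<le> T"
  shows "F t - F s = integral {s..t} f"
proof -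
  have "F t = F 0 + integral {0..t} f" "F s = F 0 + integral {0..s} f"
    using ac_on_eq[OF assms(1), of t] ac_on_eq[OF assms(1), of s] assms(2-4) by auto
  then show ?thesis
    using integral_diff_indefinite[OF ac_on_integrable[OF assms(1)] assms(2-4)] by linarith
qed

lemma abs_integral_le:
  fixes f :: "real \<Rightarrow> real"
  assumes "f absolutely_integrable_on {0..T}" "0 \<le> s" "t \<le> T"
  shows "\<bar>integral {s..t} f\<bar> \<le> integral {s..t} (\<lambda>x. \<bar>f x\<bar>)"
  using Henstock_Kurzweil_Integration.integral_norm_bound_integral[of f "{s..t}" "\<lambda>x. \<bar>f x\<bar>"] abs_integrable_sub[OF assms] by simp

lemma ac_on_abs_diff:
  assumes "ac_on T F f" "0 \<le> s" "s \<le> t" "t \<le> T"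
  shows "\<bar>F t - F s\<bar> \<le> integral {s..t} (\<lambda>x. \<bar>f x\<bar>)"
  using ac_on_diff[OF assms] abs_integral_le[OF ac_on_integrable[OF assms(1)], of s t] assms by simp

lemma ac_on_continuous:
  assumes "ac_on T F f" shows "continuous_on {0..T} F"
proof -
  have "f integrable_on {0..T}"
    using ac_on_integrable[OF assms] by (rule set_lebesgue_integral_eq_integral(1))
  then have "continuous_on {0..T} (\<lambda>t. F 0 + integral {0..t} f)"
    by (intro continuous_intros indefinite_integral_continuous_1)
  then show ?thesis
    by (rule continuous_on_eq) (rule ac_on_eq[OF assms, symmetric])
qed

text \<open>Increments quadratic in a continuous monotone function replace Lebesgue's differentiation
  theorem in the product and chain rules for \<^const>\<open>ac_on\<close>.\<close>

lemma constant_of_quadratic_increments: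
  fixes D \<tau> :: "real \<Rightarrow> real"
  assumes \<tau>: "continuous_on {0..T} \<tau>" "\<And>s t. 0 \<le> s \<Longrightarrow> s \<le> t \<Longrightarrow> t \<le> T \<Longrightarrow> \<tau> s \<le> \<tau> t"
    and C: "0 \<le> C"
    and D: "\<And>s t. 0 \<le> s \<Longrightarrow> s \<le> t \<Longrightarrow> t \<le> T \<Longrightarrow> \<bar>D t - D s\<bar> \<le> C * (\<tau> t - \<tau> s)\<^sup>2"
    and t: "0 \<le> t" "t \<le> T"
  shows "D t = D 0"
proof -
  define V where "V = \<tau> t - \<tau> 0"
  have V: "0 \<le> V" using \<tau>(2)[of 0 t] t by (simp add: V_def)
  have "\<bar>D t - D 0\<bar> \<le> C * V * \<epsilon>" if e: "0 < \<epsilon>" for \<epsilon>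
  proof -
    have "uniformly_continuous_on {0..T} \<tau>"
      using \<tau>(1) by (rule compact_uniformly_continuous) simp
    then obtain \<delta> where \<delta>: "0 < \<delta>"
      "\<And>x y. x \<in> {0..T} \<Longrightarrow> y \<in> {0..T} \<Longrightarrow> dist y x < \<delta> \<Longrightarrow> dist (\<tau> y) (\<tau> x) < \<epsilon>"
      using e unfolding uniformly_continuous_on_def by metis
    obtain n :: nat where n: "t / \<delta> < real n" using reals_Archimedean2 by blast
    have n0: "0 < real n" using n t \<delta> by (smt (verit) divide_nonneg_pos)
    define p where "p i = t * real i / real n" for i :: nat
    have p: "0 \<le> p i" "p i \<le> p (Suc i)" for i
      using t n0 by (auto simp: p_def divide_right_mono mult_left_mono)
    have pT: "p i \<le> T" if "i \<le> n" for i
    proof -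
      have "p i \<le> t * real n / real n" unfolding p_def using that t n0
        by (intro divide_right_mono mult_left_mono) auto
      then show ?thesis using n0 t by simp
    qed
    \<comment> \<open>One factor of the squared increment is below \<epsilon> by uniform continuity;
      the other is kept, as it telescopes to \<open>V\<close> over the mesh.\<close>
    have step: "\<bar>D (p (Suc i)) - D (p i)\<bar> \<le> C * \<epsilon> * (\<tau> (p (Suc i)) - \<tau> (p i))" if i: "i < n" for i
    proof -
      have "p (Suc i) - p i = t / real n" using n0 by (simp add: p_def field_simps)
      also have "\<dots> < \<delta>" using n n0 \<delta> by (simp add: field_simps)
      finally have "dist (p (Suc i)) (p i) < \<delta>" using p[of i] by (simp add: dist_real_def)
      then have "dist (\<tau> (p (Suc i))) (\<tau> (p i)) < \<epsilon>"
        using p pT[of i] pT[of "Suc i"] i by (intro \<delta>(2)) auto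
      moreover have m: "\<tau> (p i) \<le> \<tau> (p (Suc i))" using p pT[of "Suc i"] i by (intro \<tau>(2)) auto
      ultimately have "\<tau> (p (Suc i)) - \<tau> (p i) \<le> \<epsilon>" by (simp add: dist_real_def)
      then have "(\<tau> (p (Suc i)) - \<tau> (p i))\<^sup>2 \<le> \<epsilon> * (\<tau> (p (Suc i)) - \<tau> (p i))"
        unfolding power2_eq_square using m by (intro mult_right_mono) auto
      then have "C * (\<tau> (p (Suc i)) - \<tau> (p i))\<^sup>2 \<le> C * (\<epsilon> * (\<tau> (p (Suc i)) - \<tau> (p i)))"
        using C by (intro mult_left_mono) auto
      moreover have "\<bar>D (p (Suc i)) - D (p i)\<bar> \<le> C * (\<tau> (p (Suc i)) - \<tau> (p i))\<^sup>2"
        using p pT[of "Suc i"] i by (intro D) auto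
      ultimately show ?thesis by (simp add: mult.assoc)
    qed
    have pn: "p n = t" "p 0 = 0" using n0 by (auto simp: p_def)
    have "\<bar>D t - D 0\<bar> = \<bar>\<Sum>i<n. D (p (Suc i)) - D (p i)\<bar>"
      by (subst sum_lessThan_telescope) (simp add: pn)
    also have "\<dots> \<le> (\<Sum>i<n. \<bar>D (p (Suc i)) - D (p i)\<bar>)" by (rule sum_abs)
    also have "\<dots> \<le> (\<Sum>i<n. C * \<epsilon> * (\<tau> (p (Suc i)) - \<tau> (p i)))"
      by (intro sum_mono step) auto
    also have "\<dots> = C * \<epsilon> * V"
      unfolding sum_distrib_left[symmetric] by (subst sum_lessThan_telescope) (simp add: pn V_def)
    finally show ?thesis by (simp add: mult_ac)
  qed
  note e = this
  have "\<bar>D t - D 0\<bar> \<le> 0"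
  proof (rule field_le_epsilon)
    fix \<epsilon> :: real assume "0 < \<epsilon>"
    \<comment> \<open>The summand 1 covers the case \<open>C * V = 0\<close>.\<close>
    then have "\<bar>D t - D 0\<bar> \<le> C * V * (\<epsilon> / (C * V + 1))"
      using C V by (intro e) (simp add: add_nonneg_pos)
    also have "\<dots> \<le> \<epsilon>"
    proof -
      define q where "q = C * V"
      have q: "0 \<le> q" "0 < q + 1" using C V by (auto simp: q_def add_nonneg_pos)
      show ?thesis unfolding q_def[symmetric] using q \<open>0 < \<epsilon>\<close> by (simp add: pos_divide_le_eq algebra_simps)
    qed
    finally show "\<bar>D t - D 0\<bar> \<le> 0 + \<epsilon>" by simp
  qed
  then show ?thesis by simp
qed

text \<open>The preceding rigidity applies to \<open>F\<close> minus the primitive of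
  \<open>f\<close>, with the primitive of the weight \<open>w\<close> as the monotone
  function.\<close>

lemma ac_onI_quadratic:
  assumes f: "f absolutely_integrable_on {0..T}" and w: "w absolutely_integrable_on {0..T}"
    and w0: "\<And>x. 0 \<le> w x" and C: "0 \<le> C"
    and le: "\<And>s t. 0 \<le> s \<Longrightarrow> s \<le> t \<Longrightarrow> t \<le> T \<Longrightarrow>
       \<bar>F t - F s - integral {s..t} f\<bar> \<le> C * (integral {s..t} w)\<^sup>2"
  shows "ac_on T F f"
proof -
  have wi: "w integrable_on {0..T}" using w by (rule set_lebesgue_integral_eq_integral(1))
  have "F t - integral {0..t} f = F 0 - integral {0..0} f" if t: "t \<in> {0..T}" for t
  proof (rule constant_of_quadratic_increments[where \<tau> = "\<lambda>t. integral {0..t} w" and C = C and T = T])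
    show "continuous_on {0..T} (\<lambda>t. integral {0..t} w)"
      by (rule indefinite_integral_continuous_1[OF wi])
    show "integral {0..s} w \<le> integral {0..t} w" if "0 \<le> s" "s \<le> t" "t \<le> T" for s t
    proof -
      have "0 \<le> integral {s..t} w" using w0 by (intro integral_nonneg abs_integrable_sub(2)[OF w] that) auto
      then show ?thesis using integral_diff_indefinite[OF w that] by simp
    qed
    show "\<bar>(F t - integral {0..t} f) - (F s - integral {0..s} f)\<bar> \<le> C * (integral {0..t} w - integral {0..s} w)\<^sup>2"
      if "0 \<le> s" "s \<le> t" "t \<le> T" for s t
    proof -
      have "(F t - integral {0..t} f) - (F s - integral {0..s} f) = F t - F s - integral {s..t} f"
        using integral_diff_indefinite[OF f that] by linarith
      then show ?thesis using le[OF that] integral_diff_indefinite[OF w that] by simp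
    qed
  qed (use t C in auto)
  note eq = this
  have "F t = F 0 + integral {0..t} f" if "t \<in> {0..T}" for t
    using eq[OF that] by simp
  then show ?thesis using f by (intro ac_onI)
qed

lemma continuous_times_abs_integrable:
  fixes f g :: "real \<Rightarrow> real"
  assumes "continuous_on {0..T} f" "g absolutely_integrable_on {0..T}"
  shows "(\<lambda>x. f x * g x) absolutely_integrable_on {0..T}"
proof (rule absolutely_integrable_bounded_measurable_product_real)
  show "f \<in> borel_measurable (lebesgue_on {0..T})"
    using assms(1) by (intro continuous_imp_measurable_on_sets_lebesgue) auto
  show "bounded (f ` {0..T})"
    using assms(1) by (intro compact_imp_bounded compact_continuous_image) auto
qed (use assms in auto)

text \<open>The cost of freezing a continuous factor at the left end point; what remains as main
  term is an exact increment of the primitive of \<open>f\<close>.\<close>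

lemma ac_on_weighted_increment:
  fixes f G g :: "real \<Rightarrow> real"
  assumes f: "f absolutely_integrable_on {0..T}" and G: "continuous_on {0..T} G"
    and st: "0 \<le> s" "s \<le> t" "t \<le> T"
    and B: "\<And>r. r \<in> {s..t} \<Longrightarrow> \<bar>G r - G s\<bar> \<le> B"
  shows "\<bar>integral {s..t} (\<lambda>r. G r * f r) - G s * integral {s..t} f\<bar> \<le> B * integral {s..t} (\<lambda>r. \<bar>f r\<bar>)"
proof -
  have 1: "(\<lambda>r. G r * f r) integrable_on {s..t}"
    by (rule abs_integrable_sub(2)[OF continuous_times_abs_integrable[OF G f] st(1,3)])
  have 2: "(\<lambda>r. G s * f r) integrable_on {s..t}"
    using abs_integrable_sub(2)[OF f st(1,3)] by (rule integrable_on_mult_right)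
  have "integral {s..t} (\<lambda>r. G r * f r) - G s * integral {s..t} f = integral {s..t} (\<lambda>r. G r * f r - G s * f r)"
    using 1 2 by (simp add: Henstock_Kurzweil_Integration.integral_diff)
  also have "norm \<dots> \<le> integral {s..t} (\<lambda>r. B * \<bar>f r\<bar>)"
  proof (rule Henstock_Kurzweil_Integration.integral_norm_bound_integral)
    show "(\<lambda>r. G r * f r - G s * f r) integrable_on {s..t}" using 1 2 by (rule integrable_diff)
    show "(\<lambda>r. B * \<bar>f r\<bar>) integrable_on {s..t}"
      using abs_integrable_sub(3)[OF f st(1,3)] by (rule integrable_on_mult_right)
    show "norm (G r * f r - G s * f r) \<le> B * \<bar>f r\<bar>" if "r \<in> {s..t}" for r
      using B[OF that] by (simp add: left_diff_distrib[symmetric] abs_mult mult_right_mono)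
  qed
  finally show ?thesis by simp
qed

text \<open>The increment of the product differs from the integral by three terms, each at most the
  integral of |f| times that of |g| over [s, t]; hence the constant 3 and a quadratic bound.\<close>

lemma ac_on_mult:
  assumes F: "ac_on T F f" and G: "ac_on T G g"
  shows "ac_on T (\<lambda>t. F t * G t) (\<lambda>t. G t * f t + F t * g t)"
proof (rule ac_onI_quadratic[where w = "\<lambda>t. \<bar>f t\<bar> + \<bar>g t\<bar>" and C = 3])
  note fi = ac_on_integrable[OF F] and gi = ac_on_integrable[OF G]
  have i1: "(\<lambda>t. G t * f t) absolutely_integrable_on {0..T}"
    by (rule continuous_times_abs_integrable[OF ac_on_continuous[OF G] fi])
  have i2: "(\<lambda>t. F t * g t) absolutely_integrable_on {0..T}"
    by (rule continuous_times_abs_integrable[OF ac_on_continuous[OF F] gi])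
  show "(\<lambda>t. G t * f t + F t * g t) absolutely_integrable_on {0..T}"
    using i1 i2 by (rule set_integral_add)
  show "(\<lambda>t. \<bar>f t\<bar> + \<bar>g t\<bar>) absolutely_integrable_on {0..T}"
    using fi gi by (intro set_integral_add set_integrable_abs)
  fix s t :: real assume st: "0 \<le> s" "s \<le> t" "t \<le> T"
  define a where "a = integral {s..t} (\<lambda>x. \<bar>f x\<bar>)"
  define b where "b = integral {s..t} (\<lambda>x. \<bar>g x\<bar>)"
  have ab: "integral {s..t} (\<lambda>t. \<bar>f t\<bar> + \<bar>g t\<bar>) = a + b"
    unfolding a_def b_def using abs_integrable_sub(3)[OF fi st(1,3)] abs_integrable_sub(3)[OF gi st(1,3)]
    by (rule Henstock_Kurzweil_Integration.integral_add)
  have a0: "0 \<le> a" "0 \<le> b" unfolding a_def b_def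
    using abs_integrable_sub(3)[OF fi st(1,3)] abs_integrable_sub(3)[OF gi st(1,3)]
    by (auto intro!: integral_nonneg)
  have mono: "integral {s..r} (\<lambda>x. \<bar>u x\<bar>) \<le> integral {s..t} (\<lambda>x. \<bar>u x\<bar>)"
    if "u absolutely_integrable_on {0..T}" "r \<in> {s..t}" for u :: "real \<Rightarrow> real" and r
    using that st by (intro integral_subset_le abs_integrable_sub(3)[OF that(1)]) auto
  have Gs: "\<bar>G r - G s\<bar> \<le> b" if "r \<in> {s..t}" for r
    using ac_on_abs_diff[OF G st(1), of r] mono[OF gi that] that st by (auto simp: b_def)
  have Fs: "\<bar>F r - F s\<bar> \<le> a" if "r \<in> {s..t}" for r
    using ac_on_abs_diff[OF F st(1), of r] mono[OF fi that] that st by (auto simp: a_def)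
  have I: "integral {s..t} (\<lambda>t. G t * f t + F t * g t) = integral {s..t} (\<lambda>t. G t * f t) + integral {s..t} (\<lambda>t. F t * g t)"
    using abs_integrable_sub(2)[OF i1 st(1,3)] abs_integrable_sub(2)[OF i2 st(1,3)]
    by (rule Henstock_Kurzweil_Integration.integral_add)
  have e1: "\<bar>integral {s..t} (\<lambda>t. G t * f t) - G s * (F t - F s)\<bar> \<le> b * a"
    using ac_on_weighted_increment[OF fi ac_on_continuous[OF G] st Gs] ac_on_diff[OF F st] by (simp add: a_def)
  have e2: "\<bar>integral {s..t} (\<lambda>t. F t * g t) - F s * (G t - G s)\<bar> \<le> a * b"
    using ac_on_weighted_increment[OF gi ac_on_continuous[OF F] st Fs] ac_on_diff[OF G st] by (simp add: b_def)
  have e3: "\<bar>(F t - F s) * (G t - G s)\<bar> \<le> a * b"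
    unfolding abs_mult using Fs[of t] Gs[of t] st a0 by (intro mult_mono) auto
  have "F t * G t - F s * G s = (F t - F s) * (G t - G s) + G s * (F t - F s) + F s * (G t - G s)"
    by (simp add: algebra_simps)
  with e1 e2 e3 I have "\<bar>F t * G t - F s * G s - integral {s..t} (\<lambda>t. G t * f t + F t * g t)\<bar> \<le> 3 * (a * b)"
    by (simp add: mult.commute)
  also have "3 * (a * b) \<le> 3 * (a + b)\<^sup>2"
    using a0 by (simp add: power2_eq_square algebra_simps)
  finally show "\<bar>F t * G t - F s * G s - integral {s..t} (\<lambda>t. G t * f t + F t * g t)\<bar>
      \<le> 3 * (integral {s..t} (\<lambda>t. \<bar>f t\<bar> + \<bar>g t\<bar>))\<^sup>2"
    by (simp add: ab)
qed auto

text \<open>The second derivative is bounded on the compact range of \<open>F\<close>, so both the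
  first-order Taylor expansion of \<Psi> and the freezing of its derivative at \<open>s\<close> err
  quadratically. Only nonnegative arguments matter because the inner function will be
  \<open>W\<close>, a multiple of |H|^2.\<close>

lemma ac_on_compose:
  fixes \<Psi> \<Psi>' \<Psi>'' :: "real \<Rightarrow> real"
  assumes F: "ac_on T F f" and F0: "\<And>t. 0 \<le> F t"
    and d1: "\<And>y. 0 \<le> y \<Longrightarrow> (\<Psi> has_real_derivative \<Psi>' y) (at y)"
    and d2: "\<And>y. 0 \<le> y \<Longrightarrow> (\<Psi>' has_real_derivative \<Psi>'' y) (at y)"
    and d3: "\<And>y. 0 \<le> y \<Longrightarrow> isCont \<Psi>'' y"
  shows "ac_on T (\<lambda>t. \<Psi> (F t)) (\<lambda>t. \<Psi>' (F t) * f t)"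
proof -
  note fi = ac_on_integrable[OF F] and Fc = ac_on_continuous[OF F]
  have "compact (F ` {0..T})" using Fc by (intro compact_continuous_image) auto
  then obtain B0 where B0: "\<forall>t\<in>{0..T}. \<bar>F t\<bar> \<le> B0"
    using compact_imp_bounded[of "F ` {0..T}"] by (auto simp: bounded_iff)
  define B where "B = max B0 0"
  have B: "F t \<le> B" if "t \<in> {0..T}" for t
    using bspec[OF B0 that] unfolding B_def by linarith
  have Bn: "0 \<le> B" by (simp add: B_def)
  have "compact (\<Psi>'' ` {0..B})"
    using d3 by (intro compact_continuous_image continuous_at_imp_continuous_on) auto
  then obtain L where L: "\<forall>y\<in>{0..B}. \<bar>\<Psi>'' y\<bar> \<le> L"
    using compact_imp_bounded[of "\<Psi>'' ` {0..B}"] by (auto simp: bounded_iff)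
  have "0 \<in> {0..B}" using Bn by simp
  with L have "\<bar>\<Psi>'' 0\<bar> \<le> L" by (rule bspec)
  then have L0: "0 \<le> L" by linarith
  have lip: "\<bar>\<Psi>' y - \<Psi>' z\<bar> \<le> L * \<bar>y - z\<bar>" if "y \<in> {0..B}" "z \<in> {0..B}" for y z
  proof -
    have "norm (\<Psi>' y - \<Psi>' z) \<le> L * norm (y - z)"
    proof (rule field_differentiable_bound[of "{0..B}" \<Psi>' \<Psi>''])
      show "(\<Psi>' has_field_derivative \<Psi>'' x) (at x within {0..B})" if "x \<in> {0..B}" for x
        by (rule has_field_derivative_at_within, rule d2) (use that in simp)
      show "norm (\<Psi>'' x) \<le> L" if "x \<in> {0..B}" for x
        using bspec[OF L that] by (simp only: real_norm_def)
    qed (use that in simp_all)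
    then show ?thesis by simp
  qed
  have quad: "\<bar>\<Psi> y - \<Psi> z - \<Psi>' z * (y - z)\<bar> \<le> L * \<bar>y - z\<bar> * \<bar>y - z\<bar>" if yz: "y \<in> {0..B}" "z \<in> {0..B}" for y z
  proof -
    define S where "S = closed_segment z y"
    have S: "S \<subseteq> {0..B}" unfolding S_def using yz by (intro closed_segment_subset) auto
    have "norm ((\<Psi> y - \<Psi>' z * y) - (\<Psi> z - \<Psi>' z * z)) \<le> (L * \<bar>y - z\<bar>) * norm (y - z)"
    proof (rule field_differentiable_bound[of S "\<lambda>y. \<Psi> y - \<Psi>' z * y" "\<lambda>y. \<Psi>' y - \<Psi>' z"])
      fix x assume x: "x \<in> S"
      show "((\<lambda>y. \<Psi> y - \<Psi>' z * y) has_field_derivative \<Psi>' x - \<Psi>' z) (at x within S)"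
      proof (rule has_field_derivative_at_within)
        have "0 \<le> x" using x S by auto
        from d1[OF this] show "((\<lambda>y. \<Psi> y - \<Psi>' z * y) has_field_derivative \<Psi>' x - \<Psi>' z) (at x)"
          by (auto intro!: derivative_eq_intros)
      qed
      have "\<bar>x - z\<bar> \<le> \<bar>y - z\<bar>"
        using x unfolding S_def closed_segment_eq_real_ivl by (auto split: if_splits)
      then have "L * \<bar>x - z\<bar> \<le> L * \<bar>y - z\<bar>" using L0 by (rule mult_left_mono)
      then show "norm (\<Psi>' x - \<Psi>' z) \<le> L * \<bar>y - z\<bar>" using lip[of x z] x S yz by auto
    qed (auto simp: S_def)
    then show ?thesis by (simp add: algebra_simps)
  qed
  have Pc: "continuous_on {0..T} (\<lambda>t. \<Psi>' (F t))"
  proof (rule continuous_on_compose2[OF _ Fc])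
    show "continuous_on {0..} \<Psi>'"
      using d2 by (intro continuous_at_imp_continuous_on) (auto intro: DERIV_isCont)
  qed (use F0 in auto)
  show ?thesis
  proof (rule ac_onI_quadratic[where w = "\<lambda>t. \<bar>f t\<bar>" and C = "2 * L"])
    show "(\<lambda>t. \<Psi>' (F t) * f t) absolutely_integrable_on {0..T}"
      by (rule continuous_times_abs_integrable[OF Pc fi])
    show "(\<lambda>t. \<bar>f t\<bar>) absolutely_integrable_on {0..T}" using fi by (rule set_integrable_abs)
    fix s t :: real assume st: "0 \<le> s" "s \<le> t" "t \<le> T"
    define a where "a = integral {s..t} (\<lambda>x. \<bar>f x\<bar>)"
    have a0: "0 \<le> a" unfolding a_def using abs_integrable_sub(3)[OF fi st(1,3)] by (intro integral_nonneg) auto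
    have FB: "F r \<in> {0..B}" if "r \<in> {s..t}" for r using that st B[of r] F0[of r] by auto
    have Fs: "\<bar>F r - F s\<bar> \<le> a" if "r \<in> {s..t}" for r
    proof -
      have "integral {s..r} (\<lambda>x. \<bar>f x\<bar>) \<le> a" unfolding a_def
        using that st by (intro integral_subset_le abs_integrable_sub(3)[OF fi]) auto
      then show ?thesis using ac_on_abs_diff[OF F st(1), of r] that st by auto
    qed
    have PB: "\<bar>\<Psi>' (F r) - \<Psi>' (F s)\<bar> \<le> L * a" if "r \<in> {s..t}" for r
    proof -
      have "L * \<bar>F r - F s\<bar> \<le> L * a" using Fs[OF that] L0 by (rule mult_left_mono)
      then show ?thesis using lip[OF FB[OF that] FB[of s]] st by auto
    qed
    have e1: "\<bar>integral {s..t} (\<lambda>r. \<Psi>' (F r) * f r) - \<Psi>' (F s) * (F t - F s)\<bar> \<le> L * a * a"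
      using ac_on_weighted_increment[OF fi Pc st PB] ac_on_diff[OF F st] by (simp add: a_def)
    have "L * \<bar>F t - F s\<bar> * \<bar>F t - F s\<bar> \<le> L * a * a"
      using Fs[of t] st L0 a0 by (intro mult_mono) auto
    then have e2: "\<bar>\<Psi> (F t) - \<Psi> (F s) - \<Psi>' (F s) * (F t - F s)\<bar> \<le> L * a * a"
      using quad[OF FB[of t] FB[of s]] st by auto
    have "\<bar>\<Psi> (F t) - \<Psi> (F s) - integral {s..t} (\<lambda>r. \<Psi>' (F r) * f r)\<bar> \<le> 2 * (L * a * a)"
      using e1 e2 by linarith
    then show "\<bar>\<Psi> (F t) - \<Psi> (F s) - integral {s..t} (\<lambda>r. \<Psi>' (F r) * f r)\<bar>
        \<le> 2 * L * (integral {s..t} (\<lambda>t. \<bar>f t\<bar>))\<^sup>2"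
      by (simp add: a_def power2_eq_square mult.assoc)
  qed (use L0 in auto)
qed

lemma ac_on_const: "ac_on T (\<lambda>t. c) (\<lambda>t. 0)"
  by (simp add: ac_on_def)

lemma ac_on_add:
  assumes F: "ac_on T F f" and G: "ac_on T G g"
  shows "ac_on T (\<lambda>t. F t + G t) (\<lambda>t. f t + g t)"
proof -
  note fi = ac_on_integrable[OF F] and gi = ac_on_integrable[OF G]
  have "(F t + G t) = (F 0 + G 0) + integral {0..t} (\<lambda>t. f t + g t)" if t: "t \<in> {0..T}" for t
  proof -
    have "integral {0..t} (\<lambda>t. f t + g t) = integral {0..t} f + integral {0..t} g"
      using t abs_integrable_sub(2)[OF fi, of 0 t] abs_integrable_sub(2)[OF gi, of 0 t]
      by (intro Henstock_Kurzweil_Integration.integral_add) auto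
    moreover have "F t = F 0 + integral {0..t} f" "G t = G 0 + integral {0..t} g"
      using ac_on_eq[OF F t] ac_on_eq[OF G t] .
    ultimately show ?thesis by linarith
  qed
  then show ?thesis using set_integral_add(1)[OF fi gi] by (intro ac_onI)
qed

lemma ac_on_sum:
  assumes "\<And>i. i \<in> A \<Longrightarrow> ac_on T (F i) (f i)"
  shows "ac_on T (\<lambda>t. \<Sum>i\<in>A. F i t) (\<lambda>t. \<Sum>i\<in>A. f i t)"
  using assms by (induction A rule: infinite_finite_induct) (auto intro: ac_on_const ac_on_add)

lemma ac_on_cmult:
  assumes F: "ac_on T F f" shows "ac_on T (\<lambda>t. c * F t) (\<lambda>t. c * f t)"
  using ac_on_mult[OF ac_on_const[of T c] F] by simp

lemma ac_on_C1:
  assumes d: "\<And>t. (F has_real_derivative f t) (at t)" and c: "continuous_on {0..T} f"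
  shows "ac_on T F f"
proof -
  have "F t = F 0 + integral {0..t} f" if "t \<in> {0..T}" for t
  proof -
    have "(f has_integral F t - F 0) {0..t}"
      using that d by (intro fundamental_theorem_of_calculus)
        (auto simp: has_real_derivative_iff_has_vector_derivative[symmetric] intro: has_field_derivative_at_within)
    then show ?thesis by (simp add: integral_unique)
  qed
  moreover have "f absolutely_integrable_on {0..T}"
    using c by (rule absolutely_integrable_continuous_real)
  ultimately show ?thesis by (intro ac_onI)
qed

lemma ac_on_indefinite:
  assumes "f absolutely_integrable_on {0..T}"
  shows "ac_on T (\<lambda>t. c + integral {0..t} f) f"
  using assms by (simp add: ac_on_def)

section \<open>Smooth bump functions and test functions\<close>

lemma poly_times_exp_minus_tendsto_0:
  fixes p :: "real poly"
  shows "((\<lambda>y. poly p y * exp (- y)) \<longlongrightarrow> 0) at_top"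
proof -
  have "((\<lambda>y. \<Sum>i\<le>degree p. coeff p i * (y ^ i / exp y)) \<longlongrightarrow> 0) at_top"
    by (intro tendsto_null_sum tendsto_mult_right_zero tendsto_power_div_exp_0)
  moreover have "(\<lambda>y. \<Sum>i\<le>degree p. coeff p i * (y ^ i / exp y)) = (\<lambda>y. poly p y * exp (- y))"
    by (auto simp: poly_altdef exp_minus divide_inverse sum_distrib_right mult.assoc)
  ultimately show ?thesis by simp
qed

text \<open>Polynomials in 1/x times the flat function exp(-1/x): a family stable under
  differentiation, also at the origin.\<close>

definition efun :: "real poly \<Rightarrow> real \<Rightarrow> real" where
  "efun p x = (if 0 < x then poly p (1 / x) * exp (- (1 / x)) else 0)"

text \<open>With y = 1/x the polynomial contributes -y^2 p'(y) and the exponential y^2 p(y), hence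
  the factor \<open>[:0, 0, 1:]\<close>. At 0 the difference quotient vanishes in the limit because
  exp(-y) beats every power of y.\<close>

lemma efun_deriv:
  "(efun p has_real_derivative efun ([:0, 0, 1:] * (p - pderiv p)) x) (at x)"
proof -
  consider "x < 0" | "x = 0" | "0 < x" by linarith
  then show ?thesis
  proof cases
    case 1
    have "((\<lambda>x. 0) has_real_derivative 0) (at x)" by simp
    then have "(efun p has_real_derivative 0) (at x)"
      by (rule has_field_derivative_transform_within_open[where S = "{..<0}"]) (use 1 in \<open>auto simp: efun_def\<close>)
    then show ?thesis using 1 by (simp add: efun_def)
  next
    case 2
    have right: "((\<lambda>h. efun p h / h) \<longlongrightarrow> 0) (at_right 0)"
      unfolding filterlim_at_right_to_top
    proof (rule Lim_transform_eventually[OF poly_times_exp_minus_tendsto_0[of "pCons 0 p"]])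
      show "\<forall>\<^sub>F y in at_top. poly (pCons 0 p) y * exp (- y) = efun p (inverse y) / inverse y"
        using eventually_gt_at_top[of 0] by eventually_elim (simp add: efun_def field_simps)
    qed
    have "((\<lambda>h. 0) \<longlongrightarrow> (0::real)) (at_left 0)" by simp
    then have left: "((\<lambda>h. efun p h / h) \<longlongrightarrow> 0) (at_left 0)"
    proof (rule Lim_transform_eventually)
      show "\<forall>\<^sub>F h in at_left 0. 0 = efun p h / h"
        by (auto simp: eventually_at_filter efun_def)
    qed
    have "((\<lambda>h. efun p h / h) \<longlongrightarrow> 0) (at 0)" using left right by (rule filterlim_split_at)
    then show ?thesis using 2 by (simp add: DERIV_def efun_def)
  next
    case 3
    have d: "((\<lambda>x. 1 / x) has_real_derivative - (1 / x\<^sup>2)) (at x)"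
      using 3 by (auto intro!: derivative_eq_intros simp: power2_eq_square)
    have d1: "((\<lambda>x. poly p (1 / x)) has_real_derivative poly (pderiv p) (1 / x) * - (1 / x\<^sup>2)) (at x)"
      by (rule DERIV_chain2[OF poly_DERIV d])
    have d2: "((\<lambda>x. exp (- (1 / x))) has_real_derivative exp (- (1 / x)) * - (- (1 / x\<^sup>2))) (at x)"
      by (rule DERIV_chain2[OF DERIV_exp DERIV_minus[OF d]])
    have "(efun p has_real_derivative poly (pderiv p) (1 / x) * - (1 / x\<^sup>2) * exp (- (1 / x))
        + exp (- (1 / x)) * - (- (1 / x\<^sup>2)) * poly p (1 / x)) (at x)"
      by (rule has_field_derivative_transform_within_open[OF DERIV_mult[OF d1 d2], where S = "{0<..}"])
         (use 3 in \<open>auto simp: efun_def\<close>)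
    also have "poly (pderiv p) (1 / x) * - (1 / x\<^sup>2) * exp (- (1 / x))
        + exp (- (1 / x)) * - (- (1 / x\<^sup>2)) * poly p (1 / x) = efun ([:0, 0, 1:] * (p - pderiv p)) x"
      using 3 by (simp add: efun_def power2_eq_square field_simps)
    finally show ?thesis .
  qed
qed

text \<open>Every member has a derivative that is again a member, which gives smoothness by
  iteration. Constants, sums and products provide the powers in \<open>bump\<close>.\<close>

inductive bump_alg :: "real \<Rightarrow> real \<Rightarrow> (real \<Rightarrow> real) \<Rightarrow> bool" for a b where
  left: "bump_alg a b (\<lambda>x. efun p (x - a))"
| right: "bump_alg a b (\<lambda>x. efun p (b - x))"
| const: "bump_alg a b (\<lambda>x. c)"
| add: "bump_alg a b f \<Longrightarrow> bump_alg a b g \<Longrightarrow> bump_alg a b (\<lambda>x. f x + g x)"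
| mult: "bump_alg a b f \<Longrightarrow> bump_alg a b g \<Longrightarrow> bump_alg a b (\<lambda>x. f x * g x)"

lemma bump_alg_deriv:
  assumes "bump_alg a b f"
  shows "\<exists>f'. bump_alg a b f' \<and> (\<forall>x. (f has_real_derivative f' x) (at x))"
  using assms
proof induction
  case (left p)
  have "((\<lambda>x. efun p (x - a)) has_real_derivative efun ([:0, 0, 1:] * (p - pderiv p)) (x - a)) (at x)" for x
  proof -
    have d: "((\<lambda>x. x - a) has_real_derivative 1) (at x)" by (auto intro!: derivative_eq_intros)
    show ?thesis using DERIV_chain2[OF efun_deriv d] by simp
  qed
  then show ?case using bump_alg.left by blast
next
  case (right p)
  have "((\<lambda>x. efun p (b - x)) has_real_derivative - 1 * efun ([:0, 0, 1:] * (p - pderiv p)) (b - x)) (at x)" for x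
  proof -
    have d: "((\<lambda>x. b - x) has_real_derivative - 1) (at x)" by (auto intro!: derivative_eq_intros)
    show ?thesis using DERIV_chain2[OF efun_deriv d] by simp
  qed
  then show ?case using bump_alg.mult[OF bump_alg.const[of a b "-1"] bump_alg.right] by blast
next
  case (const c)
  show ?case using bump_alg.const[of a b 0] by auto
next
  case (add f g)
  then obtain f' g' where f': "bump_alg a b f'" "\<And>x. (f has_real_derivative f' x) (at x)"
    and g': "bump_alg a b g'" "\<And>x. (g has_real_derivative g' x) (at x)" by blast
  have "((\<lambda>x. f x + g x) has_real_derivative f' x + g' x) (at x)" for x
    using f'(2) g'(2) by (rule DERIV_add)
  then show ?case using bump_alg.add[OF f'(1) g'(1)] by blast
next
  case (mult f g)
  then obtain f' g' where f': "bump_alg a b f'" "\<And>x. (f has_real_derivative f' x) (at x)"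
    and g': "bump_alg a b g'" "\<And>x. (g has_real_derivative g' x) (at x)" by blast
  have "((\<lambda>x. f x * g x) has_real_derivative f' x * g x + g' x * f x) (at x)" for x
    using f'(2) g'(2) by (rule DERIV_mult)
  then show ?case
    using bump_alg.add[OF bump_alg.mult[OF f'(1) mult.hyps(2)] bump_alg.mult[OF g'(1) mult.hyps(1)]] by blast
qed

text \<open>A sequence of explicit derivatives can be combined term by term, which is awkward for
  iterated \<open>deriv\<close>.\<close>

lemma smooth_iff:
  "smooth f \<longleftrightarrow> (\<exists>F. F 0 = f \<and> (\<forall>k x. (F k has_real_derivative F (Suc k) x) (at x)))"
proof
  assume "smooth f"
  then have "((deriv ^^ k) f has_real_derivative (deriv ^^ Suc k) f x) (at x)" for k x
    by (simp add: smooth_def DERIV_deriv_iff_field_differentiable)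
  then show "\<exists>F. F 0 = f \<and> (\<forall>k x. (F k has_real_derivative F (Suc k) x) (at x))"
    by (intro exI[of _ "\<lambda>k. (deriv ^^ k) f"]) simp
next
  assume "\<exists>F. F 0 = f \<and> (\<forall>k x. (F k has_real_derivative F (Suc k) x) (at x))"
  then obtain F where F: "F 0 = f" "\<And>k x. (F k has_real_derivative F (Suc k) x) (at x)" by blast
  have "(deriv ^^ k) f = F k" for k
  proof (induction k)
    case (Suc k)
    then show ?case using DERIV_imp_deriv[OF F(2), of k] by auto
  qed (simp add: F)
  then show "smooth f"
    unfolding smooth_def using F(2) by (auto simp: field_differentiable_def)
qed

lemma bump_alg_smooth:
  assumes "bump_alg a b f" shows "smooth f"
proof -
  obtain D where D: "\<And>f. bump_alg a b f \<Longrightarrow> bump_alg a b (D f)"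
    "\<And>f x. bump_alg a b f \<Longrightarrow> (f has_real_derivative D f x) (at x)"
    using bump_alg_deriv by metis
  have "bump_alg a b ((D ^^ k) f)" for k by (induction k) (auto intro: assms D)
  then show ?thesis unfolding smooth_iff using D(2)
    by (intro exI[of _ "\<lambda>k. (D ^^ k) f"]) auto
qed

text \<open>Test functions that increase to the indicator of the open interval from \<open>a\<close> to \<open>b\<close> as
  \<open>n\<close> grows.\<close>

definition bump :: "real \<Rightarrow> real \<Rightarrow> nat \<Rightarrow> real \<Rightarrow> real" where
  "bump a b n x = 1 - (1 - efun 1 (x - a) * efun 1 (b - x)) ^ n"

lemma efun_1_bounds: "0 \<le> efun 1 x" "efun 1 x \<le> 1" "0 < x \<Longrightarrow> 0 < efun 1 x" "x \<le> 0 \<Longrightarrow> efun 1 x = 0"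
  by (auto simp: efun_def)

lemma efun_prod_bounds:
  "0 \<le> efun 1 (x - a) * efun 1 (b - x)" "efun 1 (x - a) * efun 1 (b - x) \<le> 1"
  using efun_1_bounds by (auto intro!: mult_le_one)

lemma bump_bounds: "0 \<le> bump a b n x" "bump a b n x \<le> 1"
  using efun_prod_bounds[where x = x and a = a and b = b] by (auto simp: bump_def intro!: power_le_one)

lemma bump_outside: "x \<notin> {a<..<b} \<Longrightarrow> bump a b n x = 0"
  using efun_1_bounds(4)[of "x - a"] efun_1_bounds(4)[of "b - x"] by (auto simp: bump_def)

lemma bump_tendsto: "(\<lambda>n. bump a b n x) \<longlonglongrightarrow> indicator {a<..<b} x"
proof (cases "x \<in> {a<..<b}")
  case True
  then have "0 < efun 1 (x - a) * efun 1 (b - x)" using efun_1_bounds(3) by simp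
  then have "(\<lambda>n. (1 - efun 1 (x - a) * efun 1 (b - x)) ^ n) \<longlonglongrightarrow> 0"
    using efun_prod_bounds(2)[where x = x and a = a and b = b] by (intro LIMSEQ_power_zero) auto
  from tendsto_diff[OF tendsto_const[of 1] this] show ?thesis using True by (simp add: bump_def)
qed (simp add: bump_outside)

lemma test_function_bump:
  assumes "{a..b} \<subseteq> S" shows "test_function S (bump a b n)"
proof -
  have 1: "bump_alg a b (\<lambda>x. 1 + -1 * (efun 1 (x - a) * efun 1 (b - x)))"
    by (intro bump_alg.add bump_alg.mult bump_alg.const bump_alg.left bump_alg.right)
  have "bump_alg a b (\<lambda>x. (1 + -1 * (efun 1 (x - a) * efun 1 (b - x))) ^ n)"
  proof (induction n)
    case (Suc n)
    from bump_alg.mult[OF 1 this] show ?case by simp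
  qed (simp add: bump_alg.const)
  then have "bump_alg a b (\<lambda>x. 1 + -1 * (1 + -1 * (efun 1 (x - a) * efun 1 (b - x))) ^ n)"
    by (intro bump_alg.add bump_alg.mult bump_alg.const)
  then have "bump_alg a b (bump a b n)" by (simp add: bump_def[abs_def])
  then have "smooth (bump a b n)" by (rule bump_alg_smooth)
  moreover have "\<forall>x. x \<notin> {a..b} \<longrightarrow> bump a b n x = 0" by (auto intro!: bump_outside)
  ultimately show ?thesis unfolding test_function_def using assms by (intro conjI exI[of _ "{a..b}"]) auto
qed

lemma smooth_continuous: "smooth f \<Longrightarrow> continuous_on A f"
  unfolding smooth_iff by (auto intro!: continuous_at_imp_continuous_on intro: DERIV_isCont)

lemma smooth_deriv:
  assumes "smooth f" shows "smooth ((deriv ^^ k) f)"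
proof -
  have "(deriv ^^ j) ((deriv ^^ k) f) = (deriv ^^ (j + k)) f" for j by (simp add: funpow_add)
  then show ?thesis using assms by (auto simp: smooth_def)
qed

lemma test_function_deriv:
  assumes "test_function S \<phi>" shows "test_function S ((deriv ^^ k) \<phi>)"
proof -
  obtain K where K: "compact K" "K \<subseteq> S" "\<And>x. x \<notin> K \<Longrightarrow> \<phi> x = 0"
    using assms by (auto simp: test_function_def)
  have "(deriv ^^ k) \<phi> x = 0" if "x \<notin> K" for x
    using that
  proof (induction k arbitrary: x)
    case (Suc k)
    have "((\<lambda>x. 0) has_real_derivative 0) (at x)" by simp
    then have "((deriv ^^ k) \<phi> has_real_derivative 0) (at x)"
      by (rule has_field_derivative_transform_within_open[where S = "- K"])
         (use Suc K(1) in \<open>auto intro: compact_imp_closed open_Compl\<close>)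
    then show ?case by (simp add: DERIV_imp_deriv)
  qed (simp add: K)
  then show ?thesis using assms K by (auto simp: test_function_def smooth_deriv)
qed

lemma test_function_continuous: "test_function S \<phi> \<Longrightarrow> continuous_on A \<phi>"
  by (simp add: test_function_def smooth_continuous)

lemma test_function_DERIV: "test_function S \<phi> \<Longrightarrow> (\<phi> has_real_derivative deriv \<phi> x) (at x)"
proof -
  assume "test_function S \<phi>"
  then have "((deriv ^^ 0) \<phi>) field_differentiable (at x)"
    unfolding test_function_def smooth_def by blast
  then show ?thesis by (simp add: DERIV_deriv_iff_field_differentiable)
qed

lemma test_function_support:
  assumes "test_function {0<..<T} \<phi>" "0 < T"
  obtains a b where "0 < a" "a < b" "b < T" "\<And>x. x \<notin> {a..b} \<Longrightarrow> \<phi> x = 0"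
proof -
  obtain K where K: "compact K" "K \<subseteq> {0<..<T}" "\<And>x. x \<notin> K \<Longrightarrow> \<phi> x = 0"
    using assms by (auto simp: test_function_def)
  show ?thesis
  proof (cases "K = {}")
    case True
    then show ?thesis using K that[of "T / 3" "T / 2"] assms by auto
  next
    case False
    obtain a where a: "a \<in> K" "\<And>x. x \<in> K \<Longrightarrow> a \<le> x" using compact_attains_inf[OF K(1) False] by blast
    obtain b where b: "b \<in> K" "\<And>x. x \<in> K \<Longrightarrow> x \<le> b" using compact_attains_sup[OF K(1) False] by blast
    have ab: "0 < a" "a \<le> b" "b < T" using a b K(2) by auto
    show ?thesis
    \<comment> \<open>The right end is moved halfway to \<open>T\<close> so that the interval is
      nondegenerate even if \<open>K\<close> is a single point.\<close>
    proof (rule that[of a "(b + T) / 2"])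
      fix x assume "x \<notin> {a..(b + T) / 2}"
      then have "x \<notin> K" using a(2)[of x] b(2)[of x] ab by auto
      then show "\<phi> x = 0" by (rule K)
    qed (use ab in auto)
  qed
qed

lemma test_function_lincomb:
  assumes "test_function S \<phi>" "test_function S \<psi>"
  shows "test_function S (\<lambda>x. \<phi> x + c * \<psi> x)"
proof -
  obtain F where F: "F 0 = \<phi>" "\<And>k x. (F k has_real_derivative F (Suc k) x) (at x)"
    using assms(1) by (auto simp: test_function_def smooth_iff)
  obtain G where G: "G 0 = \<psi>" "\<And>k x. (G k has_real_derivative G (Suc k) x) (at x)"
    using assms(2) by (auto simp: test_function_def smooth_iff)
  have "((\<lambda>x. F k x + c * G k x) has_real_derivative F (Suc k) x + c * G (Suc k) x) (at x)" for k x
    by (intro DERIV_add DERIV_cmult F G)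
  then have "smooth (\<lambda>x. \<phi> x + c * \<psi> x)"
    unfolding smooth_iff using F(1) G(1) by (intro exI[of _ "\<lambda>k x. F k x + c * G k x"]) auto
  moreover obtain K where "compact K" "K \<subseteq> S" "\<And>x. x \<notin> K \<Longrightarrow> \<phi> x = 0"
    using assms by (auto simp: test_function_def)
  moreover obtain L where "compact L" "L \<subseteq> S" "\<And>x. x \<notin> L \<Longrightarrow> \<psi> x = 0"
    using assms by (auto simp: test_function_def)
  ultimately show ?thesis unfolding test_function_def
    by (intro conjI exI[of _ "K \<union> L"]) auto
qed

text \<open>The vanishing mean brings the primitive back to 0 on the right of the support, so that
  it is compactly supported again.\<close>

lemma test_function_primitive:
  assumes \<zeta>: "test_function {0<..<T} \<zeta>" and T: "0 < T" and zero: "integral {0..T} \<zeta> = 0"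
  obtains \<phi> where "test_function {0<..<T} \<phi>" "deriv \<phi> = \<zeta>"
proof -
  obtain a b where ab: "0 < a" "a < b" "b < T" "\<And>x. x \<notin> {a..b} \<Longrightarrow> \<zeta> x = 0"
    using test_function_support[OF \<zeta> T] by metis
  define \<phi> where "\<phi> x = integral {0..x} \<zeta>" for x
  have ci: "\<zeta> integrable_on {c..d}" for c d
    by (intro integrable_continuous_real test_function_continuous[OF \<zeta>])
  have small: "\<phi> x = 0" if "x < a" for x
  proof -
    have "(\<zeta> has_integral 0) {0..x}"
      by (rule has_integral_is_0) (use that ab in auto)
    then show ?thesis by (simp add: \<phi>_def integral_unique)
  qed
  have large: "\<phi> x = 0" if "b < x" for x
  proof -
    have z: "integral {b..y} \<zeta> = 0" for y
    proof -
      have "(\<zeta> has_integral 0) {b<..<y}"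
        by (rule has_integral_is_0) (use ab in auto)
      then show ?thesis by (metis integral_open_interval_real integral_unique)
    qed
    have "integral {0..b} \<zeta> + integral {b..T} \<zeta> = integral {0..T} \<zeta>"
      using ab ci by (intro Henstock_Kurzweil_Integration.integral_combine) auto
    moreover have "integral {0..b} \<zeta> + integral {b..x} \<zeta> = integral {0..x} \<zeta>"
      using ab that ci by (intro Henstock_Kurzweil_Integration.integral_combine) auto
    ultimately show ?thesis using z zero by (simp add: \<phi>_def)
  qed
  have d: "(\<phi> has_real_derivative \<zeta> x) (at x)" for x
  proof (cases "x < a")
    case True
    have "((\<lambda>x. 0) has_real_derivative 0) (at x)" by simp
    then have "(\<phi> has_real_derivative 0) (at x)"
      by (rule has_field_derivative_transform_within_open[where S = "{..<a}"]) (use True small in auto)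
    then show ?thesis using ab(4)[of x] True by simp
  next
    case False
    then have x: "0 < x" using ab by simp
    have "(\<phi> has_real_derivative \<zeta> x) (at x within {0..x + 1})"
      unfolding \<phi>_def[abs_def]
      by (rule integral_has_real_derivative) (use x test_function_continuous[OF \<zeta>] in auto)
    moreover have "at x within {0..x + 1} = at x"
      using x by (intro at_within_interior) (simp add: interior_atLeastAtMost_real)
    ultimately show ?thesis by simp
  qed
  obtain F where F: "F 0 = \<zeta>" "\<And>k x. (F k has_real_derivative F (Suc k) x) (at x)"
    using \<zeta> by (auto simp: test_function_def smooth_iff)
  have "smooth \<phi>" unfolding smooth_iff
  proof (intro exI[of _ "\<lambda>k. case k of 0 \<Rightarrow> \<phi> | Suc j \<Rightarrow> F j"] conjI allI)
    fix k x
    show "((case k of 0 \<Rightarrow> \<phi> | Suc j \<Rightarrow> F j) has_real_derivative (case Suc k of 0 \<Rightarrow> \<phi> | Suc j \<Rightarrow> F j) x) (at x)"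
      using d F by (cases k) auto
  qed simp
  moreover have "\<phi> x = 0" if "x \<notin> {a..b}" for x
    using small[of x] large[of x] that by auto
  ultimately have "test_function {0<..<T} \<phi>"
    unfolding test_function_def using ab by (intro conjI exI[of _ "{a..b}"]) auto
  moreover have "deriv \<phi> = \<zeta>" using DERIV_imp_deriv[OF d] by auto
  ultimately show ?thesis by (rule that)
qed

text \<open>Passage from Lebesgue measurable functions on the open interval to a Borel function on
  the line, where uniqueness results for \<open>lborel\<close> apply; test functions supported in
  [a, b] do not notice the change.\<close>

lemma locally_integrable_borel_version:
  assumes f: "locally_integrable {0<..<T} f" and ab: "0 < a" "b < T"
  obtains F where "integrable lborel F" "AE x in lborel. x \<in> {a..b} \<longrightarrow> f x = F x"
    "\<And>x. x \<notin> {a..b} \<Longrightarrow> F x = 0"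
    "\<And>\<psi>. \<psi> \<in> borel_measurable borel \<Longrightarrow> (\<And>x. x \<notin> {a..b} \<Longrightarrow> \<psi> x = 0) \<Longrightarrow>
       (\<integral>x. f x * \<psi> x \<partial>ivl T) = (\<integral>x. F x * \<psi> x \<partial>lborel)"
proof -
  let ?K = "{a..b}"
  have "compact ?K \<and> ?K \<subseteq> {0<..<T}" using ab by auto
  then have "integrable (lebesgue_on ?K) f" using f unfolding locally_integrable_def by blast
  then have i: "integrable lebesgue (\<lambda>x. indicator ?K x * f x)"
    by (subst (asm) integrable_restrict_space) auto
  obtain F1 where F1: "F1 \<in> borel_measurable lborel" "AE x in lborel. indicator ?K x * f x = F1 x"
    using completion_ex_borel_measurable_real[OF borel_measurable_integrable[OF i]] by auto
  define F where "F x = indicator ?K x * F1 x" for x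
  have Fm[measurable]: "F \<in> borel_measurable borel" using F1(1) unfolding F_def by simp
  have e: "AE x in lborel. indicator ?K x * f x = F x"
    using F1(2)
  proof eventually_elim
    case (elim x)
    then show ?case by (cases "x \<in> ?K") (auto simp: F_def)
  qed
  have "integrable lebesgue F"
    by (rule integrable_cong_AE_imp[OF i]) (auto intro: measurable_completion AE_completion[OF e])
  then have Fi: "integrable lborel F" by (subst (asm) integrable_completion) auto
  show ?thesis
  proof (rule that[OF Fi])
    show "AE x in lborel. x \<in> ?K \<longrightarrow> f x = F x" using e by eventually_elim auto
    show "F x = 0" if "x \<notin> ?K" for x using that by (simp add: F_def)
    fix \<psi> :: "real \<Rightarrow> real" assume \<psi>: "\<psi> \<in> borel_measurable borel" "\<And>x. x \<notin> ?K \<Longrightarrow> \<psi> x = 0"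
    have \<psi>m: "\<psi> \<in> borel_measurable lebesgue" using \<psi>(1) by (intro measurable_completion) simp
    have Fl: "F \<in> borel_measurable lebesgue" by (intro measurable_completion) simp
    have "(\<integral>x. f x * \<psi> x \<partial>ivl T) = (\<integral>x. indicator {0<..<T} x *\<^sub>R (f x * \<psi> x) \<partial>lebesgue)"
      by (rule integral_restrict_space) simp
    also have "\<dots> = (\<integral>x. (indicator ?K x * f x) * \<psi> x \<partial>lebesgue)"
      using \<psi>(2) ab by (intro Bochner_Integration.integral_cong refl) (auto simp: indicator_def)
    also have "\<dots> = (\<integral>x. F x * \<psi> x \<partial>lebesgue)"
    proof (rule integral_cong_AE)
      show "AE x in lebesgue. indicator ?K x * f x * \<psi> x = F x * \<psi> x"
        using AE_completion[OF e] by eventually_elim simp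
      show "(\<lambda>x. indicator ?K x * f x * \<psi> x) \<in> borel_measurable lebesgue"
        using borel_measurable_times[OF borel_measurable_integrable[OF i] \<psi>m] .
      show "(\<lambda>x. F x * \<psi> x) \<in> borel_measurable lebesgue"
        using borel_measurable_times[OF Fl \<psi>m] .
    qed
    also have "\<dots> = (\<integral>x. F x * \<psi> x \<partial>lborel)"
      using \<psi>(1) by (intro integral_completion) simp
    finally show "(\<integral>x. f x * \<psi> x \<partial>ivl T) = (\<integral>x. F x * \<psi> x \<partial>lborel)" .
  qed
qed

text \<open>The intervals [T/(n+2), T - T/(n+2)] exhaust (0, T), and a countable union of null sets
  is null.\<close>

lemma AE_ivl_exhaust:
  fixes P :: "real \<Rightarrow> bool"
  assumes T: "0 < T" and P: "\<And>a b::real. 0 < a \<Longrightarrow> b < T \<Longrightarrow> AE x in lborel. x \<in> {a..b} \<longrightarrow> P x"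
  shows "AE x in ivl T. P x"
proof -
  have "AE x in lborel. \<forall>n::nat. x \<in> {T / (real n + 2)..T - T / (real n + 2)} \<longrightarrow> P x"
    unfolding AE_all_countable using T by (intro allI P) auto
  then have "AE x in lborel. x \<in> {0<..<T} \<longrightarrow> P x"
  proof eventually_elim
    case (elim x)
    show ?case
    proof
      assume x: "x \<in> {0<..<T}"
      obtain n :: nat where n: "T / x + T / (T - x) < real n" using reals_Archimedean2 by blast
      have p: "0 < T / x" "0 < T / (T - x)" using x T by auto
      have "T / x \<le> real n + 2" "T / (T - x) \<le> real n + 2" using n p by linarith+
      then have "T \<le> (real n + 2) * x" "T \<le> (real n + 2) * (T - x)" using x by (auto simp: pos_divide_le_eq)
      then have "T / (real n + 2) \<le> x" "T / (real n + 2) \<le> T - x" by (auto simp: pos_divide_le_eq mult.commute)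
      then show "P x" using elim[rule_format, of n] by auto
    qed
  qed
  then have "AE x in lebesgue. x \<in> {0<..<T} \<longrightarrow> P x" by (rule AE_completion)
  then show ?thesis by (subst AE_restrict_space_iff) auto
qed

text \<open>The fundamental lemma of the calculus of variations. Bumps tend boundedly to the
  indicator of an interval inside [a, b], so all interval integrals of the Borel version
  vanish.\<close>

lemma AE_eq_0_if_test_integrals_0:
  assumes f: "locally_integrable {0<..<T} f" and T: "0 < T"
    and zero: "\<And>\<phi>. test_function {0<..<T} \<phi> \<Longrightarrow> (\<integral>x. f x * \<phi> x \<partial>ivl T) = 0"
  shows "AE x in ivl T. f x = 0"
proof (rule AE_ivl_exhaust[OF T])
  fix a b :: real assume ab: "0 < a" "b < T"
  obtain F where F: "integrable lborel F" "AE x in lborel. x \<in> {a..b} \<longrightarrow> f x = F x"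
    "\<And>x. x \<notin> {a..b} \<Longrightarrow> F x = 0"
    "\<And>\<psi>. \<psi> \<in> borel_measurable borel \<Longrightarrow> (\<And>x. x \<notin> {a..b} \<Longrightarrow> \<psi> x = 0) \<Longrightarrow>
       (\<integral>x. f x * \<psi> x \<partial>ivl T) = (\<integral>x. F x * \<psi> x \<partial>lborel)"
    using locally_integrable_borel_version[OF f ab] by blast
  have [measurable]: "F \<in> borel_measurable borel" using borel_measurable_integrable[OF F(1)] by simp
  have bm[measurable]: "bump c d n \<in> borel_measurable borel" for c d n
    using test_function_continuous[OF test_function_bump[of c d UNIV n]] by (intro borel_measurable_continuous_onI) simp
  have "AE x in lborel. F x = 0"
  proof (rule AE_eq_0_if_interval_integrals_0[OF F(1)])
    fix c' d' :: real
    \<comment> \<open>Intersecting with [a, b] keeps the supports of the bumps compactly inside (0,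
      T).\<close>
    define c where "c = max c' a"
    define d where "d = min d' b"
    have "(\<integral>x. F x * bump c d n x \<partial>lborel) = 0" for n
    proof -
      have "(\<integral>x. F x * bump c d n x \<partial>lborel) = (\<integral>x. f x * bump c d n x \<partial>ivl T)"
        by (rule F(4)[symmetric]) (auto intro!: bump_outside simp: c_def d_def)
      also have "\<dots> = 0"
        by (rule zero, rule test_function_bump) (use ab in \<open>auto simp: c_def d_def\<close>)
      finally show ?thesis .
    qed
    moreover have "(\<lambda>n. \<integral>x. F x * bump c d n x \<partial>lborel) \<longlonglongrightarrow> (\<integral>x. F x * indicator {c<..<d} x \<partial>lborel)"
    proof (rule integral_dominated_convergence[where w = "\<lambda>x. \<bar>F x\<bar>"])
      show "AE x in lborel. (\<lambda>n. F x * bump c d n x) \<longlonglongrightarrow> F x * indicator {c<..<d} x"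
        by (intro AE_I2 tendsto_mult_left bump_tendsto)
      show "AE x in lborel. norm (F x * bump c d n x) \<le> \<bar>F x\<bar>" for n
        using bump_bounds by (intro AE_I2) (auto simp: abs_mult intro!: mult_left_le)
    qed (use F(1) in auto)
    ultimately have "(\<integral>x. F x * indicator {c<..<d} x \<partial>lborel) = 0"
      by (simp add: LIMSEQ_const_iff)
    moreover have "(\<integral>x. indicator {c'..d'} x * F x \<partial>lborel) = (\<integral>x. F x * indicator {c<..<d} x \<partial>lborel)"
    proof (rule integral_cong_AE)
      have "AE x in lborel. x \<noteq> c \<and> x \<noteq> d"
        using AE_lborel_singleton[of c] AE_lborel_singleton[of d] by eventually_elim simp
      then show "AE x in lborel. indicator {c'..d'} x * F x = F x * indicator {c<..<d} x"
      proof eventually_elim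
        case (elim x)
        then show ?case using F(3)[of x] by (cases "x \<in> {a..b}") (auto simp: indicator_def c_def d_def)
      qed
    qed measurable
    ultimately show "(\<integral>x. indicator {c'..d'} x * F x \<partial>lborel) = 0" by simp
  qed
  with F(2) show "AE x in lborel. x \<in> {a..b} \<longrightarrow> f x = 0" by eventually_elim auto
qed

lemma locally_integrable_times_test:
  assumes f: "locally_integrable {0<..<T} f" and \<phi>: "test_function {0<..<T} \<phi>" and T: "0 < T"
  shows "integrable (ivl T) (\<lambda>x. f x * \<phi> x)"
proof -
  obtain a b where ab: "0 < a" "a < b" "b < T" "\<And>x. x \<notin> {a..b} \<Longrightarrow> \<phi> x = 0"
    using test_function_support[OF \<phi> T] by metis
  have "compact {a..b} \<and> {a..b} \<subseteq> {0<..<T}" using ab by auto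
  then have i: "integrable (lebesgue_on {a..b}) f" using f unfolding locally_integrable_def by blast
  have "compact (\<phi> ` {a..b})" by (intro compact_continuous_image test_function_continuous[OF \<phi>]) auto
  then obtain B where B: "\<forall>x\<in>{a..b}. \<bar>\<phi> x\<bar> \<le> B"
    using compact_imp_bounded[of "\<phi> ` {a..b}"] by (auto simp: bounded_iff)
  have \<phi>m: "\<phi> \<in> borel_measurable (lebesgue_on {a..b})"
    by (rule continuous_imp_measurable_on_sets_lebesgue[OF test_function_continuous[OF \<phi>]]) simp
  have "integrable (lebesgue_on {a..b}) (\<lambda>x. B * f x)" using i by simp
  then have "integrable (lebesgue_on {a..b}) (\<lambda>x. f x * \<phi> x)"
  proof (rule Bochner_Integration.integrable_bound)
    show "(\<lambda>x. f x * \<phi> x) \<in> borel_measurable (lebesgue_on {a..b})"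
      using borel_measurable_integrable[OF i] \<phi>m by (rule borel_measurable_times)
    show "AE x in lebesgue_on {a..b}. norm (f x * \<phi> x) \<le> norm (B * f x)"
    proof (rule AE_I2)
      fix x assume "x \<in> space (lebesgue_on {a..b})"
      then have "\<bar>\<phi> x\<bar> \<le> \<bar>B\<bar>" using B by force
      then have "\<bar>\<phi> x\<bar> * \<bar>f x\<bar> \<le> \<bar>B\<bar> * \<bar>f x\<bar>" by (rule mult_right_mono) simp
      then show "norm (f x * \<phi> x) \<le> norm (B * f x)" by (simp add: abs_mult mult.commute)
    qed
  qed
  then have "integrable lebesgue (\<lambda>x. indicator {a..b} x *\<^sub>R (f x * \<phi> x))"
    by (subst (asm) integrable_restrict_space) auto
  also have "(\<lambda>x. indicator {a..b} x *\<^sub>R (f x * \<phi> x)) = (\<lambda>x. indicator {0<..<T} x *\<^sub>R (f x * \<phi> x))"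
    using ab by (auto simp: indicator_def fun_eq_iff)
  finally show ?thesis by (subst integrable_restrict_space) auto
qed

lemma locally_integrable_diff:
  assumes "locally_integrable S f" "locally_integrable S g"
  shows "locally_integrable S (\<lambda>x. f x - g x)"
  using assms unfolding locally_integrable_def by (intro allI impI Bochner_Integration.integrable_diff) auto

lemma locally_integrable_abs_integrable:
  assumes "f absolutely_integrable_on {0..T}"
  shows "locally_integrable {0<..<T} f"
  unfolding locally_integrable_def
proof (intro allI impI)
  fix K :: "real set" assume K: "compact K \<and> K \<subseteq> {0<..<T}"
  have "K \<in> sets lebesgue" using K by (intro fmeasurableD lmeasurable_compact) simp
  moreover have "f absolutely_integrable_on K"
    by (rule set_integrable_subset[OF assms]) (use K calculation in auto)
  ultimately show "integrable (lebesgue_on K) f"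
    by (subst integrable_restrict_space) (auto simp: set_integrable_def)
qed

lemma locally_integrable_const: "locally_integrable {0<..<T} (\<lambda>x. c)"
  by (rule locally_integrable_abs_integrable) (intro absolutely_integrable_continuous_real continuous_intros)

lemma abs_integrable_ivl:
  fixes f :: "real \<Rightarrow> real"
  assumes "f absolutely_integrable_on {0..T}"
  shows "integrable (ivl T) f" "(\<integral>x. f x \<partial>ivl T) = integral {0..T} f"
proof -
  have "f absolutely_integrable_on {0<..<T}"
    by (rule set_integrable_subset[OF assms]) auto
  then show 1: "integrable (ivl T) f"
    by (subst integrable_restrict_space) (auto simp: set_integrable_def)
  have "(\<integral>x. f x \<partial>ivl T) = integral {0<..<T} f"
    by (rule lebesgue_integral_eq_integral[OF 1]) simp
  then show "(\<integral>x. f x \<partial>ivl T) = integral {0..T} f"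
    by (simp add: integral_open_interval_real)
qed

lemma weak_derivative_unique:
  assumes v: "has_weak_derivative k {0<..<T} u v" and w: "has_weak_derivative k {0<..<T} u w" and T: "0 < T"
  shows "AE x in ivl T. v x = w x"
proof -
  have lv: "locally_integrable {0<..<T} v" "locally_integrable {0<..<T} w"
    using v w by (auto simp: has_weak_derivative_def)
  have "AE x in ivl T. v x - w x = 0"
  proof (rule AE_eq_0_if_test_integrals_0[OF locally_integrable_diff[OF lv] T])
    fix \<phi> assume \<phi>: "test_function {0<..<T} \<phi>"
    have "(\<integral>x. u x * (deriv ^^ k) \<phi> x \<partial>ivl T) = (-1) ^ k * (\<integral>x. v x * \<phi> x \<partial>ivl T)"
      using v \<phi> unfolding has_weak_derivative_def by blast
    moreover have "(\<integral>x. u x * (deriv ^^ k) \<phi> x \<partial>ivl T) = (-1) ^ k * (\<integral>x. w x * \<phi> x \<partial>ivl T)"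
      using w \<phi> unfolding has_weak_derivative_def by blast
    ultimately have "(\<integral>x. v x * \<phi> x \<partial>ivl T) = (\<integral>x. w x * \<phi> x \<partial>ivl T)" by simp
    then show "(\<integral>x. (v x - w x) * \<phi> x \<partial>ivl T) = 0"
      using locally_integrable_times_test[OF lv(1) \<phi> T] locally_integrable_times_test[OF lv(2) \<phi> T]
      by (simp add: left_diff_distrib)
  qed
  then show ?thesis by eventually_elim simp
qed

text \<open>The choice operator returns some weak derivative; uniqueness identifies it almost
  everywhere with the version at hand.\<close>

lemma AE_weak_deriv:
  assumes "has_weak_derivative 1 {0<..<T} u v" "0 < T"
  shows "AE t in ivl T. weak_deriv {0<..<T} u t = v t"
proof -
  have "has_weak_derivative 1 {0<..<T} u (weak_deriv {0<..<T} u)"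
    unfolding weak_deriv_def
    by (rule someI[of "has_weak_derivative 1 {0<..<T} u", OF assms(1)])
  from weak_derivative_unique[OF this assms] show ?thesis .
qed

text \<open>Du Bois-Reymond: subtracting the right multiple of a fixed bump \<eta> from a test
  function leaves mean zero, and test functions of mean zero are derivatives of test functions. The
  constant is the \<eta>-weighted mean of \<open>f\<close>.\<close>

lemma AE_const_if_derivative_integrals_0:
  assumes f: "locally_integrable {0<..<T} f" and T: "0 < T"
    and zero: "\<And>\<phi>. test_function {0<..<T} \<phi> \<Longrightarrow> (\<integral>x. f x * deriv \<phi> x \<partial>ivl T) = 0"
  obtains c where "AE x in ivl T. f x = c"
proof -
  define \<eta> where "\<eta> = bump (T / 3) (2 * T / 3) 1"
  have \<eta>: "test_function {0<..<T} \<eta>" unfolding \<eta>_def using T by (intro test_function_bump) auto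
  have ti: "\<phi> absolutely_integrable_on {0..T}" if "test_function {0<..<T} \<phi>" for \<phi>
    using test_function_continuous[OF that] by (rule absolutely_integrable_continuous_real)
  have thk: "\<phi> integrable_on {0..T}" if "test_function {0<..<T} \<phi>" for \<phi>
    using test_function_continuous[OF that] by (rule integrable_continuous_real)
  define N where "N = integral {0..T} \<eta>"
  \<comment> \<open>A continuous nonnegative function with integral 0 vanishes, but \<eta> is
    positive at the midpoint of the interval.\<close>
  have N0: "N \<noteq> 0"
  proof
    assume "N = 0"
    then have "(\<eta> has_integral 0) (cbox 0 T)"
      using integrable_integral[OF thk[OF \<eta>]] by (simp add: N_def)
    then have "\<eta> (T / 2) = 0"
      by (rule has_integral_0_cbox_imp_0[rotated 2])
         (use T test_function_continuous[OF \<eta>] bump_bounds in \<open>auto simp: \<eta>_def\<close>)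
    moreover have "0 < efun 1 (T / 2 - T / 3) * efun 1 (2 * T / 3 - T / 2)"
      using T by (intro mult_pos_pos efun_1_bounds(3)) auto
    ultimately show False by (simp add: \<eta>_def bump_def)
  qed
  define c where "c = (\<integral>x. f x * \<eta> x \<partial>ivl T) / N"
  have "AE x in ivl T. f x - c = 0"
  proof (rule AE_eq_0_if_test_integrals_0[OF locally_integrable_diff[OF f locally_integrable_const] T])
    fix \<psi> assume \<psi>: "test_function {0<..<T} \<psi>"
    define m where "m = integral {0..T} \<psi>"
    define \<zeta> where "\<zeta> x = \<psi> x + (- m / N) * \<eta> x" for x
    have \<zeta>: "test_function {0<..<T} \<zeta>" unfolding \<zeta>_def by (rule test_function_lincomb[OF \<psi> \<eta>])
    have "integral {0..T} \<zeta> = m + (- m / N) * N"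
      unfolding \<zeta>_def
      using Henstock_Kurzweil_Integration.integral_add[OF thk[OF \<psi>] integrable_on_mult_right[OF thk[OF \<eta>], of "- m / N"]]
      by (simp only: integral_mult_right m_def[symmetric] N_def[symmetric])
    then have "integral {0..T} \<zeta> = 0" using N0 by simp
    then obtain \<phi> where "test_function {0<..<T} \<phi>" "deriv \<phi> = \<zeta>"
      using test_function_primitive[OF \<zeta> T] by metis
    then have "(\<integral>x. f x * \<zeta> x \<partial>ivl T) = 0" using zero by metis
    also have "(\<lambda>x. f x * \<zeta> x) = (\<lambda>x. f x * \<psi> x + (- m / N) * (f x * \<eta> x))"
      by (auto simp: \<zeta>_def algebra_simps)
    also have "(\<integral>x. \<dots> x \<partial>ivl T) = (\<integral>x. f x * \<psi> x \<partial>ivl T) + (- m / N) * (\<integral>x. f x * \<eta> x \<partial>ivl T)"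
      using locally_integrable_times_test[OF f \<psi> T] locally_integrable_times_test[OF f \<eta> T]
      by (subst Bochner_Integration.integral_add) auto
    finally have "(\<integral>x. f x * \<psi> x \<partial>ivl T) = m * c" by (simp add: c_def)
    moreover have "(\<integral>x. \<psi> x \<partial>ivl T) = m"
      unfolding m_def by (rule abs_integrable_ivl(2)[OF ti[OF \<psi>]])
    moreover have "(\<integral>x. (f x - c) * \<psi> x \<partial>ivl T) = (\<integral>x. f x * \<psi> x \<partial>ivl T) - c * (\<integral>x. \<psi> x \<partial>ivl T)"
      using locally_integrable_times_test[OF f \<psi> T] abs_integrable_ivl(1)[OF ti[OF \<psi>]]
      by (simp add: left_diff_distrib)
    ultimately show "(\<integral>x. (f x - c) * \<psi> x \<partial>ivl T) = 0" by simp
  qed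
  then have "AE x in ivl T. f x = c" by eventually_elim simp
  then show ?thesis by (rule that)
qed

section \<open>Absolutely continuous versions of weakly differentiable functions\<close>

lemma ac_on_weak_derivative:
  assumes F: "ac_on T F f" and T: "0 < T"
  shows "has_weak_derivative 1 {0<..<T} F f"
  unfolding has_weak_derivative_def
proof (intro conjI allI impI)
  note Fc = ac_on_continuous[OF F] and fi = ac_on_integrable[OF F]
  show "locally_integrable {0<..<T} F"
    by (intro locally_integrable_abs_integrable absolutely_integrable_continuous_real Fc)
  show "locally_integrable {0<..<T} f" by (rule locally_integrable_abs_integrable[OF fi])
  fix \<phi> assume \<phi>: "test_function {0<..<T} \<phi>"
  obtain a b where ab: "0 < a" "a < b" "b < T" "\<And>x. x \<notin> {a..b} \<Longrightarrow> \<phi> x = 0"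
    using test_function_support[OF \<phi> T] by metis
  have \<phi>': "continuous_on A (deriv \<phi>)" for A
    using test_function_continuous[OF test_function_deriv[OF \<phi>, of 1]] by simp
  have ac: "ac_on T \<phi> (deriv \<phi>)"
    by (rule ac_on_C1[OF test_function_DERIV[OF \<phi>] \<phi>'])
  have i1: "(\<lambda>t. \<phi> t * f t) absolutely_integrable_on {0..T}"
    by (rule continuous_times_abs_integrable[OF ac_on_continuous[OF ac] fi])
  have i2: "(\<lambda>t. F t * deriv \<phi> t) absolutely_integrable_on {0..T}"
    by (rule continuous_times_abs_integrable[OF Fc ac_on_integrable[OF ac]])
  have "F T * \<phi> T - F 0 * \<phi> 0 = integral {0..T} (\<lambda>t. \<phi> t * f t + F t * deriv \<phi> t)"
    using ac_on_diff[OF ac_on_mult[OF F ac], of 0 T] T by simp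
  also have "\<dots> = integral {0..T} (\<lambda>t. \<phi> t * f t) + integral {0..T} (\<lambda>t. F t * deriv \<phi> t)"
    using set_lebesgue_integral_eq_integral(1)[OF i1] set_lebesgue_integral_eq_integral(1)[OF i2]
    by (rule Henstock_Kurzweil_Integration.integral_add)
  also have "\<dots> = (\<integral>t. \<phi> t * f t \<partial>ivl T) + (\<integral>t. F t * deriv \<phi> t \<partial>ivl T)"
    using abs_integrable_ivl(2)[OF i1] abs_integrable_ivl(2)[OF i2] by simp
  finally show "(\<integral>x. F x * (deriv ^^ 1) \<phi> x \<partial>ivl T) = (- 1) ^ 1 * (\<integral>x. f x * \<phi> x \<partial>ivl T)"
    using ab by (simp add: mult.commute)
qed

text \<open>The difference of \<open>u\<close> and the primitive of \<open>w\<close> has weak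
  derivative 0, so it is almost everywhere constant; this constant becomes the initial value of
  \<open>U\<close>.\<close>

lemma weak_derivative_ac_version:
  assumes uv: "has_weak_derivative 1 {0<..<T} u v" and T: "0 < T"
    and w: "w absolutely_integrable_on {0..T}" and vw: "AE x in ivl T. v x = w x"
  obtains U where "ac_on T U w" "AE x in ivl T. u x = U x"
proof -
  have lu: "locally_integrable {0<..<T} u" and lv: "locally_integrable {0<..<T} v"
    using uv by (auto simp: has_weak_derivative_def)
  define W where "W t = 0 + integral {0..t} w" for t
  have acW: "ac_on T W w" unfolding W_def by (rule ac_on_indefinite[OF w])
  have wW: "has_weak_derivative 1 {0<..<T} W w" by (rule ac_on_weak_derivative[OF acW T])
  then have lW: "locally_integrable {0<..<T} W" and lw: "locally_integrable {0<..<T} w"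
    by (auto simp: has_weak_derivative_def)
  obtain c where c: "AE x in ivl T. u x - W x = c"
  proof (rule AE_const_if_derivative_integrals_0[OF locally_integrable_diff[OF lu lW] T])
    fix \<phi> assume \<phi>: "test_function {0<..<T} \<phi>"
    have d\<phi>: "test_function {0<..<T} (deriv \<phi>)" using test_function_deriv[OF \<phi>, of 1] by simp
    have "(\<integral>x. u x * deriv \<phi> x \<partial>ivl T) = - (\<integral>x. v x * \<phi> x \<partial>ivl T)"
      using uv \<phi> by (simp add: has_weak_derivative_def)
    also have "(\<integral>x. v x * \<phi> x \<partial>ivl T) = (\<integral>x. w x * \<phi> x \<partial>ivl T)"
      using borel_measurable_integrable[OF locally_integrable_times_test[OF lv \<phi> T]]
        borel_measurable_integrable[OF locally_integrable_times_test[OF lw \<phi> T]]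
    proof (rule integral_cong_AE)
      show "AE x in ivl T. v x * \<phi> x = w x * \<phi> x" using vw by eventually_elim simp
    qed
    also have "- \<dots> = (\<integral>x. W x * deriv \<phi> x \<partial>ivl T)"
      using wW \<phi> by (simp add: has_weak_derivative_def)
    finally show "(\<integral>x. (u x - W x) * deriv \<phi> x \<partial>ivl T) = 0"
      using locally_integrable_times_test[OF lu d\<phi> T] locally_integrable_times_test[OF lW d\<phi> T]
      by (simp add: left_diff_distrib)
  qed blast
  show ?thesis
  proof (rule that)
    show "ac_on T (\<lambda>t. c + integral {0..t} w) w" by (rule ac_on_indefinite[OF w])
    show "AE x in ivl T. u x = c + integral {0..x} w"
      using c by eventually_elim (simp add: W_def)
  qed
qed

text \<open>The derivative of order \<open>k\<close> of a test function is itself a test function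
  for the first weak derivative of \<open>u\<close>.\<close>

lemma weak_derivative_shift:
  assumes u1: "has_weak_derivative 1 S u v" and uk: "has_weak_derivative (Suc k) S u w"
  shows "has_weak_derivative k S v w"
  unfolding has_weak_derivative_def
proof (intro conjI allI impI)
  show "locally_integrable S v" "locally_integrable S w"
    using u1 uk by (auto simp: has_weak_derivative_def)
  fix \<phi> assume \<phi>: "test_function S \<phi>"
  have "(\<integral>x. u x * (deriv ^^ 1) ((deriv ^^ k) \<phi>) x \<partial>lebesgue_on S)
     = (-1) ^ 1 * (\<integral>x. v x * (deriv ^^ k) \<phi> x \<partial>lebesgue_on S)"
    using u1 test_function_deriv[OF \<phi>, of k] unfolding has_weak_derivative_def by blast
  moreover have "(\<integral>x. u x * (deriv ^^ Suc k) \<phi> x \<partial>lebesgue_on S)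
     = (-1) ^ Suc k * (\<integral>x. w x * \<phi> x \<partial>lebesgue_on S)"
    using uk \<phi> unfolding has_weak_derivative_def by blast
  ultimately show "(\<integral>x. v x * (deriv ^^ k) \<phi> x \<partial>lebesgue_on S) = (- 1) ^ k * (\<integral>x. w x * \<phi> x \<partial>lebesgue_on S)"
    by simp
qed

text \<open>The induction passes from \<open>u\<close> to its first weak derivative, whose chain is
  shorter by one; integrating the start of that chain prepends one more function. The top entry is
  the prescribed version \<open>w\<close>.\<close>

lemma weak_derivatives_ac_version:
  assumes T: "0 < T" and "\<And>k. k \<le> m \<Longrightarrow> \<exists>v. has_weak_derivative k {0<..<T} u v"
    and "has_weak_derivative m {0<..<T} u v" and w: "w absolutely_integrable_on {0..T}"
    and vw: "AE x in ivl T. v x = w x"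
  shows "\<exists>H. H m = w \<and> (\<forall>l<m. ac_on T (H l) (H (Suc l))) \<and> (AE x in ivl T. u x = H 0 x)"
  using assms(2,3)
proof (induction m arbitrary: u)
  case 0
  have lu: "locally_integrable {0<..<T} u" using 0(2) by (simp add: has_weak_derivative_def)
  then have "has_weak_derivative 0 {0<..<T} u u" by (simp add: has_weak_derivative_def)
  from weak_derivative_unique[OF this 0(2) T] have "AE x in ivl T. u x = v x" .
  with vw have "AE x in ivl T. u x = w x" by eventually_elim simp
  then show ?case by (intro exI[of _ "\<lambda>_. w"]) simp
next
  case (Suc m)
  obtain v1 where v1: "has_weak_derivative 1 {0<..<T} u v1" using Suc.prems(1)[of 1] by auto
  have "\<exists>v. has_weak_derivative k {0<..<T} v1 v" if "k \<le> m" for k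
    using Suc.prems(1)[of "Suc k"] weak_derivative_shift[OF v1] that by auto
  moreover have "has_weak_derivative m {0<..<T} v1 v"
    by (rule weak_derivative_shift[OF v1 Suc.prems(2)])
  ultimately obtain H where H: "H m = w" "\<forall>l<m. ac_on T (H l) (H (Suc l))" "AE x in ivl T. v1 x = H 0 x"
    using Suc.IH by blast
  \<comment> \<open>Either this is the top entry \<open>w\<close> itself, or it is absolutely
    continuous and therefore continuous.\<close>
  have "H 0 absolutely_integrable_on {0..T}"
  proof (cases "m = 0")
    case True
    then show ?thesis using H(1) w by simp
  next
    case False
    then show ?thesis using H(2) by (intro absolutely_integrable_continuous_real ac_on_continuous) auto
  qed
  then obtain U where U: "ac_on T U (H 0)" "AE x in ivl T. u x = U x"
    using weak_derivative_ac_version[OF v1 T _ H(3)] by blast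
  show ?case
  proof (intro exI[of _ "\<lambda>l. case l of 0 \<Rightarrow> U | Suc j \<Rightarrow> H j"] conjI allI impI)
    fix l assume "l < Suc m"
    then show "ac_on T (case l of 0 \<Rightarrow> U | Suc j \<Rightarrow> H j) (case Suc l of 0 \<Rightarrow> U | Suc j \<Rightarrow> H j)"
      using U(1) H(2) by (cases l) auto
  qed (use H U in auto)
qed

lemma integrable_ivl_borel_version:
  fixes v :: "real \<Rightarrow> real"
  assumes v: "integrable (ivl T) v"
  obtains w where "w \<in> borel_measurable borel" "w absolutely_integrable_on {0..T}" "AE x in ivl T. v x = w x"
proof -
  have i: "integrable lebesgue (\<lambda>x. indicator {0<..<T} x * v x)"
    using v by (subst (asm) integrable_restrict_space) auto
  obtain w where w: "w \<in> borel_measurable lborel" "AE x in lborel. indicator {0<..<T} x * v x = w x"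
    using completion_ex_borel_measurable_real[OF borel_measurable_integrable[OF i]] by auto
  have wl: "w \<in> borel_measurable lebesgue" using w(1) by (rule measurable_completion)
  have "integrable lebesgue w"
    by (rule integrable_cong_AE_imp[OF i wl AE_completion[OF w(2)]])
  then have "w absolutely_integrable_on {0..T}"
    unfolding set_integrable_def by (intro integrable_mult_indicator) auto
  moreover have "AE x in ivl T. v x = w x"
    using AE_completion[OF w(2)] by (subst AE_restrict_space_iff) (auto elim!: eventually_mono)
  ultimately show ?thesis using w(1) by (intro that) auto
qed

section \<open>Time derivatives of the kernel\<close>

text \<open>Both $\sinh w / w$ and $(w\cosh w - \sinh w)/w^3$ are power series in $w^2$ with positive
  coefficients; in terms of $y = \beta^2|H|^2$ the Langevin quotient becomes smooth at $H = 0$.\<close>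

definition sinhc_coeff :: "nat \<Rightarrow> real" where "sinhc_coeff n = 1 / fact (2 * n + 1)"
definition coshd_coeff :: "nat \<Rightarrow> real" where "coshd_coeff n = 1 / fact (2 * n + 2) - 1 / fact (2 * n + 3)"

definition entire_coeff :: "(nat \<Rightarrow> real) \<Rightarrow> bool" where
  "entire_coeff c \<longleftrightarrow> (\<forall>y. summable (\<lambda>n. c n * y ^ n))"

definition pseries :: "(nat \<Rightarrow> real) \<Rightarrow> real \<Rightarrow> real" where "pseries c y = (\<Sum>n. c n * y ^ n)"

lemma entire_coeffI:
  assumes "\<And>n. \<bar>c n\<bar> \<le> 1 / fact n" shows "entire_coeff c"
  unfolding entire_coeff_def
proof
  fix y :: real
  show "summable (\<lambda>n. c n * y ^ n)"
  proof (rule summable_comparison_test')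
    show "summable (\<lambda>n. inverse (fact n) * \<bar>y\<bar> ^ n)" by (rule summable_exp)
    show "norm (c n * y ^ n) \<le> inverse (fact n) * \<bar>y\<bar> ^ n" if "n \<ge> 0" for n
      using mult_right_mono[OF assms[of n], of "\<bar>y\<bar> ^ n"] by (simp add: abs_mult power_abs inverse_eq_divide)
  qed
qed

lemma entire_sinhc: "entire_coeff sinhc_coeff"
proof (rule entire_coeffI)
  fix n
  have "fact n \<le> (fact (2 * n + 1) :: real)" by (rule fact_mono) simp
  then show "\<bar>sinhc_coeff n\<bar> \<le> 1 / fact n"
    by (simp add: sinhc_coeff_def frac_le del: fact_Suc)
qed

lemma entire_coshd: "entire_coeff coshd_coeff"
proof (rule entire_coeffI)
  fix n
  have "fact n \<le> (fact (2 * n + 2) :: real)" by (rule fact_mono) simp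
  then have 1: "1 / fact (2 * n + 2) \<le> 1 / (fact n :: real)" by (intro frac_le) auto
  have "fact (2 * n + 2) \<le> (fact (2 * n + 3) :: real)" by (rule fact_mono) simp
  then have 2: "1 / fact (2 * n + 3) \<le> 1 / (fact (2 * n + 2) :: real)" by (intro frac_le) auto
  have 3: "0 \<le> 1 / (fact (2 * n + 3) :: real)" by simp
  show "\<bar>coshd_coeff n\<bar> \<le> 1 / fact n"
    unfolding coshd_coeff_def using 1 2 3 by linarith
qed

lemma pseries_deriv:
  assumes "entire_coeff c"
  shows "entire_coeff (diffs c)" "(pseries c has_real_derivative pseries (diffs c) y) (at y)"
  using termdiff_converges_all[of c] termdiffs_strong_converges_everywhere[of c y] assms
  by (auto simp: entire_coeff_def pseries_def[abs_def])

lemma sinhc_pos: "0 \<le> y \<Longrightarrow> 0 < pseries sinhc_coeff y"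
proof -
  assume y: "0 \<le> y"
  have "(\<Sum>n<1. sinhc_coeff n * y ^ n) \<le> pseries sinhc_coeff y"
    unfolding pseries_def using entire_sinhc y
    by (intro sum_le_suminf) (auto simp: entire_coeff_def sinhc_coeff_def)
  then show ?thesis by (simp add: sinhc_coeff_def)
qed

lemma sinh_pseries: "sinh w = w * pseries sinhc_coeff (w\<^sup>2)" for w :: real
proof -
  have "(\<lambda>n. if even (2 * n + 1) then 0 else w ^ (2 * n + 1) /\<^sub>R fact (2 * n + 1)) sums sinh w"
  proof (subst sums_mono_reindex[of "\<lambda>n. 2 * n + 1" "\<lambda>n. if even n then 0 else w ^ n /\<^sub>R fact n"])
    show "(if even n then 0 else w ^ n /\<^sub>R fact n) = 0" if "n \<notin> range (\<lambda>n. 2 * n + 1)" for n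
      using that by (auto elim!: oddE)
  qed (auto simp: strict_mono_def sinh_converges)
  then have 1: "(\<lambda>n. w ^ (2 * n + 1) / fact (2 * n + 1)) sums sinh w"
    by (simp add: divide_inverse mult.commute del: fact_Suc power_Suc)
  have "(\<lambda>n. sinhc_coeff n * (w\<^sup>2) ^ n) sums pseries sinhc_coeff (w\<^sup>2)"
    unfolding pseries_def using entire_sinhc by (intro summable_sums) (simp add: entire_coeff_def)
  then have "(\<lambda>n. w * (sinhc_coeff n * (w\<^sup>2) ^ n)) sums (w * pseries sinhc_coeff (w\<^sup>2))" by (rule sums_mult)
  also have "(\<lambda>n. w * (sinhc_coeff n * (w\<^sup>2) ^ n)) = (\<lambda>n. w ^ (2 * n + 1) / fact (2 * n + 1))"
    by (auto simp: sinhc_coeff_def power_mult fun_eq_iff simp del: fact_Suc)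
  finally show ?thesis using 1 sums_unique2 by blast
qed

lemma cosh_minus_sinh_pseries: "w * cosh w - sinh w = w ^ 3 * pseries coshd_coeff (w\<^sup>2)" for w :: real
proof -
  have "(\<lambda>n. if even (2 * n) then w ^ (2 * n) /\<^sub>R fact (2 * n) else 0) sums cosh w"
  proof (subst sums_mono_reindex[of "\<lambda>n. 2 * n" "\<lambda>n. if even n then w ^ n /\<^sub>R fact n else 0"])
    show "(if even n then w ^ n /\<^sub>R fact n else 0) = 0" if "n \<notin> range (\<lambda>n. 2 * n)" for n
      using that by (auto elim!: evenE)
  qed (auto simp: strict_mono_def cosh_converges)
  then have "(\<lambda>n. w ^ (2 * n) / fact (2 * n)) sums cosh w"
    by (simp add: divide_inverse mult.commute)
  then have 1: "(\<lambda>n. w * (w ^ (2 * n) / fact (2 * n))) sums (w * cosh w)" by (rule sums_mult)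
  have "(\<lambda>n. if even (2 * n + 1) then 0 else w ^ (2 * n + 1) /\<^sub>R fact (2 * n + 1)) sums sinh w"
  proof (subst sums_mono_reindex[of "\<lambda>n. 2 * n + 1" "\<lambda>n. if even n then 0 else w ^ n /\<^sub>R fact n"])
    show "(if even n then 0 else w ^ n /\<^sub>R fact n) = 0" if "n \<notin> range (\<lambda>n. 2 * n + 1)" for n
      using that by (auto elim!: oddE)
  qed (auto simp: strict_mono_def sinh_converges)
  then have 2: "(\<lambda>n. w ^ (2 * n + 1) / fact (2 * n + 1)) sums sinh w"
    by (simp add: divide_inverse mult.commute del: fact_Suc power_Suc)
  define f where "f n = w * (w ^ (2 * n) / fact (2 * n)) - w ^ (2 * n + 1) / fact (2 * n + 1)" for n
  have "f sums (w * cosh w - sinh w)" unfolding f_def by (rule sums_diff[OF 1 2])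
  moreover have "f 0 = 0" by (simp add: f_def)
  ultimately have 3: "(\<lambda>n. f (Suc n)) sums (w * cosh w - sinh w)" by (simp add: sums_Suc_iff)
  have "(\<lambda>n. coshd_coeff n * (w\<^sup>2) ^ n) sums pseries coshd_coeff (w\<^sup>2)"
    unfolding pseries_def using entire_coshd by (intro summable_sums) (simp add: entire_coeff_def)
  then have "(\<lambda>n. w ^ 3 * (coshd_coeff n * (w\<^sup>2) ^ n)) sums (w ^ 3 * pseries coshd_coeff (w\<^sup>2))" by (rule sums_mult)
  also have "(\<lambda>n. w ^ 3 * (coshd_coeff n * (w\<^sup>2) ^ n)) = (\<lambda>n. f (Suc n))"
  proof
    fix n
    have e: "2 * Suc n = 2 * n + 2" "2 * n + 2 + 1 = 2 * n + 3" by simp_all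
    have p: "w * w ^ (2 * n + 2) = w ^ 3 * (w\<^sup>2) ^ n" "w ^ (2 * n + 3) = w ^ 3 * (w\<^sup>2) ^ n"
    proof -
      have "(w\<^sup>2) ^ n = w ^ (2 * n)" by (simp add: power_mult)
      then show "w * w ^ (2 * n + 2) = w ^ 3 * (w\<^sup>2) ^ n" "w ^ (2 * n + 3) = w ^ 3 * (w\<^sup>2) ^ n"
        by (simp_all add: power_add power3_eq_cube power2_eq_square mult_ac)
    qed
    have alg: "w ^ 3 * ((1 / A - 1 / B) * Y) = X / A - Z / B"
      if "X = w ^ 3 * Y" "Z = w ^ 3 * Y" for A B X Y Z :: real
      using that by (simp add: algebra_simps)
    show "w ^ 3 * (coshd_coeff n * (w\<^sup>2) ^ n) = f (Suc n)"
      unfolding f_def e coshd_coeff_def times_divide_eq_right by (rule alg[OF p])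
  qed
  finally show ?thesis using 3 sums_unique2 by blast
qed

text \<open>With w = \<beta> z the Langevin function is (w cosh w - sinh w) / (w sinh w), that is,
  w^3 D over w^2 S for the two series. Division by z leaves a function of z^2 alone.\<close>

lemma langevin_quot_pseries:
  assumes "0 < \<beta>"
  shows "langevin_quot \<beta> z = \<beta> * (pseries coshd_coeff (\<beta>\<^sup>2 * z\<^sup>2) * inverse (pseries sinhc_coeff (\<beta>\<^sup>2 * z\<^sup>2)))"
proof (cases "z = 0")
  case True
  \<comment> \<open>The leading coefficient is 1/2 - 1/6 = 1/3, which matches the continuous
    extension in \<open>langevin_quot\<close>.\<close>
  have "pseries coshd_coeff 0 = 1 / 3" "pseries sinhc_coeff 0 = 1"
    unfolding pseries_def powser_zero by (simp_all add: coshd_coeff_def sinhc_coeff_def fact_numeral)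
  then show ?thesis using True by (simp add: langevin_quot_def)
next
  case False
  define w where "w = \<beta> * z"
  have w: "w \<noteq> 0" "\<beta>\<^sup>2 * z\<^sup>2 = w\<^sup>2" using False assms by (auto simp: w_def power_mult_distrib)
  define S where "S = pseries sinhc_coeff (w\<^sup>2)"
  define D where "D = pseries coshd_coeff (w\<^sup>2)"
  have S: "S > 0" unfolding S_def by (rule sinhc_pos) simp
  have sw: "sinh w = w * S" using sinh_pseries by (simp add: S_def)
  have "cosh w = (sinh w + w ^ 3 * D) / w"
    using cosh_minus_sinh_pseries[of w] w(1) by (simp add: D_def field_simps)
  then have "cosh w / sinh w - 1 / w = w * D / S"
    using w(1) S unfolding sw by (simp add: field_simps power3_eq_cube)
  then have "langevin_quot \<beta> z = w * D / S / z"
    using False by (simp add: langevin_quot_def langevin_def w_def)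
  also have "\<dots> = \<beta> * (D * inverse S)" using False by (simp add: w_def divide_inverse)
  finally show ?thesis by (simp add: w(2) S_def D_def)
qed

inductive oclass :: "(real \<Rightarrow> real) \<Rightarrow> bool" where
  series: "entire_coeff c \<Longrightarrow> oclass (pseries c)"
| recip: "oclass (\<lambda>y. inverse (pseries sinhc_coeff y))"
| const: "oclass (\<lambda>y. c)"
| add: "oclass f \<Longrightarrow> oclass g \<Longrightarrow> oclass (\<lambda>y. f y + g y)"
| mult: "oclass f \<Longrightarrow> oclass g \<Longrightarrow> oclass (\<lambda>y. f y * g y)"

lemma oclass_deriv:
  assumes "oclass f"
  shows "\<exists>f'. oclass f' \<and> (\<forall>y\<ge>0. (f has_real_derivative f' y) (at y))"
  using assms
proof induction
  case (series c)
  then show ?case using pseries_deriv oclass.series by blast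
next
  case recip
  let ?S = "pseries sinhc_coeff"
  let ?f' = "\<lambda>y. (- 1 * pseries (diffs sinhc_coeff) y) * (inverse (?S y) * inverse (?S y))"
  have "oclass ?f'"
    by (intro oclass.mult oclass.recip oclass.series oclass.const pseries_deriv(1) entire_sinhc)
  moreover have "((\<lambda>y. inverse (?S y)) has_real_derivative ?f' y) (at y)" if "0 \<le> y" for y
  proof -
    have "?S y \<noteq> 0" using sinhc_pos[OF that] by simp
    from DERIV_inverse_fun[OF pseries_deriv(2)[OF entire_sinhc] this] show ?thesis
      by (simp add: power2_eq_square mult_ac)
  qed
  ultimately show ?case by blast
next
  case (const c)
  have "((\<lambda>y. c) has_real_derivative 0) (at y)" for y by simp
  then show ?case using oclass.const[of 0] by blast
next
  case (add f g)
  then obtain f' g' where "oclass f'" "\<forall>y\<ge>0. (f has_real_derivative f' y) (at y)"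
    and "oclass g'" "\<forall>y\<ge>0. (g has_real_derivative g' y) (at y)" by blast
  then show ?case
    by (intro exI[of _ "\<lambda>y. f' y + g' y"] conjI oclass.add) (auto intro: DERIV_add)
next
  case (mult f g)
  then obtain f' g' where fg: "oclass f'" "\<forall>y\<ge>0. (f has_real_derivative f' y) (at y)"
    "oclass g'" "\<forall>y\<ge>0. (g has_real_derivative g' y) (at y)" by blast
  have "oclass (\<lambda>y. f' y * g y + g' y * f y)"
    using fg mult.hyps by (intro oclass.add oclass.mult) auto
  moreover have "\<forall>y\<ge>0. ((\<lambda>y. f y * g y) has_real_derivative f' y * g y + g' y * f y) (at y)"
    using fg by (auto intro: DERIV_mult)
  ultimately show ?case by blast
qed

lemma pseries_measurable [measurable]: "entire_coeff c \<Longrightarrow> pseries c \<in> borel_measurable borel"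
  by (intro borel_measurable_continuous_onI continuous_at_imp_continuous_on ballI)
     (use pseries_deriv(2) in \<open>auto intro: DERIV_isCont\<close>)

lemma oclass_measurable: "oclass f \<Longrightarrow> f \<in> borel_measurable borel"
proof (induction rule: oclass.induct)
  case recip
  show ?case using pseries_measurable[OF entire_sinhc] by (rule borel_measurable_inverse)
qed (auto intro: pseries_measurable borel_measurable_add borel_measurable_times)

lemma oclass_isCont: "oclass f \<Longrightarrow> 0 \<le> y \<Longrightarrow> isCont f y"
  using oclass_deriv[of f] by (auto intro: DERIV_isCont)

text \<open>\<open>h l i\<close> is a version of the derivative of order \<open>l\<close> of
  component \<open>i\<close> of the applied field: orders below \<open>m\<close> are absolutely
  continuous, order \<open>m\<close> is only Borel and integrable. The bound on \<open>g\<close>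
  holds everywhere, so that later bounds are uniform in \<open>x\<close>.\<close>

locale kernel_data =
  fixes M :: "'x measure" and T \<beta> :: real and m :: nat
    and g :: "'x \<Rightarrow> real ^ 'd" and h :: "nat \<Rightarrow> 'd \<Rightarrow> real \<Rightarrow> real"
  assumes T: "0 < T" and m: "1 \<le> m"
    and g_measurable: "\<And>i. (\<lambda>x. g x $ i) \<in> borel_measurable M"
    and g_bounded: "\<exists>G. \<forall>x i. \<bar>g x $ i\<bar> \<le> G"
    and h_ac: "\<And>l i. l < m \<Longrightarrow> ac_on T (h l i) (h (Suc l) i)"
    and h_borel: "\<And>i. h m i \<in> borel_measurable borel"
begin

text \<open>Differences are written as sums with \<open>- g\<close> because the expressions
  \<open>dp\<close> are generated by sums and products.\<close>

definition W :: "'x \<Rightarrow> real \<Rightarrow> real" where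
  "W x t = \<beta>\<^sup>2 * (\<Sum>i\<in>UNIV. (h 0 i t + - g x $ i) * (h 0 i t + - g x $ i))"

text \<open>Iterated time derivatives of the magnetization: in \<open>dp k\<close> only derivatives of the applied field of
  order at most \<open>k\<close> occur, and in \<open>de k\<close> below that of order \<open>Suc k\<close> occurs in addition, but
  only linearly.  Hence all square integrability is carried by the highest derivative.\<close>

inductive dp :: "nat \<Rightarrow> ('x \<Rightarrow> real \<Rightarrow> real) \<Rightarrow> bool" for k where
  const: "b \<in> borel_measurable M \<Longrightarrow> (\<And>x. \<bar>b x\<bar> \<le> B) \<Longrightarrow> dp k (\<lambda>x t. b x)"
| deriv: "l \<le> k \<Longrightarrow> dp k (\<lambda>x t. h l i t)"
| outer: "oclass f \<Longrightarrow> dp k (\<lambda>x t. f (W x t))"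
| add: "dp k F \<Longrightarrow> dp k G \<Longrightarrow> dp k (\<lambda>x t. F x t + G x t)"
| mult: "dp k F \<Longrightarrow> dp k G \<Longrightarrow> dp k (\<lambda>x t. F x t * G x t)"

lemma dp_const: "dp k (\<lambda>x t. c)"
  by (rule dp.const[of _ "\<bar>c\<bar>"]) auto

lemma dp_g: "dp k (\<lambda>x t. - g x $ i)"
proof -
  obtain G where "\<forall>x i. \<bar>g x $ i\<bar> \<le> G" using g_bounded by blast
  then show ?thesis by (intro dp.const[of _ G] borel_measurable_uminus g_measurable) auto
qed

lemma dp_sum: "(\<And>i. i \<in> A \<Longrightarrow> dp k (F i)) \<Longrightarrow> dp k (\<lambda>x t. \<Sum>i\<in>A. F i x t)"
  by (induction A rule: infinite_finite_induct) (auto intro: dp_const dp.add)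

lemma dp_mono: "dp k F \<Longrightarrow> k \<le> k' \<Longrightarrow> dp k' F"
  by (induction rule: dp.induct) (auto intro: dp.intros)

lemma W_nonneg: "0 \<le> W x t"
proof -
  have "0 \<le> (\<Sum>i\<in>UNIV. (h 0 i t + - g x $ i) * (h 0 i t + - g x $ i))"
    by (rule sum_nonneg) (rule zero_le_square)
  then show ?thesis unfolding W_def by (intro mult_nonneg_nonneg) auto
qed

lemma h_continuous: "l < m \<Longrightarrow> continuous_on {0..T} (h l i)"
  by (rule ac_on_continuous[OF h_ac])

lemma h_integrable: "l \<le> m \<Longrightarrow> h l i absolutely_integrable_on {0..T}"
proof (cases "l = m")
  case True
  with m have "ac_on T (h (l - 1) i) (h (Suc (l - 1)) i)" by (intro h_ac) auto
  then show ?thesis using True m by (auto dest: ac_on_integrable)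
next
  case False
  assume "l \<le> m"
  with False show ?thesis by (intro absolutely_integrable_continuous_real h_continuous) auto
qed

lemma W_bounded: obtains Z where "\<And>x t. t \<in> {0..T} \<Longrightarrow> W x t \<le> Z"
proof -
  obtain G where G: "\<forall>x i. \<bar>g x $ i\<bar> \<le> G" using g_bounded by blast
  have "\<exists>B. \<forall>t\<in>{0..T}. \<bar>h 0 i t\<bar> \<le> B" for i
  proof -
    have "compact (h 0 i ` {0..T})" using m by (intro compact_continuous_image h_continuous) auto
    then show ?thesis using compact_imp_bounded[of "h 0 i ` {0..T}"] by (auto simp: bounded_iff)
  qed
  then obtain B where B: "\<And>i t. t \<in> {0..T} \<Longrightarrow> \<bar>h 0 i t\<bar> \<le> B i" by metis
  have "W x t \<le> \<beta>\<^sup>2 * (\<Sum>i\<in>UNIV. (B i + G) * (B i + G))" if t: "t \<in> {0..T}" for x t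
  proof -
    have "(h 0 i t + - g x $ i) * (h 0 i t + - g x $ i) \<le> (B i + G) * (B i + G)" for i
    proof -
      have "\<bar>h 0 i t + - g x $ i\<bar> \<le> B i + G" using B[OF t, of i] G[rule_format, of x i] by linarith
      then have "\<bar>h 0 i t + - g x $ i\<bar> * \<bar>h 0 i t + - g x $ i\<bar> \<le> (B i + G) * (B i + G)"
        by (intro mult_mono) auto
      then show ?thesis by simp
    qed
    then show ?thesis unfolding W_def by (intro mult_left_mono sum_mono) auto
  qed
  then show ?thesis by (rule that)
qed

text \<open>Below order \<open>m\<close> the derivatives of the field are continuous on a compact
  interval, and \<open>W\<close> stays in one compact range for all \<open>x\<close>.\<close>

lemma dp_bounded:
  assumes "dp k F" "k < m" shows "\<exists>C. \<forall>x. \<forall>t\<in>{0..T}. \<bar>F x t\<bar> \<le> C"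
  using assms(1)
proof induction
  case (const b B)
  then show ?case by blast
next
  case (deriv l i)
  have "compact (h l i ` {0..T})" using deriv assms(2) by (intro compact_continuous_image h_continuous) auto
  then show ?case using compact_imp_bounded[of "h l i ` {0..T}"] by (auto simp: bounded_iff)
next
  case (outer f)
  obtain Z where Z: "\<And>x t. t \<in> {0..T} \<Longrightarrow> W x t \<le> Z" using W_bounded by blast
  have "compact (f ` {0..Z})"
    by (intro compact_continuous_image continuous_at_imp_continuous_on) (auto intro: oclass_isCont[OF outer])
  then obtain C where C: "\<forall>y\<in>{0..Z}. \<bar>f y\<bar> \<le> C"
    using compact_imp_bounded[of "f ` {0..Z}"] by (auto simp: bounded_iff)
  have "\<bar>f (W x t)\<bar> \<le> C" if "t \<in> {0..T}" for x t
  proof -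
    have "W x t \<in> {0..Z}" using Z[OF that] W_nonneg by simp
    with C show ?thesis by blast
  qed
  then show ?case by blast
next
  case (add F G)
  then obtain C D where C: "\<forall>x. \<forall>t\<in>{0..T}. \<bar>F x t\<bar> \<le> C" and D: "\<forall>x. \<forall>t\<in>{0..T}. \<bar>G x t\<bar> \<le> D" by blast
  have "\<bar>F x t + G x t\<bar> \<le> C + D" if "t \<in> {0..T}" for x t
    using bspec[OF spec[OF C], OF that, of x] bspec[OF spec[OF D], OF that, of x] by linarith
  then show ?case by blast
next
  case (mult F G)
  then obtain C D where C: "\<forall>x. \<forall>t\<in>{0..T}. \<bar>F x t\<bar> \<le> C" and D: "\<forall>x. \<forall>t\<in>{0..T}. \<bar>G x t\<bar> \<le> D" by blast
  have "\<bar>F x t * G x t\<bar> \<le> C * D" if "t \<in> {0..T}" for x t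
  proof -
    have "\<bar>F x t\<bar> \<le> C" "\<bar>G x t\<bar> \<le> D" using C D that by blast+
    then show ?thesis unfolding abs_mult by (intro mult_mono) auto
  qed
  then show ?case by blast
qed

lemma dp_measurable_section:
  assumes "dp k F" shows "(\<lambda>x. F x t) \<in> borel_measurable M"
  using assms
proof induction
  case (outer f)
  have "(\<lambda>x. W x t) \<in> borel_measurable M"
    unfolding W_def by (intro borel_measurable_times borel_measurable_sum borel_measurable_add
      borel_measurable_uminus borel_measurable_const g_measurable)
  then show ?case by (rule measurable_compose[OF _ oclass_measurable[OF outer]])
qed (auto intro: borel_measurable_add borel_measurable_times)

lemma h_measurable_ivl: "l \<le> m \<Longrightarrow> h l i \<in> borel_measurable (ivl T)"
proof (cases "l = m")
  case True
  then show ?thesis using borel_measurable_ivl[OF h_borel] by simp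
next
  case False
  assume "l \<le> m"
  with False have "continuous_on {0<..<T} (h l i)"
    by (intro continuous_on_subset[OF h_continuous]) auto
  then show ?thesis by (intro continuous_imp_measurable_on_sets_lebesgue) auto
qed

lemma dp_measurable:
  assumes "dp k F" "k \<le> m" shows "case_prod F \<in> borel_measurable (M \<Otimes>\<^sub>M ivl T)"
  using assms(1)
proof induction
  case (const b B)
  then show ?case by (simp add: case_prod_beta')
next
  case (deriv l i)
  have "(\<lambda>z. h l i (snd z)) \<in> borel_measurable (M \<Otimes>\<^sub>M ivl T)"
    using deriv assms(2) by (intro measurable_compose[OF measurable_snd h_measurable_ivl]) simp
  then show ?case by (simp add: case_prod_beta')
next
  case (outer f)
  have h0: "(\<lambda>z. h 0 i (snd z)) \<in> borel_measurable (M \<Otimes>\<^sub>M ivl T)" for i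
    by (intro measurable_compose[OF measurable_snd h_measurable_ivl]) simp
  have g0: "(\<lambda>z. g (fst z) $ i) \<in> borel_measurable (M \<Otimes>\<^sub>M ivl T)" for i
    by (rule measurable_compose[OF measurable_fst g_measurable])
  have "(\<lambda>z. W (fst z) (snd z)) \<in> borel_measurable (M \<Otimes>\<^sub>M ivl T)"
    unfolding W_def by (intro borel_measurable_times borel_measurable_sum borel_measurable_add
      borel_measurable_uminus borel_measurable_const h0 g0)
  from measurable_compose[OF this oclass_measurable[OF outer]] show ?case by (simp add: case_prod_beta')
next
  case (add F G)
  then show ?case by (simp add: case_prod_beta')
next
  case (mult F G)
  then show ?case by (simp add: case_prod_beta')
qed

definition de :: "nat \<Rightarrow> ('x \<Rightarrow> real \<Rightarrow> real) \<Rightarrow> bool" where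
  "de k F \<longleftrightarrow> (\<exists>A R. (\<forall>i. dp k (A i)) \<and> dp k R \<and>
     F = (\<lambda>x t. (\<Sum>i\<in>UNIV. A i x t * h (Suc k) i t) + R x t))"

lemma de_add: "de k F \<Longrightarrow> de k G \<Longrightarrow> de k (\<lambda>x t. F x t + G x t)"
  unfolding de_def
proof (elim exE conjE)
  fix A R A' R'
  assume "\<forall>i. dp k (A i)" "dp k R" "F = (\<lambda>x t. (\<Sum>i\<in>UNIV. A i x t * h (Suc k) i t) + R x t)"
    "\<forall>i. dp k (A' i)" "dp k R'" "G = (\<lambda>x t. (\<Sum>i\<in>UNIV. A' i x t * h (Suc k) i t) + R' x t)"
  then show "\<exists>A R. (\<forall>i. dp k (A i)) \<and> dp k R \<and>
     (\<lambda>x t. F x t + G x t) = (\<lambda>x t. (\<Sum>i\<in>UNIV. A i x t * h (Suc k) i t) + R x t)"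
    by (intro exI[of _ "\<lambda>i x t. A i x t + A' i x t"] exI[of _ "\<lambda>x t. R x t + R' x t"])
       (auto intro: dp.add simp: distrib_right sum.distrib add_ac)
qed

lemma de_mult: "dp k G \<Longrightarrow> de k F \<Longrightarrow> de k (\<lambda>x t. G x t * F x t)"
  unfolding de_def
proof (elim exE conjE)
  fix A R
  assume "dp k G" "\<forall>i. dp k (A i)" "dp k R" "F = (\<lambda>x t. (\<Sum>i\<in>UNIV. A i x t * h (Suc k) i t) + R x t)"
  then show "\<exists>A R. (\<forall>i. dp k (A i)) \<and> dp k R \<and>
     (\<lambda>x t. G x t * F x t) = (\<lambda>x t. (\<Sum>i\<in>UNIV. A i x t * h (Suc k) i t) + R x t)"
    by (intro exI[of _ "\<lambda>i x t. G x t * A i x t"] exI[of _ "\<lambda>x t. G x t * R x t"])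
       (auto intro: dp.mult simp: distrib_left sum_distrib_left mult.assoc)
qed

lemma de_dp: "dp k F \<Longrightarrow> de k F"
  unfolding de_def
  by (intro exI[of _ "\<lambda>i x t. 0"] exI[of _ F]) (auto intro: dp_const)

lemma de_sum: "(\<And>i. i \<in> A \<Longrightarrow> de k (F i)) \<Longrightarrow> de k (\<lambda>x t. \<Sum>i\<in>A. F i x t)"
  by (induction A rule: infinite_finite_induct) (auto intro: de_dp dp_const de_add)

lemma de_h: "l \<le> Suc k \<Longrightarrow> de k (\<lambda>x t. h l i t)"
proof (cases "l = Suc k")
  case True
  have "(\<Sum>j\<in>UNIV. (if j = i then 1 else 0) * h (Suc k) j t) = h (Suc k) i t" for t
  proof -
    have "(\<Sum>j\<in>UNIV. (if j = i then 1 else 0) * h (Suc k) j t) = (\<Sum>j\<in>UNIV. if j = i then h (Suc k) i t else 0)"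
      by (intro sum.cong) auto
    then show ?thesis by simp
  qed
  then show ?thesis unfolding de_def True
    by (intro exI[of _ "\<lambda>j x t. if j = i then 1 else 0"] exI[of _ "\<lambda>x t. 0"]) (auto intro: dp_const)
next
  case False
  assume "l \<le> Suc k"
  with False show ?thesis by (intro de_dp dp.deriv) simp
qed

lemma dp_Suc_de: "de k F \<Longrightarrow> dp (Suc k) F"
  unfolding de_def by (auto intro!: dp.add dp_sum dp.mult dp.deriv intro: dp_mono)

lemma W_ac: "ac_on T (W x) (\<lambda>t. \<beta>\<^sup>2 * (\<Sum>i\<in>UNIV. (h 0 i t + - g x $ i) * h 1 i t + (h 0 i t + - g x $ i) * h 1 i t))"
proof -
  have "ac_on T (\<lambda>t. h 0 i t + - g x $ i) (\<lambda>t. h 1 i t + 0)" for i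
    using h_ac[of 0 i] m by (intro ac_on_add ac_on_const) simp
  then have "ac_on T (\<lambda>t. h 0 i t + - g x $ i) (h 1 i)" for i by simp
  then show ?thesis
    unfolding W_def[abs_def] by (intro ac_on_cmult ac_on_sum ac_on_mult)
qed

text \<open>Product and chain rule. Differentiation replaces one factor of order at most
  \<open>k\<close> by one of order at most \<open>Suc k\<close>, so the highest derivative enters
  linearly, as \<open>de\<close> demands; outer functions stay in their class by
  \<open>oclass_deriv\<close>.\<close>

lemma dp_deriv:
  assumes "dp k F" "k < m" shows "\<exists>F'. de k F' \<and> (\<forall>x. ac_on T (F x) (F' x))"
  using assms(1)
proof induction
  case (const b B)
  show ?case using de_dp[OF dp_const[of k 0]] ac_on_const by blast
next
  case (deriv l i)
  then show ?case using de_h[of "Suc l" k i] h_ac[of l i] assms(2)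
    by (intro exI[of _ "\<lambda>x t. h (Suc l) i t"]) auto
next
  case (outer f)
  obtain f1 where f1: "oclass f1" "\<forall>y\<ge>0. (f has_real_derivative f1 y) (at y)"
    using oclass_deriv[OF outer] by blast
  obtain f2 where f2: "oclass f2" "\<forall>y\<ge>0. (f1 has_real_derivative f2 y) (at y)"
    using oclass_deriv[OF f1(1)] by blast
  let ?W' = "\<lambda>x t. \<beta>\<^sup>2 * (\<Sum>i\<in>UNIV. (h 0 i t + - g x $ i) * h 1 i t + (h 0 i t + - g x $ i) * h 1 i t)"
  have "de k ?W'"
    by (intro de_mult de_sum de_add dp_const dp.add dp_g dp.deriv de_h) auto
  then have "de k (\<lambda>x t. f1 (W x t) * ?W' x t)"
    by (rule de_mult[OF dp.outer[OF f1(1)]])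
  moreover have "ac_on T (\<lambda>t. f (W x t)) (\<lambda>t. f1 (W x t) * ?W' x t)" for x
    by (rule ac_on_compose[OF W_ac]) (use W_nonneg f1 f2 oclass_isCont in auto)
  ultimately show ?case by blast
next
  case (add F G)
  then obtain F' G' where "de k F'" "\<forall>x. ac_on T (F x) (F' x)" "de k G'" "\<forall>x. ac_on T (G x) (G' x)" by blast
  then show ?case
    by (intro exI[of _ "\<lambda>x t. F' x t + G' x t"]) (auto intro: de_add ac_on_add)
next
  case (mult F G)
  then obtain F' G' where *: "de k F'" "\<forall>x. ac_on T (F x) (F' x)" "de k G'" "\<forall>x. ac_on T (G x) (G' x)" by blast
  show ?case
    using * mult.hyps by (intro exI[of _ "\<lambda>x t. G x t * F' x t + F x t * G' x t"]) (auto intro: de_add de_mult ac_on_mult)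
qed

text \<open>The coefficients are bounded uniformly in \<open>x\<close>, so the size is carried by
  the top derivative, which depends on time only.\<close>

lemma de_bound:
  assumes "de k F" "k < m"
  shows "\<exists>C\<ge>0. \<forall>x. \<forall>t\<in>{0..T}. \<bar>F x t\<bar> \<le> C * (1 + (\<Sum>i\<in>UNIV. \<bar>h (Suc k) i t\<bar>))"
proof -
  obtain A R where AR: "\<forall>i. dp k (A i)" "dp k R" "F = (\<lambda>x t. (\<Sum>i\<in>UNIV. A i x t * h (Suc k) i t) + R x t)"
    using assms(1) unfolding de_def by blast
  obtain B where B: "\<And>i x t. t \<in> {0..T} \<Longrightarrow> \<bar>A i x t\<bar> \<le> B i"
    using dp_bounded[OF spec[OF AR(1)] assms(2)] by metis
  obtain D where D: "\<And>x t. t \<in> {0..T} \<Longrightarrow> \<bar>R x t\<bar> \<le> D"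
    using dp_bounded[OF AR(2) assms(2)] by metis
  define C where "C = (\<Sum>i\<in>UNIV. \<bar>B i\<bar>) + \<bar>D\<bar>"
  have BC: "\<bar>B i\<bar> \<le> C" for i
  proof -
    have "\<bar>B i\<bar> \<le> (\<Sum>i\<in>UNIV. \<bar>B i\<bar>)" by (rule member_le_sum) auto
    then show ?thesis by (simp add: C_def)
  qed
  have DC: "\<bar>D\<bar> \<le> C" by (simp add: C_def sum_nonneg)
  have "\<bar>F x t\<bar> \<le> C * (1 + (\<Sum>i\<in>UNIV. \<bar>h (Suc k) i t\<bar>))" if t: "t \<in> {0..T}" for x t
  proof -
    have "\<bar>F x t\<bar> \<le> \<bar>\<Sum>i\<in>UNIV. A i x t * h (Suc k) i t\<bar> + \<bar>R x t\<bar>"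
      unfolding AR(3) by (rule abs_triangle_ineq)
    also have "\<dots> \<le> (\<Sum>i\<in>UNIV. \<bar>A i x t\<bar> * \<bar>h (Suc k) i t\<bar>) + \<bar>R x t\<bar>"
      using sum_abs[of "\<lambda>i. A i x t * h (Suc k) i t" UNIV] by (simp add: abs_mult)
    also have "\<dots> \<le> (\<Sum>i\<in>UNIV. C * \<bar>h (Suc k) i t\<bar>) + C"
    proof (intro add_mono sum_mono mult_right_mono)
      show "\<bar>A i x t\<bar> \<le> C" for i using B[OF t, of i x] BC[of i] by linarith
      show "\<bar>R x t\<bar> \<le> C" using D[OF t, of x] DC by linarith
    qed auto
    also have "\<dots> = C * (1 + (\<Sum>i\<in>UNIV. \<bar>h (Suc k) i t\<bar>))" by (simp add: sum_distrib_left distrib_left)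
    finally show ?thesis .
  qed
  moreover have "0 \<le> C" using DC by linarith
  ultimately show ?thesis by blast
qed

text \<open>A majorant, up to constants and uniformly in \<open>x\<close>, of all expressions
  \<open>de\<close> at the top order \<open>Suc k = m\<close>; the summand 1 takes care of the terms
  without the highest derivative.\<close>

definition V :: "real \<Rightarrow> real" where "V t = 1 + (\<Sum>i\<in>UNIV. \<bar>h m i t\<bar>)"

lemma V_ge_1: "1 \<le> V t" unfolding V_def by (simp add: sum_nonneg)

lemma V_integrable: "V absolutely_integrable_on {0..T}"
  unfolding V_def[abs_def]
  by (intro set_integral_add absolutely_integrable_sum set_integrable_abs h_integrable absolutely_integrable_continuous_real continuous_intros) auto

text \<open>Integrates the bound of the derivative by \<open>V\<close>. This is the regularity
  available for a coefficient that multiplies the nonsmooth top derivative.\<close>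

lemma dp_modulus:
  assumes "dp k F" "Suc k = m"
  shows "\<exists>C\<ge>0. \<forall>x s t. 0 \<le> s \<longrightarrow> s \<le> t \<longrightarrow> t \<le> T \<longrightarrow> \<bar>F x t - F x s\<bar> \<le> C * integral {s..t} V"
proof -
  obtain F' where F': "de k F'" "\<And>x. ac_on T (F x) (F' x)"
    using dp_deriv[OF assms(1)] assms(2) by auto
  obtain C where C: "0 \<le> C" "\<And>x t. t \<in> {0..T} \<Longrightarrow> \<bar>F' x t\<bar> \<le> C * V t"
    using de_bound[OF F'(1)] assms(2) unfolding V_def by auto
  have "\<bar>F x t - F x s\<bar> \<le> C * integral {s..t} V" if st: "0 \<le> s" "s \<le> t" "t \<le> T" for x s t
  proof -
    have "\<bar>F x t - F x s\<bar> \<le> integral {s..t} (\<lambda>t. \<bar>F' x t\<bar>)" by (rule ac_on_abs_diff[OF F'(2) st])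
    also have "\<dots> \<le> integral {s..t} (\<lambda>t. C * V t)"
    proof (rule integral_le)
      show "(\<lambda>t. \<bar>F' x t\<bar>) integrable_on {s..t}"
        by (rule abs_integrable_sub(3)[OF ac_on_integrable[OF F'(2)] st(1,3)])
      show "(\<lambda>t. C * V t) integrable_on {s..t}"
        by (rule integrable_on_mult_right[OF abs_integrable_sub(2)[OF V_integrable st(1,3)]])
    qed (use C st in auto)
    finally show ?thesis by simp
  qed
  with C(1) show ?thesis by blast
qed

text \<open>Alternates \<open>dp_deriv\<close>, which leads from \<open>dp\<close> to
  \<open>de\<close>, with \<open>dp_Suc_de\<close>, which reads the result as \<open>dp\<close> of
  one order more. As \<kappa> already contains first derivatives, \<open>m - 1\<close> further
  differentiations exhaust the regularity of the field.\<close>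

lemma de_chain:
  assumes "de 0 \<kappa>" "n < m"
  shows "\<exists>\<Phi>. \<Phi> 0 = \<kappa> \<and> (\<forall>j<n. \<forall>x. ac_on T (\<Phi> j x) (\<Phi> (Suc j) x)) \<and> (\<forall>j<n. dp (Suc j) (\<Phi> j)) \<and> de n (\<Phi> n)"
  using assms(2)
proof (induction n)
  case 0
  then show ?case using assms(1) by (intro exI[of _ "\<lambda>_. \<kappa>"]) auto
next
  case (Suc n)
  then obtain \<Phi> where \<Phi>: "\<Phi> 0 = \<kappa>" "\<forall>j<n. \<forall>x. ac_on T (\<Phi> j x) (\<Phi> (Suc j) x)"
    "\<forall>j<n. dp (Suc j) (\<Phi> j)" "de n (\<Phi> n)" by (metis Suc_lessD)
  obtain F' where F': "de (Suc n) F'" "\<forall>x. ac_on T (\<Phi> n x) (F' x)"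
    using dp_deriv[OF dp_Suc_de[OF \<Phi>(4)] Suc.prems] by blast
  show ?case
  proof (intro exI[of _ "\<Phi>(Suc n := F')"] conjI allI impI)
    show "ac_on T ((\<Phi>(Suc n := F')) j x) ((\<Phi>(Suc n := F')) (Suc j) x)" if "j < Suc n" for j x
      using that \<Phi>(2) F'(2) by (cases "j = n") auto
    show "dp (Suc j) ((\<Phi>(Suc n := F')) j)" if "j < Suc n" for j
      using that \<Phi>(3) dp_Suc_de[OF \<Phi>(4)] by (cases "j = n") auto
  qed (use \<Phi> F' in auto)
qed

end

lemma square_diff_const_integrable:
  fixes f :: "real \<Rightarrow> real"
  assumes f: "f integrable_on {s..t}" and f2: "(\<lambda>x. (f x)\<^sup>2) integrable_on {s..t}"
  shows "(\<lambda>x. (f x - c)\<^sup>2) integrable_on {s..t}"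
proof -
  have e: "(\<lambda>x. (f x - c)\<^sup>2) = (\<lambda>x. ((f x)\<^sup>2 + - 2 * c * f x) + c\<^sup>2)"
    by (auto simp: power2_eq_square algebra_simps)
  show ?thesis unfolding e
    by (intro integrable_add f2 integrable_on_mult_right f integrable_const_ivl)
qed

text \<open>Cauchy--Schwarz against the constant 1, read off from the nonnegative integral of the
  squared distance of \<open>f\<close> from its mean \<open>c\<close>.\<close>

lemma integral_square_le:
  fixes f :: "real \<Rightarrow> real"
  assumes f: "f integrable_on {s..t}" and f2: "(\<lambda>x. (f x)\<^sup>2) integrable_on {s..t}" and st: "s \<le> t"
  shows "(integral {s..t} f)\<^sup>2 \<le> (t - s) * integral {s..t} (\<lambda>x. (f x)\<^sup>2)"
proof (cases "s = t")
  case False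
  with st have d: "0 < t - s" by simp
  define I where "I = integral {s..t} f"
  define c where "c = I / (t - s)"
  have i1: "(\<lambda>x. - 2 * c * f x) integrable_on {s..t}" using f by (rule integrable_on_mult_right)
  have i2: "(\<lambda>x. c\<^sup>2) integrable_on {s..t}" by (rule integrable_const_ivl)
  have e: "(\<lambda>x. (f x - c)\<^sup>2) = (\<lambda>x. ((f x)\<^sup>2 + - 2 * c * f x) + c\<^sup>2)"
    by (auto simp: power2_eq_square algebra_simps)
  have "0 \<le> integral {s..t} (\<lambda>x. (f x - c)\<^sup>2)"
    by (rule integral_nonneg[OF square_diff_const_integrable[OF f f2]]) simp
  also have "\<dots> = integral {s..t} (\<lambda>x. (f x)\<^sup>2) + (- 2 * c * I + c\<^sup>2 * (t - s))"
    unfolding e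
    by (subst Henstock_Kurzweil_Integration.integral_add[OF integrable_add[OF f2 i1] i2],
        subst Henstock_Kurzweil_Integration.integral_add[OF f2 i1])
       (use st in \<open>simp add: I_def[symmetric] integral_mult_right\<close>)
  also have "- 2 * c * I + c\<^sup>2 * (t - s) = - (I\<^sup>2 / (t - s))"
  proof -
    have "- 2 * (I / L) * I + (I / L)\<^sup>2 * L = - (I\<^sup>2 / L)" if "0 < L" for L :: real
      using that by (simp add: power2_eq_square field_simps)
    from this[OF d] show ?thesis by (simp add: c_def)
  qed
  finally have "I\<^sup>2 / (t - s) \<le> integral {s..t} (\<lambda>x. (f x)\<^sup>2)" by simp
  then show ?thesis using d by (simp add: I_def pos_divide_le_eq mult.commute)
qed simp

lemma has_integral_shifted_power:
  fixes s t :: real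
  assumes "s \<le> t"
  shows "((\<lambda>\<tau>. (\<tau> - s) ^ j / fact j) has_integral (t - s) ^ Suc j / fact (Suc j)) {s..t}"
proof -
  have "((\<lambda>\<tau>. (\<tau> - s) ^ j / fact j) has_integral (t - s) ^ Suc j / fact (Suc j) - (s - s) ^ Suc j / fact (Suc j)) {s..t}"
  proof (rule fundamental_theorem_of_calculus[OF assms])
    fix x
    have "((\<lambda>\<tau>. (\<tau> - s) ^ Suc j / fact (Suc j)) has_real_derivative real (Suc j) * (x - s) ^ j / fact (Suc j)) (at x within {s..t})"
      by (auto intro!: derivative_eq_intros simp del: fact_Suc power_Suc)
    also have "real (Suc j) * (x - s) ^ j / fact (Suc j) = (x - s) ^ j / fact j"
      by (simp del: of_nat_Suc)
    finally show "((\<lambda>\<tau>. (\<tau> - s) ^ Suc j / fact (Suc j)) has_vector_derivative (x - s) ^ j / fact j) (at x within {s..t})"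
      by (simp only: has_real_derivative_iff_has_vector_derivative)
  qed
  then show ?thesis by simp
qed

section \<open>Taylor remainders and Slobodeckij seminorms on dyadic meshes\<close>

text \<open>The leading coefficient is an arbitrary \<open>E\<close> instead of \<open>\<Phi> n s\<close>, because \<open>\<Phi> n\<close> has no meaningful
  point values.\<close>

definition taylor_rem :: "(nat \<Rightarrow> real \<Rightarrow> real) \<Rightarrow> nat \<Rightarrow> real \<Rightarrow> real \<Rightarrow> real \<Rightarrow> real" where
  "taylor_rem \<Phi> n E s t = \<Phi> 0 t - (\<Sum>j<n. \<Phi> j s * ((t - s) ^ j / fact j)) - E * ((t - s) ^ n / fact n)"

text \<open>The remainder of order \<open>Suc n\<close> is the integral of the remainder of order
  \<open>n\<close> for the differentiated sequence. Each integration uses Cauchy--Schwarz once and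
  gains (e - s)^2, until only the distance of \<Phi> n from the constant \<open>E\<close> is
  left.\<close>

lemma taylor_rem_square:
  assumes "\<And>j. j < n \<Longrightarrow> ac_on T (\<Phi> j) (\<Phi> (Suc j))" and se: "0 \<le> s" "s \<le> e" "e \<le> T"
    and "\<Phi> n integrable_on {s..e}" "(\<lambda>t. (\<Phi> n t)\<^sup>2) integrable_on {s..e}"
  shows "taylor_rem \<Phi> n E s integrable_on {s..e} \<and> (\<lambda>t. (taylor_rem \<Phi> n E s t)\<^sup>2) integrable_on {s..e} \<and>
    integral {s..e} (\<lambda>t. (taylor_rem \<Phi> n E s t)\<^sup>2) \<le> (e - s) ^ (2 * n) * integral {s..e} (\<lambda>t. (\<Phi> n t - E)\<^sup>2)"
  using assms(1,5,6)
proof (induction n arbitrary: \<Phi>)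
  case 0
  have r: "taylor_rem \<Phi> 0 E s t = \<Phi> 0 t - E" for t by (simp add: taylor_rem_def)
  show ?case unfolding r[abs_def] r
    using square_diff_const_integrable[OF 0(2,3)] integrable_diff[OF 0(2) integrable_const_ivl] by auto
next
  case (Suc n)
  define \<Psi> where "\<Psi> = (\<lambda>j. \<Phi> (Suc j))"
  have IH: "taylor_rem \<Psi> n E s integrable_on {s..e}" "(\<lambda>t. (taylor_rem \<Psi> n E s t)\<^sup>2) integrable_on {s..e}"
    "integral {s..e} (\<lambda>t. (taylor_rem \<Psi> n E s t)\<^sup>2) \<le> (e - s) ^ (2 * n) * integral {s..e} (\<lambda>t. (\<Phi> (Suc n) t - E)\<^sup>2)"
    using Suc.IH[of \<Psi>] Suc.prems by (auto simp: \<Psi>_def)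
  have ac0: "ac_on T (\<Phi> 0) (\<Psi> 0)" using Suc.prems(1)[of 0] by (simp add: \<Psi>_def)
  have hi: "(taylor_rem \<Psi> n E s has_integral taylor_rem \<Phi> (Suc n) E s t) {s..t}" if t: "t \<in> {s..e}" for t
  proof -
    have st: "s \<le> t" "t \<le> T" using t se by auto
    have "(\<Psi> 0 has_integral \<Phi> 0 t - \<Phi> 0 s) {s..t}"
      using integrable_integral[OF abs_integrable_sub(2)[OF ac_on_integrable[OF ac0] se(1) st(2)]]
        ac_on_diff[OF ac0 se(1) st] by simp
    moreover have "((\<lambda>\<tau>. \<Sum>j<n. \<Psi> j s * ((\<tau> - s) ^ j / fact j)) has_integral
        (\<Sum>j<n. \<Psi> j s * ((t - s) ^ Suc j / fact (Suc j)))) {s..t}"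
      by (intro has_integral_sum has_integral_mult_right has_integral_shifted_power st) auto
    moreover have "((\<lambda>\<tau>. E * ((\<tau> - s) ^ n / fact n)) has_integral E * ((t - s) ^ Suc n / fact (Suc n))) {s..t}"
      by (intro has_integral_mult_right has_integral_shifted_power st)
    ultimately have "(taylor_rem \<Psi> n E s has_integral \<Phi> 0 t - \<Phi> 0 s - (\<Sum>j<n. \<Psi> j s * ((t - s) ^ Suc j / fact (Suc j)))
        - E * ((t - s) ^ Suc n / fact (Suc n))) {s..t}"
      unfolding taylor_rem_def[abs_def] by (intro has_integral_diff)
    also have "\<Phi> 0 t - \<Phi> 0 s - (\<Sum>j<n. \<Psi> j s * ((t - s) ^ Suc j / fact (Suc j))) - E * ((t - s) ^ Suc n / fact (Suc n))
       = taylor_rem \<Phi> (Suc n) E s t"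
      unfolding taylor_rem_def sum.lessThan_Suc_shift by (simp add: \<Psi>_def del: fact_Suc power_Suc)
    finally show ?thesis .
  qed
  define B where "B = (e - s) * integral {s..e} (\<lambda>t. (taylor_rem \<Psi> n E s t)\<^sup>2)"
  have B0: "0 \<le> integral {s..e} (\<lambda>t. (taylor_rem \<Psi> n E s t)\<^sup>2)"
    by (rule integral_nonneg[OF IH(2)]) simp
  have pt: "(taylor_rem \<Phi> (Suc n) E s t)\<^sup>2 \<le> B" if t: "t \<in> {s..e}" for t
  proof -
    have sub: "taylor_rem \<Psi> n E s integrable_on {s..t}" "(\<lambda>t. (taylor_rem \<Psi> n E s t)\<^sup>2) integrable_on {s..t}"
      using integrable_subinterval_real[OF IH(1), of s t] integrable_subinterval_real[OF IH(2), of s t] t by auto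
    have "(taylor_rem \<Phi> (Suc n) E s t)\<^sup>2 = (integral {s..t} (taylor_rem \<Psi> n E s))\<^sup>2"
      using integral_unique[OF hi[OF t]] by simp
    also have "\<dots> \<le> (t - s) * integral {s..t} (\<lambda>t. (taylor_rem \<Psi> n E s t)\<^sup>2)"
      using t by (intro integral_square_le sub) auto
    also have "\<dots> \<le> B" unfolding B_def
    proof (rule mult_mono)
      show "integral {s..t} (\<lambda>t. (taylor_rem \<Psi> n E s t)\<^sup>2) \<le> integral {s..e} (\<lambda>t. (taylor_rem \<Psi> n E s t)\<^sup>2)"
        using t by (intro integral_subset_le sub IH) auto
      show "0 \<le> integral {s..t} (\<lambda>t. (taylor_rem \<Psi> n E s t)\<^sup>2)" by (rule integral_nonneg[OF sub(2)]) simp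
    qed (use t in auto)
    finally show ?thesis .
  qed
  have cont: "continuous_on {s..e} (taylor_rem \<Phi> (Suc n) E s)"
    unfolding taylor_rem_def[abs_def]
    by (intro continuous_intros continuous_on_subset[OF ac_on_continuous[OF ac0]]) (use se in auto)
  have i2: "(\<lambda>t. (taylor_rem \<Phi> (Suc n) E s t)\<^sup>2) integrable_on {s..e}"
    by (intro integrable_continuous_real continuous_intros cont)
  have "integral {s..e} (\<lambda>t. (taylor_rem \<Phi> (Suc n) E s t)\<^sup>2) \<le> integral {s..e} (\<lambda>t. B)"
    by (rule integral_le[OF i2 integrable_const_ivl]) (rule pt)
  also have "\<dots> = (e - s)\<^sup>2 * integral {s..e} (\<lambda>t. (taylor_rem \<Psi> n E s t)\<^sup>2)"
    using se by (simp add: B_def power2_eq_square)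
  also have "\<dots> \<le> (e - s)\<^sup>2 * ((e - s) ^ (2 * n) * integral {s..e} (\<lambda>t. (\<Phi> (Suc n) t - E)\<^sup>2))"
    by (rule mult_left_mono[OF IH(3)]) simp
  also have "\<dots> = (e - s) ^ (2 * Suc n) * integral {s..e} (\<lambda>t. (\<Phi> (Suc n) t - E)\<^sup>2)"
    by (simp add: power_add power2_eq_square)
  finally show ?case using i2 integrable_continuous_real[OF cont] by blast
qed

section \<open>Nested dyadic meshes and the Gagliardo seminorm\<close>

definition dpt :: "real \<Rightarrow> nat \<Rightarrow> nat \<Rightarrow> real" where "dpt T J q = T * real q / 2 ^ J"

lemma dpt_bounds:
  assumes "0 < T"
  shows "0 \<le> dpt T J q" "dpt T J q < dpt T J (Suc q)" "q < 2 ^ J \<Longrightarrow> dpt T J (Suc q) \<le> T"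
    "dpt T J (Suc q) - dpt T J q = T / 2 ^ J" "dpt T J 0 = 0" "dpt T J (2 ^ J) = T"
proof -
  show "dpt T J (Suc q) \<le> T" if "q < 2 ^ J"
  proof -
    have "real (Suc q) \<le> 2 ^ J"
    proof -
      have "Suc q \<le> 2 ^ J" using that by simp
      then have "real (Suc q) \<le> real (2 ^ J)" by (simp only: of_nat_le_iff)
      then show ?thesis by simp
    qed
    then have "T * real (Suc q) / 2 ^ J \<le> T * 2 ^ J / 2 ^ J"
      using assms by (intro divide_right_mono mult_left_mono) auto
    then show ?thesis by (simp add: dpt_def del: of_nat_Suc)
  qed
  show "dpt T J q < dpt T J (Suc q)" using assms by (simp add: dpt_def divide_strict_right_mono)
  show "dpt T J (Suc q) - dpt T J q = T / 2 ^ J" by (simp add: dpt_def field_simps)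
qed (use assms in \<open>auto simp: dpt_def\<close>)

lemma dpt_mono: "0 < T \<Longrightarrow> q \<le> q' \<Longrightarrow> dpt T J q \<le> dpt T J q'"
  by (simp add: dpt_def divide_right_mono)

lemma sum_integral_dyadic:
  fixes f :: "real \<Rightarrow> real"
  assumes f: "f integrable_on {0..T}" and T: "0 < T"
  shows "(\<Sum>q<2 ^ J. integral {dpt T J q..dpt T J (Suc q)} f) = integral {0..T} f"
proof -
  have "(\<Sum>q<N. integral {dpt T J q..dpt T J (Suc q)} f) = integral {0..dpt T J N} f" if "N \<le> 2 ^ J" for N
    using that
  proof (induction N)
    case 0
    then show ?case by (simp add: dpt_bounds[OF T])
  next
    case (Suc N)
    have "integral {0..dpt T J N} f + integral {dpt T J N..dpt T J (Suc N)} f = integral {0..dpt T J (Suc N)} f"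
    proof (rule Henstock_Kurzweil_Integration.integral_combine)
      show "f integrable_on {0..dpt T J (Suc N)}"
        by (rule integrable_subinterval_real[OF f]) (use dpt_bounds(1,2)[OF T, of J N] dpt_bounds(3)[OF T, of N J] Suc.prems in auto)
    qed (use dpt_bounds(1,2)[OF T, of J N] in auto)
    then show ?case using Suc by simp
  qed
  from this[of "2 ^ J"] show ?thesis by (simp add: dpt_bounds[OF T])
qed

lemma dyadic_subset:
  assumes "0 < T" "q < 2 ^ J" shows "{dpt T J q..dpt T J (Suc q)} \<subseteq> {0..T}"
  using dpt_bounds(1,2)[OF assms(1), of J q] dpt_bounds(3)[OF assms] by auto

lemma nn_integral_open_interval:
  fixes f :: "real \<Rightarrow> real"
  assumes "\<And>x. 0 \<le> f x" "f integrable_on {s..e}"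
  shows "(\<integral>\<^sup>+x. indicator {s<..<e} x * ennreal (f x) \<partial>lborel) = ennreal (integral {s..e} f)"
proof -
  have "(f has_integral integral {s..e} f) {s<..<e}"
    using assms(2) has_integral_open_interval[of f "integral {s..e} f" s e] by (simp add: has_integral_integral)
  from nn_integral_has_integral_lebesgue[OF _ this] assms(1)
  have "(\<integral>\<^sup>+x. ennreal (indicator {s<..<e} x * f x) \<partial>lborel) = ennreal (integral {s..e} f)" by simp
  also have "(\<lambda>x. ennreal (indicator {s<..<e} x * f x)) = (\<lambda>x. indicator {s<..<e} x * ennreal (f x))"
    by (auto simp: indicator_def)
  finally show ?thesis .
qed

definition gkernel :: "real \<Rightarrow> (real \<Rightarrow> real) \<Rightarrow> real \<Rightarrow> real \<Rightarrow> ennreal" where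
  "gkernel \<sigma> v x y = ennreal ((v x - v y)\<^sup>2 / \<bar>x - y\<bar> powr (1 + 2 * \<sigma>))"

lemma gkernel_measurable [measurable (raw)]:
  assumes [measurable]: "v \<in> borel_measurable borel" "f \<in> borel_measurable N" "g \<in> borel_measurable N"
  shows "(\<lambda>z. gkernel \<sigma> v (f z) (g z)) \<in> borel_measurable N"
  unfolding gkernel_def by measurable

text \<open>The squared L2 distance of \<open>v\<close> from the constants on the interval, attained
  at the mean.\<close>

definition dev :: "real \<Rightarrow> real \<Rightarrow> (real \<Rightarrow> real) \<Rightarrow> real" where
  "dev s e v = integral {s..e} (\<lambda>x. (v x - integral {s..e} v / (e - s))\<^sup>2)"

lemma dev_nonneg:
  assumes "v integrable_on {s..e}" "(\<lambda>x. (v x)\<^sup>2) integrable_on {s..e}" shows "0 \<le> dev s e v"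
  unfolding dev_def by (rule integral_nonneg[OF square_diff_const_integrable[OF assms]]) simp

text \<open>A fractional Poincare inequality. The deviation from the mean at \<open>x\<close> is the
  average of v(x) - v(y) over the cell; after Cauchy--Schwarz the singular weight is inserted using
  |x - y| \<le> e - s. The exponent is (1 + 2 \<sigma>) - 1, the 1 being lost to the
  average.\<close>

lemma dev_le_gagliardo:
  fixes v :: "real \<Rightarrow> real"
  assumes [measurable]: "v \<in> borel_measurable borel" and se: "s < e" and \<sigma>: "0 < \<sigma>"
    and v: "v integrable_on {s..e}" "(\<lambda>x. (v x)\<^sup>2) integrable_on {s..e}"
  shows "ennreal (dev s e v) \<le> ennreal ((e - s) powr (2 * \<sigma>)) *
     (\<integral>\<^sup>+x. indicator {s<..<e} x * (\<integral>\<^sup>+y. indicator {s<..<e} y * gkernel \<sigma> v x y \<partial>lborel) \<partial>lborel)"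
proof -
  define c where "c = integral {s..e} v / (e - s)"
  define \<delta> where "\<delta> = e - s"
  have \<delta>: "0 < \<delta>" using se by (simp add: \<delta>_def)
  have i: "(\<lambda>x. (v x - c)\<^sup>2) integrable_on {s..e}" by (rule square_diff_const_integrable[OF v])
  have pt: "ennreal ((v x - c)\<^sup>2) \<le> ennreal (\<delta> powr (2 * \<sigma>)) * (\<integral>\<^sup>+y. indicator {s<..<e} y * gkernel \<sigma> v x y \<partial>lborel)"
    if x: "x \<in> {s<..<e}" for x
  proof -
    have i1: "(\<lambda>y. v x - v y) integrable_on {s..e}" by (rule integrable_diff[OF integrable_const_ivl v(1)])
    have i2: "(\<lambda>y. (v x - v y)\<^sup>2) integrable_on {s..e}"
      using square_diff_const_integrable[OF v, of "v x"] by (simp add: power2_commute)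
    have "integral {s..e} (\<lambda>y. v x - v y) = \<delta> * v x - integral {s..e} v"
      using se by (subst Henstock_Kurzweil_Integration.integral_diff[OF integrable_const_ivl v(1)]) (simp add: \<delta>_def)
    also have "\<dots> = \<delta> * (v x - c)" using \<delta> by (simp add: c_def \<delta>_def[symmetric] field_simps)
    finally have "(\<delta> * (v x - c))\<^sup>2 \<le> \<delta> * integral {s..e} (\<lambda>y. (v x - v y)\<^sup>2)"
      using integral_square_le[OF i1 i2] se by (simp add: \<delta>_def)
    then have "\<delta> * (\<delta> * (v x - c)\<^sup>2) \<le> \<delta> * integral {s..e} (\<lambda>y. (v x - v y)\<^sup>2)"
      by (simp only: power_mult_distrib power2_eq_square[of \<delta>] mult.assoc)
    then have "\<delta> * (v x - c)\<^sup>2 \<le> integral {s..e} (\<lambda>y. (v x - v y)\<^sup>2)"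
      using \<delta> by (simp only: mult_le_cancel_left_pos)
    then have "(v x - c)\<^sup>2 \<le> 1 / \<delta> * integral {s..e} (\<lambda>y. (v x - v y)\<^sup>2)"
      using \<delta> by (simp add: pos_le_divide_eq mult.commute)
    then have "ennreal ((v x - c)\<^sup>2) \<le> ennreal (1 / \<delta> * integral {s..e} (\<lambda>y. (v x - v y)\<^sup>2))" by (rule ennreal_leI)
    also have "\<dots> = ennreal (1 / \<delta>) * (\<integral>\<^sup>+y. indicator {s<..<e} y * ennreal ((v x - v y)\<^sup>2) \<partial>lborel)"
      by (simp only: nn_integral_open_interval[OF zero_le_power2 i2]) (rule ennreal_mult', use \<delta> in simp)
    also have "\<dots> \<le> ennreal (1 / \<delta>) * (\<integral>\<^sup>+y. ennreal (\<delta> powr (1 + 2 * \<sigma>)) * (indicator {s<..<e} y * gkernel \<sigma> v x y) \<partial>lborel)"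
    proof (rule mult_left_mono[OF nn_integral_mono])
      fix y
      show "indicator {s<..<e} y * ennreal ((v x - v y)\<^sup>2) \<le> ennreal (\<delta> powr (1 + 2 * \<sigma>)) * (indicator {s<..<e} y * gkernel \<sigma> v x y)"
      \<comment> \<open>On the diagonal the numerator is 0, so division by 0 does no harm.\<close>
      proof (cases "y \<in> {s<..<e} \<and> y \<noteq> x")
        case True
        have p: "0 < \<bar>x - y\<bar>" "\<bar>x - y\<bar> \<le> \<delta>" using True x by (auto simp: \<delta>_def)
        then have "\<bar>x - y\<bar> powr (1 + 2 * \<sigma>) \<le> \<delta> powr (1 + 2 * \<sigma>)" using \<sigma> by (intro powr_mono2) auto
        moreover have "0 < \<bar>x - y\<bar> powr (1 + 2 * \<sigma>)" using p by simp
        ultimately have "1 \<le> \<delta> powr (1 + 2 * \<sigma>) / \<bar>x - y\<bar> powr (1 + 2 * \<sigma>)" by simp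
        then have "(v x - v y)\<^sup>2 * 1 \<le> (v x - v y)\<^sup>2 * (\<delta> powr (1 + 2 * \<sigma>) / \<bar>x - y\<bar> powr (1 + 2 * \<sigma>))"
          by (intro mult_left_mono) auto
        then have "ennreal ((v x - v y)\<^sup>2) \<le> ennreal (\<delta> powr (1 + 2 * \<sigma>) * ((v x - v y)\<^sup>2 / \<bar>x - y\<bar> powr (1 + 2 * \<sigma>)))"
          by (intro ennreal_leI) (simp add: mult.commute)
        also have "\<dots> = ennreal (\<delta> powr (1 + 2 * \<sigma>)) * gkernel \<sigma> v x y"
          unfolding gkernel_def by (rule ennreal_mult') simp
        finally show ?thesis using True by simp
      next
        case False
        then show ?thesis by (auto simp: indicator_def)
      qed
    qed simp
    also have "\<dots> = ennreal (1 / \<delta>) * (ennreal (\<delta> powr (1 + 2 * \<sigma>)) * (\<integral>\<^sup>+y. indicator {s<..<e} y * gkernel \<sigma> v x y \<partial>lborel))"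
      by (subst nn_integral_cmult) auto
    finally have "ennreal ((v x - c)\<^sup>2) \<le> ennreal (1 / \<delta>) * (ennreal (\<delta> powr (1 + 2 * \<sigma>)) * (\<integral>\<^sup>+y. indicator {s<..<e} y * gkernel \<sigma> v x y \<partial>lborel))" .
    also have "\<dots> = ennreal (1 / \<delta> * \<delta> powr (1 + 2 * \<sigma>)) * (\<integral>\<^sup>+y. indicator {s<..<e} y * gkernel \<sigma> v x y \<partial>lborel)"
      by (subst ennreal_mult', use \<delta> in simp, simp only: mult.assoc)
    also have "1 / \<delta> * \<delta> powr (1 + 2 * \<sigma>) = \<delta> powr (2 * \<sigma>)"
      using \<delta> by (simp add: powr_add)
    finally show ?thesis .
  qed
  have "ennreal (dev s e v) = (\<integral>\<^sup>+x. indicator {s<..<e} x * ennreal ((v x - c)\<^sup>2) \<partial>lborel)"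
    unfolding dev_def c_def[symmetric] by (rule nn_integral_open_interval[OF _ i, symmetric]) simp
  also have "\<dots> \<le> (\<integral>\<^sup>+x. ennreal (\<delta> powr (2 * \<sigma>)) * (indicator {s<..<e} x * (\<integral>\<^sup>+y. indicator {s<..<e} y * gkernel \<sigma> v x y \<partial>lborel)) \<partial>lborel)"
    using pt by (intro nn_integral_mono) (auto simp: indicator_def)
  also have "\<dots> = ennreal (\<delta> powr (2 * \<sigma>)) * (\<integral>\<^sup>+x. indicator {s<..<e} x * (\<integral>\<^sup>+y. indicator {s<..<e} y * gkernel \<sigma> v x y \<partial>lborel) \<partial>lborel)"
    by (rule nn_integral_cmult) measurable
  finally show ?thesis by (simp add: \<delta>_def)
qed

lemma gagliardo_lborel:
  "gagliardo \<sigma> {0<..<T} v = (\<integral>\<^sup>+x. indicator {0<..<T} x * (\<integral>\<^sup>+y. indicator {0<..<T} y * gkernel \<sigma> v x y \<partial>lborel) \<partial>lborel)"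
  unfolding gagliardo_def gkernel_def
  by (simp add: nn_integral_restrict_space nn_integral_completion mult.commute)

lemma gagliardo_cong_AE:
  assumes "AE x in ivl T. v x = w x" shows "gagliardo \<sigma> {0<..<T} v = gagliardo \<sigma> {0<..<T} w"
  unfolding gagliardo_def
proof (rule nn_integral_cong_AE)
  show "AE x in ivl T. (\<integral>\<^sup>+y. ennreal ((v x - v y)\<^sup>2 / \<bar>x - y\<bar> powr (1 + 2 * \<sigma>)) \<partial>ivl T)
      = (\<integral>\<^sup>+y. ennreal ((w x - w y)\<^sup>2 / \<bar>x - y\<bar> powr (1 + 2 * \<sigma>)) \<partial>ivl T)"
    using assms
  proof eventually_elim
    case (elim x)
    show ?case
    proof (rule nn_integral_cong_AE)
      show "AE y in ivl T. ennreal ((v x - v y)\<^sup>2 / \<bar>x - y\<bar> powr (1 + 2 * \<sigma>))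
          = ennreal ((w x - w y)\<^sup>2 / \<bar>x - y\<bar> powr (1 + 2 * \<sigma>))"
        using assms by eventually_elim (simp add: elim)
    qed
  qed
qed

lemma gagliardo_abs_le: "gagliardo \<sigma> S (\<lambda>x. \<bar>v x\<bar>) \<le> gagliardo \<sigma> S v"
  unfolding gagliardo_def
proof (intro nn_integral_mono ennreal_leI divide_right_mono)
  fix x y
  have "\<bar>\<bar>v x\<bar> - \<bar>v y\<bar>\<bar> \<le> \<bar>v x - v y\<bar>" by (rule abs_triangle_ineq3)
  from power_mono[OF this, of 2] show "(\<bar>v x\<bar> - \<bar>v y\<bar>)\<^sup>2 \<le> (v x - v y)\<^sup>2" by simp
qed simp

text \<open>The squares of the cells are disjoint parts of (0, T) x (0, T), so the local double
  integrals sum to at most the full seminorm.\<close>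

lemma dev_sum_le:
  assumes vm[measurable]: "v \<in> borel_measurable borel" and T: "0 < T" and \<sigma>: "0 < \<sigma>"
    and v: "v integrable_on {0..T}" "(\<lambda>x. (v x)\<^sup>2) integrable_on {0..T}"
    and G: "gagliardo \<sigma> {0<..<T} v \<le> ennreal G" "0 \<le> G"
  shows "(\<Sum>q<2 ^ J. dev (dpt T J q) (dpt T J (Suc q)) v) \<le> (T / 2 ^ J) powr (2 * \<sigma>) * G"
proof -
  let ?I = "\<lambda>q. {dpt T J q<..<dpt T J (Suc q)}"
  let ?k = "\<lambda>A x. (\<integral>\<^sup>+y. indicator A y * gkernel \<sigma> v x y \<partial>lborel)"
  have sub: "v integrable_on {dpt T J q..dpt T J (Suc q)}" "(\<lambda>x. (v x)\<^sup>2) integrable_on {dpt T J q..dpt T J (Suc q)}"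
    if "q < 2 ^ J" for q
    using integrable_subinterval_real[OF v(1) dyadic_subset[OF T that]]
      integrable_subinterval_real[OF v(2) dyadic_subset[OF T that]] by auto
  have d0: "0 \<le> dev (dpt T J q) (dpt T J (Suc q)) v" if "q < 2 ^ J" for q
    by (rule dev_nonneg[OF sub[OF that]])
  have "ennreal (\<Sum>q<2 ^ J. dev (dpt T J q) (dpt T J (Suc q)) v) = (\<Sum>q<2 ^ J. ennreal (dev (dpt T J q) (dpt T J (Suc q)) v))"
    using d0 by (intro sum_ennreal[symmetric]) auto
  also have "\<dots> \<le> (\<Sum>q<2 ^ J. ennreal ((T / 2 ^ J) powr (2 * \<sigma>)) * (\<integral>\<^sup>+x. indicator (?I q) x * ?k (?I q) x \<partial>lborel))"
  proof (rule sum_mono)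
    fix q assume "q \<in> {..<(2::nat) ^ J}"
    then show "ennreal (dev (dpt T J q) (dpt T J (Suc q)) v) \<le> ennreal ((T / 2 ^ J) powr (2 * \<sigma>)) * (\<integral>\<^sup>+x. indicator (?I q) x * ?k (?I q) x \<partial>lborel)"
      by (intro dev_le_gagliardo[OF vm dpt_bounds(2)[OF T] \<sigma> sub, unfolded dpt_bounds(4)[OF T]]) simp_all
  qed
  also have "\<dots> = ennreal ((T / 2 ^ J) powr (2 * \<sigma>)) * (\<integral>\<^sup>+x. (\<Sum>q<2 ^ J. indicator (?I q) x * ?k (?I q) x) \<partial>lborel)"
    by (subst nn_integral_sum) (auto simp: sum_distrib_left)
  also have "\<dots> \<le> ennreal ((T / 2 ^ J) powr (2 * \<sigma>)) * (\<integral>\<^sup>+x. indicator {0<..<T} x * ?k {0<..<T} x \<partial>lborel)"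
  proof (intro mult_left_mono nn_integral_mono)
    fix x
    have sI: "?I q \<subseteq> {0<..<T}" if "q < 2 ^ J" for q
      using dpt_bounds(1,2)[OF T, of J q] dpt_bounds(3)[OF T that] by auto
    have dj: "disjoint_family_on ?I {..<2 ^ J}"
      unfolding disjoint_family_on_def
    proof (intro ballI impI)
      fix q q' :: nat assume "q \<noteq> q'"
      then consider "Suc q \<le> q'" | "Suc q' \<le> q" by linarith
      then show "?I q \<inter> ?I q' = {}"
        using dpt_mono[OF T, of "Suc q" q' J] dpt_mono[OF T, of "Suc q'" q J] by cases auto
    qed
    have "(\<Sum>q<2 ^ J. indicator (?I q) x * ?k (?I q) x) \<le> (\<Sum>q<2 ^ J. indicator (?I q) x * ?k {0<..<T} x)"
    proof (intro sum_mono mult_left_mono nn_integral_mono mult_right_mono)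
      fix q y assume "q \<in> {..<(2::nat) ^ J}"
      then show "indicator (?I q) y \<le> (indicator {0<..<T} y :: ennreal)" using sI[of q] by (auto simp: indicator_def)
    qed auto
    also have "\<dots> = indicator (\<Union>q<2 ^ J. ?I q) x * ?k {0<..<T} x"
      unfolding sum_distrib_right[symmetric] by (subst indicator_UN_disjoint[OF _ dj]) auto
    also have "\<dots> \<le> indicator {0<..<T} x * ?k {0<..<T} x"
    proof (rule mult_right_mono[OF indicator_leI])
      show "x \<in> {0<..<T}" if "x \<in> (\<Union>q<2 ^ J. ?I q)" using sI that by blast
    qed simp
    finally show "(\<Sum>q<2 ^ J. indicator (?I q) x * ?k (?I q) x) \<le> indicator {0<..<T} x * ?k {0<..<T} x" .
  qed auto
  also have "\<dots> \<le> ennreal ((T / 2 ^ J) powr (2 * \<sigma>)) * ennreal G"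
    using G(1) unfolding gagliardo_lborel by (intro mult_left_mono) auto
  also have "\<dots> = ennreal ((T / 2 ^ J) powr (2 * \<sigma>) * G)" using G(2) by (simp add: ennreal_mult')
  finally show ?thesis using G(2) by simp
qed

lemma dev_single_le:
  assumes "v \<in> borel_measurable borel" and T: "0 < T" and "0 < \<sigma>"
    and v: "v integrable_on {0..T}" "(\<lambda>x. (v x)\<^sup>2) integrable_on {0..T}"
    and "gagliardo \<sigma> {0<..<T} v \<le> ennreal G" "0 \<le> G" and q: "q < 2 ^ J"
  shows "dev (dpt T J q) (dpt T J (Suc q)) v \<le> (T / 2 ^ J) powr (2 * \<sigma>) * G"
proof -
  have "0 \<le> dev (dpt T J q) (dpt T J (Suc q)) v" if "q < 2 ^ J" for q
    by (rule dev_nonneg[OF integrable_subinterval_real[OF v(1) dyadic_subset[OF T that]]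
          integrable_subinterval_real[OF v(2) dyadic_subset[OF T that]]])
  then have "dev (dpt T J q) (dpt T J (Suc q)) v \<le> (\<Sum>q<2 ^ J. dev (dpt T J q) (dpt T J (Suc q)) v)"
    using q by (intro member_le_sum) auto
  also have "\<dots> \<le> (T / 2 ^ J) powr (2 * \<sigma>) * G" by (rule dev_sum_le) fact+
  finally show ?thesis .
qed

text \<open>The Cauchy--Schwarz inequality alone yields only the exponent $1/2$.  For larger \<open>\<sigma>\<close> the
  means over nested dyadic cells are compared.\<close>

lemma dyadic_integral_growth:
  assumes um: "u \<in> borel_measurable borel" and T: "0 < T" and \<sigma>: "0 < \<sigma>" "\<sigma> < 1"
    and u0: "\<And>x. 0 \<le> u x"
    and u: "u integrable_on {0..T}" "(\<lambda>x. (u x)\<^sup>2) integrable_on {0..T}"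
    and G: "gagliardo \<sigma> {0<..<T} u \<le> ennreal G" "0 \<le> G"
  shows "\<exists>K\<ge>0. \<forall>J q. q < 2 ^ J \<longrightarrow> integral {dpt T J q..dpt T J (Suc q)} u \<le> K * (T / 2 ^ J) powr \<sigma>"
proof -
  define I0 where "I0 = integral {0..T} u"
  have I0: "0 \<le> I0" unfolding I0_def by (rule integral_nonneg[OF u(1)]) (rule u0)
  \<comment> \<open>Passing to a child cell halves the contribution of the mean, while the target
    shrinks only by 2^(-\<sigma>); the quotient \<theta> is below 1 because \<sigma> < 1.\<close>
  define \<theta> where "\<theta> = 2 powr (\<sigma> - 1)"
  have \<theta>: "0 < \<theta>" "\<theta> < 1" using \<sigma> by (auto simp: \<theta>_def powr_less_one)
  define g where "g = 2 powr \<sigma> * sqrt (T * G)"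
  have g0: "0 \<le> g" using T G by (simp add: g_def)
  \<comment> \<open>\<open>K\<close> dominates both the start at level 0 and the fixed point of the
    recursion \<open>\<theta> * K + g\<close>, so the bound reproduces itself.\<close>
  define K where "K = max (I0 / T powr \<sigma>) (g / (1 - \<theta>))"
  have K1: "I0 \<le> K * T powr \<sigma>"
  proof -
    have "I0 / T powr \<sigma> \<le> K" by (simp add: K_def)
    then show ?thesis using T by (simp add: pos_divide_le_eq)
  qed
  have K2: "\<theta> * K + g \<le> K"
  proof -
    have "g / (1 - \<theta>) \<le> K" by (simp add: K_def)
    then have "g \<le> K * (1 - \<theta>)" using \<theta> by (simp add: pos_divide_le_eq)
    then show ?thesis by (simp add: algebra_simps)
  qed
  have K0: "0 \<le> K" using I0 by (simp add: K_def le_max_iff_disj)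
  have "integral {dpt T J q..dpt T J (Suc q)} u \<le> K * (T / 2 ^ J) powr \<sigma>" if "q < 2 ^ J" for J q
    using that
  proof (induction J arbitrary: q)
    case 0
    then show ?case using K1 by (simp add: dpt_def I0_def)
  next
    case (Suc J)
    \<comment> \<open>The parent of cell \<open>q\<close> on the next coarser mesh.\<close>
    define q' where "q' = q div 2"
    have q': "q' < 2 ^ J" using Suc.prems by (simp add: q'_def less_mult_imp_div_less mult.commute)
    define \<delta> where "\<delta> = T / 2 ^ Suc J"
    have \<delta>: "0 < \<delta>" "\<delta> \<le> T" "T / 2 ^ J = 2 * \<delta>"
    proof -
      show "0 < \<delta>" using T by (simp add: \<delta>_def)
      have "T * 1 \<le> T * 2 ^ Suc J" using T by (intro mult_left_mono one_le_power) auto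
      then show "\<delta> \<le> T" by (simp add: \<delta>_def pos_divide_le_eq)
      show "T / 2 ^ J = 2 * \<delta>" by (simp add: \<delta>_def)
    qed
    let ?s = "dpt T (Suc J) q" let ?e = "dpt T (Suc J) (Suc q)"
    let ?s' = "dpt T J q'" let ?e' = "dpt T J (Suc q')"
    have qq: "2 * q' \<le> q" "Suc q \<le> 2 * Suc q'" by (auto simp: q'_def)
    have "?s' = dpt T (Suc J) (2 * q')" "?e' = dpt T (Suc J) (2 * Suc q')" by (simp_all add: dpt_def field_simps)
    then have sub: "{?s..?e} \<subseteq> {?s'..?e'}"
      using dpt_mono[OF T qq(1), of "Suc J"] dpt_mono[OF T qq(2), of "Suc J"] by auto
    have se: "?s < ?e" "?e - ?s = \<delta>" "?e' - ?s' = 2 * \<delta>"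
    proof -
      show "?s < ?e" by (rule dpt_bounds(2)[OF T])
      show "?e - ?s = \<delta>" unfolding \<delta>_def by (rule dpt_bounds(4)[OF T])
      show "?e' - ?s' = 2 * \<delta>" unfolding \<delta>(3)[symmetric] by (rule dpt_bounds(4)[OF T])
    qed
    have iu': "u integrable_on {?s'..?e'}" "(\<lambda>x. (u x)\<^sup>2) integrable_on {?s'..?e'}"
      using integrable_subinterval_real[OF u(1) dyadic_subset[OF T q']]
        integrable_subinterval_real[OF u(2) dyadic_subset[OF T q']] by auto
    have iu: "u integrable_on {?s..?e}" "(\<lambda>x. (u x)\<^sup>2) integrable_on {?s..?e}"
      using integrable_subinterval_real[OF iu'(1) sub] integrable_subinterval_real[OF iu'(2) sub] by auto
    define c where "c = integral {?s'..?e'} u / (?e' - ?s')"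
    have i1: "(\<lambda>x. u x - c) integrable_on {?s..?e}" by (rule integrable_diff[OF iu(1) integrable_const_ivl])
    have i2: "(\<lambda>x. (u x - c)\<^sup>2) integrable_on {?s..?e}" by (rule square_diff_const_integrable[OF iu])
    have i2': "(\<lambda>x. (u x - c)\<^sup>2) integrable_on {?s'..?e'}" by (rule square_diff_const_integrable[OF iu'])
    have "(integral {?s..?e} (\<lambda>x. u x - c))\<^sup>2 \<le> \<delta> * integral {?s..?e} (\<lambda>x. (u x - c)\<^sup>2)"
      using integral_square_le[OF i1 i2] se by simp
    also have "\<dots> \<le> \<delta> * dev ?s' ?e' u"
      unfolding dev_def c_def[symmetric] using \<delta> sub by (intro mult_left_mono integral_subset_le i2 i2') auto
    \<comment> \<open>The factor \<delta> from Cauchy--Schwarz is given away for \<open>T\<close>;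
      the deviation on the parent cell alone supplies the decay.\<close>
    also have "\<dots> \<le> T * ((2 * \<delta>) powr (2 * \<sigma>) * G)"
      using dev_single_le[OF um T \<sigma>(1) u G q'] \<delta> G dev_nonneg[OF iu'] by (intro mult_mono) auto
    also have "\<dots> = (g * \<delta> powr \<sigma>)\<^sup>2"
    proof -
      have "(2 * \<delta>) powr (2 * \<sigma>) = (2 * \<delta>) powr \<sigma> * (2 * \<delta>) powr \<sigma>"
        unfolding powr_add[symmetric] by simp
      also have "(2 * \<delta>) powr \<sigma> = 2 powr \<sigma> * \<delta> powr \<sigma>"
        using \<delta> by (intro powr_mult)
      finally have "(2 * \<delta>) powr (2 * \<sigma>) = (2 powr \<sigma> * \<delta> powr \<sigma>)\<^sup>2"
        by (simp only: power2_eq_square)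
      moreover have "T * ((a * b)\<^sup>2 * G) = (a * sqrt (T * G) * b)\<^sup>2" for a b
        using T G by (simp add: power_mult_distrib)
      ultimately show ?thesis unfolding g_def by (simp only:)
    qed
    finally have "(integral {?s..?e} (\<lambda>x. u x - c))\<^sup>2 \<le> (g * \<delta> powr \<sigma>)\<^sup>2" .
    then have 1: "integral {?s..?e} (\<lambda>x. u x - c) \<le> g * \<delta> powr \<sigma>"
      by (rule power2_le_imp_le) (use g0 in simp)
    have "integral {?s..?e} u = integral {?s..?e} (\<lambda>x. u x - c) + c * \<delta>"
      using se by (subst Henstock_Kurzweil_Integration.integral_diff[OF iu(1) integrable_const_ivl]) auto
    also have "c * \<delta> = integral {?s'..?e'} u / 2" using se \<delta> by (simp add: c_def)
    also have "\<dots> \<le> K * (2 * \<delta>) powr \<sigma> / 2" using Suc.IH[OF q'] \<delta>(3) by simp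
    also have "\<dots> = \<theta> * K * \<delta> powr \<sigma>"
      using \<delta> by (simp add: \<theta>_def powr_mult powr_diff)
    finally have "integral {?s..?e} u \<le> (\<theta> * K + g) * \<delta> powr \<sigma>"
      using 1 by (simp add: distrib_right)
    also have "\<dots> \<le> K * \<delta> powr \<sigma>" by (intro mult_right_mono K2) simp
    finally show ?case by (simp add: \<delta>_def)
  qed
  then show ?thesis using K0 by blast
qed

context kernel_data
begin

lemma dp_continuous: "dp k F \<Longrightarrow> k < m \<Longrightarrow> continuous_on {0..T} (F x)"
  using dp_deriv[of k F] ac_on_continuous by blast

lemma de_integrable:
  assumes "de k F" "k < m" shows "F x absolutely_integrable_on {0..T}"
proof -
  obtain A R where AR: "\<forall>i. dp k (A i)" "dp k R" "F = (\<lambda>x t. (\<Sum>i\<in>UNIV. A i x t * h (Suc k) i t) + R x t)"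
    using assms(1) unfolding de_def by blast
  have "(\<lambda>t. A i x t * h (Suc k) i t) absolutely_integrable_on {0..T}" for i
    using assms(2) by (intro continuous_times_abs_integrable dp_continuous[OF spec[OF AR(1)]] h_integrable) auto
  moreover have "R x absolutely_integrable_on {0..T}"
    by (intro absolutely_integrable_continuous_real dp_continuous[OF AR(2) assms(2)])
  ultimately show ?thesis unfolding AR(3)
    by (intro set_integral_add absolutely_integrable_sum) auto
qed

lemma square_integrable_if_bounded:
  fixes f w :: "real \<Rightarrow> real"
  assumes f: "f absolutely_integrable_on {0..T}" and w2: "(\<lambda>t. (w t)\<^sup>2) integrable_on {0..T}"
    and le: "\<And>t. t \<in> {0..T} \<Longrightarrow> \<bar>f t\<bar> \<le> C * w t"
  shows "(\<lambda>t. (f t)\<^sup>2) integrable_on {0..T}"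
proof (rule measurable_bounded_by_integrable_imp_integrable)
  have "f \<in> borel_measurable (lebesgue_on {0..T})"
    using f by (rule absolutely_integrable_imp_borel_measurable) simp
  then show "(\<lambda>t. (f t)\<^sup>2) \<in> borel_measurable (lebesgue_on {0..T})" by (rule borel_measurable_power)
  show "(\<lambda>t. C\<^sup>2 * (w t)\<^sup>2) integrable_on {0..T}" using w2 by (rule integrable_on_mult_right)
  show "norm ((f t)\<^sup>2) \<le> C\<^sup>2 * (w t)\<^sup>2" if "t \<in> {0..T}" for t
    using power_mono[OF le[OF that], of 2] by (simp add: power_mult_distrib)
qed simp

end

section \<open>Low-rank approximation of the kernel\<close>

locale kernel_data_L2 = kernel_data +
  assumes h_square: "\<And>i. (\<lambda>t. (h m i t)\<^sup>2) integrable_on {0..T}"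
begin

lemma V_square: "(\<lambda>t. (V t)\<^sup>2) integrable_on {0..T}"
proof (rule measurable_bounded_by_integrable_imp_integrable)
  have "V \<in> borel_measurable (lebesgue_on {0..T})"
    using V_integrable by (rule absolutely_integrable_imp_borel_measurable) simp
  then show "(\<lambda>t. (V t)\<^sup>2) \<in> borel_measurable (lebesgue_on {0..T})" by (rule borel_measurable_power)
  show "(\<lambda>t. 2 + 2 * (real CARD('b) * (\<Sum>i\<in>UNIV. (h m i t)\<^sup>2))) integrable_on {0..T}"
    by (intro integrable_add integrable_const_ivl integrable_on_mult_right integrable_sum h_square) auto
  show "norm ((V t)\<^sup>2) \<le> 2 + 2 * (real CARD('b) * (\<Sum>i\<in>UNIV. (h m i t)\<^sup>2))" if "t \<in> {0..T}" for t
  proof -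
    define b where "b = (\<Sum>i\<in>UNIV. \<bar>h m i t\<bar>)"
    have "b\<^sup>2 \<le> (\<Sum>i\<in>UNIV. \<bar>h m i t\<bar>\<^sup>2) * real CARD('b)"
      unfolding b_def by (rule sum_squared_le_sum_of_squares)
    then have b2: "b\<^sup>2 \<le> real CARD('b) * (\<Sum>i\<in>UNIV. (h m i t)\<^sup>2)" by (simp add: mult.commute)
    have "2 * b \<le> 1 + b\<^sup>2" using sum_squares_bound[of 1 b] by simp
    then have "(1 + b)\<^sup>2 \<le> 2 + 2 * b\<^sup>2" by (simp add: power2_sum)
    with b2 show ?thesis by (simp add: V_def b_def[symmetric])
  qed
qed simp

definition V2 :: real where "V2 = integral {0..T} (\<lambda>t. (V t)\<^sup>2)"

lemma V2_nonneg: "0 \<le> V2"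
  unfolding V2_def by (rule integral_nonneg[OF V_square]) simp

lemma V_sub:
  assumes "q < 2 ^ J"
  shows "V integrable_on {dpt T J q..dpt T J (Suc q)}" "(\<lambda>t. (V t)\<^sup>2) integrable_on {dpt T J q..dpt T J (Suc q)}"
  using integrable_subinterval_real[OF set_lebesgue_integral_eq_integral(1)[OF V_integrable] dyadic_subset[OF T assms]]
    integrable_subinterval_real[OF V_square dyadic_subset[OF T assms]] by auto

lemma h_m_integrable: "h m i integrable_on {0..T}"
  by (rule set_lebesgue_integral_eq_integral(1)[OF h_integrable]) simp

lemma h_sub:
  assumes "q < 2 ^ J"
  shows "h m i integrable_on {dpt T J q..dpt T J (Suc q)}" "(\<lambda>t. (h m i t)\<^sup>2) integrable_on {dpt T J q..dpt T J (Suc q)}"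
  using integrable_subinterval_real[OF h_m_integrable dyadic_subset[OF T assms]]
    integrable_subinterval_real[OF h_square dyadic_subset[OF T assms]] by auto

text \<open>The growth bound is applied to each |h m i|; the summand 1 of \<open>V\<close>
  contributes the cell length, which is at most T^(1 - \<sigma>) times its own power of exponent
  \<sigma>.\<close>

lemma V_growth:
  assumes \<sigma>: "0 < \<sigma>" "\<sigma> < 1" and G: "\<And>i. gagliardo \<sigma> {0<..<T} (h m i) \<le> ennreal G" "0 \<le> G"
  shows "\<exists>K\<ge>0. \<forall>J q. q < 2 ^ J \<longrightarrow> integral {dpt T J q..dpt T J (Suc q)} V \<le> K * (T / 2 ^ J) powr \<sigma>"
proof -
  have "\<exists>K\<ge>0. \<forall>J q. q < 2 ^ J \<longrightarrow> integral {dpt T J q..dpt T J (Suc q)} (\<lambda>t. \<bar>h m i t\<bar>) \<le> K * (T / 2 ^ J) powr \<sigma>" for i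
  proof (rule dyadic_integral_growth[OF _ T \<sigma>])
    show "(\<lambda>t. \<bar>h m i t\<bar>) \<in> borel_measurable borel" using h_borel by (rule borel_measurable_abs)
    show "(\<lambda>t. \<bar>h m i t\<bar>) integrable_on {0..T}"
      using abs_integrable_sub(3)[OF h_integrable, of m 0 T i] by simp
    show "(\<lambda>t. \<bar>h m i t\<bar>\<^sup>2) integrable_on {0..T}" using h_square by simp
    show "gagliardo \<sigma> {0<..<T} (\<lambda>t. \<bar>h m i t\<bar>) \<le> ennreal G"
      using gagliardo_abs_le G(1) by (rule order_trans)
  qed (use G in auto)
  then obtain K where K: "\<And>i. 0 \<le> K i"
    "\<And>i J q. q < 2 ^ J \<Longrightarrow> integral {dpt T J q..dpt T J (Suc q)} (\<lambda>t. \<bar>h m i t\<bar>) \<le> K i * (T / 2 ^ J) powr \<sigma>"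
    by metis
  define K' where "K' = T powr (1 - \<sigma>) + (\<Sum>i\<in>UNIV. K i)"
  have "integral {dpt T J q..dpt T J (Suc q)} V \<le> K' * (T / 2 ^ J) powr \<sigma>" if q: "q < 2 ^ J" for J q
  proof -
    let ?I = "{dpt T J q..dpt T J (Suc q)}"
    define \<delta> where "\<delta> = T / 2 ^ J"
    have \<delta>: "0 < \<delta>" "\<delta> \<le> T"
    proof -
      show "0 < \<delta>" using T by (simp add: \<delta>_def)
      have "T * 1 \<le> T * 2 ^ J" using T by (intro mult_left_mono one_le_power) auto
      then show "\<delta> \<le> T" by (simp add: \<delta>_def pos_divide_le_eq)
    qed
    have ia: "(\<lambda>t. \<bar>h m i t\<bar>) integrable_on ?I" for i
      using abs_integrable_sub(3)[OF h_integrable, of m 0 T i]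
      by (intro integrable_subinterval_real[OF _ dyadic_subset[OF T q]]) simp
    have "integral ?I V = integral ?I (\<lambda>t. 1) + integral ?I (\<lambda>t. \<Sum>i\<in>UNIV. \<bar>h m i t\<bar>)"
      unfolding V_def[abs_def]
      by (intro Henstock_Kurzweil_Integration.integral_add integrable_const_ivl integrable_sum ia) auto
    also have "integral ?I (\<lambda>t. 1) = \<delta>"
      using dpt_bounds(2)[OF T, of J q] dpt_bounds(4)[OF T, of J q] by (simp add: \<delta>_def)
    also have "integral ?I (\<lambda>t. \<Sum>i\<in>UNIV. \<bar>h m i t\<bar>) = (\<Sum>i\<in>UNIV. integral ?I (\<lambda>t. \<bar>h m i t\<bar>))"
      by (intro Henstock_Kurzweil_Integration.integral_sum ia) auto
    also have "\<dots> \<le> (\<Sum>i\<in>UNIV. K i * \<delta> powr \<sigma>)"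
      unfolding \<delta>_def by (intro sum_mono K(2)[OF q])
    finally have 1: "integral ?I V \<le> \<delta> + (\<Sum>i\<in>UNIV. K i) * \<delta> powr \<sigma>"
      by (simp add: sum_distrib_right)
    have "\<delta> = \<delta> powr (1 - \<sigma>) * \<delta> powr \<sigma>" using \<delta> by (simp add: powr_add[symmetric])
    also have "\<delta> powr (1 - \<sigma>) * \<delta> powr \<sigma> \<le> T powr (1 - \<sigma>) * \<delta> powr \<sigma>"
      using \<delta> \<sigma> by (intro mult_right_mono powr_mono2) auto
    finally have "\<delta> \<le> T powr (1 - \<sigma>) * \<delta> powr \<sigma>" .
    with 1 show ?thesis unfolding K'_def distrib_right \<delta>_def[symmetric] by linarith
  qed
  moreover have "0 \<le> K'" using K(1) by (simp add: K'_def sum_nonneg)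
  ultimately show ?thesis by blast
qed

text \<open>On a cell, A h - A_s c = A (h - c) + (A - A_s) c, where A_s is the value at the left end
  point and c the mean of the top derivative h. The first part is governed by the deviation of h;
  the second by the modulus of A, an integral of \<open>V\<close> over the cell, times |c|, which is
  at most the mean of \<open>V\<close>.\<close>

lemma frozen_coefficients:
  assumes F: "de k F" "Suc k = m"
    and \<sigma>: "0 < \<sigma>" "\<sigma> < 1" and G: "\<And>i. gagliardo \<sigma> {0<..<T} (h m i) \<le> ennreal G" "0 \<le> G"
  shows "\<exists>C\<ge>0. \<forall>J. \<exists>E. (\<forall>q<2 ^ J. E q \<in> borel_measurable M \<and> (\<exists>B. \<forall>x. \<bar>E q x\<bar> \<le> B)) \<and>
     (\<forall>x. (\<Sum>q<2 ^ J. integral {dpt T J q..dpt T J (Suc q)} (\<lambda>t. (F x t - E q x)\<^sup>2)) \<le> C * (T / 2 ^ J) powr (2 * \<sigma>))"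
proof -
  obtain A R where AR: "\<forall>i. dp k (A i)" "dp k R" "F = (\<lambda>x t. (\<Sum>i\<in>UNIV. A i x t * h (Suc k) i t) + R x t)"
    using F(1) unfolding de_def by blast
  have km: "k < m" using F(2) by simp
  obtain BA where BA: "\<And>i x t. t \<in> {0..T} \<Longrightarrow> \<bar>A i x t\<bar> \<le> BA i"
    using dp_bounded[OF spec[OF AR(1)] km] by metis
  obtain BR where BR: "\<And>x t. t \<in> {0..T} \<Longrightarrow> \<bar>R x t\<bar> \<le> BR"
    using dp_bounded[OF AR(2) km] by metis
  obtain CA where CA: "\<And>i. 0 \<le> CA i"
    "\<And>i x s t. 0 \<le> s \<Longrightarrow> s \<le> t \<Longrightarrow> t \<le> T \<Longrightarrow> \<bar>A i x t - A i x s\<bar> \<le> CA i * integral {s..t} V"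
    using dp_modulus[OF spec[OF AR(1)] F(2)] by metis
  obtain CR where CR: "0 \<le> CR"
    "\<And>x s t. 0 \<le> s \<Longrightarrow> s \<le> t \<Longrightarrow> t \<le> T \<Longrightarrow> \<bar>R x t - R x s\<bar> \<le> CR * integral {s..t} V"
    using dp_modulus[OF AR(2) F(2)] by metis
  obtain K where K: "0 \<le> K" "\<And>J q. q < 2 ^ J \<Longrightarrow> integral {dpt T J q..dpt T J (Suc q)} V \<le> K * (T / 2 ^ J) powr \<sigma>"
    using V_growth[OF \<sigma> G] by blast
  define C where "C = (\<Sum>i\<in>UNIV. \<bar>BA i\<bar>) + (\<Sum>i\<in>UNIV. CA i) + CR"
  have sA: "0 \<le> (\<Sum>i\<in>UNIV. \<bar>BA i\<bar>)" "0 \<le> (\<Sum>i\<in>UNIV. CA i)" using CA(1) by (auto intro: sum_nonneg)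
  have C0: "0 \<le> C" using CR(1) sA by (simp add: C_def)
  have BAC: "\<bar>BA i\<bar> \<le> C" for i
  proof -
    have "\<bar>BA i\<bar> \<le> (\<Sum>i\<in>UNIV. \<bar>BA i\<bar>)" by (rule member_le_sum) auto
    then show ?thesis using CR(1) sA unfolding C_def by linarith
  qed
  have CAC: "CA i \<le> C" for i
  proof -
    have "CA i \<le> (\<Sum>i\<in>UNIV. CA i)" by (rule member_le_sum) (use CA(1) in auto)
    then show ?thesis using CR(1) sA unfolding C_def by linarith
  qed
  have CRC: "CR \<le> C" using sA by (simp add: C_def)
  define d where "d = real CARD('b)"
  define C' where "C' = 2 * C\<^sup>2 * (d * (d * G) + K\<^sup>2 * V2)"
  have C'0: "0 \<le> C'" unfolding C'_def d_def using G V2_nonneg by (intro mult_nonneg_nonneg add_nonneg_nonneg) auto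
  have "\<exists>E. (\<forall>q<2 ^ J. E q \<in> borel_measurable M \<and> (\<exists>B. \<forall>x. \<bar>E q x\<bar> \<le> B)) \<and>
     (\<forall>x. (\<Sum>q<2 ^ J. integral {dpt T J q..dpt T J (Suc q)} (\<lambda>t. (F x t - E q x)\<^sup>2)) \<le> C' * (T / 2 ^ J) powr (2 * \<sigma>))" for J
  proof -
    define \<delta> where "\<delta> = T / 2 ^ J"
    have \<delta>: "0 < \<delta>" using T by (simp add: \<delta>_def)
    let ?I = "\<lambda>q. {dpt T J q..dpt T J (Suc q)}"
    define c where "c i q = integral (?I q) (h m i) / (dpt T J (Suc q) - dpt T J q)" for i q
    have cI: "c i q = integral (?I q) (h m i) / \<delta>" for i q
      unfolding c_def \<delta>_def by (simp only: dpt_bounds(4)[OF T])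
    define L where "L q = integral (?I q) V" for q
    \<comment> \<open>regular factors are frozen at the left end point, the highest derivative is averaged\<close>
    define E where "E q x = (\<Sum>i\<in>UNIV. A i x (dpt T J q) * c i q) + R x (dpt T J q)" for q x
    have Em: "E q \<in> borel_measurable M" for q
      unfolding E_def using AR dp_measurable_section
      by (intro borel_measurable_add borel_measurable_sum borel_measurable_times borel_measurable_const) auto
    have Eb: "\<bar>E q x\<bar> \<le> (\<Sum>i\<in>UNIV. \<bar>BA i\<bar> * \<bar>c i q\<bar>) + BR" if q: "q < 2 ^ J" for q x
    proof -
      have p: "dpt T J q \<in> {0..T}" using dyadic_subset[OF T q] dpt_bounds(2)[OF T, of J q] by auto
      have "\<bar>E q x\<bar> \<le> \<bar>\<Sum>i\<in>UNIV. A i x (dpt T J q) * c i q\<bar> + \<bar>R x (dpt T J q)\<bar>"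
        unfolding E_def by (rule abs_triangle_ineq)
      also have "\<dots> \<le> (\<Sum>i\<in>UNIV. \<bar>A i x (dpt T J q)\<bar> * \<bar>c i q\<bar>) + BR"
        using sum_abs[of "\<lambda>i. A i x (dpt T J q) * c i q" UNIV] BR[OF p, of x] by (simp add: abs_mult)
      also have "\<dots> \<le> (\<Sum>i\<in>UNIV. \<bar>BA i\<bar> * \<bar>c i q\<bar>) + BR"
        using BA[OF p, of _ x] by (intro add_mono sum_mono mult_right_mono order_refl) (meson abs_ge_self order_trans, simp)
      finally show ?thesis .
    qed
    have main: "integral (?I q) (\<lambda>t. (F x t - E q x)\<^sup>2)
        \<le> 2 * C\<^sup>2 * (d * (\<Sum>i\<in>UNIV. dev (dpt T J q) (dpt T J (Suc q)) (h m i)) + K\<^sup>2 * \<delta> powr (2 * \<sigma>) * integral (?I q) (\<lambda>t. (V t)\<^sup>2))"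
      if q: "q < 2 ^ J" for q x
    proof -
      let ?s = "dpt T J q" let ?e = "dpt T J (Suc q)"
      have se: "?s < ?e" "?e - ?s = \<delta>" "0 \<le> ?s" "?e \<le> T"
        using dpt_bounds(1)[OF T, of J q] dpt_bounds(2)[OF T, of J q] dpt_bounds(4)[OF T, of J q] dpt_bounds(3)[OF T q]
        by (simp_all add: \<delta>_def)
      have L0: "0 \<le> L q" unfolding L_def
        by (rule integral_nonneg[OF V_sub(1)[OF q]]) (use V_ge_1 in \<open>auto intro: order_trans[OF zero_le_one]\<close>)
      \<comment> \<open>All means together, with the 1 standing for the term \<open>R\<close>, are
        bounded by the mean of \<open>V\<close> on the cell.\<close>
      have csum: "1 + (\<Sum>i\<in>UNIV. \<bar>c i q\<bar>) \<le> L q / \<delta>"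
      proof -
        have ia: "(\<lambda>t. \<bar>h m i t\<bar>) integrable_on ?I q" for i
          using abs_integrable_sub(3)[OF h_integrable, of m 0 T i]
          by (intro integrable_subinterval_real[OF _ dyadic_subset[OF T q]]) simp
        have "\<bar>c i q\<bar> \<le> integral (?I q) (\<lambda>t. \<bar>h m i t\<bar>) / \<delta>" for i
        proof -
          have "\<bar>integral (?I q) (h m i)\<bar> \<le> integral (?I q) (\<lambda>t. \<bar>h m i t\<bar>)"
            using abs_integral_le[OF h_integrable[of m i]] se by simp
          then show ?thesis using \<delta> by (simp add: cI abs_divide divide_right_mono)
        qed
        then have "1 + (\<Sum>i\<in>UNIV. \<bar>c i q\<bar>) \<le> \<delta> / \<delta> + (\<Sum>i\<in>UNIV. integral (?I q) (\<lambda>t. \<bar>h m i t\<bar>) / \<delta>)"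
          using \<delta> by (intro add_mono sum_mono) auto
        also have "\<dots> = (\<delta> + (\<Sum>i\<in>UNIV. integral (?I q) (\<lambda>t. \<bar>h m i t\<bar>))) / \<delta>"
          by (simp add: add_divide_distrib sum_divide_distrib)
        also have "\<delta> + (\<Sum>i\<in>UNIV. integral (?I q) (\<lambda>t. \<bar>h m i t\<bar>)) = integral (?I q) (\<lambda>t. 1) + integral (?I q) (\<lambda>t. \<Sum>i\<in>UNIV. \<bar>h m i t\<bar>)"
        proof -
          have "integral (?I q) (\<lambda>t. 1) = \<delta>" using se by simp
          moreover have "integral (?I q) (\<lambda>t. \<Sum>i\<in>UNIV. \<bar>h m i t\<bar>) = (\<Sum>i\<in>UNIV. integral (?I q) (\<lambda>t. \<bar>h m i t\<bar>))"
            by (intro Henstock_Kurzweil_Integration.integral_sum ia) auto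
          ultimately show ?thesis by simp
        qed
        also have "\<dots> = L q" unfolding L_def V_def[abs_def]
          by (intro Henstock_Kurzweil_Integration.integral_add[symmetric] integrable_const_ivl integrable_sum ia) auto
        finally show ?thesis .
      qed
      have pt: "(F x t - E q x)\<^sup>2 \<le> 2 * C\<^sup>2 * (d * (\<Sum>i\<in>UNIV. (h m i t - c i q)\<^sup>2) + (L q * (L q / \<delta>))\<^sup>2)"
        if t: "t \<in> ?I q" for t
      proof -
        have tT: "t \<in> {0..T}" using t se by auto
        have Lt: "integral {?s..t} V \<le> L q"
          unfolding L_def
        proof (rule integral_subset_le)
          show "V integrable_on {?s..t}" by (rule integrable_subinterval_real[OF V_sub(1)[OF q]]) (use t in auto)
          show "V integrable_on ?I q" by (rule V_sub(1)[OF q])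
          show "\<forall>x\<in>?I q. 0 \<le> V x" using V_ge_1 by (auto intro: order_trans[OF zero_le_one])
        qed (use t in auto)
        have dA: "\<bar>A i x t - A i x ?s\<bar> \<le> C * L q" for i
        proof -
          have "\<bar>A i x t - A i x ?s\<bar> \<le> CA i * integral {?s..t} V" using t se by (intro CA(2)) auto
          also have "\<dots> \<le> CA i * L q" using CA(1) by (intro mult_left_mono Lt)
          also have "\<dots> \<le> C * L q" using L0 by (intro mult_right_mono CAC)
          finally show ?thesis .
        qed
        have dR: "\<bar>R x t - R x ?s\<bar> \<le> C * L q"
        proof -
          have "\<bar>R x t - R x ?s\<bar> \<le> CR * integral {?s..t} V" using t se by (intro CR(2)) auto
          also have "\<dots> \<le> CR * L q" using CR(1) by (intro mult_left_mono Lt)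
          also have "\<dots> \<le> C * L q" using L0 by (intro mult_right_mono CRC)
          finally show ?thesis .
        qed
        have Ab: "\<bar>A i x t\<bar> \<le> C" for i using BA[OF tT, of i x] BAC[of i] by linarith
        define a where "a = (\<Sum>i\<in>UNIV. \<bar>h m i t - c i q\<bar>)"
        have summand: "\<bar>A i x t * h m i t - A i x ?s * c i q\<bar> \<le> C * \<bar>h m i t - c i q\<bar> + C * L q * \<bar>c i q\<bar>" for i
        proof -
          have "A i x t * h m i t - A i x ?s * c i q = A i x t * (h m i t - c i q) + (A i x t - A i x ?s) * c i q"
            by (simp add: algebra_simps)
          also have "\<bar>\<dots>\<bar> \<le> \<bar>A i x t * (h m i t - c i q)\<bar> + \<bar>(A i x t - A i x ?s) * c i q\<bar>"
            by (rule abs_triangle_ineq)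
          also have "\<dots> \<le> C * \<bar>h m i t - c i q\<bar> + C * L q * \<bar>c i q\<bar>"
            unfolding abs_mult using Ab[of i] dA[of i] by (intro add_mono mult_right_mono) auto
          finally show ?thesis .
        qed
        have FE: "F x t - E q x = (\<Sum>i\<in>UNIV. A i x t * h m i t - A i x ?s * c i q) + (R x t - R x ?s)"
          unfolding AR(3) E_def F(2) by (simp add: sum_subtractf)
        have "\<bar>F x t - E q x\<bar> \<le> \<bar>\<Sum>i\<in>UNIV. A i x t * h m i t - A i x ?s * c i q\<bar> + \<bar>R x t - R x ?s\<bar>"
          unfolding FE by (rule abs_triangle_ineq)
        also have "\<dots> \<le> (\<Sum>i\<in>UNIV. C * \<bar>h m i t - c i q\<bar> + C * L q * \<bar>c i q\<bar>) + C * L q"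
          by (intro add_mono dR order_trans[OF sum_abs] sum_mono summand)
        also have "\<dots> = C * a + C * L q * (1 + (\<Sum>i\<in>UNIV. \<bar>c i q\<bar>))"
          by (simp add: a_def sum.distrib sum_distrib_left distrib_left)
        also have "\<dots> \<le> C * a + C * L q * (L q / \<delta>)"
          using csum C0 L0 by (intro add_left_mono mult_left_mono) auto
        also have "\<dots> = C * (a + L q * (L q / \<delta>))" by (simp add: algebra_simps)
        finally have "\<bar>F x t - E q x\<bar>\<^sup>2 \<le> (C * (a + L q * (L q / \<delta>)))\<^sup>2" by (intro power_mono) auto
        also have "\<dots> = C\<^sup>2 * (a + L q * (L q / \<delta>))\<^sup>2" by (rule power_mult_distrib)
        also have "\<dots> \<le> C\<^sup>2 * (2 * a\<^sup>2 + 2 * (L q * (L q / \<delta>))\<^sup>2)"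
        proof (rule mult_left_mono)
          show "(a + b)\<^sup>2 \<le> 2 * a\<^sup>2 + 2 * b\<^sup>2" for b
            using sum_squares_bound[of a b] by (simp add: power2_sum)
        qed simp
        also have "\<dots> = 2 * C\<^sup>2 * (a\<^sup>2 + (L q * (L q / \<delta>))\<^sup>2)" by (simp add: algebra_simps)
        also have "\<dots> \<le> 2 * C\<^sup>2 * (d * (\<Sum>i\<in>UNIV. (h m i t - c i q)\<^sup>2) + (L q * (L q / \<delta>))\<^sup>2)"
        proof (intro mult_left_mono add_right_mono)
          have "a\<^sup>2 \<le> (\<Sum>i\<in>UNIV. \<bar>h m i t - c i q\<bar>\<^sup>2) * real CARD('b)"
            unfolding a_def by (rule sum_squared_le_sum_of_squares)
          then show "a\<^sup>2 \<le> d * (\<Sum>i\<in>UNIV. (h m i t - c i q)\<^sup>2)" by (simp add: d_def mult.commute)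
        qed simp
        finally show ?thesis by simp
      qed
      have isq: "(\<lambda>t. (h m i t - c i q)\<^sup>2) integrable_on ?I q" for i
        by (rule square_diff_const_integrable[OF h_sub[OF q]])
      have iR: "(\<lambda>t. 2 * C\<^sup>2 * (d * (\<Sum>i\<in>UNIV. (h m i t - c i q)\<^sup>2) + (L q * (L q / \<delta>))\<^sup>2)) integrable_on ?I q"
        by (intro integrable_on_mult_right integrable_add integrable_sum isq integrable_const_ivl) auto
      have Fi: "F x absolutely_integrable_on {0..T}" by (rule de_integrable[OF F(1) km])
      obtain CF where CF: "\<And>t. t \<in> {0..T} \<Longrightarrow> \<bar>F x t\<bar> \<le> CF * V t"
        using de_bound[OF F(1) km] unfolding V_def F(2) by metis
      have Fs: "F x integrable_on ?I q" "(\<lambda>t. (F x t)\<^sup>2) integrable_on ?I q"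
        using integrable_subinterval_real[OF set_lebesgue_integral_eq_integral(1)[OF Fi] dyadic_subset[OF T q]]
          integrable_subinterval_real[OF square_integrable_if_bounded[OF Fi V_square CF] dyadic_subset[OF T q]] by auto
      have "integral (?I q) (\<lambda>t. (F x t - E q x)\<^sup>2)
         \<le> integral (?I q) (\<lambda>t. 2 * C\<^sup>2 * (d * (\<Sum>i\<in>UNIV. (h m i t - c i q)\<^sup>2) + (L q * (L q / \<delta>))\<^sup>2))"
        by (rule integral_le[OF square_diff_const_integrable[OF Fs] iR]) (rule pt)
      also have "\<dots> = 2 * C\<^sup>2 * (d * (\<Sum>i\<in>UNIV. dev ?s ?e (h m i)) + (L q * (L q / \<delta>))\<^sup>2 * \<delta>)"
      proof -
        have "integral (?I q) (\<lambda>t. d * (\<Sum>i\<in>UNIV. (h m i t - c i q)\<^sup>2) + (L q * (L q / \<delta>))\<^sup>2)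
           = integral (?I q) (\<lambda>t. d * (\<Sum>i\<in>UNIV. (h m i t - c i q)\<^sup>2)) + integral (?I q) (\<lambda>t. (L q * (L q / \<delta>))\<^sup>2)"
          by (intro Henstock_Kurzweil_Integration.integral_add integrable_on_mult_right integrable_sum isq integrable_const_ivl) auto
        also have "integral (?I q) (\<lambda>t. (L q * (L q / \<delta>))\<^sup>2) = (L q * (L q / \<delta>))\<^sup>2 * \<delta>"
          using se by (simp add: mult.commute)
        also have "integral (?I q) (\<lambda>t. d * (\<Sum>i\<in>UNIV. (h m i t - c i q)\<^sup>2)) = d * (\<Sum>i\<in>UNIV. dev ?s ?e (h m i))"
          unfolding integral_mult_right dev_def c_def
          by (subst Henstock_Kurzweil_Integration.integral_sum) (use isq in \<open>auto simp: c_def\<close>)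
        finally show ?thesis by (simp only: integral_mult_right)
      qed
      also have "\<dots> \<le> 2 * C\<^sup>2 * (d * (\<Sum>i\<in>UNIV. dev ?s ?e (h m i)) + K\<^sup>2 * \<delta> powr (2 * \<sigma>) * integral (?I q) (\<lambda>t. (V t)\<^sup>2))"
      proof (intro mult_left_mono add_left_mono)
        \<comment> \<open>One factor (L q)^2 takes the growth bound and yields the power 2 \<sigma>
          of \<delta>. The other, divided by \<delta>, takes Cauchy--Schwarz and yields the integral
          of V^2, which can be summed over the cells.\<close>
        have "(L q * (L q / \<delta>))\<^sup>2 * \<delta> = (L q)\<^sup>2 * ((L q)\<^sup>2 / \<delta>)"
          using \<delta> by (simp add: power2_eq_square field_simps)
        also have "\<dots> \<le> (K\<^sup>2 * \<delta> powr (2 * \<sigma>)) * integral (?I q) (\<lambda>t. (V t)\<^sup>2)"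
        proof (rule mult_mono)
          have "(L q)\<^sup>2 \<le> (K * \<delta> powr \<sigma>)\<^sup>2" using K(2)[OF q] L0 by (intro power_mono) (auto simp: L_def \<delta>_def)
          also have "\<dots> = K\<^sup>2 * (\<delta> powr \<sigma> * \<delta> powr \<sigma>)" by (simp add: power2_eq_square)
          also have "\<delta> powr \<sigma> * \<delta> powr \<sigma> = \<delta> powr (2 * \<sigma>)" unfolding powr_add[symmetric] by simp
          finally show "(L q)\<^sup>2 \<le> K\<^sup>2 * \<delta> powr (2 * \<sigma>)" .
          have "(L q)\<^sup>2 \<le> \<delta> * integral (?I q) (\<lambda>t. (V t)\<^sup>2)"
            unfolding L_def using integral_square_le[OF V_sub[OF q]] se by simp
          then show "(L q)\<^sup>2 / \<delta> \<le> integral (?I q) (\<lambda>t. (V t)\<^sup>2)" using \<delta> by (simp add: pos_divide_le_eq mult.commute)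
        qed (use \<delta> in auto)
        finally show "(L q * (L q / \<delta>))\<^sup>2 * \<delta> \<le> K\<^sup>2 * \<delta> powr (2 * \<sigma>) * integral (?I q) (\<lambda>t. (V t)\<^sup>2)" .
      qed simp
      finally show ?thesis .
    qed
    have "(\<Sum>q<2 ^ J. integral (?I q) (\<lambda>t. (F x t - E q x)\<^sup>2)) \<le> C' * \<delta> powr (2 * \<sigma>)" for x
    proof -
      have "(\<Sum>q<2 ^ J. integral (?I q) (\<lambda>t. (F x t - E q x)\<^sup>2))
        \<le> (\<Sum>q<2 ^ J. 2 * C\<^sup>2 * (d * (\<Sum>i\<in>UNIV. dev (dpt T J q) (dpt T J (Suc q)) (h m i)) + K\<^sup>2 * \<delta> powr (2 * \<sigma>) * integral (?I q) (\<lambda>t. (V t)\<^sup>2)))"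
        by (intro sum_mono main) simp
      also have "\<dots> = 2 * C\<^sup>2 * (d * (\<Sum>q<2 ^ J. \<Sum>i\<in>UNIV. dev (dpt T J q) (dpt T J (Suc q)) (h m i))
          + K\<^sup>2 * \<delta> powr (2 * \<sigma>) * (\<Sum>q<2 ^ J. integral (?I q) (\<lambda>t. (V t)\<^sup>2)))"
        by (simp only: sum_distrib_left[symmetric] sum.distrib)
      also have "(\<Sum>q<2 ^ J. \<Sum>i\<in>UNIV. dev (dpt T J q) (dpt T J (Suc q)) (h m i))
         = (\<Sum>i\<in>UNIV. \<Sum>q<2 ^ J. dev (dpt T J q) (dpt T J (Suc q)) (h m i))" by (rule sum.swap)
      also have "(\<Sum>q<2 ^ J. integral (?I q) (\<lambda>t. (V t)\<^sup>2)) = V2"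
        unfolding V2_def by (rule sum_integral_dyadic[OF V_square T])
      also have "2 * C\<^sup>2 * (d * (\<Sum>i\<in>UNIV. \<Sum>q<2 ^ J. dev (dpt T J q) (dpt T J (Suc q)) (h m i)) + K\<^sup>2 * \<delta> powr (2 * \<sigma>) * V2)
         \<le> 2 * C\<^sup>2 * (d * (\<Sum>i\<in>(UNIV :: 'b set). \<delta> powr (2 * \<sigma>) * G) + K\<^sup>2 * \<delta> powr (2 * \<sigma>) * V2)"
        unfolding \<delta>_def
        by (intro mult_left_mono add_right_mono sum_mono dev_sum_le[OF h_borel T \<sigma>(1) h_m_integrable h_square G]) (auto simp: d_def)
      also have "\<dots> = C' * \<delta> powr (2 * \<sigma>)"
        by (simp add: C'_def d_def[symmetric] algebra_simps)
      finally show ?thesis .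
    qed
    then show ?thesis using Em Eb unfolding \<delta>_def by (intro exI[of _ E]) blast
  qed
  then show ?thesis using C'0 by blast
qed

end

text \<open>Numbers the pairs of a mesh cell and a Taylor degree by one index, as
  \<open>singular_system_bound\<close> expects.\<close>

lemma sum_div_mod:
  fixes f :: "nat \<Rightarrow> nat \<Rightarrow> real"
  shows "(\<Sum>r<N * m. f (r div m) (r mod m)) = (\<Sum>q<N. \<Sum>k<m. f q k)"
proof -
  have "(\<Sum>r<N * m. f (r div m) (r mod m)) = (\<Sum>q<N. \<Sum>r\<in>{q * m..<q * m + m}. f (r div m) (r mod m))"
    by (rule sum.nat_group[symmetric])
  also have "\<dots> = (\<Sum>q<N. \<Sum>k<m. f q k)"
  proof (rule sum.cong[OF refl])
    fix q
    have "(\<Sum>r\<in>{q * m..<q * m + m}. f (r div m) (r mod m)) = (\<Sum>k\<in>{0..<m}. f ((k + q * m) div m) ((k + q * m) mod m))"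
      using sum.shift_bounds_nat_ivl[of "\<lambda>r. f (r div m) (r mod m)" 0 "q * m" m] by (simp add: add.commute)
    also have "\<dots> = (\<Sum>k\<in>{0..<m}. f q k)" by (intro sum.cong) auto
    finally show "(\<Sum>r\<in>{q * m..<q * m + m}. f (r div m) (r mod m)) = (\<Sum>k<m. f q k)" by (simp add: atLeast0LessThan)
  qed
  finally show ?thesis .
qed

lemma dyadic_cell:
  assumes T: "0 < T" and t: "t \<in> {0<..<T}"
  obtains q where "q < 2 ^ J" "t \<in> {dpt T J q..<dpt T J (Suc q)}"
proof -
  define y where "y = t * 2 ^ J / T"
  have y: "0 \<le> y" "y < 2 ^ J" using t T by (auto simp: y_def pos_divide_less_eq mult.commute)
  define q where "q = nat \<lfloor>y\<rfloor>"
  have q: "real q \<le> y" "y < real q + 1" using y by (auto simp: q_def of_nat_nat)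
  have "real q < 2 ^ J" using q(1) y(2) by linarith
  then have "real q < real (2 ^ J)" by (simp only: of_nat_power of_nat_numeral)
  then have "q < 2 ^ J" by (simp only: of_nat_less_iff)
  moreover have "t = T * y / 2 ^ J" using T by (simp add: y_def)
  then have "dpt T J q \<le> t" "t < dpt T J (Suc q)"
    using q T by (auto simp: dpt_def intro!: divide_right_mono divide_strict_right_mono mult_left_mono mult_strict_left_mono)
  ultimately show ?thesis by (intro that) auto
qed

lemma dyadic_cell_unique:
  assumes T: "0 < T" and "t \<in> {dpt T J q..<dpt T J (Suc q)}" "t \<in> {dpt T J q'..<dpt T J (Suc q')}"
  shows "q = q'"
proof (rule ccontr)
  assume "q \<noteq> q'"
  then consider "Suc q \<le> q'" | "Suc q' \<le> q" by linarith
  then show False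
    using dpt_mono[OF T, of "Suc q" q' J] dpt_mono[OF T, of "Suc q'" q J] assms by cases auto
qed

lemma nn_integral_closed_interval:
  fixes f :: "real \<Rightarrow> real"
  assumes "\<And>x. 0 \<le> f x" "f integrable_on {s..e}"
  shows "(\<integral>\<^sup>+x. indicator {s..e} x * ennreal (f x) \<partial>lborel) = ennreal (integral {s..e} f)"
proof -
  have "(\<integral>\<^sup>+x. ennreal (indicator {s..e} x * f x) \<partial>lborel) = ennreal (integral {s..e} f)"
    using nn_integral_has_integral_lebesgue[OF _ integrable_integral[OF assms(2)]] assms(1) by simp
  also have "(\<lambda>x. ennreal (indicator {s..e} x * f x)) = (\<lambda>x. indicator {s..e} x * ennreal (f x))"
    by (auto simp: indicator_def)
  finally show ?thesis .
qed

context kernel_data_L2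
begin

text \<open>The case of integral smoothness: the top derivative is not approximated at all, and
  \<open>E = 0\<close> leaves a bounded sum. The exponent is spelled \<open>2 * 0\<close> to match
  the fractional statement at \<sigma> = 0.\<close>

lemma bounded_coefficients:
  assumes F: "de k F" "Suc k = m"
  shows "\<exists>C\<ge>0. \<forall>J. \<exists>E. (\<forall>q<2 ^ J. E q \<in> borel_measurable M \<and> (\<exists>B. \<forall>x. \<bar>E q x\<bar> \<le> B)) \<and>
     (\<forall>x. (\<Sum>q<2 ^ J. integral {dpt T J q..dpt T J (Suc q)} (\<lambda>t. (F x t - E q x)\<^sup>2)) \<le> C * (T / 2 ^ J) powr (2 * 0))"
proof -
  have km: "k < m" using F(2) by simp
  obtain C where C: "0 \<le> C" "\<And>x t. t \<in> {0..T} \<Longrightarrow> \<bar>F x t\<bar> \<le> C * V t"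
    using de_bound[OF F(1) km] unfolding V_def F(2) by metis
  have "(\<Sum>q<2 ^ J. integral {dpt T J q..dpt T J (Suc q)} (\<lambda>t. (F x t - 0)\<^sup>2)) \<le> C\<^sup>2 * V2" for J x
  proof -
    have Fi: "F x absolutely_integrable_on {0..T}" by (rule de_integrable[OF F(1) km])
    have F2: "(\<lambda>t. (F x t)\<^sup>2) integrable_on {0..T}" by (rule square_integrable_if_bounded[OF Fi V_square C(2)])
    have "(\<Sum>q<2 ^ J. integral {dpt T J q..dpt T J (Suc q)} (\<lambda>t. (F x t)\<^sup>2)) = integral {0..T} (\<lambda>t. (F x t)\<^sup>2)"
      by (rule sum_integral_dyadic[OF F2 T])
    also have "\<dots> \<le> integral {0..T} (\<lambda>t. C\<^sup>2 * (V t)\<^sup>2)"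
    proof (rule integral_le[OF F2 integrable_on_mult_right[OF V_square]])
      show "(F x t)\<^sup>2 \<le> C\<^sup>2 * (V t)\<^sup>2" if "t \<in> {0..T}" for t
        using power_mono[OF C(2)[OF that, of x], of 2] by (simp add: power_mult_distrib)
    qed
    finally show ?thesis by (simp add: V2_def)
  qed
  then show ?thesis
  proof (intro exI[of _ "C\<^sup>2 * V2"] conjI allI)
    fix J
    assume *: "\<And>J x. (\<Sum>q<2 ^ J. integral {dpt T J q..dpt T J (Suc q)} (\<lambda>t. (F x t - 0)\<^sup>2)) \<le> C\<^sup>2 * V2"
    have "(T / 2 ^ J) powr (2 * 0) = 1" using T by simp
    then show "\<exists>E. (\<forall>q<2 ^ J. E q \<in> borel_measurable M \<and> (\<exists>B. \<forall>x. \<bar>E q x\<bar> \<le> B)) \<and>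
     (\<forall>x. (\<Sum>q<2 ^ J. integral {dpt T J q..dpt T J (Suc q)} (\<lambda>t. (F x t - E q x)\<^sup>2)) \<le> C\<^sup>2 * V2 * (T / 2 ^ J) powr (2 * 0))"
      using * by (intro exI[of _ "\<lambda>q x. 0"]) auto
  qed (use V2_nonneg in auto)
qed

text \<open>The rank counts \<open>m\<close> Taylor coefficients on each of the 2^J cells. The
  squared error gains the power 2 (m - 1) of the cell length from the Taylor remainder and the power
  2 \<sigma> from the premise \<open>fr\<close>, which hides how the leading coefficients
  \<open>E\<close> are found.\<close>

lemma kernel_lowrank:
  assumes \<kappa>: "de 0 \<kappa>" and fin: "finite_measure M"
    and fr: "\<And>F. de (m - 1) F \<Longrightarrow> \<exists>C\<ge>0. \<forall>J. \<exists>E. (\<forall>q<2 ^ J. E q \<in> borel_measurable M \<and> (\<exists>B. \<forall>x. \<bar>E q x\<bar> \<le> B)) \<and>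
     (\<forall>x. (\<Sum>q<2 ^ J. integral {dpt T J q..dpt T J (Suc q)} (\<lambda>t. (F x t - E q x)\<^sup>2)) \<le> C * (T / 2 ^ J) powr (2 * \<sigma>))"
  shows "\<exists>C\<ge>0. \<forall>J. \<exists>b d \<rho>. (\<forall>x. \<forall>t\<in>{0<..<T}. \<kappa> x t = (\<Sum>r<2 ^ J * m. b r x * d r t) + \<rho> x t) \<and>
     (\<forall>r<2 ^ J * m. b r \<in> L2 M) \<and> case_prod \<rho> \<in> borel_measurable (M \<Otimes>\<^sub>M ivl T) \<and>
     (\<integral>\<^sup>+t. \<integral>\<^sup>+x. ennreal ((\<rho> x t)\<^sup>2) \<partial>M \<partial>ivl T) \<le> ennreal (C * (1 / 2 ^ J) powr (2 * (real (m - 1) + \<sigma>)))"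
proof -
  interpret finite_measure M by fact
  interpret N: sigma_finite_measure "ivl T" by (rule sigma_finite_ivl)
  interpret P: pair_sigma_finite M "ivl T" by unfold_locales
  define n where "n = m - 1"
  have n: "n < m" "Suc n = m" using m by (auto simp: n_def)
  obtain \<Phi> where \<Phi>: "\<Phi> 0 = \<kappa>" "\<forall>j<n. \<forall>x. ac_on T (\<Phi> j x) (\<Phi> (Suc j) x)"
    "\<forall>j<n. dp (Suc j) (\<Phi> j)" "de n (\<Phi> n)" using de_chain[OF \<kappa> n(1)] by blast
  obtain C where C: "0 \<le> C" "\<And>J. \<exists>E. (\<forall>q<2 ^ J. E q \<in> borel_measurable M \<and> (\<exists>B. \<forall>x. \<bar>E q x\<bar> \<le> B)) \<and>
     (\<forall>x. (\<Sum>q<2 ^ J. integral {dpt T J q..dpt T J (Suc q)} (\<lambda>t. (\<Phi> n x t - E q x)\<^sup>2)) \<le> C * (T / 2 ^ J) powr (2 * \<sigma>))"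
    using fr[OF \<Phi>(4)[unfolded n_def]] unfolding n_def[symmetric] by blast
  define C' where "C' = C * T powr (2 * (real n + \<sigma>)) * measure M (space M)"
  have C': "0 \<le> C'" using C(1) by (simp add: C'_def)
  have "\<exists>b d \<rho>. (\<forall>x. \<forall>t\<in>{0<..<T}. \<kappa> x t = (\<Sum>r<2 ^ J * m. b r x * d r t) + \<rho> x t) \<and>
     (\<forall>r<2 ^ J * m. b r \<in> L2 M) \<and> case_prod \<rho> \<in> borel_measurable (M \<Otimes>\<^sub>M ivl T) \<and>
     (\<integral>\<^sup>+t. \<integral>\<^sup>+x. ennreal ((\<rho> x t)\<^sup>2) \<partial>M \<partial>ivl T) \<le> ennreal (C' * (1 / 2 ^ J) powr (2 * (real n + \<sigma>)))" for J
  proof -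
    obtain E where E: "\<And>q. q < 2 ^ J \<Longrightarrow> E q \<in> borel_measurable M" "\<And>q. q < 2 ^ J \<Longrightarrow> \<exists>B. \<forall>x. \<bar>E q x\<bar> \<le> B"
      "\<And>x. (\<Sum>q<2 ^ J. integral {dpt T J q..dpt T J (Suc q)} (\<lambda>t. (\<Phi> n x t - E q x)\<^sup>2)) \<le> C * (T / 2 ^ J) powr (2 * \<sigma>)"
      using C(2)[of J] by blast
    define \<delta> where "\<delta> = T / 2 ^ J"
    have \<delta>: "0 < \<delta>" using T by (simp add: \<delta>_def)
    define bb where "bb q k x = (if k < n then \<Phi> k x (dpt T J q) / fact k else E q x / fact n)" for q k x
    \<comment> \<open>Half-open cells are disjoint, so exactly one of them contributes at each
      time.\<close>
    define dd where "dd q k t = indicator {dpt T J q..<dpt T J (Suc q)} t * (t - dpt T J q) ^ k" for q k t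
    define rem where "rem q x = taylor_rem (\<lambda>j. \<Phi> j x) n (E q x) (dpt T J q)" for q x
    define \<rho> where "\<rho> x t = \<kappa> x t - (\<Sum>q<2 ^ J. \<Sum>k<m. bb q k x * dd q k t)" for x t
    have bbL: "bb q k \<in> L2 M" if q: "q < 2 ^ J" for q k
    proof (cases "k < n")
      case True
      have dpk: "dp (Suc k) (\<Phi> k)" using \<Phi>(3) True by blast
      obtain B where B: "\<forall>x. \<forall>t\<in>{0..T}. \<bar>\<Phi> k x t\<bar> \<le> B"
        using dp_bounded[OF dpk] True n by auto
      have p: "dpt T J q \<in> {0..T}" using dyadic_subset[OF T q] dpt_bounds(2)[OF T, of J q] by auto
      have "(\<lambda>x. \<Phi> k x (dpt T J q) / fact k) \<in> L2 M"
      proof (rule L2_bounded[OF fin])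
        show "(\<lambda>x. \<Phi> k x (dpt T J q) / fact k) \<in> borel_measurable M"
          using dp_measurable_section[OF dpk] by (intro borel_measurable_divide borel_measurable_const)
        show "\<bar>\<Phi> k x (dpt T J q) / fact k\<bar> \<le> B / fact k" for x
          using B p by (simp add: abs_divide divide_right_mono)
      qed
      then show ?thesis using True by (simp add: bb_def[abs_def])
    next
      case False
      obtain B where B: "\<forall>x. \<bar>E q x\<bar> \<le> B" using E(2)[OF q] by blast
      have "(\<lambda>x. E q x / fact n) \<in> L2 M"
      proof (rule L2_bounded[OF fin])
        show "(\<lambda>x. E q x / fact n) \<in> borel_measurable M"
          using E(1)[OF q] by (intro borel_measurable_divide borel_measurable_const)
        show "\<bar>E q x / fact n\<bar> \<le> B / fact n" for x
          using B by (simp add: abs_divide divide_right_mono)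
      qed
      then show ?thesis using False by (simp add: bb_def[abs_def])
    qed
    have ddm: "dd q k \<in> borel_measurable (ivl T)" for q k
      unfolding dd_def by (intro borel_measurable_ivl) measurable
    have \<kappa>m: "case_prod \<kappa> \<in> borel_measurable (M \<Otimes>\<^sub>M ivl T)"
      by (rule dp_measurable[OF dp_Suc_de[OF \<kappa>]]) (use m in simp)
    have prodm: "(\<lambda>z. bb q k (fst z) * dd q k (snd z)) \<in> borel_measurable (M \<Otimes>\<^sub>M ivl T)" if "q < 2 ^ J" for q k
      using measurable_compose[OF measurable_fst L2_measurable[OF bbL[OF that]]]
        measurable_compose[OF measurable_snd ddm] by (rule borel_measurable_times)
    have \<rho>m: "case_prod \<rho> \<in> borel_measurable (M \<Otimes>\<^sub>M ivl T)"
    proof -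
      have "(\<lambda>z. (case_prod \<kappa>) z - (\<Sum>q<2 ^ J. \<Sum>k<m. bb q k (fst z) * dd q k (snd z))) \<in> borel_measurable (M \<Otimes>\<^sub>M ivl T)"
        by (intro borel_measurable_diff \<kappa>m borel_measurable_sum prodm) simp
      then show ?thesis by (simp add: \<rho>_def case_prod_beta')
    qed
    have cell: "\<rho> x t = rem q x t" if q: "q < 2 ^ J" and t: "t \<in> {dpt T J q..<dpt T J (Suc q)}" for x t q
    proof -
      have "(\<Sum>q'<2 ^ J. \<Sum>k<m. bb q' k x * dd q' k t) = (\<Sum>q'<2 ^ J. if q' = q then (\<Sum>k<m. bb q k x * (t - dpt T J q) ^ k) else 0)"
      proof (rule sum.cong[OF refl])
        fix q'
        show "(\<Sum>k<m. bb q' k x * dd q' k t) = (if q' = q then (\<Sum>k<m. bb q k x * (t - dpt T J q) ^ k) else 0)"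
        proof (cases "q' = q")
          case True
          then show ?thesis using t by (simp add: dd_def)
        next
          case False
          then have "t \<notin> {dpt T J q'..<dpt T J (Suc q')}" using dyadic_cell_unique[OF T t] by blast
          then show ?thesis using False by (simp add: dd_def)
        qed
      qed
      also have "\<dots> = (\<Sum>k<m. bb q k x * (t - dpt T J q) ^ k)" using q by simp
      also have "\<dots> = (\<Sum>k<n. bb q k x * (t - dpt T J q) ^ k) + bb q n x * (t - dpt T J q) ^ n"
        unfolding n(2)[symmetric] by (rule sum.lessThan_Suc)
      also have "\<dots> = (\<Sum>k<n. \<Phi> k x (dpt T J q) * ((t - dpt T J q) ^ k / fact k)) + E q x * ((t - dpt T J q) ^ n / fact n)"
        by (simp add: bb_def)
      finally show ?thesis by (simp add: \<rho>_def rem_def taylor_rem_def \<Phi>(1))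
    qed
    have Fi: "\<Phi> n x absolutely_integrable_on {0..T}" for x by (rule de_integrable[OF \<Phi>(4) n(1)])
    obtain CF where CF: "\<And>x t. t \<in> {0..T} \<Longrightarrow> \<bar>\<Phi> n x t\<bar> \<le> CF * V t"
      using de_bound[OF \<Phi>(4) n(1)] unfolding V_def n(2) by metis
    have rem2: "(\<lambda>t. (rem q x t)\<^sup>2) integrable_on {dpt T J q..dpt T J (Suc q)}"
      "integral {dpt T J q..dpt T J (Suc q)} (\<lambda>t. (rem q x t)\<^sup>2) \<le> \<delta> ^ (2 * n) * integral {dpt T J q..dpt T J (Suc q)} (\<lambda>t. (\<Phi> n x t - E q x)\<^sup>2)"
      if q: "q < 2 ^ J" for q x
    proof -
      have se: "0 \<le> dpt T J q" "dpt T J q \<le> dpt T J (Suc q)" "dpt T J (Suc q) \<le> T"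
        using dpt_bounds(1)[OF T, of J q] dpt_bounds(2)[OF T, of J q] dpt_bounds(3)[OF T q] by auto
      have ac: "ac_on T (\<Phi> j x) (\<Phi> (Suc j) x)" if "j < n" for j using \<Phi>(2) that by blast
      have Fs: "\<Phi> n x integrable_on {dpt T J q..dpt T J (Suc q)}" "(\<lambda>t. (\<Phi> n x t)\<^sup>2) integrable_on {dpt T J q..dpt T J (Suc q)}"
        using integrable_subinterval_real[OF set_lebesgue_integral_eq_integral(1)[OF Fi] dyadic_subset[OF T q]]
          integrable_subinterval_real[OF square_integrable_if_bounded[OF Fi V_square CF] dyadic_subset[OF T q]] by auto
      from taylor_rem_square[OF ac se Fs, where E = "E q x"]
      show "(\<lambda>t. (rem q x t)\<^sup>2) integrable_on {dpt T J q..dpt T J (Suc q)}"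
        "integral {dpt T J q..dpt T J (Suc q)} (\<lambda>t. (rem q x t)\<^sup>2) \<le> \<delta> ^ (2 * n) * integral {dpt T J q..dpt T J (Suc q)} (\<lambda>t. (\<Phi> n x t - E q x)\<^sup>2)"
        unfolding rem_def dpt_bounds(4)[OF T] \<delta>_def by blast+
    qed
    define K where "K = C * T powr (2 * (real n + \<sigma>)) * (1 / 2 ^ J) powr (2 * (real n + \<sigma>))"
    have K0: "0 \<le> K" using C(1) by (simp add: K_def)
    have inner: "(\<integral>\<^sup>+t. ennreal ((\<rho> x t)\<^sup>2) \<partial>ivl T) \<le> ennreal K" if x: "x \<in> space M" for x
    proof -
      have rm: "\<rho> x \<in> borel_measurable (ivl T)"
      proof -
        have "(\<lambda>t. (x, t)) \<in> ivl T \<rightarrow>\<^sub>M M \<Otimes>\<^sub>M ivl T" using x by (intro measurable_Pair) auto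
        from measurable_compose[OF this \<rho>m] show ?thesis by simp
      qed
      let ?c = "\<lambda>q. {dpt T J q..<dpt T J (Suc q)}"
      have cm: "(indicator (?c q) :: real \<Rightarrow> ennreal) \<in> borel_measurable (ivl T)" for q
        by (intro borel_measurable_ivl) measurable
      have "(\<integral>\<^sup>+t. ennreal ((\<rho> x t)\<^sup>2) \<partial>ivl T) \<le> (\<integral>\<^sup>+t. (\<Sum>q<2 ^ J. indicator (?c q) t * ennreal ((\<rho> x t)\<^sup>2)) \<partial>ivl T)"
      proof (rule nn_integral_mono)
        fix t assume "t \<in> space (ivl T)"
        then obtain q where q: "q < 2 ^ J" "t \<in> ?c q" using dyadic_cell[OF T] by auto
        have "indicator (?c q) t * ennreal ((\<rho> x t)\<^sup>2) \<le> (\<Sum>q<2 ^ J. indicator (?c q) t * ennreal ((\<rho> x t)\<^sup>2))"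
          using q by (intro member_le_sum) auto
        then show "ennreal ((\<rho> x t)\<^sup>2) \<le> (\<Sum>q<2 ^ J. indicator (?c q) t * ennreal ((\<rho> x t)\<^sup>2))" using q by simp
      qed
      also have "\<dots> = (\<Sum>q<2 ^ J. \<integral>\<^sup>+t. indicator (?c q) t * ennreal ((\<rho> x t)\<^sup>2) \<partial>ivl T)"
        using cm rm by (intro nn_integral_sum) auto
      also have "\<dots> \<le> (\<Sum>q<2 ^ J. ennreal (integral {dpt T J q..dpt T J (Suc q)} (\<lambda>t. (rem q x t)\<^sup>2)))"
      proof (rule sum_mono)
        fix q assume "q \<in> {..<(2::nat) ^ J}"
        then have q: "q < 2 ^ J" by simp
        have "(\<integral>\<^sup>+t. indicator (?c q) t * ennreal ((\<rho> x t)\<^sup>2) \<partial>ivl T)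
           = (\<integral>\<^sup>+t. indicator (?c q) t * ennreal ((\<rho> x t)\<^sup>2) * indicator {0<..<T} t \<partial>lebesgue)"
          by (rule nn_integral_restrict_space) simp
        also have "\<dots> \<le> (\<integral>\<^sup>+t. indicator {dpt T J q..dpt T J (Suc q)} t * ennreal ((rem q x t)\<^sup>2) \<partial>lebesgue)"
        proof (rule nn_integral_mono)
          fix t
          show "indicator (?c q) t * ennreal ((\<rho> x t)\<^sup>2) * indicator {0<..<T} t
              \<le> indicator {dpt T J q..dpt T J (Suc q)} t * ennreal ((rem q x t)\<^sup>2)"
            using cell[OF q, of t x] by (auto simp: indicator_def)
        qed
        also have "\<dots> = (\<integral>\<^sup>+t. indicator {dpt T J q..dpt T J (Suc q)} t * ennreal ((rem q x t)\<^sup>2) \<partial>lborel)"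
          by (rule nn_integral_completion)
        also have "\<dots> = ennreal (integral {dpt T J q..dpt T J (Suc q)} (\<lambda>t. (rem q x t)\<^sup>2))"
          by (rule nn_integral_closed_interval[OF _ rem2(1)[OF q]]) simp
        finally show "(\<integral>\<^sup>+t. indicator (?c q) t * ennreal ((\<rho> x t)\<^sup>2) \<partial>ivl T)
           \<le> ennreal (integral {dpt T J q..dpt T J (Suc q)} (\<lambda>t. (rem q x t)\<^sup>2))" .
      qed
      also have "\<dots> = ennreal (\<Sum>q<2 ^ J. integral {dpt T J q..dpt T J (Suc q)} (\<lambda>t. (rem q x t)\<^sup>2))"
        by (rule sum_ennreal) (auto intro!: integral_nonneg rem2)
      also have "\<dots> \<le> ennreal K"
      proof (rule ennreal_leI)
        have "(\<Sum>q<2 ^ J. integral {dpt T J q..dpt T J (Suc q)} (\<lambda>t. (rem q x t)\<^sup>2))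
           \<le> (\<Sum>q<2 ^ J. \<delta> ^ (2 * n) * integral {dpt T J q..dpt T J (Suc q)} (\<lambda>t. (\<Phi> n x t - E q x)\<^sup>2))"
          by (intro sum_mono rem2) simp
        also have "\<dots> = \<delta> ^ (2 * n) * (\<Sum>q<2 ^ J. integral {dpt T J q..dpt T J (Suc q)} (\<lambda>t. (\<Phi> n x t - E q x)\<^sup>2))"
          by (simp only: sum_distrib_left)
        also have "\<dots> \<le> \<delta> ^ (2 * n) * (C * \<delta> powr (2 * \<sigma>))"
          using E(3)[of x] \<delta> unfolding \<delta>_def by (intro mult_left_mono) auto
        also have "\<dots> = C * (\<delta> powr real (2 * n) * \<delta> powr (2 * \<sigma>))"
          unfolding powr_realpow[OF \<delta>, of "2 * n"] by (simp only: mult_ac)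
        also have "\<delta> powr real (2 * n) * \<delta> powr (2 * \<sigma>) = \<delta> powr (2 * (real n + \<sigma>))"
          unfolding powr_add[symmetric] by (simp add: distrib_left)
        also have "\<delta> = T * (1 / 2 ^ J)" by (simp add: \<delta>_def)
        also have "(T * (1 / 2 ^ J)) powr (2 * (real n + \<sigma>)) = T powr (2 * (real n + \<sigma>)) * (1 / 2 ^ J) powr (2 * (real n + \<sigma>))"
          by (rule powr_mult)
        finally show "(\<Sum>q<2 ^ J. integral {dpt T J q..dpt T J (Suc q)} (\<lambda>t. (rem q x t)\<^sup>2)) \<le> K"
          by (simp add: K_def mult.assoc)
      qed
      finally show ?thesis .
    qed
    have "(\<integral>\<^sup>+t. \<integral>\<^sup>+x. ennreal ((\<rho> x t)\<^sup>2) \<partial>M \<partial>ivl T) = (\<integral>\<^sup>+x. \<integral>\<^sup>+t. ennreal ((\<rho> x t)\<^sup>2) \<partial>ivl T \<partial>M)"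
    proof (rule P.Fubini')
      have "(\<lambda>z. ennreal ((case_prod \<rho> z)\<^sup>2)) \<in> borel_measurable (M \<Otimes>\<^sub>M ivl T)" using \<rho>m by simp
      then show "(\<lambda>(x, t). ennreal ((\<rho> x t)\<^sup>2)) \<in> borel_measurable (M \<Otimes>\<^sub>M ivl T)" by (simp add: case_prod_beta')
    qed
    also have "\<dots> \<le> (\<integral>\<^sup>+x. ennreal K \<partial>M)" by (intro nn_integral_mono inner)
    also have "\<dots> = ennreal K * emeasure M (space M)" by simp
    also have "\<dots> = ennreal (K * measure M (space M))"
      unfolding emeasure_eq_measure using K0 by (simp add: ennreal_mult')
    also have "K * measure M (space M) = C' * (1 / 2 ^ J) powr (2 * (real n + \<sigma>))"
      by (simp add: K_def C'_def)
    finally have fin_le: "(\<integral>\<^sup>+t. \<integral>\<^sup>+x. ennreal ((\<rho> x t)\<^sup>2) \<partial>M \<partial>ivl T) \<le> ennreal (C' * (1 / 2 ^ J) powr (2 * (real n + \<sigma>)))" .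
    show ?thesis
    proof (intro exI[of _ "\<lambda>r. bb (r div m) (r mod m)"] exI[of _ "\<lambda>r. dd (r div m) (r mod m)"] exI[of _ \<rho>] conjI allI ballI impI)
      show "\<kappa> x t = (\<Sum>r<2 ^ J * m. bb (r div m) (r mod m) x * dd (r div m) (r mod m) t) + \<rho> x t" for x t
        unfolding sum_div_mod[of "\<lambda>q k. bb q k x * dd q k t"] by (simp add: \<rho>_def)
      show "bb (r div m) (r mod m) \<in> L2 M" if "r < 2 ^ J * m" for r
        by (rule bbL) (use that in \<open>simp add: less_mult_imp_div_less\<close>)
    qed (fact \<rho>m fin_le)+
  qed
  then show ?thesis using C' unfolding n_def[symmetric] by blast
qed

end

section \<open>The decay rate\<close>

text \<open>Lebesgue measure is complete, so agreement almost everywhere transfers measurability.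
  The weak derivatives chosen in \<open>kappa\<close> bring no measurability in \<open>x\<close> of
  their own; the filtered kernel inherits it in this way from its explicit version.\<close>

lemma lebesgue_on_AE_measurable:
  fixes f g :: "'a::euclidean_space \<Rightarrow> real"
  assumes S: "S \<in> sets lebesgue" and g: "g \<in> borel_measurable (lebesgue_on S)"
    and eq: "AE x in lebesgue_on S. f x = g x"
  shows "f \<in> borel_measurable (lebesgue_on S)"
proof -
  have gm: "(\<lambda>x. indicator S x * g x) \<in> borel_measurable lebesgue"
    using g S by (subst (asm) borel_measurable_restrict_space_iff) auto
  have ae: "AE x in lebesgue. indicator S x * g x = indicator S x * f x"
    using eq S by (subst (asm) AE_restrict_space_iff) (auto elim!: eventually_mono simp: indicator_def)
  have "(\<lambda>x. indicator S x * f x) \<in> borel_measurable lebesgue"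
  proof (rule measurableI)
    fix A :: "real set" assume A: "A \<in> sets borel"
    show "(\<lambda>x. indicator S x * f x) -` A \<inter> space lebesgue \<in> sets lebesgue"
    proof (rule completion.in_sets_AE)
      show "AE x in lebesgue. (x \<in> (\<lambda>x. indicator S x * g x) -` A \<inter> space lebesgue)
          = (x \<in> (\<lambda>x. indicator S x * f x) -` A \<inter> space lebesgue)"
        using ae by eventually_elim (simp only: vimage_def Int_iff mem_Collect_eq)
      show "(\<lambda>x. indicator S x * g x) -` A \<inter> space lebesgue \<in> sets lebesgue"
        using gm A by (rule measurable_sets)
    qed simp
  qed simp
  then show ?thesis using S by (subst borel_measurable_restrict_space_iff) auto
qed

lemma lebesgue_on_integral_cong_AE:
  fixes f g :: "'a::euclidean_space \<Rightarrow> real"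
  assumes "S \<in> sets lebesgue" "g \<in> borel_measurable (lebesgue_on S)" "AE x in lebesgue_on S. f x = g x"
  shows "(\<integral>x. f x \<partial>lebesgue_on S) = (\<integral>x. g x \<partial>lebesgue_on S)"
  using lebesgue_on_AE_measurable[OF assms] assms(2,3) by (rule integral_cong_AE)

lemma AE_ivl_reflect:
  assumes "AE x in lborel. P x" shows "AE x in ivl T. P (t - x)"
proof -
  obtain N where N: "{x \<in> space lborel. \<not> P x} \<subseteq> N" "emeasure lborel N = 0" "N \<in> sets lborel"
    using assms by (rule AE_E)
  have "AE x in lborel. x \<notin> N" using N by (intro AE_not_in) (auto simp: null_sets_def)
  then have "AE x in lborel. t + (-1) * x \<notin> N"
    using N(3) by (intro AE_borel_affine) auto
  then have "AE x in lborel. P (t - x)"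
    by eventually_elim (use N(1) in auto)
  then have "AE x in lebesgue. P (t - x)" by (rule AE_completion)
  then show ?thesis by (subst AE_restrict_space_iff) (auto elim!: eventually_mono)
qed

lemma weak_derivative_cong_AE:
  assumes U: "has_weak_derivative 1 {0<..<T} U D" and T: "0 < T"
    and eq: "AE x in ivl T. u x = U x"
  shows "has_weak_derivative 1 {0<..<T} u D"
  unfolding has_weak_derivative_def
proof (intro conjI allI impI)
  have lU: "locally_integrable {0<..<T} U" using U by (simp add: has_weak_derivative_def)
  show lu: "locally_integrable {0<..<T} u"
    unfolding locally_integrable_def
  proof (intro allI impI)
    fix K :: "real set" assume K: "compact K \<and> K \<subseteq> {0<..<T}"
    then have Ks: "K \<in> sets lebesgue" by (intro fmeasurableD lmeasurable_compact) simp
    have i: "integrable (lebesgue_on K) U" using lU K unfolding locally_integrable_def by blast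
    have "AE x in lebesgue. x \<in> {0<..<T} \<longrightarrow> u x = U x"
      using eq by (subst (asm) AE_restrict_space_iff) auto
    then have "AE x in lebesgue. x \<in> K \<longrightarrow> u x = U x" using K by (auto elim!: eventually_mono)
    then have ae: "AE x in lebesgue_on K. u x = U x" using Ks by (subst AE_restrict_space_iff) auto
    show "integrable (lebesgue_on K) u"
    proof (rule integrable_cong_AE_imp[OF i])
      show "u \<in> borel_measurable (lebesgue_on K)"
        by (rule lebesgue_on_AE_measurable[OF Ks borel_measurable_integrable[OF i] ae])
      show "AE x in lebesgue_on K. U x = u x" using ae by eventually_elim simp
    qed
  qed
  show "locally_integrable {0<..<T} D" using U by (simp add: has_weak_derivative_def)
  fix \<phi> assume \<phi>: "test_function {0<..<T} \<phi>"
  note d\<phi> = test_function_deriv[OF \<phi>, of 1]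
  have "(\<integral>x. u x * (deriv ^^ 1) \<phi> x \<partial>ivl T) = (\<integral>x. U x * (deriv ^^ 1) \<phi> x \<partial>ivl T)"
  proof (rule lebesgue_on_integral_cong_AE)
    show "(\<lambda>x. U x * (deriv ^^ 1) \<phi> x) \<in> borel_measurable (ivl T)"
      by (rule borel_measurable_integrable[OF locally_integrable_times_test[OF lU d\<phi> T]])
    show "AE x in ivl T. u x * (deriv ^^ 1) \<phi> x = U x * (deriv ^^ 1) \<phi> x"
      using eq by eventually_elim simp
  qed simp
  also have "\<dots> = (- 1) ^ 1 * (\<integral>x. D x * \<phi> x \<partial>ivl T)"
    using U \<phi> unfolding has_weak_derivative_def by blast
  finally show "(\<integral>x. u x * (deriv ^^ 1) \<phi> x \<partial>ivl T) = (- 1) ^ 1 * (\<integral>x. D x * \<phi> x \<partial>ivl T)" .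
qed

text \<open>Expands |H|^2 in coordinates, in the shape of \<open>W\<close>, and writes g - h as -1
  times h - g; in this form the magnetization is visibly a \<open>dp\<close> expression of order
  0.\<close>

lemma magnetization_component:
  fixes g :: "'x \<Rightarrow> real ^ 'd"
  assumes "0 < \<beta>"
  shows "magnetization \<beta> g h x t $ i =
    (\<beta> * (pseries coshd_coeff (\<beta>\<^sup>2 * (\<Sum>j\<in>UNIV. (h t $ j + - g x $ j) * (h t $ j + - g x $ j))) *
      inverse (pseries sinhc_coeff (\<beta>\<^sup>2 * (\<Sum>j\<in>UNIV. (h t $ j + - g x $ j) * (h t $ j + - g x $ j)))))) *
     (- 1 * (h t $ i + - g x $ i))"
proof -
  have "(norm (g x - h t))\<^sup>2 = (\<Sum>j\<in>UNIV. (g x $ j - h t $ j) * (g x $ j - h t $ j))"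
    by (simp add: power2_norm_eq_inner inner_vec_def)
  also have "\<dots> = (\<Sum>j\<in>UNIV. (h t $ j + - g x $ j) * (h t $ j + - g x $ j))"
    by (intro sum.cong refl) (simp add: algebra_simps)
  finally show ?thesis
    unfolding magnetization_def Let_def langevin_quot_pseries[OF assms] by simp
qed

text \<open>The L2 weak derivative of order \<open>m\<close> gets a Borel version, from which the
  lower orders are recovered by integration. Weak derivatives are unique almost everywhere, so the
  Gagliardo seminorm passes to the Borel version.\<close>

lemma sobolev_ac_version:
  assumes u: "u \<in> sobolev_H s {0<..<T}" and s: "1 \<le> s" and T: "0 < T"
  defines "m \<equiv> nat \<lfloor>s\<rfloor>"
  obtains H where "\<And>l. l < m \<Longrightarrow> ac_on T (H l) (H (Suc l))" "H m \<in> borel_measurable borel"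
    "(\<lambda>t. (H m t)\<^sup>2) integrable_on {0..T}" "AE x in ivl T. u x = H 0 x"
    "s \<notin> \<int> \<Longrightarrow> gagliardo (frac s) {0<..<T} (H m) < \<infinity>"
proof -
  have D: "\<exists>v\<in>L2 (ivl T). has_weak_derivative k {0<..<T} u v" if "k \<le> m" for k
    using u that by (auto simp: sobolev_H_def m_def)
  obtain v where v: "v \<in> L2 (ivl T)" "has_weak_derivative m {0<..<T} u v" using D[of m] by auto
  have vi: "integrable (ivl T) v" by (rule finite_measure_L2_integrable[OF finite_measure_ivl v(1)])
  obtain w where w: "w \<in> borel_measurable borel" "w absolutely_integrable_on {0..T}" "AE x in ivl T. v x = w x"
    using integrable_ivl_borel_version[OF vi] .
  obtain H where H: "H m = w" "\<forall>l<m. ac_on T (H l) (H (Suc l))" "AE x in ivl T. u x = H 0 x"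
    using weak_derivatives_ac_version[OF T _ v(2) w(2,3)] D by blast
  have "integrable (ivl T) (\<lambda>t. (w t)\<^sup>2)"
  proof (rule integrable_cong_AE_imp)
    show "integrable (ivl T) (\<lambda>t. (v t)\<^sup>2)" using v(1) by (simp add: L2_def)
    show "(\<lambda>t. (w t)\<^sup>2) \<in> borel_measurable (ivl T)"
      using w(1) by (intro borel_measurable_ivl borel_measurable_power)
    show "AE x in ivl T. (v x)\<^sup>2 = (w x)\<^sup>2" using w(3) by eventually_elim simp
  qed
  then have "(\<lambda>t. (w t)\<^sup>2) integrable_on {0<..<T}" by (rule integrable_on_lebesgue_on) simp
  then have w2: "(\<lambda>t. (w t)\<^sup>2) integrable_on {0..T}" by (simp add: integrable_on_open_interval_real)
  have gag: "gagliardo (frac s) {0<..<T} w < \<infinity>" if "s \<notin> \<int>"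
  proof -
    obtain v' where v': "has_weak_derivative m {0<..<T} u v'" "gagliardo (frac s) {0<..<T} v' < \<infinity>"
      using u \<open>s \<notin> \<int>\<close> by (auto simp: sobolev_H_def m_def)
    have "AE x in ivl T. v' x = w x"
      using weak_derivative_unique[OF v'(1) v(2) T] w(3) by eventually_elim simp
    from gagliardo_cong_AE[OF this] v'(2) show ?thesis by simp
  qed
  show ?thesis using H w w2 gag by (intro that[of H]) auto
qed

text \<open>Clipping at a common bound changes values only on a null set and produces bounds at
  every point, as \<open>kernel_data\<close> requires.\<close>

lemma Linfty_components_clip:
  fixes f :: "'a \<Rightarrow> real ^ 'd"
  assumes "\<And>i. (\<lambda>x. f x $ i) \<in> Linfty M"
  obtains g :: "'a \<Rightarrow> real ^ 'd" and C where "\<And>i. (\<lambda>x. g x $ i) \<in> borel_measurable M"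
    "\<And>x i. \<bar>g x $ i\<bar> \<le> C" "AE x in M. f x = g x"
proof -
  have "\<forall>i. \<exists>C. AE x in M. \<bar>f x $ i\<bar> \<le> C" using assms by (auto simp: Linfty_def)
  then obtain B where B: "\<And>i. AE x in M. \<bar>f x $ i\<bar> \<le> B i" by metis
  define C where "C = (\<Sum>i\<in>UNIV. \<bar>B i\<bar>)"
  have BC: "\<bar>B i\<bar> \<le> C" for i unfolding C_def by (rule member_le_sum) auto
  have C0: "0 \<le> C" by (simp add: C_def sum_nonneg)
  define g :: "'a \<Rightarrow> real ^ 'd" where "g x = (\<chi> i. max (- C) (min C (f x $ i)))" for x
  have "(\<lambda>x. g x $ i) \<in> borel_measurable M" for i
    unfolding g_def vec_lambda_beta using assms[of i] unfolding Linfty_def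
    by (intro borel_measurable_max borel_measurable_min borel_measurable_const) auto
  moreover have "\<bar>g x $ i\<bar> \<le> C" for x i using C0 by (auto simp: g_def max_def min_def)
  moreover have "AE x in M. f x = g x"
  proof -
    have "AE x in M. \<forall>i\<in>UNIV. \<bar>f x $ i\<bar> \<le> B i" using B by (intro AE_finite_allI) auto
    then show ?thesis
    proof eventually_elim
      case (elim x)
      have "f x $ i = g x $ i" for i
      proof -
        have "\<bar>f x $ i\<bar> \<le> C" using elim BC[of i] by (meson UNIV_I abs_ge_self order_trans)
        then show ?thesis by (auto simp: g_def max_def min_def)
      qed
      then show ?case by (simp add: vec_eq_iff)
    qed
  qed
  ultimately show ?thesis by (rule that)
qed

text \<open>For \<open>n \<ge> 2 * D\<close> the bounds are used with the largest level \<open>J\<close> such that \<open>2 * D * 2 ^ J \<le> n\<close>;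
  for smaller \<open>n\<close> the estimate without finite-rank corrections suffices.\<close>

lemma singular_value_rate:
  assumes b: "\<And>n l J. 1 \<le> n \<Longrightarrow> 0 < l \<Longrightarrow> P n l \<Longrightarrow> l\<^sup>2 * real (n - D * 2 ^ J) \<le> X * 2 powr - (2 * \<gamma> * real J)"
    and b0: "\<And>n l. 1 \<le> n \<Longrightarrow> 0 < l \<Longrightarrow> P n l \<Longrightarrow> l\<^sup>2 * real n \<le> X0"
    and D: "1 \<le> D" and \<gamma>: "0 \<le> \<gamma>" and X: "0 \<le> X" "0 \<le> X0"
  shows "\<exists>C\<ge>0. \<forall>n l. 1 \<le> n \<longrightarrow> 0 < l \<longrightarrow> P n l \<longrightarrow> l \<le> C * real n powr (- 1 / 2 - \<gamma>)"
proof -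
  \<comment> \<open>The first summand serves \<open>n \<ge> 2 * D\<close>, its factor 2 coming from
    the at least n/2 remaining directions; the second covers the finitely many smaller
    \<open>n\<close>.\<close>
  define Y where "Y = 2 * X * (4 * real D) powr (2 * \<gamma>) + X0 * (2 * real D) powr (2 * \<gamma>)"
  have Y: "0 \<le> Y" using X by (simp add: Y_def)
  have main: "l\<^sup>2 \<le> Y * real n powr (- 1 - 2 * \<gamma>)" if n: "1 \<le> n" and l: "0 < l" and P: "P n l" for n l
  proof (cases "2 * D \<le> n")
    case True
    define A where "A = {J. 2 * D * 2 ^ J \<le> n}"
    have "A \<subseteq> {..n}"
    proof
      fix J assume "J \<in> A"
      have "J < 2 ^ J" by (rule less_exp)
      also have "2 ^ J \<le> 2 * D * 2 ^ J" using D by simp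
      finally show "J \<in> {..n}" using \<open>J \<in> A\<close> by (simp add: A_def)
    qed
    then have fA: "finite A" by (rule finite_subset) simp
    have "0 \<in> A" using True by (simp add: A_def)
    define J where "J = Max A"
    have JA: "J \<in> A" unfolding J_def using fA \<open>0 \<in> A\<close> by (intro Max_in) auto
    have "Suc J \<notin> A" using Max_ge[OF fA, of "Suc J"] by (auto simp: J_def)
    \<comment> \<open>By maximality 2^J exceeds n / (4 D), which converts decay in 2^J into decay in
      n.\<close>
    then have up: "n < 4 * D * 2 ^ J" by (simp add: A_def)
    have low: "2 * (D * 2 ^ J) \<le> n" using JA by (simp add: A_def mult.assoc)
    have "real n / 2 \<le> real (n - D * 2 ^ J)"
    proof -
      have "real (n - D * 2 ^ J) = real n - real (D * 2 ^ J)" using low by (simp only: of_nat_diff)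
      moreover have "2 * real (D * 2 ^ J) \<le> real n" using low by (metis of_nat_le_iff of_nat_mult of_nat_numeral)
      ultimately show ?thesis by linarith
    qed
    then have "l\<^sup>2 * (real n / 2) \<le> l\<^sup>2 * real (n - D * 2 ^ J)" by (rule mult_left_mono) simp
    also have "\<dots> \<le> X * 2 powr - (2 * \<gamma> * real J)" by (rule b[OF n l P])
    also have "\<dots> \<le> X * (real n / (4 * real D)) powr - (2 * \<gamma>)"
    proof (rule mult_left_mono[OF _ X(1)])
      have "real n < real (4 * D * 2 ^ J)" using up by (simp only: of_nat_less_iff)
      then have "real n / (4 * real D) \<le> 2 ^ J" using D by (simp add: pos_divide_le_eq mult_ac)
      moreover have p: "0 < real n / (4 * real D)" using n D by simp
      ultimately have "(2 ^ J) powr - (2 * \<gamma>) \<le> (real n / (4 * real D)) powr - (2 * \<gamma>)"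
        using \<gamma> by (intro powr_mono2') auto
      moreover have "(2 ^ J) powr - (2 * \<gamma>) = 2 powr - (2 * \<gamma> * real J)"
        by (simp add: powr_realpow[symmetric] powr_powr mult_ac)
      ultimately show "2 powr - (2 * \<gamma> * real J) \<le> (real n / (4 * real D)) powr - (2 * \<gamma>)" by simp
    qed
    also have "(real n / (4 * real D)) powr - (2 * \<gamma>) = real n powr - (2 * \<gamma>) * (4 * real D) powr (2 * \<gamma>)"
      using n D by (simp add: powr_divide powr_minus field_simps)
    finally have "l\<^sup>2 * real n \<le> 2 * X * (4 * real D) powr (2 * \<gamma>) * real n powr - (2 * \<gamma>)"
      by (simp add: mult_ac)
    also have "\<dots> \<le> Y * real n powr - (2 * \<gamma>)"
      using X by (intro mult_right_mono) (auto simp: Y_def)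
    finally have "l\<^sup>2 \<le> Y * real n powr - (2 * \<gamma>) / real n" using n by (simp add: pos_le_divide_eq)
    also have "\<dots> = Y * real n powr (- 1 - 2 * \<gamma>)"
      using n by (simp add: powr_diff powr_minus divide_inverse mult_ac)
    finally show ?thesis .
  next
    case False
    have "l\<^sup>2 * real n \<le> X0 * 1" using b0[OF n l P] by simp
    also have "\<dots> \<le> X0 * ((2 * real D) powr (2 * \<gamma>) * real n powr - (2 * \<gamma>))"
    proof (rule mult_left_mono[OF _ X(2)])
      have "real n \<le> 2 * real D" using False by linarith
      then have "real n powr (2 * \<gamma>) \<le> (2 * real D) powr (2 * \<gamma>)" using \<gamma> by (intro powr_mono2) auto
      then show "1 \<le> (2 * real D) powr (2 * \<gamma>) * real n powr - (2 * \<gamma>)"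
        using n by (simp add: powr_minus divide_inverse[symmetric])
    qed
    also have "\<dots> \<le> Y * real n powr - (2 * \<gamma>)"
      unfolding mult.assoc[symmetric] using X by (intro mult_right_mono) (auto simp: Y_def)
    finally have "l\<^sup>2 \<le> Y * real n powr - (2 * \<gamma>) / real n" using n by (simp add: pos_le_divide_eq)
    also have "\<dots> = Y * real n powr (- 1 - 2 * \<gamma>)"
      using n by (simp add: powr_diff powr_minus divide_inverse mult_ac)
    finally show ?thesis .
  qed
  have "l \<le> sqrt Y * real n powr (- 1 / 2 - \<gamma>)" if n: "1 \<le> n" and l: "0 < l" and P: "P n l" for n l
  proof (rule power2_le_imp_le)
    have "real n powr (- 1 - 2 * \<gamma>) = (real n powr (- 1 / 2 - \<gamma>))\<^sup>2"
      unfolding power2_eq_square powr_add[symmetric] by simp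
    then show "l\<^sup>2 \<le> (sqrt Y * real n powr (- 1 / 2 - \<gamma>))\<^sup>2"
      using main[OF n l P] Y by (simp add: power_mult_distrib)
  qed (use Y in simp)
  then show ?thesis using Y by (intro exI[of _ "sqrt Y"]) auto
qed

theorem theorem4p5:
  fixes \<Omega> :: "(real ^ 'd) set"
    and T mu0 m0 \<beta> s r :: real
    and \<theta> :: ennreal
    and h :: "real \<Rightarrow> real ^ 'd"
    and g p :: "real ^ 'd \<Rightarrow> real ^ 'd"
    and a :: "real \<Rightarrow> real"
  assumes "CARD('d) \<in> {1, 2, 3}"
    and "bounded_domain \<Omega>" and "strong_lipschitz_boundary \<Omega>"
    and "0 < T" and "0 < mu0" and "0 < m0" and "0 < \<beta>"
    and "1 \<le> s" and "\<And>i. (\<lambda>t. h t $ i) \<in> sobolev_H s {0<..<T}"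
    and "\<And>i. (\<lambda>x. g x $ i) \<in> Linfty (lebesgue_on \<Omega>)"
    and "\<And>i. (\<lambda>x. p x $ i) \<in> Linfty (lebesgue_on \<Omega>)"
    and "0 \<le> r" and "0 < \<theta>" and "zero_extension T a \<in> besov r 1 \<theta>"
  shows "let F = integral_operator (lebesgue_on \<Omega>)
                   (filtered_kernel T a (kappa T mu0 m0 \<beta> g h p))
     in (\<forall>c \<in> L2 (lebesgue_on \<Omega>). F c \<in> L2 (lebesgue_on {0<..<T})) \<and>
        (\<exists>C. \<forall>n\<ge>1. singular_value (lebesgue_on \<Omega>) (lebesgue_on {0<..<T}) F n
                      \<le> C * real n powr (1 / 2 - s - r))"
proof -
  define M where "M = lebesgue_on \<Omega>"
  define F where "F = integral_operator M (filtered_kernel T a (kappa T mu0 m0 \<beta> g h p))"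
  define m where "m = nat \<lfloor>s\<rfloor>"
  define \<sigma> where "\<sigma> = frac s"
  note T = \<open>0 < T\<close> and \<beta> = \<open>0 < \<beta>\<close>
  have m1: "1 \<le> m" using \<open>1 \<le> s\<close> by (simp add: m_def le_nat_iff le_floor_iff)
  have ms: "real m + \<sigma> = s" using \<open>1 \<le> s\<close> by (simp add: m_def \<sigma>_def frac_def of_nat_nat)
  have \<sigma>: "0 \<le> \<sigma>" "\<sigma> < 1" by (auto simp: \<sigma>_def frac_lt_1)
  have \<Omega>m: "\<Omega> \<in> sets lebesgue" and \<Omega>f: "\<Omega> \<in> lmeasurable"
    using \<open>bounded_domain \<Omega>\<close> lmeasurable_open[of \<Omega>] by (auto simp: bounded_domain_def fmeasurableD)
  have fin: "finite_measure M" unfolding M_def by (rule finite_measure_lebesgue_on[OF \<Omega>f])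
  let ?P = "\<lambda>i H. (\<forall>l<m. ac_on T (H l) (H (Suc l))) \<and> H m \<in> borel_measurable borel \<and>
      (\<lambda>t. (H m t)\<^sup>2) integrable_on {0..T} \<and> (AE x in ivl T. h x $ i = H 0 x) \<and>
      (s \<notin> \<int> \<longrightarrow> gagliardo \<sigma> {0<..<T} (H m) < \<infinity>)"
  have "\<exists>H. ?P i H" for i
    using sobolev_ac_version[OF assms(9)[of i] \<open>1 \<le> s\<close> T] unfolding m_def \<sigma>_def by blast
  then have "\<forall>i. \<exists>H. ?P i H" by (rule allI)
  from choice[OF this] obtain Hi where HP: "\<forall>i. ?P i (Hi i)" by (rule exE)
  have Hi: "\<And>i l. l < m \<Longrightarrow> ac_on T (Hi i l) (Hi i (Suc l))" "\<And>i. Hi i m \<in> borel_measurable borel"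
      "\<And>i. (\<lambda>t. (Hi i m t)\<^sup>2) integrable_on {0..T}" "\<And>i. AE x in ivl T. h x $ i = Hi i 0 x"
      "\<And>i. s \<notin> \<int> \<Longrightarrow> gagliardo \<sigma> {0<..<T} (Hi i m) < \<infinity>" using HP by simp_all
  define hh where "hh l i = Hi i l" for l i
  obtain gb :: "real ^ 'd \<Rightarrow> real ^ 'd" and Cg where gb: "\<And>i. (\<lambda>x. gb x $ i) \<in> borel_measurable M"
    "\<And>x i. \<bar>gb x $ i\<bar> \<le> Cg" "AE x in M. g x = gb x"
    using Linfty_components_clip[of g M] assms(10) unfolding M_def by blast
  obtain pb :: "real ^ 'd \<Rightarrow> real ^ 'd" and Cp where pb: "\<And>i. (\<lambda>x. pb x $ i) \<in> borel_measurable M"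
    "\<And>x i. \<bar>pb x $ i\<bar> \<le> Cp" "AE x in M. p x = pb x"
    using Linfty_components_clip[of p M] assms(11) unfolding M_def by blast
  interpret kernel_data_L2 M T \<beta> m gb hh
  proof
    show "\<exists>G. \<forall>x i. \<bar>gb x $ i\<bar> \<le> G" using gb(2) by blast
  qed (use T m1 gb(1) Hi in \<open>auto simp: hh_def\<close>)
  interpret finite_measure M by (rule fin)
  interpret N: sigma_finite_measure "ivl T" by (rule sigma_finite_ivl)
  interpret P: pair_sigma_finite M "ivl T" by unfold_locales
  \<comment> \<open>Component \<open>i\<close> of the magnetization, computed from the
    representatives \<open>gb\<close> and \<open>hh\<close>.\<close>
  define u where "u i x t = (\<beta> * (pseries coshd_coeff (W x t) * inverse (pseries sinhc_coeff (W x t)))) * (- 1 * (hh 0 i t + - gb x $ i))" for i x t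
  have du: "dp 0 (u i)" for i
  proof -
    have "oclass (\<lambda>y. \<beta> * (pseries coshd_coeff y * inverse (pseries sinhc_coeff y)))"
      by (intro oclass.mult oclass.const oclass.series oclass.recip entire_coshd)
    from dp.mult[OF dp.outer[OF this] dp.mult[OF dp_const[of 0 "- 1"] dp.add[OF dp.deriv[of 0 0 i] dp_g[of 0 i]]]]
    show ?thesis unfolding u_def[abs_def] by simp
  qed
  obtain D where D: "\<And>i. de 0 (D i)" "\<And>i x. ac_on T (u i x) (D i x)"
    using dp_deriv[OF du] m1 by (metis Suc_le_eq One_nat_def)
  define \<kappa> where "\<kappa> x t = (\<Sum>i\<in>UNIV. mu0 * m0 * pb x $ i * D i x t)" for x t
  have de\<kappa>: "de 0 \<kappa>"
  proof -
    have "dp 0 (\<lambda>x t. mu0 * m0 * pb x $ i)" for i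
    proof (rule dp.const)
      show "(\<lambda>x. mu0 * m0 * pb x $ i) \<in> borel_measurable M"
        using pb(1) by (intro borel_measurable_times borel_measurable_const)
      show "\<bar>mu0 * m0 * pb x $ i\<bar> \<le> \<bar>mu0 * m0\<bar> * Cp" for x
        using pb(2)[of x i] by (simp add: abs_mult mult_left_mono)
    qed
    then show ?thesis unfolding \<kappa>_def[abs_def] by (intro de_sum de_mult D)
  qed
  have \<kappa>m: "case_prod \<kappa> \<in> borel_measurable (M \<Otimes>\<^sub>M ivl T)"
    by (rule dp_measurable[OF dp_Suc_de[OF de\<kappa>]]) (use m1 in simp)
  have h_all: "AE t in ivl T. \<forall>i\<in>UNIV. h t $ i = hh 0 i t"
    unfolding hh_def using Hi(4) by (intro AE_finite_allI) auto
  \<comment> \<open>This holds at points \<open>x\<close> where \<open>g\<close> and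
    \<open>p\<close> coincide with their bounded versions, hence at almost all \<open>x\<close>;
    there the chosen weak derivatives equal \<open>D\<close> for almost all times.\<close>
  have kappa_eq: "AE t in ivl T. kappa T mu0 m0 \<beta> g h p x t = \<kappa> x t" if gx: "g x = gb x" and px: "p x = pb x" for x
  proof -
    have "AE t in ivl T. weak_deriv {0<..<T} (\<lambda>\<tau>. magnetization \<beta> g h x \<tau> $ i) t = D i x t" for i
    proof (rule AE_weak_deriv[OF _ T], rule weak_derivative_cong_AE[OF ac_on_weak_derivative[OF D(2) T] T])
      show "AE t in ivl T. magnetization \<beta> g h x t $ i = u i x t"
        using h_all
      proof eventually_elim
        case (elim t)
        then show ?case
          unfolding magnetization_component[OF \<beta>] u_def W_def gx by simp
      qed
    qed
    then have "AE t in ivl T. \<forall>i\<in>UNIV. weak_deriv {0<..<T} (\<lambda>\<tau>. magnetization \<beta> g h x \<tau> $ i) t = D i x t"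
      by (intro AE_finite_allI) auto
    then show ?thesis
    proof eventually_elim
      case (elim t)
      then show ?case
        by (simp add: kappa_def \<kappa>_def inner_vec_def px sum_distrib_left mult.assoc)
    qed
  qed
  obtain a0 Ca Da where a0: "integrable lborel a0" "AE x in lborel. zero_extension T a x = a0 x" "0 \<le> Ca"
    "\<And>J. \<exists>p e. (\<forall>\<tau>. \<bar>\<tau>\<bar> < T \<longrightarrow> a0 \<tau> = (\<Sum>j<Da * 2 ^ J. p j * \<tau> ^ j) + e \<tau>) \<and>
        integrable lborel e \<and> (\<integral>t. \<bar>e t\<bar> \<partial>lborel) \<le> Ca * 2 powr - (r * real J)"
    by (rule besov_polynomial_approximation[OF assms(14,13,12) T], rule that) assumption+
  have a0m [measurable]: "a0 \<in> borel_measurable borel" using borel_measurable_integrable[OF a0(1)] by simp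
  have a_eq: "AE t' in ivl T. a (t - t') = a0 (t - t')" if t: "t \<in> {0<..<T}" for t
  proof -
    have "AE t' in ivl T. t' \<in> {0<..<T}" using AE_space[of "ivl T"] by simp
    with AE_ivl_reflect[OF a0(2), of t T] show ?thesis
    proof eventually_elim
      case (elim t')
      then have "t - t' \<in> {-T..T}" using t by auto
      with elim show ?case by (simp add: zero_extension_def)
    qed
  qed
  have \<kappa>_section: "\<kappa> x \<in> borel_measurable (ivl T)" if "x \<in> space M" for x
  proof -
    have "(\<lambda>t. (x, t)) \<in> ivl T \<rightarrow>\<^sub>M M \<Otimes>\<^sub>M ivl T" using that by (intro measurable_Pair) auto
    from measurable_compose[OF this \<kappa>m] show ?thesis by simp
  qed
  have a0_shift: "(\<lambda>t'. a0 (t - t')) \<in> borel_measurable (ivl T)" for t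
    by (intro borel_measurable_ivl) measurable
  have fk_eq: "filtered_kernel T a (kappa T mu0 m0 \<beta> g h p) x t = (\<integral>t'. \<kappa> x t' * a0 (t - t') \<partial>ivl T)"
    if x: "x \<in> space M" "g x = gb x" "p x = pb x" and t: "t \<in> {0<..<T}" for x t
    unfolding filtered_kernel_def
  proof (rule lebesgue_on_integral_cong_AE)
    show "(\<lambda>t'. \<kappa> x t' * a0 (t - t')) \<in> borel_measurable (ivl T)"
      using \<kappa>_section[OF x(1)] a0_shift by (rule borel_measurable_times)
    show "AE t' in ivl T. kappa T mu0 m0 \<beta> g h p x t' * a (t - t') = \<kappa> x t' * a0 (t - t')"
      using kappa_eq[OF x(2,3)] a_eq[OF t] by eventually_elim simp
  qed simp
  obtain C\<kappa> where C\<kappa>: "0 \<le> C\<kappa>" "\<And>x t. t \<in> {0..T} \<Longrightarrow> \<bar>\<kappa> x t\<bar> \<le> C\<kappa> * (1 + (\<Sum>i\<in>UNIV. \<bar>hh (Suc 0) i t\<bar>))"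
    using de_bound[OF de\<kappa>] m1 by auto
  \<comment> \<open>The factor 1 gives the sum the shape of \<open>L2_sum\<close>.\<close>
  define Bd where "Bd t = C\<kappa> * (1 + (\<Sum>i\<in>UNIV. 1 * \<bar>hh (Suc 0) i t\<bar>))" for t
  have hL2: "(\<lambda>t. \<bar>hh (Suc 0) i t\<bar>) \<in> L2 (ivl T)" for i
  proof -
    have m: "hh (Suc 0) i \<in> borel_measurable (ivl T)" using m1 by (intro h_measurable_ivl) simp
    have i2: "(\<lambda>t. (hh (Suc 0) i t)\<^sup>2) integrable_on {0..T}"
    \<comment> \<open>For \<open>m = 1\<close> the first derivative is the top one and only square
      integrable; otherwise it is continuous.\<close>
    proof (cases "m = 1")
      case True
      then show ?thesis using h_square[of i] by simp
    next
      case False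
      then have "continuous_on {0..T} (hh (Suc 0) i)" using m1 by (intro h_continuous) simp
      then show ?thesis by (intro integrable_continuous_real continuous_intros)
    qed
    have "(\<lambda>t. (hh (Suc 0) i t)\<^sup>2) absolutely_integrable_on {0..T}"
      using i2 by (subst absolutely_integrable_on_iff_nonneg) auto
    from abs_integrable_ivl(1)[OF this] m show ?thesis by (simp add: L2_def)
  qed
  have BL2: "Bd \<in> L2 (ivl T)"
  proof -
    have "(\<lambda>t. 1) \<in> L2 (ivl T)" by (rule L2_bounded[OF finite_measure_ivl, of _ _ 1]) auto
    then show ?thesis unfolding Bd_def[abs_def] by (intro L2_scale L2_add L2_sum hL2)
  qed
  interpret FO: filtered_operator M T \<kappa> Bd a0 F
  proof
    show "F c t = (\<integral>x. c x * (\<integral>t'. \<kappa> x t' * a0 (t - t') \<partial>ivl T) \<partial>M)" if c: "c \<in> L2 M" and t: "t \<in> {0<..<T}" for c t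
      unfolding F_def integral_operator_def M_def
    proof (rule lebesgue_on_integral_cong_AE[OF \<Omega>m])
      have "(\<lambda>z. \<kappa> (fst z) (snd z) * a0 (t - snd z)) \<in> borel_measurable (M \<Otimes>\<^sub>M ivl T)"
        using \<kappa>m measurable_compose[OF measurable_snd a0_shift[of t]]
        by (intro borel_measurable_times) (simp_all add: case_prod_beta')
      then have "(\<lambda>x. \<integral>t'. \<kappa> x t' * a0 (t - t') \<partial>ivl T) \<in> borel_measurable M"
        by (intro N.borel_measurable_lebesgue_integral) (simp add: case_prod_beta')
      then show "(\<lambda>x. c x * (\<integral>t'. \<kappa> x t' * a0 (t - t') \<partial>ivl T)) \<in> borel_measurable (lebesgue_on \<Omega>)"
        using L2_measurable[OF c] unfolding M_def by (intro borel_measurable_times)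
      show "AE x in lebesgue_on \<Omega>. c x * filtered_kernel T a (kappa T mu0 m0 \<beta> g h p) x t = c x * (\<integral>t'. \<kappa> x t' * a0 (t - t') \<partial>ivl T)"
        using gb(3) pb(3) AE_space[of M] unfolding M_def
      proof eventually_elim
        case (elim x)
        then show ?case using fk_eq[of x t] t by (simp add: M_def)
      qed
    qed
    show "\<bar>\<kappa> x t\<bar> \<le> Bd t" if "x \<in> space M" "t \<in> {0<..<T}" for x t
      using C\<kappa>(2)[of t x] that by (simp add: Bd_def)
  qed (use fin \<kappa>m BL2 a0(1) in auto)
  have part1: "\<forall>c \<in> L2 M. F c \<in> L2 (ivl T)" using FO.A_L2 by blast
  \<comment> \<open>For integral \<open>s\<close> the exponent \<sigma> is 0 and zero coefficients
    suffice; otherwise the Gagliardo seminorms of the top derivatives make freezing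
    effective.\<close>
  have fr: "\<exists>C\<ge>0. \<forall>J. \<exists>E. (\<forall>q<2 ^ J. E q \<in> borel_measurable M \<and> (\<exists>B. \<forall>x. \<bar>E q x\<bar> \<le> B)) \<and>
     (\<forall>x. (\<Sum>q<2 ^ J. integral {dpt T J q..dpt T J (Suc q)} (\<lambda>t. (\<Phi> x t - E q x)\<^sup>2)) \<le> C * (T / 2 ^ J) powr (2 * \<sigma>))"
    if \<Phi>: "de (m - 1) \<Phi>" for \<Phi>
  proof (cases "s \<in> \<int>")
    case True
    then have "\<sigma> = 0" by (simp add: \<sigma>_def)
    then show ?thesis using bounded_coefficients[OF \<Phi>] m1 by simp
  next
    case False
    then have \<sigma>0: "0 < \<sigma>" by (simp add: \<sigma>_def)
    define G where "G = (\<Sum>i\<in>UNIV. enn2real (gagliardo \<sigma> {0<..<T} (hh m i)))"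
    have "gagliardo \<sigma> {0<..<T} (hh m i) \<le> ennreal G" for i
    proof -
      have "gagliardo \<sigma> {0<..<T} (hh m i) < \<top>" using Hi(5)[OF False, of i] by (simp add: hh_def)
      then have "gagliardo \<sigma> {0<..<T} (hh m i) = ennreal (enn2real (gagliardo \<sigma> {0<..<T} (hh m i)))" by simp
      also have "\<dots> \<le> ennreal G" unfolding G_def by (intro ennreal_leI member_le_sum) auto
      finally show ?thesis .
    qed
    moreover have "0 \<le> G" by (simp add: G_def sum_nonneg)
    ultimately show ?thesis using m1 by (intro frozen_coefficients[OF \<Phi> _ \<sigma>0 \<sigma>(2)]) auto
  qed
  obtain CK where CK: "0 \<le> CK" "\<And>J. \<exists>b d \<rho>. (\<forall>x. \<forall>t\<in>{0<..<T}. \<kappa> x t = (\<Sum>r<2 ^ J * m. b r x * d r t) + \<rho> x t) \<and>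
     (\<forall>r<2 ^ J * m. b r \<in> L2 M) \<and> case_prod \<rho> \<in> borel_measurable (M \<Otimes>\<^sub>M ivl T) \<and>
     (\<integral>\<^sup>+t. \<integral>\<^sup>+x. ennreal ((\<rho> x t)\<^sup>2) \<partial>M \<partial>ivl T) \<le> ennreal (CK * (1 / 2 ^ J) powr (2 * (real (m - 1) + \<sigma>)))"
    using kernel_lowrank[OF de\<kappa> fin fr] by blast
  define \<gamma> where "\<gamma> = s - 1 + r"
  have ms1: "real (m - 1) + \<sigma> = s - 1" using ms m1 by simp
  \<comment> \<open>The condition on \<open>l\<close> under the supremum in
    \<open>singular_value\<close>.\<close>
  define Q where "Q n l \<longleftrightarrow> (\<exists>v lam. (\<forall>i<n. \<forall>j<n. L2_inner M (v i) (v j) = (if i = j then 1 else 0)) \<and>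
              (\<forall>i<n. l \<le> lam i \<and> singular_vector M (ivl T) F (lam i) (v i)))" for n :: nat and l
  \<comment> \<open>The ranks \<open>m * 2 ^ J\<close> of the kernel and \<open>Da * 2 ^ J\<close>
    of the filter add up, while the squared errors, of exponents 2 r and 2 (s - 1), multiply to
    exponent 2 \<gamma>.\<close>
  have b: "l\<^sup>2 * real (n - (m + Da) * 2 ^ J) \<le> Ca\<^sup>2 * CK * 2 powr - (2 * \<gamma> * real J)"
    if "1 \<le> n" "0 < l" "Q n l" for n l J
  proof -
    obtain v lam where v: "\<And>i j. i < n \<Longrightarrow> j < n \<Longrightarrow> L2_inner M (v i) (v j) = (if i = j then 1 else 0)"
      "\<And>i. i < n \<Longrightarrow> l \<le> lam i" "\<And>i. i < n \<Longrightarrow> singular_vector M (ivl T) F (lam i) (v i)"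
      using \<open>Q n l\<close> unfolding Q_def by blast
    obtain b d \<rho> where bd: "\<And>x t. t \<in> {0<..<T} \<Longrightarrow> \<kappa> x t = (\<Sum>r<2 ^ J * m. b r x * d r t) + \<rho> x t"
      "\<And>r. r < 2 ^ J * m \<Longrightarrow> b r \<in> L2 M" "case_prod \<rho> \<in> borel_measurable (M \<Otimes>\<^sub>M ivl T)"
      "(\<integral>\<^sup>+t. \<integral>\<^sup>+x. ennreal ((\<rho> x t)\<^sup>2) \<partial>M \<partial>ivl T) \<le> ennreal (CK * (1 / 2 ^ J) powr (2 * (real (m - 1) + \<sigma>)))"
      using CK(2)[of J] by blast
    obtain q e where qe: "\<And>\<tau>. \<bar>\<tau>\<bar> < T \<Longrightarrow> a0 \<tau> = (\<Sum>j<Da * 2 ^ J. q j * \<tau> ^ j) + e \<tau>"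
      "integrable lborel e" "(\<integral>t. \<bar>e t\<bar> \<partial>lborel) \<le> Ca * 2 powr - (r * real J)"
      using a0(4)[of J] by blast
    have "l\<^sup>2 * real (n - (2 ^ J * m + Da * 2 ^ J)) \<le> (Ca * 2 powr - (r * real J))\<^sup>2 * (CK * (1 / 2 ^ J) powr (2 * (real (m - 1) + \<sigma>)))"
      by (rule FO.singular_system_bound[OF bd(1) bd(2,3,4) _ qe(1) qe(2,3) v \<open>0 < l\<close>]) (use CK(1) in auto)
    also have "\<dots> = Ca\<^sup>2 * CK * 2 powr - (2 * \<gamma> * real J)"
    proof -
      have "(2 powr - (r * real J))\<^sup>2 = 2 powr (- (r * real J) + - (r * real J))"
        unfolding powr_add by (rule power2_eq_square)
      moreover have "(1 / 2 ^ J) powr (2 * (s - 1)) = 2 powr - (2 * (s - 1) * real J)"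
      proof -
        have "(1 / 2 ^ J :: real) = 2 powr - real J" by (simp add: powr_minus powr_realpow divide_inverse)
        then show ?thesis by (simp add: powr_powr mult_ac)
      qed
      moreover have "2 powr (- (r * real J) + - (r * real J)) * 2 powr - (2 * (s - 1) * real J) = 2 powr - (2 * \<gamma> * real J)"
        unfolding powr_add[symmetric] by (simp add: \<gamma>_def algebra_simps)
      ultimately show ?thesis unfolding ms1 power_mult_distrib by (metis mult.assoc mult.left_commute)
    qed
    also have "2 ^ J * m + Da * 2 ^ J = (m + Da) * 2 ^ J" by (simp add: algebra_simps)
    finally show ?thesis .
  qed
  \<comment> \<open>The Hilbert--Schmidt bound with empty finite-rank parts, used for small
    \<open>n\<close>.\<close>
  define X0 where "X0 = (\<integral>t. \<bar>a0 t\<bar> \<partial>lborel)\<^sup>2 * ((\<integral>t. (Bd t)\<^sup>2 \<partial>ivl T) * measure M (space M))"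
  have b0: "l\<^sup>2 * real n \<le> X0" if "1 \<le> n" "0 < l" "Q n l" for n l
  proof -
    obtain v lam where v: "\<And>i j. i < n \<Longrightarrow> j < n \<Longrightarrow> L2_inner M (v i) (v j) = (if i = j then 1 else 0)"
      "\<And>i. i < n \<Longrightarrow> l \<le> lam i" "\<And>i. i < n \<Longrightarrow> singular_vector M (ivl T) F (lam i) (v i)"
      using \<open>Q n l\<close> unfolding Q_def by blast
    have "(\<integral>\<^sup>+t. \<integral>\<^sup>+x. ennreal ((\<kappa> x t)\<^sup>2) \<partial>M \<partial>ivl T) \<le> (\<integral>\<^sup>+t. \<integral>\<^sup>+x. ennreal ((Bd t)\<^sup>2) \<partial>M \<partial>ivl T)"
    proof (intro nn_integral_mono ennreal_leI)
      fix t x assume "t \<in> space (ivl T)" "x \<in> space M"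
      then have "\<bar>\<kappa> x t\<bar>\<^sup>2 \<le> (Bd t)\<^sup>2" using FO.k_le[of x t] by (intro power_mono) auto
      then show "(\<kappa> x t)\<^sup>2 \<le> (Bd t)\<^sup>2" by simp
    qed
    also have "\<dots> = (\<integral>\<^sup>+t. ennreal ((Bd t)\<^sup>2) \<partial>ivl T) * emeasure M (space M)"
      using BL2 by (simp add: nn_integral_multc L2_def)
    also have "\<dots> = ennreal ((\<integral>t. (Bd t)\<^sup>2 \<partial>ivl T) * measure M (space M))"
      using BL2 by (simp add: nn_integral_eq_integral L2_def emeasure_eq_measure ennreal_mult)
    finally have kk: "(\<integral>\<^sup>+t. \<integral>\<^sup>+x. ennreal ((\<kappa> x t)\<^sup>2) \<partial>M \<partial>ivl T) \<le> ennreal ((\<integral>t. (Bd t)\<^sup>2 \<partial>ivl T) * measure M (space M))" .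
    have "l\<^sup>2 * real (n - (0 + 0)) \<le> (\<integral>t. \<bar>a0 t\<bar> \<partial>lborel)\<^sup>2 * ((\<integral>t. (Bd t)\<^sup>2 \<partial>ivl T) * measure M (space M))"
      by (rule FO.singular_system_bound[where b = "\<lambda>_ _. 0" and d = "\<lambda>_ _. 0" and \<rho> = \<kappa> and p = "\<lambda>_. 0" and e = a0 and lam = lam,
            OF _ _ \<kappa>m kk _ _ a0(1) order_refl v \<open>0 < l\<close>]) auto
    then show ?thesis by (simp add: X0_def)
  qed
  have "\<exists>C\<ge>0. \<forall>n l. 1 \<le> n \<longrightarrow> 0 < l \<longrightarrow> Q n l \<longrightarrow> l \<le> C * real n powr (- 1 / 2 - \<gamma>)"
    by (rule singular_value_rate[OF b b0]) (use m1 \<open>1 \<le> s\<close> \<open>0 \<le> r\<close> CK(1) in \<open>auto simp: \<gamma>_def X0_def\<close>)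
  then obtain C where C: "0 \<le> C" "\<And>n l. 1 \<le> n \<Longrightarrow> 0 < l \<Longrightarrow> Q n l \<Longrightarrow> l \<le> C * real n powr (- 1 / 2 - \<gamma>)"
    by blast
  \<comment> \<open>The 1/2 gained by counting directions turns the exponent s - 1 into s -
    1/2.\<close>
  have ex: "- 1 / 2 - \<gamma> = 1 / 2 - s - r" by (simp add: \<gamma>_def)
  have part2: "singular_value M (ivl T) F n \<le> C * real n powr (1 / 2 - s - r)" if n: "1 \<le> n" for n
    unfolding singular_value_def
  \<comment> \<open>The element 0 makes the set nonempty, so a bound for its members bounds the
    supremum.\<close>
  proof (rule cSup_least)
    fix l assume "l \<in> {0} \<union> {l. 0 < l \<and>
     (\<exists>v lam. (\<forall>i<n. \<forall>j<n. L2_inner M (v i) (v j) = (if i = j then 1 else 0)) \<and>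
              (\<forall>i<n. l \<le> lam i \<and> singular_vector M (ivl T) F (lam i) (v i)))}"
    then consider "l = 0" | "0 < l" "Q n l" unfolding Q_def by blast
    then show "l \<le> C * real n powr (1 / 2 - s - r)"
      using C(1) C(2)[OF n] unfolding ex by cases auto
  qed simp
  show ?thesis
    unfolding Let_def M_def[symmetric] F_def[symmetric] using part1 part2 by blast
qed

end
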